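(* Parametrize the complex simple Lie algebras $\mathfrak g$ by triples $(\alpha,\beta,\gamma)$ as follows: - $\mathfrak{sp}_{2n}$: $(-2,1,n+2)$; - $\mathfrak{sl}_n$: $(-2,2,n)$; - $\mathfrak{so}_n$: $(-2,4,n-4)$; - exceptional series: $(-2,a+4,2a+4)$ with $a=-1,-\frac23,0,1,2,4,8$, that is, $\mathfrak{sl}_3$: $(-2,3,2)$; $\mathfrak g_2$: $(-2,\frac{10}{3},\frac83)$; $\mathfrak{so}_8$: $(-2,4,4)$; $\mathfrak f_4$: $(-2,5,6)$; $\mathfrak e_6$: $(-2,6,8)$; $\mathfrak e_7$: $(-2,8,12)$; $\mathfrak e_8$: $(-2,12,20)$; - series $F3_r$: $(-2,a,a(r-2)+4)$, where for $r\ge 3$ and $a=1,2,4$ the Lie algebra is $\mathfrak{sp}_{2r},\mathfrak{sl}_{2r},\mathfrak{so}_{4r}$ respectively, and for $r=3$, $a=8$ it is $\mathfrak e_7$. Then, for every integer $k\ge 1$, $Y_k(\alpha)$ is the $k$-th Cartan power $\mathfrak g^{(k)}$ of $\mathfrak g$ (the irreducible module with highest weight $k\alpha_0$, where $\alpha_0$ is the highest root of $\mathfrak g$), and $$\dim \mathfrak g^{(k)}=\frac{\beta+\gamma-3+2k}{\beta+\gamma-3}\cdot\frac{\binom{\beta+\gamma/2-3+k}{k}\binom{\gamma+\beta/2-3+k}{k}\binom{\beta+\gamma-4+k}{k}}{\binom{-1+\beta/2+k}{k}\binom{-1+\gamma/2+k}{k}}.$$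
   Context: Generalized binomial coefficients: for an integer $y\ge 0$ and a number $x$, $\binom{y+x}{y}=\frac{(1+x)(2+x)\cdots(y+x)}{y!}$. The triples are Vogel's parameters: normalizing the Casimir so that its eigenvalue on the adjoint representation is $2t$ with $t=\alpha+\beta+\gamma$, one has $S^2\mathfrak g=\mathbb C\oplus Y_2(\alpha)\oplus Y_2(\beta)\oplus Y_2(\gamma)$ with (possibly zero or virtual) Casimir eigenspaces of eigenvalues $4t-2\alpha,4t-2\beta,4t-2\gamma$. In general $Y_k(\alpha)$ denotes the module contained in $S^k\mathfrak g$ with Casimir eigenvalue $2kt-(k^2-k)\alpha$ and with dimension $$\dim Y_k(\alpha)=\frac{t-(k-\frac12)\alpha}{t+\frac{\alpha}{2}}\cdot\frac{\binom{-\frac{2t}{\alpha}-2+k}{k}\binom{\frac{\beta-2t}{\alpha}-1+k}{k}\binom{\frac{\gamma-2t}{\alpha}-1+k}{k}}{\binom{-\frac{\beta}{\alpha}-1+k}{k}\binom{-\frac{\gamma}{\alpha}-1+k}{k}}.$$ *)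

theory Defs
  imports Complex_Main "HOL-Library.Multiset" "HOL-Library.Function_Algebras"
    "Jordan_Normal_Form.Matrix"
begin

section \<open>Vector spaces of complex-valued functions\<close>

definition fun_scale :: "complex \<Rightarrow> ('b \<Rightarrow> complex) \<Rightarrow> 'b \<Rightarrow> complex" where
  "fun_scale c f = (\<lambda>x. c * f x)"

global_interpretation fun_space: vector_space "fun_scale :: complex \<Rightarrow> ('b \<Rightarrow> complex) \<Rightarrow> 'b \<Rightarrow> complex"
  by unfold_locales (auto simp: fun_scale_def fun_eq_iff algebra_simps)


section \<open>The classical matrix Lie algebras and the exceptional Cartan matrices\<close>

definition sl_mat :: "nat \<Rightarrow> complex mat set" where
  "sl_mat n = {A \<in> carrier_mat n n. (\<Sum>i<n. A $$ (i, i)) = 0}"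

definition so_mat :: "nat \<Rightarrow> complex mat set" where
  "so_mat n = {A \<in> carrier_mat n n. transpose_mat A = - A}"

definition symplectic_form :: "nat \<Rightarrow> complex mat" where
  "symplectic_form n = four_block_mat (0\<^sub>m n n) (1\<^sub>m n) (- 1\<^sub>m n) (0\<^sub>m n n)"

text \<open>\<open>sp_mat n\<close> is the Lie algebra usually written \<open>sp\<^sub>2\<^sub>n\<close>: its matrices have size \<open>2 * n\<close>.\<close>

definition sp_mat :: "nat \<Rightarrow> complex mat set" where
  "sp_mat n = {A \<in> carrier_mat (2 * n) (2 * n).
     transpose_mat A * symplectic_form n + symplectic_form n * A = 0\<^sub>m (2 * n) (2 * n)}"

definition cartan_G2 :: "int list list" where
  "cartan_G2 = [[2, -1], [-3, 2]]"

definition cartan_F4 :: "int list list" where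
  "cartan_F4 =
    [[ 2, -1,  0,  0],
     [-1,  2, -2,  0],
     [ 0, -1,  2, -1],
     [ 0,  0, -1,  2]]"

definition cartan_E6 :: "int list list" where
  "cartan_E6 =
    [[ 2,  0, -1,  0,  0,  0],
     [ 0,  2,  0, -1,  0,  0],
     [-1,  0,  2, -1,  0,  0],
     [ 0, -1, -1,  2, -1,  0],
     [ 0,  0,  0, -1,  2, -1],
     [ 0,  0,  0,  0, -1,  2]]"

definition cartan_E7 :: "int list list" where
  "cartan_E7 =
    [[ 2,  0, -1,  0,  0,  0,  0],
     [ 0,  2,  0, -1,  0,  0,  0],
     [-1,  0,  2, -1,  0,  0,  0],
     [ 0, -1, -1,  2, -1,  0,  0],
     [ 0,  0,  0, -1,  2, -1,  0],
     [ 0,  0,  0,  0, -1,  2, -1],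
     [ 0,  0,  0,  0,  0, -1,  2]]"

definition cartan_E8 :: "int list list" where
  "cartan_E8 =
    [[ 2,  0, -1,  0,  0,  0,  0,  0],
     [ 0,  2,  0, -1,  0,  0,  0,  0],
     [-1,  0,  2, -1,  0,  0,  0,  0],
     [ 0, -1, -1,  2, -1,  0,  0,  0],
     [ 0,  0,  0, -1,  2, -1,  0,  0],
     [ 0,  0,  0,  0, -1,  2, -1,  0],
     [ 0,  0,  0,  0,  0, -1,  2, -1],
     [ 0,  0,  0,  0,  0,  0, -1,  2]]"


section \<open>Complex Lie algebras\<close>

text \<open>The Lie algebra is a finite-dimensional subspace \<open>G\<close> of the vector space on the ambient type,
  so that, e.g., all the \<open>sl\<^sub>n\<close> can live in one type.  Operations are only constrained on \<open>G\<close>.\<close>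

locale lie_algebra = vector_space scale
  for scale :: "complex \<Rightarrow> 'a::ab_group_add \<Rightarrow> 'a" +
  fixes G :: "'a set"
    and br :: "'a \<Rightarrow> 'a \<Rightarrow> 'a"
  assumes carrier_subspace: "subspace G"
    and carrier_finite_dim: "\<exists>E. finite E \<and> span E = G"
    and br_closed: "x \<in> G \<Longrightarrow> y \<in> G \<Longrightarrow> br x y \<in> G"
    and br_add_left: "x \<in> G \<Longrightarrow> y \<in> G \<Longrightarrow> z \<in> G \<Longrightarrow> br (x + y) z = br x z + br y z"
    and br_add_right: "x \<in> G \<Longrightarrow> y \<in> G \<Longrightarrow> z \<in> G \<Longrightarrow> br x (y + z) = br x y + br x z"
    and br_scale_left: "x \<in> G \<Longrightarrow> y \<in> G \<Longrightarrow> br (scale c x) y = scale c (br x y)"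
    and br_scale_right: "x \<in> G \<Longrightarrow> y \<in> G \<Longrightarrow> br x (scale c y) = scale c (br x y)"
    and br_self: "x \<in> G \<Longrightarrow> br x x = 0"
    and jacobi: "x \<in> G \<Longrightarrow> y \<in> G \<Longrightarrow> z \<in> G \<Longrightarrow>
           br x (br y z) + br y (br z x) + br z (br x y) = 0"
begin

definition ideal :: "'a set \<Rightarrow> bool" where
  "ideal I \<longleftrightarrow> subspace I \<and> I \<subseteq> G \<and> (\<forall>x\<in>G. \<forall>y\<in>I. br x y \<in> I)"

definition simple :: bool where
  "simple \<longleftrightarrow> (\<exists>x\<in>G. \<exists>y\<in>G. br x y \<noteq> 0) \<and> (\<forall>I. ideal I \<longrightarrow> I = {0} \<or> I = G)"

definition isomorphic_to_mat :: "complex mat set \<Rightarrow> bool" where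
  "isomorphic_to_mat L \<longleftrightarrow> (\<exists>\<phi>. bij_betw \<phi> G L \<and>
     (\<forall>x\<in>G. \<forall>y\<in>G. \<phi> (x + y) = \<phi> x + \<phi> y) \<and>
     (\<forall>c. \<forall>x\<in>G. \<phi> (scale c x) = c \<cdot>\<^sub>m \<phi> x) \<and>
     (\<forall>x\<in>G. \<forall>y\<in>G. \<phi> (br x y) = \<phi> x * \<phi> y - \<phi> y * \<phi> x))"


subsection \<open>Cartan subalgebras, roots, highest root\<close>

text \<open>Elements of a dual space \<open>U\<^sup>*\<close> are normalized to vanish outside \<open>U\<close>, so that equality of
  functionals is equality of functions and \<open>dual U\<close> is a subspace of the function space.\<close>

definition dual :: "'a set \<Rightarrow> ('a \<Rightarrow> complex) set" where
  "dual U = {f. (\<forall>x\<in>U. \<forall>y\<in>U. f (x + y) = f x + f y) \<and>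
     (\<forall>c. \<forall>x\<in>U. f (scale c x) = c * f x) \<and> (\<forall>x. x \<notin> U \<longrightarrow> f x = 0)}"

text \<open>Cartan subalgebras of semisimple complex Lie algebras: self-centralizing abelian subalgebras
  acting diagonalizably in the adjoint representation.\<close>

definition cartan_subalgebra :: "'a set \<Rightarrow> bool" where
  "cartan_subalgebra H \<longleftrightarrow> subspace H \<and> H \<subseteq> G \<and>
     (\<forall>x\<in>H. \<forall>y\<in>H. br x y = 0) \<and>
     (\<forall>x\<in>G. (\<forall>h\<in>H. br h x = 0) \<longrightarrow> x \<in> H) \<and>
     (\<forall>h\<in>H. G \<subseteq> span {x \<in> G. \<exists>c. br h x = scale c x})"

definition root_space :: "'a set \<Rightarrow> ('a \<Rightarrow> complex) \<Rightarrow> 'a set" where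
  "root_space H r = {x \<in> G. \<forall>h\<in>H. br h x = scale (r h) x}"

definition roots :: "'a set \<Rightarrow> ('a \<Rightarrow> complex) set" where
  "roots H = {r \<in> dual H. r \<noteq> 0 \<and> root_space H r \<noteq> {0}}"

definition nat_combination :: "('a \<Rightarrow> complex) set \<Rightarrow> ('a \<Rightarrow> complex) \<Rightarrow> bool" where
  "nat_combination \<Delta> r \<longleftrightarrow>
     (\<exists>c :: ('a \<Rightarrow> complex) \<Rightarrow> nat. r = (\<Sum>d\<in>\<Delta>. fun_scale (of_nat (c d)) d))"

definition root_base :: "'a set \<Rightarrow> ('a \<Rightarrow> complex) set \<Rightarrow> bool" where
  "root_base H \<Delta> \<longleftrightarrow> \<Delta> \<subseteq> roots H \<and> finite \<Delta> \<and> fun_space.independent \<Delta> \<and>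
     (\<forall>r\<in>roots H. nat_combination \<Delta> r \<or> nat_combination \<Delta> (- r))"

definition positive_roots :: "'a set \<Rightarrow> ('a \<Rightarrow> complex) set \<Rightarrow> ('a \<Rightarrow> complex) set" where
  "positive_roots H \<Delta> = {r \<in> roots H. nat_combination \<Delta> r}"

definition highest_root :: "'a set \<Rightarrow> ('a \<Rightarrow> complex) set \<Rightarrow> ('a \<Rightarrow> complex) \<Rightarrow> bool" where
  "highest_root H \<Delta> \<theta> \<longleftrightarrow> \<theta> \<in> roots H \<and> (\<forall>r\<in>roots H. nat_combination \<Delta> (\<theta> - r))"

definition coroot :: "'a set \<Rightarrow> ('a \<Rightarrow> complex) \<Rightarrow> 'a \<Rightarrow> bool" where
  "coroot H r h \<longleftrightarrow>
     (\<exists>x\<in>root_space H r. \<exists>y\<in>root_space H (- r). h = br x y) \<and> r h = 2"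

text \<open>For a suitable numbering \<open>ds\<close> of a base, the \<open>(i, j)\<close> entry of \<open>A\<close> is the value of the
  \<open>j\<close>-th simple root on the coroot of the \<open>i\<close>-th.\<close>

definition has_cartan_matrix :: "int list list \<Rightarrow> bool" where
  "has_cartan_matrix A \<longleftrightarrow> (\<exists>H ds hs. cartan_subalgebra H \<and>
     distinct ds \<and> root_base H (set ds) \<and> length ds = length A \<and> length hs = length A \<and>
     (\<forall>i<length A. coroot H (ds ! i) (hs ! i)) \<and>
     (\<forall>i<length A. \<forall>j<length A. (ds ! j) (hs ! i) = of_int (A ! i ! j)))"


subsection \<open>Vogel's parameters\<close>

definition exceptional_series :: "complex \<Rightarrow> bool" where
  "exceptional_series a \<longleftrightarrow>
     a = - 1 \<and> isomorphic_to_mat (sl_mat 3) \<or>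
     a = - 2 / 3 \<and> has_cartan_matrix cartan_G2 \<or>
     a = 0 \<and> isomorphic_to_mat (so_mat 8) \<or>
     a = 1 \<and> has_cartan_matrix cartan_F4 \<or>
     a = 2 \<and> has_cartan_matrix cartan_E6 \<or>
     a = 4 \<and> has_cartan_matrix cartan_E7 \<or>
     a = 8 \<and> has_cartan_matrix cartan_E8"

definition F3_series :: "complex \<Rightarrow> nat \<Rightarrow> bool" where
  "F3_series a r \<longleftrightarrow>
     r \<ge> 3 \<and> a = 1 \<and> isomorphic_to_mat (sp_mat r) \<or>
     r \<ge> 3 \<and> a = 2 \<and> isomorphic_to_mat (sl_mat (2 * r)) \<or>
     r \<ge> 3 \<and> a = 4 \<and> isomorphic_to_mat (so_mat (4 * r)) \<or>
     r = 3 \<and> a = 8 \<and> has_cartan_matrix cartan_E7"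

text \<open>The bounds on \<open>n\<close> are those for which the algebra is simple, except that \<open>so\<^sub>3\<close> is omitted:
  its triple \<open>(-2, 4, -1)\<close> makes the denominators \<open>t + \<alpha> / 2\<close> and \<open>\<beta> + \<gamma> - 3\<close> of the dimension
  formulas vanish.  It is isomorphic to \<open>sl\<^sub>2\<close>, which is covered.\<close>

inductive vogel_triple :: "complex \<Rightarrow> complex \<Rightarrow> complex \<Rightarrow> bool" where
  sp: "n \<ge> 1 \<Longrightarrow> isomorphic_to_mat (sp_mat n) \<Longrightarrow> vogel_triple (- 2) 1 (of_nat n + 2)"
| sl: "n \<ge> 2 \<Longrightarrow> isomorphic_to_mat (sl_mat n) \<Longrightarrow> vogel_triple (- 2) 2 (of_nat n)"
| so: "n \<ge> 5 \<Longrightarrow> isomorphic_to_mat (so_mat n) \<Longrightarrow> vogel_triple (- 2) 4 (of_nat n - 4)"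
| exceptional: "exceptional_series a \<Longrightarrow> vogel_triple (- 2) (a + 4) (2 * a + 4)"
| F3: "F3_series a r \<Longrightarrow> vogel_triple (- 2) a (a * (of_nat r - 2) + 4)"


subsection \<open>Modules and highest weights\<close>

definition lie_module ::
  "(complex \<Rightarrow> 'v::ab_group_add \<Rightarrow> 'v) \<Rightarrow> 'v set \<Rightarrow> ('a \<Rightarrow> 'v \<Rightarrow> 'v) \<Rightarrow> bool" where
  "lie_module sV V \<rho> \<longleftrightarrow> vector_space sV \<and> module.subspace sV V \<and>
     (\<exists>E. finite E \<and> module.span sV E = V) \<and>
     (\<forall>x\<in>G. \<forall>v\<in>V. \<rho> x v \<in> V) \<and>
     (\<forall>x\<in>G. \<forall>v\<in>V. \<forall>w\<in>V. \<rho> x (v + w) = \<rho> x v + \<rho> x w) \<and>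
     (\<forall>x\<in>G. \<forall>c. \<forall>v\<in>V. \<rho> x (sV c v) = sV c (\<rho> x v)) \<and>
     (\<forall>x\<in>G. \<forall>y\<in>G. \<forall>v\<in>V. \<rho> (x + y) v = \<rho> x v + \<rho> y v) \<and>
     (\<forall>c. \<forall>x\<in>G. \<forall>v\<in>V. \<rho> (scale c x) v = sV c (\<rho> x v)) \<and>
     (\<forall>x\<in>G. \<forall>y\<in>G. \<forall>v\<in>V. \<rho> (br x y) v = \<rho> x (\<rho> y v) - \<rho> y (\<rho> x v))"

definition submodule ::
  "(complex \<Rightarrow> 'v::ab_group_add \<Rightarrow> 'v) \<Rightarrow> 'v set \<Rightarrow> ('a \<Rightarrow> 'v \<Rightarrow> 'v) \<Rightarrow> 'v set \<Rightarrow> bool" where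
  "submodule sV V \<rho> W \<longleftrightarrow> module.subspace sV W \<and> W \<subseteq> V \<and> (\<forall>x\<in>G. \<forall>w\<in>W. \<rho> x w \<in> W)"

definition irreducible_module ::
  "(complex \<Rightarrow> 'v::ab_group_add \<Rightarrow> 'v) \<Rightarrow> 'v set \<Rightarrow> ('a \<Rightarrow> 'v \<Rightarrow> 'v) \<Rightarrow> bool" where
  "irreducible_module sV V \<rho> \<longleftrightarrow> lie_module sV V \<rho> \<and> V \<noteq> {0} \<and>
     (\<forall>W. submodule sV V \<rho> W \<longrightarrow> W = {0} \<or> W = V)"

definition highest_weight_vector ::
  "'a set \<Rightarrow> ('a \<Rightarrow> complex) set \<Rightarrow> (complex \<Rightarrow> 'v::ab_group_add \<Rightarrow> 'v) \<Rightarrow> ('a \<Rightarrow> 'v \<Rightarrow> 'v) \<Rightarrow>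
     ('a \<Rightarrow> complex) \<Rightarrow> 'v \<Rightarrow> bool" where
  "highest_weight_vector H \<Delta> sV \<rho> \<mu> v \<longleftrightarrow> v \<noteq> 0 \<and> (\<forall>h\<in>H. \<rho> h v = sV (\<mu> h) v) \<and>
     (\<forall>r\<in>positive_roots H \<Delta>. \<forall>x\<in>root_space H r. \<rho> x v = 0)"

definition irreducible_with_highest_weight ::
  "'a set \<Rightarrow> ('a \<Rightarrow> complex) set \<Rightarrow> ('a \<Rightarrow> complex) \<Rightarrow>
     (complex \<Rightarrow> 'v::ab_group_add \<Rightarrow> 'v) \<Rightarrow> 'v set \<Rightarrow> ('a \<Rightarrow> 'v \<Rightarrow> 'v) \<Rightarrow> bool" where
  "irreducible_with_highest_weight H \<Delta> \<mu> sV V \<rho> \<longleftrightarrow> irreducible_module sV V \<rho> \<and>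
     (\<exists>v\<in>V. highest_weight_vector H \<Delta> sV \<rho> \<mu> v)"

definition cartan_power ::
  "'a set \<Rightarrow> ('a \<Rightarrow> complex) set \<Rightarrow> ('a \<Rightarrow> complex) \<Rightarrow> nat \<Rightarrow>
     (complex \<Rightarrow> 'v::ab_group_add \<Rightarrow> 'v) \<Rightarrow> 'v set \<Rightarrow> ('a \<Rightarrow> 'v \<Rightarrow> 'v) \<Rightarrow> bool" where
  "cartan_power H \<Delta> \<theta> k sV V \<rho> \<longleftrightarrow>
     irreducible_with_highest_weight H \<Delta> (fun_scale (of_nat k) \<theta>) sV V \<rho>"


subsection \<open>The normalized Casimir operator\<close>

definition invariant_form :: "('a \<Rightarrow> 'a \<Rightarrow> complex) \<Rightarrow> bool" where
  "invariant_form B \<longleftrightarrow>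
     (\<forall>x\<in>G. \<forall>y\<in>G. \<forall>z\<in>G. B (x + y) z = B x z + B y z) \<and>
     (\<forall>c. \<forall>x\<in>G. \<forall>y\<in>G. B (scale c x) y = c * B x y) \<and>
     (\<forall>x\<in>G. \<forall>y\<in>G. B x y = B y x) \<and>
     (\<forall>x\<in>G. \<forall>y\<in>G. \<forall>z\<in>G. B (br x y) z = B x (br y z)) \<and>
     (\<forall>x\<in>G. (\<forall>y\<in>G. B x y = 0) \<longrightarrow> x = 0)"

definition some_basis :: "'a set" where
  "some_basis = (SOME E. finite E \<and> independent E \<and> span E = G)"

definition dual_vector :: "('a \<Rightarrow> 'a \<Rightarrow> complex) \<Rightarrow> 'a \<Rightarrow> 'a" where
  "dual_vector B e =
     (THE y. y \<in> G \<and> (\<forall>e'\<in>some_basis. B y e' = (if e' = e then 1 else 0)))"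

text \<open>The operator does not depend on the chosen basis of \<open>G\<close>.\<close>

definition casimir ::
  "('a \<Rightarrow> 'a \<Rightarrow> complex) \<Rightarrow> ('a \<Rightarrow> 'v::ab_group_add \<Rightarrow> 'v) \<Rightarrow> 'v \<Rightarrow> 'v" where
  "casimir B \<rho> v = (\<Sum>e\<in>some_basis. \<rho> e (\<rho> (dual_vector B e) v))"

text \<open>On a simple Lie algebra the invariant forms are proportional, so for \<open>t \<noteq> 0\<close> the following
  condition determines \<open>B\<close>, and thereby the Casimir operator.\<close>

definition casimir_normalized :: "('a \<Rightarrow> 'a \<Rightarrow> complex) \<Rightarrow> complex \<Rightarrow> bool" where
  "casimir_normalized B t \<longleftrightarrow> invariant_form B \<and> (\<forall>x\<in>G. casimir B br x = scale (2 * t) x)"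


subsection \<open>Symmetric powers\<close>

text \<open>The tensor power \<open>G\<^sup>\<otimes>\<^sup>k\<close> is modelled by multilinear functions of \<open>k\<close> elements of \<open>G\<^sup>*\<close>: the
  decomposable tensor of \<open>xs\<close> takes \<open>fs\<close> to the product of the \<open>(fs ! i) (xs ! i)\<close>.  The symmetric
  power is the space of symmetric tensors, which is the usual one in characteristic 0.\<close>

definition dual_lists :: "nat \<Rightarrow> ('a \<Rightarrow> complex) list set" where
  "dual_lists k = {fs. length fs = k \<and> set fs \<subseteq> dual G}"

definition tensor :: "'a list \<Rightarrow> ('a \<Rightarrow> complex) list \<Rightarrow> complex" where
  "tensor xs = (\<lambda>fs. if fs \<in> dual_lists (length xs)
                     then \<Prod>i<length xs. (fs ! i) (xs ! i) else 0)"

definition tensor_power :: "nat \<Rightarrow> (('a \<Rightarrow> complex) list \<Rightarrow> complex) set" where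
  "tensor_power k = fun_space.span {tensor xs | xs. length xs = k \<and> set xs \<subseteq> G}"

definition sym_power :: "nat \<Rightarrow> (('a \<Rightarrow> complex) list \<Rightarrow> complex) set" where
  "sym_power k = {T \<in> tensor_power k. \<forall>fs gs. mset fs = mset gs \<longrightarrow> T fs = T gs}"

definition pullback_ad :: "'a \<Rightarrow> ('a \<Rightarrow> complex) \<Rightarrow> 'a \<Rightarrow> complex" where
  "pullback_ad x f = (\<lambda>y. if y \<in> G then f (br x y) else 0)"

definition tensor_action ::
  "nat \<Rightarrow> 'a \<Rightarrow> (('a \<Rightarrow> complex) list \<Rightarrow> complex) \<Rightarrow> ('a \<Rightarrow> complex) list \<Rightarrow> complex" where
  "tensor_action k x T = (\<lambda>fs. if fs \<in> dual_lists k
      then \<Sum>i<k. T (fs[i := pullback_ad x (fs ! i)]) else 0)"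

lemma pullback_ad_dual:
  assumes "x \<in> G" "f \<in> dual G"
  shows "pullback_ad x f \<in> dual G"
  using assms carrier_subspace
  by (auto simp: dual_def pullback_ad_def br_closed br_add_right br_scale_right
      subspace_add subspace_scale)

text \<open>The action of \<open>G\<close> on tensors is the one induced by the adjoint representation.\<close>

lemma tensor_action_tensor:
  assumes x: "x \<in> G" and xs: "length xs = k" "set xs \<subseteq> G"
  shows "tensor_action k x (tensor xs) = (\<Sum>i<k. tensor (xs[i := br x (xs ! i)]))"
proof
  fix fs
  have app: "(\<Sum>i\<in>I. F i) fs = (\<Sum>i\<in>I. F i fs)" if "finite I"
    for I :: "nat set" and F :: "nat \<Rightarrow> ('a \<Rightarrow> complex) list \<Rightarrow> complex"
    using that by induction auto
  show "tensor_action k x (tensor xs) fs = (\<Sum>i<k. tensor (xs[i := br x (xs ! i)])) fs"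
  proof (cases "fs \<in> dual_lists k")
    case True
    then have fs: "length fs = k" "set fs \<subseteq> dual G" by (auto simp: dual_lists_def)
    have "tensor xs (fs[i := pullback_ad x (fs ! i)]) = tensor (xs[i := br x (xs ! i)]) fs"
      if i: "i < k" for i
    proof -
      have "fs ! i \<in> dual G" using fs i by auto
      then have "fs[i := pullback_ad x (fs ! i)] \<in> dual_lists k"
        using fs pullback_ad_dual[OF x] set_update_subset_insert[of fs i]
        by (auto simp: dual_lists_def dest!: subsetD[OF set_update_subset_insert])
      moreover have "xs ! j \<in> G" if "j < k" for j using xs that by auto
      ultimately show ?thesis using True xs fs i
        by (auto simp: tensor_def nth_list_update pullback_ad_def intro!: prod.cong)
    qed
    then show ?thesis using True by (simp add: tensor_action_def app)
  next
    case False
    then show ?thesis using xs by (simp add: tensor_action_def app tensor_def)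
  qed
qed


subsection \<open>The modules \<open>Y\<^sub>k(\<alpha>)\<close>\<close>

definition vogel_dim :: "complex \<Rightarrow> complex \<Rightarrow> complex \<Rightarrow> nat \<Rightarrow> complex" where
  "vogel_dim \<alpha> \<beta> \<gamma> k = (let t = \<alpha> + \<beta> + \<gamma>; \<kappa> = of_nat k in
     (t - (\<kappa> - 1 / 2) * \<alpha>) / (t + \<alpha> / 2) *
     (((- 2 * t / \<alpha> - 2 + \<kappa>) gchoose k) *
      (((\<beta> - 2 * t) / \<alpha> - 1 + \<kappa>) gchoose k) *
      (((\<gamma> - 2 * t) / \<alpha> - 1 + \<kappa>) gchoose k)) /
     (((- \<beta> / \<alpha> - 1 + \<kappa>) gchoose k) * ((- \<gamma> / \<alpha> - 1 + \<kappa>) gchoose k)))"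

definition Y_module :: "('a \<Rightarrow> 'a \<Rightarrow> complex) \<Rightarrow> complex \<Rightarrow> complex \<Rightarrow> complex \<Rightarrow> nat \<Rightarrow>
     (('a \<Rightarrow> complex) list \<Rightarrow> complex) set \<Rightarrow> bool" where
  "Y_module B \<alpha> \<beta> \<gamma> k Y \<longleftrightarrow>
     submodule fun_scale (sym_power k) (tensor_action k) Y \<and>
     (\<forall>T\<in>Y. casimir B (tensor_action k) T =
        fun_scale (2 * of_nat k * (\<alpha> + \<beta> + \<gamma>) - ((of_nat k)\<^sup>2 - of_nat k) * \<alpha>) T) \<and>
     of_nat (fun_space.dim Y) = vogel_dim \<alpha> \<beta> \<gamma> k"

end

end

(*
The k-th power of a highest root vector is a highest weight vector of weight k theta in S^k g.
On g^(tensor k) the Casimir operator takes its largest eigenvalue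
(k theta, k theta + 2 rho) = 2kt + (k^2 - k)(theta, theta) on the submodule it generates, because the
weight k theta is the highest one and occurs once; so that eigenspace is the Cartan power, and since
(theta, theta) = 2 = -alpha it is Y_k. Weyl's formula, obtained from Freudenthal's identity in the
group ring of the weight space, gives its dimension as a product to which only the roots r with
(r, theta) nonzero contribute. The eigenspace does not refer to a Cartan subalgebra, so the product,
and likewise (theta, theta) = 2, may be computed with a convenient one: the diagonal matrices, or, for
the exceptional algebras, one whose root system is grown from the Cartan matrix by reflections.
*)

theory Submission
  imports Defs "HOL-Library.Poly_Mapping"
begin

section \<open>Linear algebra on subspaces\<close>

text \<open>The given Cartan subalgebra is arbitrary, so whatever is computed in a convenient one
  must come back through data visible in the symmetric powers themselves. The length of theta does
  so: in degree two the largest Casimir eigenvalue is 4t + 2(theta, theta). Root theory starts from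
  the normalization: eigenvalue 2t on the adjoint module makes the Killing form 2t times B, and t >
  0 makes the dual form definite on real weights. Highest weight vectors of quotients W / U of
  submodules take the place of complete reducibility: their weights mu are dominant, and among
  dominant weights below k theta the value (mu, mu + 2 rho) determines k theta. The Weyl group
  enters only as words in simple reflections. An alternating element of the group ring is determined
  by its coefficients at strictly dominant exponents. For the denominator integrality leaves the
  single exponent rho; for denominator times character the eigenvalue equation of a Laplacian leaves
  the single exponent lambda + rho.\<close>

locale vspace = vector_space
begin

text \<open>Operators of a Lie algebra or of a module are constrained only on its carrier, so
  linearity and trace are taken relative to a subspace of the ambient type.\<close>

definition lin_on :: "'b set => ('b => 'b) => bool" where
  "lin_on U f \<longleftrightarrow> (\<forall>x\<in>U. \<forall>y\<in>U. f (x + y) = f x + f y) \<and>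
     (\<forall>c. \<forall>x\<in>U. f (scale c x) = scale c (f x))"

definition fin_dim :: "'b set => bool" where
  "fin_dim U \<longleftrightarrow> subspace U \<and> (\<exists>E. finite E \<and> U \<subseteq> span E)"

definition sub_basis :: "'b set => 'b set" where
  "sub_basis U = (SOME E. E \<subseteq> U \<and> independent E \<and> U \<subseteq> span E \<and> card E = dim U)"

definition trace_on :: "'b set => ('b => 'b) => 'a" where "trace_on U f = (\<Sum>b\<in>sub_basis U. representation (sub_basis U) (f b) b)"

lemma lin_on_add: "lin_on U f ==> x \<in> U ==> y \<in> U ==> f (x + y) = f x + f y" by (auto simp: lin_on_def)

lemma lin_on_scale: "lin_on U f ==> x \<in> U ==> f (scale c x) = scale c (f x)" by (auto simp: lin_on_def)

lemma lin_on_zero: assumes "lin_on U f" "x \<in> U" shows "f 0 = 0" using lin_on_scale[OF assms, of 0] by simp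

lemma lin_on_diff: assumes "lin_on U f" "subspace U" "x \<in> U" "y \<in> U" shows "f (x - y) = f x - f y"
proof -
  have "f (x + scale (- 1) y) = f x + scale (- 1) (f y)"
    using assms by (simp add: lin_on_add lin_on_scale subspace_scale del: scale_minus_left)
  thus ?thesis by simp
qed

lemma lin_on_mono: "lin_on U f ==> W \<subseteq> U ==> lin_on W f" unfolding lin_on_def by blast

lemma lin_on_sum: assumes "lin_on U f" "subspace U" "\<And>i. i \<in> I ==> g i \<in> U"
  shows "f (\<Sum>i\<in>I. g i) = (\<Sum>i\<in>I. f (g i))" using assms(3)
proof (induction I rule: infinite_finite_induct)
  case (insert i I)
  thus ?case using assms(1,2) by (simp add: lin_on_add subspace_sum)
qed (use lin_on_zero[OF assms(1)] subspace_0[OF assms(2)] in auto)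

lemma sub_basis: assumes "fin_dim U" shows "sub_basis U \<subseteq> U" "independent (sub_basis U)" "span (sub_basis U) = U"
    "finite (sub_basis U)" "card (sub_basis U) = dim U"
proof -
  have "\<exists>E. E \<subseteq> U \<and> independent E \<and> U \<subseteq> span E \<and> card E = dim U"
    using basis_exists[of U] by metis
  hence *: "sub_basis U \<subseteq> U \<and> independent (sub_basis U) \<and> U \<subseteq> span (sub_basis U) \<and>
     card (sub_basis U) = dim U" unfolding sub_basis_def by (rule someI_ex)
  thus "sub_basis U \<subseteq> U" "independent (sub_basis U)" "card (sub_basis U) = dim U" by auto
  show "span (sub_basis U) = U" using * assms by (intro span_subspace) (auto simp: fin_dim_def)
  obtain E where "finite E" "U \<subseteq> span E" using assms by (auto simp: fin_dim_def)
  thus "finite (sub_basis U)" using * independent_span_bound[of E "sub_basis U"] by auto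
qed

lemma fin_dim_subset: "fin_dim U ==> subspace W ==> W \<subseteq> U ==> fin_dim W" unfolding fin_dim_def by blast

lemma card_independent_le_dim: assumes "fin_dim U" "independent S" "S \<subseteq> U" shows "finite S \<and> card S \<le> dim U"
  using independent_span_bound[of "sub_basis U" S] sub_basis[OF assms(1)] assms by auto

lemma fin_dim_dim_mono: assumes "fin_dim U" "subspace W" "W \<subseteq> U" shows "dim W \<le> dim U"
  using card_independent_le_dim[OF assms(1), of "sub_basis W"] sub_basis[OF fin_dim_subset[OF assms]]
    assms(3) by auto

lemma fin_dim_eqI: assumes "fin_dim U" "subspace W" "W \<subseteq> U" "dim W = dim U" shows "W = U"
proof (rule ccontr)
  assume "W \<noteq> U"
  then obtain x where x: "x \<in> U" "x \<notin> W" using assms(3) by auto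
  note W = sub_basis[OF fin_dim_subset[OF assms(1-3)]]
  have "independent (insert x (sub_basis W))" using x W by (intro independent_insertI) auto
  hence "card (insert x (sub_basis W)) \<le> dim U" using card_independent_le_dim[OF assms(1)] W x assms(3) by auto
  moreover have "x \<notin> sub_basis W" using x W by auto
  ultimately show False using W assms(4) by simp
qed

lemma dim_le_injective: assumes U: "fin_dim U" and W: "fin_dim W" and f: "lin_on U f" "\<And>x. x \<in> U ==> f x \<in> W"
    and inj: "\<And>x. x \<in> U ==> f x = 0 ==> x = 0" shows "dim U \<le> dim W"
proof -
  note B = sub_basis[OF U]
  have sU: "subspace U" using U by (simp add: fin_dim_def)
  have injon: "inj_on f (sub_basis U)"
  proof
    fix x y assume "x \<in> sub_basis U" "y \<in> sub_basis U" "f x = f y"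
    hence "f (x - y) = 0" "x - y \<in> U" using B lin_on_diff[OF f(1) sU, of x y] sU by (auto intro: subspace_diff)
    thus "x = y" using inj[of "x - y"] by simp
  qed
  have "independent (f ` sub_basis U)"
  proof (rule independent_if_scalars_zero)
    show "finite (f ` sub_basis U)" using B by simp
    fix g y assume g: "(\<Sum>x\<in>f ` sub_basis U. scale (g x) x) = 0" and y: "y \<in> f ` sub_basis U"
    have "0 = (\<Sum>b\<in>sub_basis U. scale (g (f b)) (f b))" using g sum.reindex[OF injon, of "\<lambda>x. scale (g x) x"] by simp
    also have "\<dots> = (\<Sum>b\<in>sub_basis U. f (scale (g (f b)) b))" using B f(1) by (intro sum.cong refl) (auto simp: lin_on_scale)
    also have "\<dots> = f (\<Sum>b\<in>sub_basis U. scale (g (f b)) b)"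
      using B by (intro lin_on_sum[OF f(1) sU, symmetric] subspace_scale[OF sU]) auto
    finally have "f (\<Sum>b\<in>sub_basis U. scale (g (f b)) b) = 0" by simp
    moreover have "(\<Sum>b\<in>sub_basis U. scale (g (f b)) b) \<in> U" using B by (intro subspace_sum[OF sU] subspace_scale[OF sU]) auto
    ultimately have "(\<Sum>b\<in>sub_basis U. scale (g (f b)) b) = 0" using inj by blast
    hence "g (f b) = 0" if "b \<in> sub_basis U" for b using independentD[OF B(2) B(4) order_refl, of "\<lambda>b. g (f b)" b] that by simp
    thus "g y = 0" using y by auto
  qed
  hence "card (f ` sub_basis U) \<le> dim W" using B f(2) by (intro card_independent_le_dim[OF W, THEN conjunct2]) auto
  thus ?thesis using B card_image[OF injon] by simp
qed

lemma representation_sum_basis: assumes "independent E" "finite E" "x \<in> span E"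
  shows "(\<Sum>b\<in>E. scale (representation E x b) b) = x" using sum_representation_eq[OF assms(1,3,2)] by auto

lemma representation_lin_on: assumes E: "independent E" "finite E" "span E = W" and f: "lin_on W f" "\<And>x. x \<in> W ==> f x \<in> U"
    and B: "independent B" "finite B" "span B = U" and x: "x \<in> W"
  shows "representation B (f x) b = (\<Sum>c\<in>E. representation E x c * representation B (f c) b)"
proof -
  have sW: "subspace W" using E(3) by auto
  have EW: "c \<in> E ==> c \<in> W" for c using E(3) span_base by auto
  have "f x = f (\<Sum>c\<in>E. scale (representation E x c) c)" using representation_sum_basis[OF E(1,2)] x E(3) by simp
  also have "\<dots> = (\<Sum>c\<in>E. scale (representation E x c) (f c))"
    using EW f(1) by (subst lin_on_sum[OF f(1) sW]) (auto simp: lin_on_scale subspace_scale[OF sW])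
  finally have "representation B (f x) b = representation B (\<Sum>c\<in>E. scale (representation E x c) (f c)) b" by simp
  also have "\<dots> = (\<Sum>c\<in>E. representation E x c * representation B (f c) b)"
    using f(2) EW B by (subst representation_sum) (auto intro!: span_scale simp: representation_scale)
  finally show ?thesis .
qed

text \<open>Both sides expand to the same double sum of matrix entries. With one map the identity
  this gives independence of the trace from the basis; with neighbouring weight spaces it gives the
  recursion along root strings.\<close>

lemma trace_on_basis_swap: assumes B: "independent B" "finite B" "span B = U" and E: "independent E" "finite E" "span E = W"
    and f: "lin_on W f" "\<And>x. x \<in> W ==> f x \<in> U" and g: "lin_on U g" "\<And>x. x \<in> U ==> g x \<in> W"
  shows "(\<Sum>b\<in>B. representation B (f (g b)) b) = (\<Sum>c\<in>E. representation E (g (f c)) c)"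
proof -
  have BU: "b \<in> B ==> b \<in> U" for b using B(3) span_base by auto
  have EW: "c \<in> E ==> c \<in> W" for c using E(3) span_base by auto
  have "(\<Sum>b\<in>B. representation B (f (g b)) b) = (\<Sum>b\<in>B. \<Sum>c\<in>E. representation E (g b) c * representation B (f c) b)"
    using BU g(2) by (intro sum.cong refl representation_lin_on[OF E f B]) auto
  also have "\<dots> = (\<Sum>c\<in>E. \<Sum>b\<in>B. representation B (f c) b * representation E (g b) c)"
    by (subst sum.swap) (simp add: mult.commute)
  also have "\<dots> = (\<Sum>c\<in>E. representation E (g (f c)) c)"
    using EW f(2) by (intro sum.cong refl representation_lin_on[OF B g E, symmetric]) auto
  finally show ?thesis .
qed

lemma trace_on_swap: assumes "fin_dim U" "fin_dim W" "lin_on W f" "\<And>x. x \<in> W ==> f x \<in> U"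
    and "lin_on U g" "\<And>x. x \<in> U ==> g x \<in> W" shows "trace_on U (\<lambda>x. f (g x)) = trace_on W (\<lambda>x. g (f x))"
  unfolding trace_on_def using trace_on_basis_swap[OF sub_basis(2,4,3)[OF assms(1)] sub_basis(2,4,3)[OF assms(2)] assms(3-6)] .

lemma trace_on_any_basis: assumes "fin_dim U" "independent B" "finite B" "span B = U" and "lin_on U f" "\<And>x. x \<in> U ==> f x \<in> U"
  shows "trace_on U f = (\<Sum>b\<in>B. representation B (f b) b)" unfolding trace_on_def
  using trace_on_basis_swap[OF sub_basis(2,4,3)[OF assms(1)] assms(2-4), of "\<lambda>x. x" f] assms(5,6) by (auto simp: lin_on_def)

lemma trace_on_cong: assumes "fin_dim U" "\<And>x. x \<in> U ==> f x = g x" shows "trace_on U f = trace_on U g"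
  unfolding trace_on_def using sub_basis(1)[OF assms(1)] assms(2) by (intro sum.cong refl) (auto simp: subset_iff)

lemma trace_on_add: assumes "fin_dim U" "\<And>x. x \<in> U ==> f x \<in> U" "\<And>x. x \<in> U ==> g x \<in> U"
  shows "trace_on U (\<lambda>x. f x + g x) = trace_on U f + trace_on U g" unfolding trace_on_def sum.distrib[symmetric]
  using sub_basis[OF assms(1)] assms(2,3) by (intro sum.cong refl) (auto simp: representation_add subset_iff)

lemma trace_on_scale: assumes "fin_dim U" "\<And>x. x \<in> U ==> f x \<in> U"
  shows "trace_on U (\<lambda>x. scale c (f x)) = c * trace_on U f" unfolding trace_on_def sum_distrib_left
  using sub_basis[OF assms(1)] assms(2) by (intro sum.cong refl) (auto simp: representation_scale subset_iff)

lemma trace_on_id: assumes "fin_dim U" shows "trace_on U (\<lambda>x. x) = of_nat (dim U)"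
proof -
  have "trace_on U (\<lambda>x. x) = (\<Sum>b\<in>sub_basis U. 1)" unfolding trace_on_def using sub_basis[OF assms]
    by (intro sum.cong refl) (auto simp: representation_basis)
  thus ?thesis using sub_basis[OF assms] by simp
qed

lemma trace_on_sum: assumes "fin_dim U" "finite I" "\<And>i x. i \<in> I ==> x \<in> U ==> f i x \<in> U"
  shows "trace_on U (\<lambda>x. \<Sum>i\<in>I. f i x) = (\<Sum>i\<in>I. trace_on U (f i))" using assms(2,3)
proof (induction I)
  case empty
  thus ?case using sub_basis[OF assms(1)] by (simp add: trace_on_def representation_zero)
next
  case (insert i I)
  have "subspace U" using assms(1) by (simp add: fin_dim_def)
  thus ?case using insert by (simp add: trace_on_add[OF assms(1)] subspace_sum)
qed

text \<open>Applying \<open>f a - e \<nu> a\<close> to the sum kills the term at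
  \<open>\<nu>\<close> and rescales the others, for a suitable \<open>a\<close> by a nonzero factor
  at the given index; induct on \<open>S\<close>. With \<open>W = {0}\<close> this is independence
  of joint eigenvectors.\<close>

lemma joint_eigen_components: assumes V: "subspace V" and lin: "\<And>a. a \<in> A ==> lin_on V (f a)"
    and W: "subspace W" "W \<subseteq> V" and stable: "\<And>a w. a \<in> A ==> w \<in> W ==> f a w \<in> W"
    and "finite S" and v: "\<And>\<mu>. \<mu> \<in> S ==> v \<mu> \<in> V"
    and eig: "\<And>\<mu> a. \<mu> \<in> S ==> a \<in> A ==> f a (v \<mu>) = scale (e \<mu> a) (v \<mu>)"
    and sep: "\<And>\<mu> \<nu>. \<mu> \<in> S ==> \<nu> \<in> S ==> \<mu> \<noteq> \<nu> ==> \<exists>a\<in>A. e \<mu> a \<noteq> e \<nu> a"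
    and sumW: "(\<Sum>\<mu>\<in>S. v \<mu>) \<in> W" and "\<mu> \<in> S" shows "v \<mu> \<in> W"
  using \<open>finite S\<close> v eig sep sumW \<open>\<mu> \<in> S\<close>
proof (induction S arbitrary: v \<mu>)
  case (insert \<nu> S)
  define w where "w = v \<nu> + (\<Sum>\<mu>\<in>S. v \<mu>)"
  have wW: "w \<in> W" using insert by (simp add: w_def)
  have S: "v \<mu> \<in> W" if \<mu>: "\<mu> \<in> S" for \<mu>
  proof -
    obtain a where a: "a \<in> A" "e \<mu> a \<noteq> e \<nu> a" using insert.prems(3)[of \<mu> \<nu>] \<mu> insert.hyps by auto
    define u where "u = (\<lambda>\<mu>. scale (e \<mu> a - e \<nu> a) (v \<mu>))"
    have "f a w = f a (v \<nu>) + (\<Sum>\<mu>\<in>S. f a (v \<mu>))" using insert.prems(1) lin[OF a(1)] V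
      by (simp add: w_def lin_on_add subspace_sum lin_on_sum)
    also have "\<dots> = scale (e \<nu> a) (v \<nu>) + (\<Sum>\<mu>\<in>S. scale (e \<mu> a) (v \<mu>))" using insert.prems(2) a(1) by simp
    finally have "f a w - scale (e \<nu> a) w = (\<Sum>\<mu>\<in>S. u \<mu>)"
      by (simp add: w_def u_def scale_right_distrib scale_left_diff_distrib scale_sum_right sum_subtractf)
    moreover have "f a w - scale (e \<nu> a) w \<in> W" using W(1) stable[OF a(1) wW] wW by (simp add: subspace_diff subspace_scale)
    ultimately have sW: "(\<Sum>\<mu>\<in>S. u \<mu>) \<in> W" by simp
    have uV: "u \<mu> \<in> V" if "\<mu> \<in> S" for \<mu> using insert.prems(1) that V by (simp add: u_def subspace_scale)
    have ue: "f b (u \<mu>) = scale (e \<mu> b) (u \<mu>)" if "\<mu> \<in> S" "b \<in> A" for \<mu> b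
      using insert.prems(1,2) that by (simp add: u_def lin_on_scale[OF lin] mult.commute)
    have "u \<mu> \<in> W" by (rule insert.IH[of u, OF uV ue _ sW \<mu>]) (use insert.prems(3) in auto)
    hence "scale (inverse (e \<mu> a - e \<nu> a)) (u \<mu>) \<in> W" using W(1) by (simp add: subspace_scale)
    thus ?thesis using a(2) by (simp add: u_def)
  qed
  have "v \<nu> = w - (\<Sum>\<mu>\<in>S. v \<mu>)" by (simp add: w_def)
  hence "v \<nu> \<in> W" using S W(1) wW by (simp add: subspace_diff subspace_sum)
  thus ?case using insert.prems(5) S by blast
qed blast

lemma span_Union_decomp: assumes "\<And>i. i \<in> I ==> subspace (E i)" and "x \<in> span (\<Union>i\<in>I. E i)"
  shows "\<exists>S y. finite S \<and> S \<subseteq> I \<and> (\<forall>i\<in>S. y i \<in> E i) \<and> x = (\<Sum>i\<in>S. y i)"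
  using assms(2)
proof (induction rule: span_induct_alt)
  case base
  show ?case by (rule exI[of _ "{}"]) auto
next
  case (step c u z)
  then obtain S y where S: "finite S" "S \<subseteq> I" "\<forall>i\<in>S. y i \<in> E i" "z = (\<Sum>i\<in>S. y i)" by auto
  obtain j where j: "j \<in> I" "u \<in> E j" using step by auto
  define y' where "y' = (\<lambda>i. (if i = j then scale c u else 0) + (if i \<in> S then y i else 0))"
  have "(\<Sum>i\<in>insert j S. y' i) = scale c u + z"
  proof -
    have "(\<Sum>i\<in>insert j S. if i \<in> S then y i else 0) = (\<Sum>i\<in>S. y i)"
      using S(1) by (intro sum.mono_neutral_cong_right) auto
    moreover have "(\<Sum>i\<in>insert j S. if i = j then scale c u else 0) = scale c u" using S(1) by simp
    ultimately show ?thesis using S(4) by (simp only: y'_def sum.distrib)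
  qed
  moreover have "\<forall>i\<in>insert j S. y' i \<in> E i" using S assms(1) j by (auto simp: y'_def subspace_add subspace_scale subspace_0)
  ultimately show ?case using S j by (intro exI[of _ "insert j S"] exI[of _ y']) auto
qed

lemma subspace_eigenspace: assumes "subspace V" "lin_on V f" shows "subspace {x \<in> V. f x = scale c x}"
  using assms lin_on_zero[OF assms(2) subspace_0[OF assms(1)]] by (intro subspaceI)
    (auto simp: subspace_0 subspace_add subspace_scale lin_on_add lin_on_scale lin_on_zero
      scale_right_distrib mult.commute)

text \<open>A joint eigenvector \<open>x\<close> of the earlier operators splits into eigenvectors
  \<open>y c\<close> of the new one. If \<open>f b x = d x\<close>, then by commutation the vectors
  \<open>(f b - d) (y c)\<close> are eigenvectors of \<open>f a\<close> for distinct eigenvalues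
  with sum 0, so each vanishes.\<close>

lemma simultaneous_diagonalization: assumes "finite A" and V: "subspace V" and lin: "\<And>a. a \<in> A ==> lin_on V (f a)"
    and into: "\<And>a x. a \<in> A ==> x \<in> V ==> f a x \<in> V"
    and comm: "\<And>a b x. a \<in> A ==> b \<in> A ==> x \<in> V ==> f a (f b x) = f b (f a x)"
    and diag: "\<And>a. a \<in> A ==> V \<subseteq> span {x \<in> V. \<exists>c. f a x = scale c x}"
  shows "V \<subseteq> span {x \<in> V. \<forall>a\<in>A. \<exists>c. f a x = scale c x}" using assms(1) lin into comm diag
proof (induction A)
  case empty
  thus ?case by (auto intro: span_base)
next
  case (insert a A)
  note lin' = insert.prems(1) and into' = insert.prems(2)
  let ?J = "{x \<in> V. \<forall>b\<in>insert a A. \<exists>c. f b x = scale c x}"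
  have "x \<in> span ?J" if x: "x \<in> V" and xA: "\<forall>b\<in>A. \<exists>c. f b x = scale c x" for x
  proof -
    have eq: "{x \<in> V. \<exists>c. f a x = scale c x} = (\<Union>c\<in>UNIV. {x \<in> V. f a x = scale c x})" by auto
    have "x \<in> span (\<Union>c\<in>UNIV. {x \<in> V. f a x = scale c x})" using insert.prems(4)[of a] x unfolding eq by auto
    then obtain S y where S: "finite S" "\<forall>c\<in>S. y c \<in> V \<and> f a (y c) = scale c (y c)" "x = (\<Sum>c\<in>S. y c)"
      using span_Union_decomp[of UNIV "\<lambda>c. {x \<in> V. f a x = scale c x}" x]
        subspace_eigenspace[OF V lin'[of a]] by auto
    have "y c \<in> ?J" if c: "c \<in> S" for c
    proof -
      have "\<exists>d. f b (y c) = scale d (y c)" if b: "b \<in> A" for b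
      proof -
        obtain d where d: "f b x = scale d x" using xA b by auto
        define z where "z = (\<lambda>c. f b (y c) - scale d (y c))"
        have zV: "z c \<in> V" if "c \<in> S" for c using S(2) that into' b V by (simp add: z_def subspace_diff subspace_scale)
        have bV: "lin_on V (f b)" using lin' b by simp
        have aV: "lin_on V (f a)" using lin' by simp
        have "(\<Sum>c\<in>S. z c) = f b x - scale d x"
          using S(2) by (simp add: z_def sum_subtractf S(3) lin_on_sum[OF bV V] scale_sum_right)
        hence z0: "(\<Sum>c\<in>S. z c) \<in> {0}" using d by simp
        have za: "f i (z c) = scale c (z c)" if "c \<in> S" "i \<in> {a}" for c i
          using S(2) that insert.prems(3)[of a b "y c"] b into'[of b "y c"]
          by (simp add: z_def lin_on_diff[OF aV V] subspace_scale[OF V] lin_on_scale[OF aV]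
              scale_right_diff_distrib mult.commute lin_on_scale[OF bV])
        have "z c \<in> {0}" by (rule joint_eigen_components[where f=f and A="{a}" and S=S and e="\<lambda>c a. c" and v=z, OF V])
            (use aV V zV za z0 c S(1) lin_on_zero[OF aV subspace_0[OF V]] in \<open>auto simp: subspace_0[OF V]\<close>)
        thus ?thesis by (auto simp: z_def)
      qed
      thus ?thesis using S(2) c by auto
    qed
    thus ?thesis unfolding S(3) by (intro span_sum span_base) auto
  qed
  hence "{x \<in> V. \<forall>a\<in>A. \<exists>c. f a x = scale c x} \<subseteq> span ?J" by auto
  hence "span {x \<in> V. \<forall>a\<in>A. \<exists>c. f a x = scale c x} \<subseteq> span ?J" by (intro span_minimal) auto
  moreover have "V \<subseteq> span {x \<in> V. \<forall>a\<in>A. \<exists>c. f a x = scale c x}" using insert by simp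
  ultimately show ?case by blast
qed

end

lemma (in vspace) subspace_scale_cancel: assumes "subspace U" "scale c x \<in> U" "c \<noteq> 0" shows "x \<in> U"
  using subspace_scale[OF assms(1,2), of "inverse c"] assms(3) by simp

text \<open>The source of finiteness: chains of raising or lowering operators end, and a module has
  finitely many weights.\<close>

lemma (in vspace) joint_eigen_card: assumes V: "fin_dim V" and lin: "\<And>a. a \<in> A ==> lin_on V (f a)"
    and "finite S" and v: "\<And>\<mu>. \<mu> \<in> S ==> v \<mu> \<in> V" "\<And>\<mu>. \<mu> \<in> S ==> v \<mu> \<noteq> 0"
    and eig: "\<And>\<mu> a. \<mu> \<in> S ==> a \<in> A ==> f a (v \<mu>) = scale (e \<mu> a) (v \<mu>)"
    and sep: "\<And>\<mu> \<nu>. \<mu> \<in> S ==> \<nu> \<in> S ==> \<mu> \<noteq> \<nu> ==> \<exists>a\<in>A. e \<mu> a \<noteq> e \<nu> a"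
  shows "card S \<le> dim V"
proof -
  have sV: "subspace V" using V by (simp add: fin_dim_def)
  have zero: "f a 0 = 0" if "a \<in> A" for a using lin_on_zero[OF lin[OF that] subspace_0[OF sV]] .
  have comp: "g \<mu> = 0" if g: "\<And>\<mu>. \<mu> \<in> S ==> \<exists>c. g \<mu> = scale c (v \<mu>)" and 0: "(\<Sum>\<mu>\<in>S. g \<mu>) = 0" and "\<mu> \<in> S"
    for g \<mu>
  proof -
    have gV: "g \<mu> \<in> V" if "\<mu> \<in> S" for \<mu> using g[OF that] v(1)[OF that] sV by (auto simp: subspace_scale)
    have ge: "f a (g \<mu>) = scale (e \<mu> a) (g \<mu>)" if "\<mu> \<in> S" "a \<in> A" for \<mu> a
      using g[OF that(1)] v(1)[OF that(1)] eig[OF that] lin_on_scale[OF lin[OF that(2)]] by (auto simp: mult.commute)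
    have "g \<mu> \<in> {0}" by (rule joint_eigen_components[where f=f and A=A and S=S and e=e, OF sV lin])
        (use sV zero gV ge sep \<open>finite S\<close> 0 \<open>\<mu> \<in> S\<close> in \<open>auto simp: subspace_0\<close>)
    thus ?thesis by simp
  qed
  have inj: "inj_on v S"
  proof (rule inj_onI, rule ccontr)
    fix \<mu> \<nu> assume *: "\<mu> \<in> S" "\<nu> \<in> S" "v \<mu> = v \<nu>" "\<mu> \<noteq> \<nu>"
    \<comment> \<open>Two coinciding vectors would give the vanishing combination
      \<open>v \<mu> - v \<nu>\<close> of joint eigenvectors.\<close>
    define g where "g = (\<lambda>\<kappa>. (if \<kappa> = \<mu> then v \<kappa> else 0) + (if \<kappa> = \<nu> then - v \<kappa> else 0))"
    have "(\<Sum>\<kappa>\<in>S. g \<kappa>) = 0" unfolding g_def sum.distrib using * \<open>finite S\<close> by simp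
    moreover have "\<exists>c. g \<kappa> = scale c (v \<kappa>)" for \<kappa>
    proof (cases "\<kappa> = \<mu>")
      case True thus ?thesis using * by (intro exI[of _ 1]) (simp add: g_def)
    next
      case False
      thus ?thesis by (cases "\<kappa> = \<nu>") (auto simp: g_def intro: exI[of _ "-1"] exI[of _ 0])
    qed
    ultimately have "g \<mu> = 0" using comp * by blast
    thus False using * v(2)[of \<mu>] by (auto simp: g_def split: if_splits)
  qed
  have "independent (v ` S)"
  proof (rule independent_if_scalars_zero)
    fix g y assume g: "(\<Sum>x\<in>v ` S. scale (g x) x) = 0" and y: "y \<in> v ` S"
    obtain \<mu> where \<mu>: "\<mu> \<in> S" "y = v \<mu>" using y by auto
    have "(\<Sum>\<mu>\<in>S. scale (g (v \<mu>)) (v \<mu>)) = 0" using g sum.reindex[OF inj, of "\<lambda>x. scale (g x) x"] by simp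
    hence "scale (g (v \<mu>)) (v \<mu>) = 0" using \<mu> by (intro comp[of "\<lambda>\<mu>. scale (g (v \<mu>)) (v \<mu>)"]) auto
    thus "g y = 0" using \<mu> v(2) by auto
  qed (use \<open>finite S\<close> in auto)
  hence "card (v ` S) \<le> dim V" using v(1) card_independent_le_dim[OF V] by blast
  thus ?thesis using card_image[OF inj] by simp
qed

section \<open>Representations\<close>

sublocale lie_algebra \<subseteq> vspace scale by unfold_locales

locale lie_rep = lie_algebra + fixes sV :: "complex => 'v::ab_group_add => 'v" and V :: "'v set" and \<rho> :: "'a => 'v => 'v"
  assumes module: "lie_module sV V \<rho>"
begin

sublocale M: vspace sV using module unfolding lie_module_def vspace_def by blast

lemma V_fin_dim: "M.fin_dim V"
proof -
  obtain E where "finite E" "M.span E = V" using module unfolding lie_module_def by blast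
  thus ?thesis unfolding M.fin_dim_def by (intro conjI exI[of _ E]) auto
qed

lemma V_subspace: "M.subspace V" using V_fin_dim by (simp add: M.fin_dim_def)

lemma act_in: "x \<in> G ==> v \<in> V ==> \<rho> x v \<in> V"
  and act_add: "x \<in> G ==> v \<in> V ==> w \<in> V ==> \<rho> x (v + w) = \<rho> x v + \<rho> x w"
  and act_scale: "x \<in> G ==> v \<in> V ==> \<rho> x (sV c v) = sV c (\<rho> x v)"
  and act_add_left: "x \<in> G ==> y \<in> G ==> v \<in> V ==> \<rho> (x + y) v = \<rho> x v + \<rho> y v"
  and act_scale_left: "x \<in> G ==> v \<in> V ==> \<rho> (scale c x) v = sV c (\<rho> x v)"
  and act_br: "x \<in> G ==> y \<in> G ==> v \<in> V ==> \<rho> (br x y) v = \<rho> x (\<rho> y v) - \<rho> y (\<rho> x v)"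
  using module unfolding lie_module_def by blast+

lemma act_lin: "x \<in> G ==> M.lin_on V (\<rho> x)" unfolding M.lin_on_def using act_add act_scale by blast

lemma act_zero: "x \<in> G ==> \<rho> x 0 = 0" using M.lin_on_zero[OF act_lin M.subspace_0[OF V_subspace]] .

lemma act_diff: "x \<in> G ==> v \<in> V ==> w \<in> V ==> \<rho> x (v - w) = \<rho> x v - \<rho> x w"
  using M.lin_on_diff[OF act_lin V_subspace] .

lemma act_sum: "x \<in> G ==> (\<And>i. i \<in> I ==> g i \<in> V) ==> \<rho> x (\<Sum>i\<in>I. g i) = (\<Sum>i\<in>I. \<rho> x (g i))"
  using M.lin_on_sum[OF act_lin V_subspace] .

lemma act_zero_left: "v \<in> V ==> \<rho> 0 v = 0" using act_scale_left[of 0 v 0] carrier_subspace by (simp add: subspace_0)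

lemma act_sum_left: assumes "v \<in> V" "\<And>i. i \<in> I ==> g i \<in> G"
  shows "\<rho> (\<Sum>i\<in>I. g i) v = (\<Sum>i\<in>I. \<rho> (g i) v)" using assms(2)
proof (induction I rule: infinite_finite_induct)
  case (insert i I)
  thus ?case using assms(1) carrier_subspace by (simp add: act_add_left subspace_sum)
qed (use assms(1) act_zero_left in auto)

subsection \<open>The action of an \<open>sl\<^sub>2\<close>-triple\<close>

lemma pow_in: "x \<in> G ==> v \<in> V ==> (\<rho> x ^^ n) v \<in> V" by (induction n) (auto intro: act_in)

lemma pow_scale: "x \<in> G ==> v \<in> V ==> (\<rho> x ^^ n) (sV c v) = sV c ((\<rho> x ^^ n) v)"
  by (induction n) (auto simp: act_scale pow_in)

lemma pow_add: "x \<in> G ==> v \<in> V ==> w \<in> V ==> (\<rho> x ^^ n) (v + w) = (\<rho> x ^^ n) v + (\<rho> x ^^ n) w"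
  by (induction n) (auto simp: act_add pow_in)

end

definition (in lie_algebra) sl2_triple :: "'a => 'a => 'a => bool" where
  "sl2_triple e f h \<longleftrightarrow> e \<in> G \<and> f \<in> G \<and> h \<in> G \<and> br e f = h \<and> br h e = scale 2 e \<and>
     br h f = scale (- 2) f"

context lie_rep
begin

context fixes e f h assumes sl2: "sl2_triple e f h"
begin

lemma efh: "e \<in> G" "f \<in> G" "h \<in> G" using sl2 by (auto simp: sl2_triple_def)

lemma h_e: "v \<in> V ==> \<rho> h v = sV m v ==> \<rho> h (\<rho> e v) = sV (m + 2) (\<rho> e v)"
  using act_br[of h e v] sl2 by (simp add: sl2_triple_def act_scale_left act_scale M.scale_left_distrib
     algebra_simps)

lemma h_f: "v \<in> V ==> \<rho> h v = sV m v ==> \<rho> h (\<rho> f v) = sV (m - 2) (\<rho> f v)"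
  using act_br[of h f v] sl2 act_scale_left[of f v "-2"] by (simp add: sl2_triple_def act_scale M.scale_left_diff_distrib algebra_simps)

lemma e_f: "v \<in> V ==> \<rho> h v = sV m v ==> \<rho> e (\<rho> f v) = \<rho> f (\<rho> e v) + sV m v"
  using act_br[of e f v] sl2 by (simp add: sl2_triple_def algebra_simps)

lemma h_pow_e: "v \<in> V ==> \<rho> h v = sV m v ==> \<rho> h ((\<rho> e ^^ n) v) = sV (m + 2 * of_nat n) ((\<rho> e ^^ n) v)"
proof (induction n)
  case (Suc n)
  thus ?case using h_e[OF pow_in[OF efh(1), of v n], of "m + 2 * of_nat n"] by (simp add: algebra_simps)
qed simp

lemma h_pow_f: "v \<in> V ==> \<rho> h v = sV m v ==> \<rho> h ((\<rho> f ^^ n) v) = sV (m - 2 * of_nat n) ((\<rho> f ^^ n) v)"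
proof (induction n)
  case (Suc n)
  thus ?case using h_f[OF pow_in[OF efh(2), of v n], of "m - 2 * of_nat n"] by (simp add: algebra_simps)
qed simp

text \<open>Nonzero vectors \<open>u n\<close> would be eigenvectors of \<open>h\<close> for
  infinitely many distinct eigenvalues.\<close>

lemma pow_nilpotent: assumes u: "\<And>n. u n \<in> V" and hu: "\<And>n. \<rho> h (u n) = sV (m + c * of_nat n) (u n)" and c: "c \<noteq> 0"
  shows "\<exists>n. u n = 0"
proof (rule ccontr)
  assume "\<nexists>n. u n = 0"
  hence "card {..M.dim V} \<le> M.dim V" using u hu c efh
    by (intro M.joint_eigen_card[of V "{()}" "\<lambda>_. \<rho> h" _ u "\<lambda>n _. m + c * of_nat n"]) (auto simp: V_fin_dim act_lin)
  thus False by simp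
qed

lemma pow_e_zero: "v \<in> V ==> \<rho> h v = sV m v ==> \<exists>n. (\<rho> e ^^ n) v = 0"
  using pow_nilpotent[of "\<lambda>n. (\<rho> e ^^ n) v" m 2] h_pow_e[of v m] pow_in efh by simp

lemma pow_f_zero: "v \<in> V ==> \<rho> h v = sV m v ==> \<exists>n. (\<rho> f ^^ n) v = 0"
  using pow_nilpotent[of "\<lambda>n. (\<rho> f ^^ n) v" m "-2"] h_pow_f[of v m] pow_in efh by simp

text \<open>On weights \<open>m \<ge> 0\<close> the operator \<open>f e\<close> has no negative eigenvalues: otherwise the chain
  \<open>e\<^sup>n x\<close> would never vanish.\<close>

lemma fe_no_negative_eigenvalue: assumes x: "x \<in> V" "\<rho> h x = sV (of_real m) x" "\<rho> f (\<rho> e x) = sV (of_real (- c)) x"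
    and "c > 0" "m \<ge> 0" shows "x = 0"
proof (rule ccontr)
  assume x0: "x \<noteq> 0"
  \<comment> \<open>The eigenvalue of \<open>f e\<close> on \<open>e^i x\<close>: start with
    \<open>- c\<close> and subtract the weights \<open>m + 2 * j\<close> for j from 1 to i.\<close>
  define d where "d = (\<lambda>i::nat. - (c + of_nat i * (m + of_nat i + 1)))"
  have fe: "\<rho> f ((\<rho> e ^^ Suc i) x) = sV (of_real (d i)) ((\<rho> e ^^ i) x)" for i
  proof (induction i)
    case 0
    thus ?case using x by (simp add: d_def)
  next
    case (Suc i)
    let ?y = "(\<rho> e ^^ Suc i) x"
    have y: "?y \<in> V" "\<rho> h ?y = sV (of_real m + 2 * of_nat (Suc i)) ?y"
      using pow_in[OF efh(1) x(1), of "Suc i"] h_pow_e[OF x(1,2), of "Suc i"] by (auto simp del: of_nat_Suc)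
    have "\<rho> e (\<rho> f ?y) = sV (of_real (d i)) ?y"
      using Suc act_scale[OF efh(1) pow_in[OF efh(1) x(1)], of "of_real (d i)" i] by simp
    hence "\<rho> f (\<rho> e ?y) = sV (of_real (d i)) ?y - sV (of_real m + 2 * of_nat (Suc i)) ?y"
      using e_f[OF y] by (simp add: algebra_simps)
    also have "\<dots> = sV (of_real (d (Suc i))) ?y" unfolding M.scale_left_diff_distrib[symmetric]
      by (rule arg_cong[where f="\<lambda>c. sV c _"]) (simp add: d_def algebra_simps)
    finally show ?case by simp
  qed
  have "(\<rho> e ^^ i) x \<noteq> 0" for i
  proof (induction i)
    case (Suc i)
    have "c + of_nat i * (m + of_nat i + 1) > 0" using assms(4,5) by (simp add: add_pos_nonneg)
    hence "d i \<noteq> 0" by (simp add: d_def)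
    hence "sV (of_real (d i)) ((\<rho> e ^^ i) x) \<noteq> 0" using Suc by simp
    thus ?case using fe[of i] act_zero[OF efh(2)] by metis
  qed (simp add: x0)
  thus False using pow_e_zero[OF x(1,2)] by blast
qed

lemma e_pow_f: assumes x: "x \<in> V" "\<rho> h x = sV m x" shows "\<rho> e ((\<rho> f ^^ Suc n) x) =
    (\<rho> f ^^ Suc n) (\<rho> e x) + sV (of_nat (Suc n) * (m - of_nat n)) ((\<rho> f ^^ n) x)"
proof (induction n)
  case 0
  thus ?case using e_f[OF x] by simp
next
  case (Suc n)
  let ?y = "(\<rho> f ^^ Suc n) x"
  have y: "?y \<in> V" "\<rho> h ?y = sV (m - 2 * of_nat (Suc n)) ?y"
    using pow_in[OF efh(2) x(1), of "Suc n"] h_pow_f[OF x, of "Suc n"] by (auto simp del: of_nat_Suc)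
  have ex: "\<rho> e x \<in> V" using act_in efh x by blast
  have "\<rho> e (\<rho> f ?y) = \<rho> f (\<rho> e ?y) + sV (m - 2 * of_nat (Suc n)) ?y" by (rule e_f[OF y])
  also have "\<rho> f (\<rho> e ?y) = (\<rho> f ^^ Suc (Suc n)) (\<rho> e x) + sV (of_nat (Suc n) * (m - of_nat n)) ?y" unfolding Suc
    using act_add[OF efh(2) pow_in[OF efh(2) ex, of "Suc n"] M.subspace_scale[OF V_subspace pow_in[OF efh(2) x(1)]]]
      act_scale[OF efh(2) pow_in[OF efh(2) x(1)]] by (simp del: of_nat_Suc)
  finally have "\<rho> e (\<rho> f ?y) = (\<rho> f ^^ Suc (Suc n)) (\<rho> e x) +
      (sV (of_nat (Suc n) * (m - of_nat n)) ?y + sV (m - 2 * of_nat (Suc n)) ?y)" by (simp only: add.assoc)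
  also have "sV (of_nat (Suc n) * (m - of_nat n)) ?y + sV (m - 2 * of_nat (Suc n)) ?y =
     sV (of_nat (Suc (Suc n)) * (m - of_nat (Suc n))) ?y" unfolding M.scale_left_distrib[symmetric]
    by (rule arg_cong[where f="\<lambda>c. sV c _"]) (simp add: algebra_simps)
  finally show ?case by simp
qed

text \<open>Moving one \<open>e\<close> to the right gives
  \<open>e^(j+1) f^(j+1) x = e^j f^j y\<close> with \<open>y = (f e + (j + 1) (m - j)) x\<close> of
  the same weight. By induction \<open>y = 0\<close>, so \<open>x\<close> would be an eigenvector of
  \<open>f e\<close> with a negative eigenvalue.\<close>

lemma pow_ef_injective: assumes "x \<in> V" "\<rho> h x = sV (of_nat m) x" "(\<rho> e ^^ j) ((\<rho> f ^^ j) x) = 0" "j \<le> m"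
  shows "x = 0" using assms
proof (induction j arbitrary: x)
  case (Suc j)
  let ?y = "\<rho> f (\<rho> e x) + sV (of_nat (Suc j) * (of_nat m - of_nat j)) x"
  have xe: "\<rho> e x \<in> V" "\<rho> h (\<rho> e x) = sV (of_nat m + 2) (\<rho> e x)" using Suc.prems efh act_in h_e by auto
  have xfe: "\<rho> f (\<rho> e x) \<in> V" "\<rho> h (\<rho> f (\<rho> e x)) = sV (of_nat m) (\<rho> f (\<rho> e x))"
    using h_f[OF xe] act_in[OF efh(2) xe(1)] by auto
  have y: "?y \<in> V" "\<rho> h ?y = sV (of_nat m) ?y" using xfe Suc.prems efh V_subspace
    by (auto simp: act_add act_scale M.subspace_add M.subspace_scale M.scale_right_distrib mult.commute)
  have "(\<rho> e ^^ Suc j) ((\<rho> f ^^ Suc j) x) = (\<rho> e ^^ j) (\<rho> e ((\<rho> f ^^ Suc j) x))"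
    by (simp only: funpow_Suc_right o_def)
  also have "\<dots> = (\<rho> e ^^ j) ((\<rho> f ^^ j) ?y)"
  proof -
    have "(\<rho> f ^^ Suc j) (\<rho> e x) = (\<rho> f ^^ j) (\<rho> f (\<rho> e x))" by (simp only: funpow_Suc_right o_def)
    thus ?thesis unfolding e_pow_f[OF Suc.prems(1,2)] using pow_add[OF efh(2) xfe(1) M.subspace_scale[OF V_subspace Suc.prems(1)]]
        pow_scale[OF efh(2) Suc.prems(1)] by (simp del: of_nat_Suc)
  qed
  finally have "(\<rho> e ^^ j) ((\<rho> f ^^ j) ?y) = 0" using Suc.prems(3) by simp
  hence "?y = 0" using Suc.IH[OF y] Suc.prems(4) by simp
  hence "\<rho> f (\<rho> e x) = sV (of_real (- (real (Suc j) * (real m - real j)))) x" by (simp add: eq_neg_iff_add_eq_0 del: of_nat_Suc)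
  thus ?case using Suc.prems by (intro fe_no_negative_eigenvalue[of x "real m" "real (Suc j) * (real m - real j)"]) auto
qed simp

text \<open>Thus \<open>f^m\<close> embeds the space of weight m into that of weight -m, which is
  where the Weyl invariance of multiplicities comes from.\<close>

lemma pow_f_injective: assumes "x \<in> V" "\<rho> h x = sV (of_nat m) x" "(\<rho> f ^^ m) x = 0" shows "x = 0"
proof -
  have "(\<rho> e ^^ n) 0 = 0" for n using act_zero efh(1) by (induction n) auto
  thus ?thesis using pow_ef_injective[OF assms(1,2), of m] assms(3) by simp
qed

lemma f_injective: assumes "x \<in> V" "\<rho> h x = sV (of_nat m) x" "m > 0" "\<rho> f x = 0" shows "x = 0"
proof -
  have "(\<rho> f ^^ m) x = 0" using assms(3,4) act_zero efh(2)
  proof (induction m)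
    case (Suc m) thus ?case by (cases m) auto
  qed simp
  thus ?thesis using pow_f_injective assms by blast
qed

text \<open>Stated relative to a stable subspace \<open>U\<close>, i.e. for a highest weight vector of \<open>V / U\<close>.\<close>

lemma highest_weight_dominant:
  assumes U: "M.subspace U" "U \<subseteq> V" "\<And>u. u \<in> U ==> \<rho> e u \<in> U" "\<And>u. u \<in> U ==> \<rho> f u \<in> U"
    and x: "x \<in> V" "x \<notin> U" "\<rho> h x = sV m x" "\<rho> e x \<in> U" shows "\<exists>n::nat. m = of_nat n"
proof -
  have fU: "(\<rho> f ^^ n) u \<in> U" if "u \<in> U" for n u using that U(4) by (induction n) auto
  obtain n where "(\<rho> f ^^ n) x = 0" using pow_f_zero x by blast
  hence ex: "\<exists>n. (\<rho> f ^^ n) x \<in> U" using U(1) M.subspace_0 by metis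
  define n where "n = (LEAST n. (\<rho> f ^^ n) x \<in> U)"
  have n: "(\<rho> f ^^ n) x \<in> U" unfolding n_def using ex by (rule LeastI_ex)
  then obtain n' where n': "n = Suc n'" using x(2) by (cases n) auto
  have nn: "(\<rho> f ^^ n') x \<notin> U" using not_less_Least[of n' "\<lambda>n. (\<rho> f ^^ n) x \<in> U"] n' n_def by auto
  \<comment> \<open>Modulo \<open>U\<close> the vector \<open>e f^n x\<close> is this multiple of
    \<open>f^n' x\<close>, which is not in \<open>U\<close> by minimality of \<open>n\<close>; so
    the coefficient vanishes and \<open>m = n'\<close>.\<close>
  have "sV (of_nat (Suc n') * (m - of_nat n')) ((\<rho> f ^^ n') x) = \<rho> e ((\<rho> f ^^ n) x) - (\<rho> f ^^ n) (\<rho> e x)"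
    using e_pow_f[OF x(1,3), of n'] n' by (simp del: of_nat_Suc)
  also have "\<dots> \<in> U" by (rule M.subspace_diff[OF U(1) U(3)[OF n] fU[OF x(4)]])
  finally have *: "sV (of_nat (Suc n') * (m - of_nat n')) ((\<rho> f ^^ n') x) \<in> U" .
  hence "of_nat (Suc n') * (m - of_nat n') = 0" using M.subspace_scale_cancel[OF U(1)] nn by blast
  thus ?thesis by (auto simp del: of_nat_Suc)
qed

text \<open>The last nonzero vector of the chain \<open>e^n x\<close> is a highest weight vector, so
  its weight, which differs from \<open>m\<close> by an even integer, is a natural number.\<close>

lemma weight_integral: assumes x: "x \<in> V" "x \<noteq> 0" "\<rho> h x = sV m x" shows "m \<in> \<int>"
proof -
  have ex: "\<exists>n. (\<rho> e ^^ n) x = 0" using pow_e_zero x by blast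
  define n where "n = (LEAST n. (\<rho> e ^^ n) x = 0)"
  have n: "(\<rho> e ^^ n) x = 0" unfolding n_def using ex by (rule LeastI_ex)
  then obtain n' where n': "n = Suc n'" using x(2) by (cases n) auto
  have nn: "(\<rho> e ^^ n') x \<noteq> 0" using not_less_Least[of n' "\<lambda>n. (\<rho> e ^^ n) x = 0"] n' n_def by auto
  have "\<exists>k::nat. m + 2 * of_nat n' = of_nat k" using n n' nn pow_in[OF efh(1) x(1)] h_pow_e[OF x(1,3)] act_zero efh V_subspace
    by (intro highest_weight_dominant[of "{0}" "(\<rho> e ^^ n') x"]) (auto simp: M.subspace_0)
  then obtain k :: nat where "m = of_nat k - 2 * of_nat n'" by (metis add_diff_cancel_right')
  thus ?thesis by simp
qed

end

end

subsection \<open>Direct sums\<close>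

context vspace
begin

definition direct_sum :: "'i set => ('i => 'b set) => 'b set => bool" where
  "direct_sum I U V \<longleftrightarrow> finite I \<and> fin_dim V \<and> (\<forall>i\<in>I. subspace (U i) \<and> U i \<subseteq> V) \<and>
     V \<subseteq> span (\<Union>i\<in>I. U i) \<and>
     (\<forall>u. (\<forall>i\<in>I. u i \<in> U i) \<longrightarrow> (\<Sum>i\<in>I. u i) = 0 \<longrightarrow> (\<forall>i\<in>I. u i = 0))"

lemma direct_sum_basis: assumes "direct_sum I U V"
  defines "E \<equiv> \<Union>i\<in>I. sub_basis (U i)"
  shows "independent E" "finite E" "span E = V" "\<And>i j. i \<in> I ==> j \<in> I ==> i \<noteq> j ==> sub_basis (U i) \<inter> sub_basis (U j) = {}"
proof -
  have I: "finite I" "fin_dim V" "\<And>i. i \<in> I ==> subspace (U i)" "\<And>i. i \<in> I ==> U i \<subseteq> V"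
    "V \<subseteq> span (\<Union>i\<in>I. U i)" and
    ind: "\<And>u i. (\<And>i. i \<in> I ==> u i \<in> U i) ==> (\<Sum>i\<in>I. u i) = 0 ==> i \<in> I ==> u i = 0"
    using assms(1) unfolding direct_sum_def by blast+
  have fd: "fin_dim (U i)" if "i \<in> I" for i using fin_dim_subset[OF I(2)] I that by blast
  note sb = sub_basis[OF fd]
  show finE: "finite E" using I(1) sb by (auto simp: E_def)
  show disj: "sub_basis (U i) \<inter> sub_basis (U j) = {}" if ij: "i \<in> I" "j \<in> I" "i \<noteq> j" for i j
  proof (rule ccontr)
    assume "sub_basis (U i) \<inter> sub_basis (U j) \<noteq> {}"
    then obtain b where b: "b \<in> sub_basis (U i)" "b \<in> sub_basis (U j)" by auto
    define u where "u = (\<lambda>k. (if k = i then b else 0) + (if k = j then - b else 0))"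
    have "(\<Sum>k\<in>I. u k) = 0" unfolding u_def sum.distrib using ij I(1) by simp
    moreover have "u k \<in> U k" if "k \<in> I" for k using b sb(1)[OF ij(1)] sb(1)[OF ij(2)] I(3)[OF that] ij(3)
      by (auto simp: u_def subspace_0 subspace_neg)
    ultimately have "u i = 0" using ind ij(1) by blast
    hence "b = 0" using ij by (simp add: u_def)
    thus False using b sb(2)[OF ij(1)] dependent_zero by blast
  qed
  show "span E = V"
  proof (rule span_subspace)
    show "E \<subseteq> V" using sb(1) I(4) by (auto simp: E_def)
    show "subspace V" using I(2) by (simp add: fin_dim_def)
    have "U i \<subseteq> span E" if "i \<in> I" for i using sb(3)[OF that] span_mono[of "sub_basis (U i)" E] that by (auto simp: E_def)
    hence "span (\<Union>i\<in>I. U i) \<subseteq> span E" by (intro span_minimal) auto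
    thus "V \<subseteq> span E" using I(5) by blast
  qed
  show "independent E"
  proof (rule independent_if_scalars_zero[OF finE])
    fix g x assume g: "(\<Sum>x\<in>E. scale (g x) x) = 0" and x: "x \<in> E"
    obtain i where i: "i \<in> I" "x \<in> sub_basis (U i)" using x by (auto simp: E_def)
    define u where "u = (\<lambda>i. \<Sum>x\<in>sub_basis (U i). scale (g x) x)"
    have "(\<Sum>i\<in>I. u i) = (\<Sum>x\<in>E. scale (g x) x)"
      unfolding u_def E_def using I(1) sb disj by (intro sum.UNION_disjoint[symmetric]) auto
    moreover have "u i \<in> U i" if "i \<in> I" for i unfolding u_def using sb(1)[OF that] I(3)[OF that]
      by (intro subspace_sum subspace_scale) auto
    ultimately have "u i = 0" using ind g i by auto
    thus "g x = 0" unfolding u_def using independentD[OF sb(2)[OF i(1)] sb(4)[OF i(1)] order_refl] i(2) by blast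
  qed
qed

lemma direct_sum_trace:
  assumes "direct_sum I U V" and f: "lin_on V f" and fU: "\<And>i x. i \<in> I ==> x \<in> U i ==> f x = scale (c i) x"
  shows "trace_on V f = (\<Sum>i\<in>I. c i * of_nat (dim (U i)))"
proof -
  have I: "finite I" "fin_dim V" "\<And>i. i \<in> I ==> subspace (U i)" "\<And>i. i \<in> I ==> U i \<subseteq> V"
    "V \<subseteq> span (\<Union>i\<in>I. U i)" using assms(1) unfolding direct_sum_def by blast+
  have fd: "fin_dim (U i)" if "i \<in> I" for i using fin_dim_subset[OF I(2)] I that by blast
  note sb = sub_basis[OF fd] and D = direct_sum_basis[OF assms(1)]
  let ?E = "\<Union>i\<in>I. sub_basis (U i)"
  have sV: "subspace V" using I by (simp add: fin_dim_def)
  have into: "f x \<in> V" if "x \<in> V" for x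
  proof -
    have "f x = f (\<Sum>b\<in>?E. scale (representation ?E x b) b)" using representation_sum_basis[OF D(1,2)] that D(3) by simp
    also have "\<dots> = (\<Sum>b\<in>?E. scale (representation ?E x b) (f b))" using D(3) span_base[of _ ?E]
      by (subst lin_on_sum[OF f sV]) (auto simp: lin_on_scale[OF f] subspace_scale[OF sV])
    also have "\<dots> \<in> V"
    proof (intro subspace_sum[OF sV] subspace_scale[OF sV])
      fix b assume "b \<in> ?E"
      then obtain i where "i \<in> I" "b \<in> sub_basis (U i)" by auto
      hence "b \<in> U i" "i \<in> I" using sb(1)[of i] by auto
      thus "f b \<in> V" using fU[of i b] I(4)[of i] by (auto intro!: subspace_scale[OF sV])
    qed
    finally show ?thesis .
  qed
  have "trace_on V f = (\<Sum>b\<in>?E. representation ?E (f b) b)" by (rule trace_on_any_basis[OF I(2) D(1,2,3) f into])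
  also have "\<dots> = (\<Sum>i\<in>I. \<Sum>b\<in>sub_basis (U i). representation ?E (f b) b)"
    using I(1) sb D(4) by (intro sum.UNION_disjoint) auto
  also have "\<dots> = (\<Sum>i\<in>I. \<Sum>b\<in>sub_basis (U i). c i)"
  proof (intro sum.cong refl)
    fix i b assume ib: "i \<in> I" "b \<in> sub_basis (U i)"
    hence "f b = scale (c i) b" "b \<in> ?E" using fU sb(1)[OF ib(1)] by blast+
    thus "representation ?E (f b) b = c i" using D(1) by (simp add: representation_scale span_base representation_basis)
  qed
  also have "\<dots> = (\<Sum>i\<in>I. c i * of_nat (dim (U i)))" using sb(5) by (intro sum.cong refl) (simp add: mult.commute)
  finally show ?thesis .
qed

lemma direct_sum_dim: assumes "direct_sum I U V" shows "dim V = (\<Sum>i\<in>I. dim (U i))"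
proof -
  have I: "finite I" "fin_dim V" "\<And>i. i \<in> I ==> subspace (U i)" "\<And>i. i \<in> I ==> U i \<subseteq> V"
    "V \<subseteq> span (\<Union>i\<in>I. U i)" using assms(1) unfolding direct_sum_def by blast+
  have fd: "fin_dim (U i)" if "i \<in> I" for i using fin_dim_subset[OF I(2)] I that by blast
  note D = direct_sum_basis[OF assms]
  have "dim V = card (\<Union>i\<in>I. sub_basis (U i))" using dim_span_eq_card_independent[OF D(1)] D(3) by simp
  also have "\<dots> = (\<Sum>i\<in>I. card (sub_basis (U i)))" using I(1) sub_basis[OF fd] D(4) by (intro card_UN_disjoint) auto
  finally show ?thesis using sub_basis(5)[OF fd] by simp
qed

end

section \<open>Weight spaces\<close>

context lie_algebra
begin

lemma br_anti: "x \<in> G ==> y \<in> G ==> br x y = - br y x"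
proof -
  assume *: "x \<in> G" "y \<in> G"
  hence "br (x + y) (x + y) = 0" using br_self carrier_subspace subspace_add by blast
  moreover have "br (x + y) (x + y) = br x x + br x y + (br y x + br y y)"
    using * carrier_subspace by (simp add: br_add_left br_add_right subspace_add)
  ultimately show ?thesis using * br_self by (simp add: eq_neg_iff_add_eq_0)
qed

lemma G_fin_dim: "fin_dim G" using carrier_finite_dim carrier_subspace by (auto simp: fin_dim_def)

lemma br_minus_right: "x \<in> G ==> y \<in> G ==> br x (- y) = - br x y" using br_scale_right[of x y "-1"] by simp

lemma adjoint_module: "lie_module scale G br"
proof -
  have "br (br x y) v = br x (br y v) - br y (br x v)" if "x \<in> G" "y \<in> G" "v \<in> G" for x y v
  proof -
    have "br v (br x y) = - br (br x y) v" "br v x = - br x v" using that br_closed by (auto intro: br_anti)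
    hence "br x (br y v) - br y (br x v) - br (br x y) v = 0" using jacobi[of x y v] that br_closed by (simp add: br_minus_right)
    thus ?thesis by simp
  qed
  thus ?thesis unfolding lie_module_def using vector_space_axioms carrier_subspace carrier_finite_dim
    by (auto simp: br_closed br_add_left br_add_right br_scale_left br_scale_right)
qed

lemma dual_subspace: "fun_space.subspace (dual U)" unfolding fun_space.subspace_def by (auto simp: dual_def fun_scale_def algebra_simps)

lemma dual_zero: "0 \<in> dual U" by (rule fun_space.subspace_0[OF dual_subspace])
lemma dual_add: "f \<in> dual U ==> g \<in> dual U ==> f + g \<in> dual U" by (rule fun_space.subspace_add[OF dual_subspace])
lemma dual_uminus: "f \<in> dual U ==> - f \<in> dual U" by (rule fun_space.subspace_neg[OF dual_subspace])
lemma dual_diff: "f \<in> dual U ==> g \<in> dual U ==> f - g \<in> dual U" by (rule fun_space.subspace_diff[OF dual_subspace])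
lemma dual_scale: "f \<in> dual U ==> fun_scale c f \<in> dual U" by (rule fun_space.subspace_scale[OF dual_subspace])
lemma dual_sum: "(\<And>i. i \<in> I ==> f i \<in> dual U) ==> (\<Sum>i\<in>I. f i) \<in> dual U"
  by (rule fun_space.subspace_sum[OF dual_subspace])

lemma dual_neqD: "f \<in> dual U ==> g \<in> dual U ==> f \<noteq> g ==> \<exists>h\<in>U. f h \<noteq> g h"
  unfolding dual_def by (auto simp: fun_eq_iff) metis

end

locale cartan_alg = lie_algebra + fixes H assumes cartan: "cartan_subalgebra H"
begin

lemma H_subspace: "subspace H" and H_sub: "H \<subseteq> G" and H_abelian: "x \<in> H ==> y \<in> H ==> br x y = 0"
  and H_self_centralizing: "x \<in> G ==> (\<And>h. h \<in> H ==> br h x = 0) ==> x \<in> H"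
  and H_diag: "h \<in> H ==> G \<subseteq> span {x \<in> G. \<exists>c. br h x = scale c x}"
  using cartan unfolding cartan_subalgebra_def by blast+

lemma H_G: "h \<in> H ==> h \<in> G" using H_sub by blast

lemma dual_H_linear: "f \<in> dual H ==> x \<in> H ==> y \<in> H ==> f (x + y) = f x + f y"
  "f \<in> dual H ==> x \<in> H ==> f (scale c x) = c * f x" by (auto simp: dual_def)

lemma dual_H_sum: "f \<in> dual H ==> (\<And>i. i \<in> I ==> g i \<in> H) ==> f (\<Sum>i\<in>I. g i) = (\<Sum>i\<in>I. f (g i))"
proof (induction I rule: infinite_finite_induct)
  case (insert i I)
  thus ?case using H_subspace by (simp add: dual_H_linear subspace_sum)
qed (use dual_H_linear(2)[of f 0 0] subspace_0[OF H_subspace] in auto)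

end

locale cartan_rep = cartan_alg scale G br H + lie_rep scale G br sV V \<rho>
  for scale :: "complex => 'a::ab_group_add => 'a" and G and br and H and sV :: "complex => 'v::ab_group_add => 'v" and V and \<rho>
begin

definition wsp :: "('a => complex) => 'v set" where "wsp \<mu> = {v \<in> V. \<forall>h\<in>H. \<rho> h v = sV (\<mu> h) v}"

definition weights :: "('a => complex) set" where "weights = {\<mu> \<in> dual H. wsp \<mu> \<noteq> {0}}"

definition wmult :: "('a => complex) => nat" where "wmult \<mu> = M.dim (wsp \<mu>)"

text \<open>A property to be proved for each kind of module: by simultaneous diagonalization for the
  adjoint module, by lowering words for highest weight modules, by tensors of root vectors for
  tensor powers.\<close>

definition weighted :: bool where "weighted \<longleftrightarrow> V \<subseteq> M.span (\<Union>\<mu>\<in>dual H. wsp \<mu>)"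

lemma wspD: "v \<in> wsp \<mu> ==> v \<in> V" "v \<in> wsp \<mu> ==> h \<in> H ==> \<rho> h v = sV (\<mu> h) v" by (auto simp: wsp_def)

lemma wsp_subspace: "M.subspace (wsp \<mu>)" unfolding wsp_def by (intro M.subspaceI)
    (auto simp: M.subspace_0[OF V_subspace] M.subspace_add[OF V_subspace] M.subspace_scale[OF V_subspace]
      act_zero act_add act_scale H_G M.scale_right_distrib mult.commute)

lemma wsp_sub: "wsp \<mu> \<subseteq> V" by (auto simp: wsp_def)

lemma wsp_fin_dim: "M.fin_dim (wsp \<mu>)" by (rule M.fin_dim_subset[OF V_fin_dim wsp_subspace wsp_sub])

lemma wsp_shift: assumes "x \<in> root_space H r" "v \<in> wsp \<mu>" shows "\<rho> x v \<in> wsp (\<mu> + r)"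
proof -
  have x: "x \<in> G" "\<And>h. h \<in> H ==> br h x = scale (r h) x" using assms(1) by (auto simp: root_space_def)
  note v = wspD[OF assms(2)]
  have "\<rho> h (\<rho> x v) = sV (\<mu> h + r h) (\<rho> x v)" if "h \<in> H" for h
    using act_br[OF H_G[OF that] x(1) v(1)] x(2)[OF that] v(2)[OF that] x(1) v(1)
    by (simp add: act_scale_left act_scale M.scale_left_distrib algebra_simps)
  thus ?thesis using x(1) v(1) by (auto simp: wsp_def act_in)
qed

lemma wsp_components: assumes W: "M.subspace W" "W \<subseteq> V" "\<And>h w. h \<in> H ==> w \<in> W ==> \<rho> h w \<in> W"
    and S: "finite S" "S \<subseteq> dual H" and v: "\<And>\<mu>. \<mu> \<in> S ==> v \<mu> \<in> wsp \<mu>"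
    and "(\<Sum>\<mu>\<in>S. v \<mu>) \<in> W" and "\<mu> \<in> S" shows "v \<mu> \<in> W"
proof -
  have sep: "\<exists>h\<in>H. \<mu> h \<noteq> \<nu> h" if "\<mu> \<in> S" "\<nu> \<in> S" "\<mu> \<noteq> \<nu>" for \<mu> \<nu>
    using dual_neqD[of \<mu> H \<nu>] S(2) that by auto
  show ?thesis by (rule M.joint_eigen_components[where A=H and f=\<rho> and S=S and e="\<lambda>\<mu> h. \<mu> h" and v=v,
          OF V_subspace act_lin[OF H_G] W S(1) wspD(1)[OF v] wspD(2)[OF v] sep]) (use assms in auto)
qed

lemma wsp_sum_zero:
  assumes "finite S" "S \<subseteq> dual H" "\<And>\<mu>. \<mu> \<in> S ==> v \<mu> \<in> wsp \<mu>" "(\<Sum>\<mu>\<in>S. v \<mu>) = 0" "\<mu> \<in> S"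
  shows "v \<mu> = 0" using wsp_components[of "{0}" S v \<mu>] assms act_zero H_G M.subspace_0[OF V_subspace] by auto

lemma finite_weights: "finite weights"
proof (rule ccontr)
  assume "infinite weights"
  then obtain S where S: "finite S" "card S = Suc (M.dim V)" "S \<subseteq> weights" using infinite_arbitrarily_large by blast
  have "\<exists>v. v \<in> wsp \<mu> \<and> v \<noteq> 0" if "\<mu> \<in> S" for \<mu>
    using S(3) that M.subspace_0[OF wsp_subspace, of \<mu>] by (auto simp: weights_def)
  then obtain v where v: "\<And>\<mu>. \<mu> \<in> S ==> v \<mu> \<in> wsp \<mu> \<and> v \<mu> \<noteq> 0" by metis
  have sep: "\<exists>h\<in>H. \<mu> h \<noteq> \<nu> h" if "\<mu> \<in> S" "\<nu> \<in> S" "\<mu> \<noteq> \<nu>" for \<mu> \<nu>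
    using dual_neqD[of \<mu> H \<nu>] S(3) that by (auto simp: weights_def)
  have v': "\<mu> \<in> S ==> v \<mu> \<in> wsp \<mu>" "\<mu> \<in> S ==> v \<mu> \<noteq> 0" for \<mu> using v by auto
  have "card S \<le> M.dim V" by (rule M.joint_eigen_card[where A=H and f=\<rho> and e="\<lambda>\<mu> h. \<mu> h" and v=v,
          OF V_fin_dim act_lin[OF H_G] S(1) wspD(1)[OF v'(1)] v'(2) wspD(2)[OF v'(1)] sep]) auto
  thus False using S by simp
qed

lemma wsp_zero_dim: "wsp \<mu> = {0} \<longleftrightarrow> wmult \<mu> = 0"
proof
  assume "wsp \<mu> = {0}"
  thus "wmult \<mu> = 0" using M.sub_basis(5)[OF wsp_fin_dim, of \<mu>] M.sub_basis(1,2)[OF wsp_fin_dim, of \<mu>]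
      M.dependent_zero[of "M.sub_basis (wsp \<mu>)"] by (auto simp: wmult_def subset_singleton_iff)
next
  assume "wmult \<mu> = 0"
  hence "M.sub_basis (wsp \<mu>) = {}" using M.sub_basis(4,5)[OF wsp_fin_dim, of \<mu>] by (auto simp: wmult_def)
  thus "wsp \<mu> = {0}" using M.sub_basis(3)[OF wsp_fin_dim, of \<mu>] by auto
qed

lemma wmult_zero: "\<mu> \<in> dual H ==> \<mu> \<notin> weights ==> wmult \<mu> = 0" using wsp_zero_dim by (auto simp: weights_def)

lemma weighted_direct_sum: assumes weighted shows "M.direct_sum weights wsp V"
proof -
  have "wsp \<mu> \<subseteq> M.span (\<Union>\<mu>\<in>weights. wsp \<mu>)" if "\<mu> \<in> dual H" for \<mu>
  proof (cases "\<mu> \<in> weights")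
    case True
    thus ?thesis by (intro subsetI M.span_base) auto
  next
    case False
    hence "wsp \<mu> = {0}" using that by (auto simp: weights_def)
    thus ?thesis by (simp add: M.span_zero)
  qed
  hence "M.span (\<Union>\<mu>\<in>dual H. wsp \<mu>) \<subseteq> M.span (\<Union>\<mu>\<in>weights. wsp \<mu>)"
    by (intro M.span_minimal) blast+
  hence "V \<subseteq> M.span (\<Union>\<mu>\<in>weights. wsp \<mu>)" using assms by (auto simp: weighted_def)
  moreover have "weights \<subseteq> dual H" by (auto simp: weights_def)
  ultimately show ?thesis unfolding M.direct_sum_def
    using wsp_subspace wsp_sub finite_weights V_fin_dim wsp_sum_zero[OF finite_weights] by blast
qed

lemma weighted_dim: "weighted ==> M.dim V = (\<Sum>\<mu>\<in>weights. wmult \<mu>)"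
  using M.direct_sum_dim[OF weighted_direct_sum] by (simp add: wmult_def)

lemma weighted_decomp: assumes weighted "v \<in> V"
  shows "\<exists>S y. finite S \<and> S \<subseteq> dual H \<and> (\<forall>\<mu>\<in>S. y \<mu> \<in> wsp \<mu>) \<and> v = (\<Sum>\<mu>\<in>S. y \<mu>)"
  using M.span_Union_decomp[of "dual H" wsp v] wsp_subspace assms by (auto simp: weighted_def)

text \<open>The recursion behind Freudenthal's formula: the trace of \<open>y x\<close> along a root string.\<close>

definition tr2 :: "'a => 'a => ('a => complex) => complex" where
  "tr2 y x \<mu> = M.trace_on (wsp \<mu>) (\<lambda>v. \<rho> y (\<rho> x v))"

lemma tr2_recursion: assumes x: "x \<in> root_space H r" and y: "y \<in> root_space H (- r)" and z: "br x y \<in> H"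
  shows "tr2 y x (\<mu> - r) = tr2 y x \<mu> + \<mu> (br x y) * of_nat (wmult \<mu>)"
proof -
  have G: "x \<in> G" "y \<in> G" using x y by (auto simp: root_space_def)
  have y': "\<rho> y v \<in> wsp (\<mu> - r)" if "v \<in> wsp \<mu>" for v using wsp_shift[OF y that] by simp
  have x': "\<rho> x v \<in> wsp \<mu>" if "v \<in> wsp (\<mu> - r)" for v using wsp_shift[OF x that] by simp
  have yx: "\<rho> y (\<rho> x v) \<in> wsp \<mu>" if "v \<in> wsp \<mu>" for v using wsp_shift[OF y wsp_shift[OF x that]] by simp
  have "tr2 y x (\<mu> - r) = M.trace_on (wsp \<mu>) (\<lambda>v. \<rho> x (\<rho> y v))" unfolding tr2_def
    by (rule M.trace_on_swap[OF wsp_fin_dim wsp_fin_dim]) (use x' y' G act_lin M.lin_on_mono wsp_sub in blast)+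
  also have "\<dots> = M.trace_on (wsp \<mu>) (\<lambda>v. \<rho> y (\<rho> x v) + sV (\<mu> (br x y)) v)"
  proof (intro M.trace_on_cong wsp_fin_dim)
    fix v assume v: "v \<in> wsp \<mu>"
    thus "\<rho> x (\<rho> y v) = \<rho> y (\<rho> x v) + sV (\<mu> (br x y)) v"
      using act_br[OF G wspD(1)[OF v]] wspD(2)[OF v z] by (simp add: algebra_simps)
  qed
  also have "\<dots> = tr2 y x \<mu> + \<mu> (br x y) * of_nat (wmult \<mu>)"
    unfolding tr2_def wmult_def using yx M.subspace_scale[OF wsp_subspace]
    by (simp add: M.trace_on_add wsp_fin_dim M.trace_on_scale M.trace_on_id)
  finally show ?thesis .
qed

lemma tr2_zero: assumes "wsp \<mu> = {0}" shows "tr2 y x \<mu> = 0"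
proof -
  have "M.sub_basis (wsp \<mu>) \<subseteq> {}" using assms M.sub_basis(1,2)[OF wsp_fin_dim, of \<mu>] M.dependent_zero
    by (metis subset_singletonD insertI1 empty_subsetI)
  thus ?thesis by (simp add: tr2_def M.trace_on_def)
qed

text \<open>Summing the recursion over the whole \<open>r\<close>-string, which is finite.\<close>

lemma string_trace_zero:
  assumes r: "r \<in> dual H" "r \<noteq> 0" and x: "x \<in> root_space H r" and y: "y \<in> root_space H (- r)" and z: "br x y \<in> H"
    and rz: "r (br x y) = 0" and s: "s \<in> weights" shows "s (br x y) = 0"
proof -
  define a where "a = (\<lambda>n::int. s + fun_scale (of_int n) r)"
  have sd: "s \<in> dual H" using s by (simp add: weights_def)
  have ad: "a n \<in> dual H" for n unfolding a_def using sd r(1) dual_add dual_scale by blast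
  have inj: "inj a"
  proof
    fix m n assume "a m = a n"
    moreover obtain h where "r h \<noteq> 0" using r(2) by (auto simp: fun_eq_iff)
    ultimately show "m = n" by (auto simp: a_def fun_scale_def dest!: fun_cong[of _ _ h])
  qed
  have "finite {n. a n \<in> weights}" using finite_vimageI[OF finite_weights inj] by (simp add: vimage_def)
  hence fin: "finite (abs ` {n. a n \<in> weights})" by simp
  \<comment> \<open>All weights \<open>s + n r\<close> have n between \<open>- K\<close> and
    \<open>K\<close>, so the sum over \<open>- K, ..., K + 1\<close> telescopes to traces at
    \<open>- K - 1\<close> and \<open>K + 1\<close>, where the weight spaces are zero.\<close>
  define K where "K = Max (insert 0 (abs ` {n. a n \<in> weights}))"
  have K: "\<bar>n\<bar> \<le> K" if "a n \<in> weights" for n unfolding K_def using fin that by (intro Max_ge) auto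
  have K0: "K \<ge> 0" unfolding K_def using fin by (intro Max_ge) auto
  have step: "tr2 y x (a (int n - K - 1)) - tr2 y x (a (int n - K)) = s (br x y) * of_nat (wmult (a (int n - K)))" for n
  proof -
    have "a (int n - K - 1) = a (int n - K) - r" by (auto simp: a_def fun_scale_def fun_eq_iff algebra_simps)
    moreover have "a (int n - K) (br x y) = s (br x y)" using rz by (simp add: a_def fun_scale_def)
    ultimately show ?thesis using tr2_recursion[OF x y z, of "a (int n - K)"] by simp
  qed
  have "(\<Sum>n<N. tr2 y x (a (int n - K - 1)) - tr2 y x (a (int n - K))) =
     tr2 y x (a (- K - 1)) - tr2 y x (a (int N - K - 1))" for N by (induction N) auto
  hence "(\<Sum>n<nat (2 * K + 2). s (br x y) * of_nat (wmult (a (int n - K)))) =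
     tr2 y x (a (- K - 1)) - tr2 y x (a (int (nat (2 * K + 2)) - K - 1))" using step by simp
  also have "\<dots> = 0"
  proof -
    have "a (- K - 1) \<notin> weights" "a (int (nat (2 * K + 2)) - K - 1) \<notin> weights"
      using K[of "- K - 1"] K[of "int (nat (2 * K + 2)) - K - 1"] K0 by auto
    thus ?thesis using ad tr2_zero by (auto simp: weights_def)
  qed
  finally have "s (br x y) * of_nat (\<Sum>n<nat (2 * K + 2). wmult (a (int n - K))) = 0" by (simp add: sum_distrib_left)
  moreover have "wmult (a (int (nat K) - K)) > 0"
    using s wsp_zero_dim[of s] K0 by (simp add: a_def fun_scale_def zero_fun_def[symmetric] weights_def)
  hence "(\<Sum>n<nat (2 * K + 2). wmult (a (int n - K))) \<noteq> 0" using K0 by (subst sum_eq_0_iff) (auto intro!: bexI[of _ "nat K"])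
  ultimately show ?thesis by (metis mult_eq_0_iff of_nat_eq_0_iff)
qed

end

section \<open>Root space decomposition of the Lie algebra\<close>

context cartan_alg
begin

sublocale adj: cartan_rep scale G br H scale G br using adjoint_module by unfold_locales

lemma adj_wsp: "adj.wsp r = root_space H r" by (auto simp: adj.wsp_def root_space_def)

lemma root_space_zero: "root_space H 0 = H" using H_self_centralizing H_sub H_abelian by (auto simp: root_space_def)

lemma roots_eq: "roots H = adj.weights - {0}" by (auto simp: roots_def adj.weights_def adj_wsp)

lemma finite_roots: "finite (roots H)" using adj.finite_weights by (simp add: roots_eq)

lemma joint_eigenvector_weight: assumes x: "x \<in> G" "\<And>h. h \<in> H ==> \<exists>c. br h x = scale c x"
  shows "\<exists>r\<in>dual H. x \<in> root_space H r"
proof (cases "x = 0")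
  case True
  thus ?thesis using dual_zero subspace_0[OF adj.wsp_subspace] by (auto simp: adj_wsp)
next
  case False
  obtain c where c: "\<And>h. h \<in> H ==> br h x = scale (c h) x" using x(2) by metis
  define r where "r = (\<lambda>h. if h \<in> H then c h else 0)"
  have "r (h + k) = r h + r k" if "h \<in> H" "k \<in> H" for h k
  proof -
    have "scale (c (h + k)) x = scale (c h + c k) x" using that c H_G x(1) H_subspace by (metis br_add_left scale_left_distrib subspace_add)
    thus ?thesis using False that H_subspace by (simp add: r_def subspace_add)
  qed
  moreover have "r (scale a h) = a * r h" if "h \<in> H" for a h
  proof -
    have "scale (c (scale a h)) x = scale (a * c h) x" using that c H_G x(1) H_subspace by (metis br_scale_left scale_scale subspace_scale)
    thus ?thesis using False that H_subspace by (simp add: r_def subspace_scale)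
  qed
  ultimately have "r \<in> dual H" unfolding dual_def by (auto simp: r_def)
  moreover have "x \<in> root_space H r" using c x(1) by (auto simp: root_space_def r_def)
  ultimately show ?thesis by blast
qed

text \<open>By definition the elements of \<open>H\<close> are diagonalizable one at a time. A
  finite basis of \<open>H\<close> can be diagonalized jointly, and a joint eigenvector of the basis
  is one for all of \<open>H\<close>, since the elements having it as an eigenvector form a
  subspace.\<close>

lemma adj_weighted: "adj.weighted"
proof -
  have "fin_dim H" using fin_dim_subset[OF G_fin_dim H_subspace H_sub] .
  note E = sub_basis[OF this]
  let ?E = "sub_basis H"
  have comm: "br h (br k x) = br k (br h x)" if "h \<in> ?E" "k \<in> ?E" "x \<in> G" for h k x
    using adj.act_br[of h k x] that E(1) H_abelian[of h k] H_G adj.act_zero_left by (auto simp: subset_iff)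
  have G: "G \<subseteq> span {x \<in> G. \<forall>h\<in>?E. \<exists>c. br h x = scale c x}" using E comm H_diag br_closed adj.act_lin H_G
    by (intro simultaneous_diagonalization) (auto simp: subset_iff carrier_subspace)
  have "{x \<in> G. \<forall>h\<in>?E. \<exists>c. br h x = scale c x} \<subseteq> (\<Union>\<mu>\<in>dual H. adj.wsp \<mu>)"
  proof
    fix x assume "x \<in> {x \<in> G. \<forall>h\<in>?E. \<exists>c. br h x = scale c x}"
    hence x: "x \<in> G" "\<And>h. h \<in> ?E ==> \<exists>c. br h x = scale c x" by auto
    have "subspace {h \<in> G. \<exists>c. br h x = scale c x}"
    proof (intro subspaceI)
      show "0 \<in> {h \<in> G. \<exists>c. br h x = scale c x}"
        using x(1) adj.act_zero_left carrier_subspace by (auto simp: subspace_0 intro!: exI[of _ 0])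
      fix h k assume "h \<in> {h \<in> G. \<exists>c. br h x = scale c x}" "k \<in> {h \<in> G. \<exists>c. br h x = scale c x}"
      then obtain c d where "h \<in> G" "br h x = scale c x" "k \<in> G" "br k x = scale d x" by auto
      thus "h + k \<in> {h \<in> G. \<exists>c. br h x = scale c x}"
        using x(1) carrier_subspace by (auto simp: br_add_left subspace_add scale_left_distrib intro!: exI[of _ "c + d"])
    next
      fix a h assume "h \<in> {h \<in> G. \<exists>c. br h x = scale c x}"
      then obtain c where "h \<in> G" "br h x = scale c x" by auto
      thus "scale a h \<in> {h \<in> G. \<exists>c. br h x = scale c x}"
        using x(1) carrier_subspace by (auto simp: br_scale_left subspace_scale intro!: exI[of _ "a * c"])
    qed
    moreover have "?E \<subseteq> {h \<in> G. \<exists>c. br h x = scale c x}" using x E(1) H_G by auto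
    ultimately have "span ?E \<subseteq> {h \<in> G. \<exists>c. br h x = scale c x}" by (intro span_minimal)
    hence "\<exists>r\<in>dual H. x \<in> root_space H r" using E(3) x(1) by (intro joint_eigenvector_weight) auto
    thus "x \<in> (\<Union>\<mu>\<in>dual H. adj.wsp \<mu>)" by (auto simp: adj_wsp)
  qed
  thus ?thesis unfolding adj.weighted_def using G span_mono by blast
qed

lemma root_decomp: "x \<in> G ==> \<exists>S y. finite S \<and> S \<subseteq> dual H \<and> (\<forall>\<mu>\<in>S. y \<mu> \<in> root_space H \<mu>) \<and> x = (\<Sum>\<mu>\<in>S. y \<mu>)"
  using adj.weighted_decomp[OF adj_weighted] by (simp add: adj_wsp)

end

section \<open>Simple Lie algebras with an invariant form\<close>

text \<open>\<open>\<tau>\<close> stands for t, which is real and positive for every triple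
  considered. That it is nonzero makes the Killing form nondegenerate; its sign makes the form on
  real weights positive.\<close>

locale form_alg = cartan_alg + fixes B :: "'a => 'a => complex" and \<tau> :: real
  assumes simple: "simple" and normalized: "casimir_normalized B (of_real \<tau>)" and tau_pos: "\<tau> > 0"
begin

lemma B_add_left: "x \<in> G ==> y \<in> G ==> z \<in> G ==> B (x + y) z = B x z + B y z"
  and B_scale_left: "x \<in> G ==> y \<in> G ==> B (scale c x) y = c * B x y" and B_sym: "x \<in> G ==> y \<in> G ==> B x y = B y x"
  and B_inv: "x \<in> G ==> y \<in> G ==> z \<in> G ==> B (br x y) z = B x (br y z)"
  and B_nondeg: "x \<in> G ==> (\<And>y. y \<in> G ==> B x y = 0) ==> x = 0"
  and casimir_adj: "x \<in> G ==> casimir B br x = scale (2 * of_real \<tau>) x"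
  using normalized unfolding casimir_normalized_def invariant_form_def by blast+

lemma B_add_right: "x \<in> G ==> y \<in> G ==> z \<in> G ==> B x (y + z) = B x y + B x z"
  using B_add_left[of y z x] B_sym carrier_subspace by (simp add: subspace_add)

lemma B_scale_right: "x \<in> G ==> y \<in> G ==> B x (scale c y) = c * B x y"
  using B_scale_left[of y x c] B_sym carrier_subspace by (simp add: subspace_scale)

lemma B_minus_left: "x \<in> G ==> y \<in> G ==> B (- x) y = - B x y" using B_scale_left[of x y "-1"] by simp

lemma B_minus_right: "x \<in> G ==> y \<in> G ==> B x (- y) = - B x y" using B_scale_right[of x y "-1"] by simp

lemma B_zero_left: "y \<in> G ==> B 0 y = 0" using B_scale_left[of 0 y 0] subspace_0[OF carrier_subspace] by simp

lemma B_zero_right: "y \<in> G ==> B y 0 = 0" using B_scale_right[of y 0 0] subspace_0[OF carrier_subspace] by simp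

lemma B_sum_left: "y \<in> G ==> (\<And>i. i \<in> I ==> g i \<in> G) ==> B (\<Sum>i\<in>I. g i) y = (\<Sum>i\<in>I. B (g i) y)"
proof (induction I rule: infinite_finite_induct)
  case (insert i I)
  thus ?case using carrier_subspace by (simp add: B_add_left subspace_sum)
qed (auto simp: B_zero_left)

lemma B_sum_right: "y \<in> G ==> (\<And>i. i \<in> I ==> g i \<in> G) ==> B y (\<Sum>i\<in>I. g i) = (\<Sum>i\<in>I. B y (g i))"
proof (induction I rule: infinite_finite_induct)
  case (insert i I)
  thus ?case using carrier_subspace by (simp add: B_add_right subspace_sum)
qed (auto simp: B_zero_right)

lemma root_space_G: "x \<in> root_space H r ==> x \<in> G"
  and root_space_br: "x \<in> root_space H r ==> h \<in> H ==> br h x = scale (r h) x" by (auto simp: root_space_def)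

lemma B_root_spaces_orth:
  assumes x: "x \<in> root_space H r" and y: "y \<in> root_space H s" and rs: "r \<in> dual H" "s \<in> dual H" "r + s \<noteq> 0"
  shows "B x y = 0"
proof -
  obtain h where h: "h \<in> H" "(r + s) h \<noteq> 0" using dual_neqD[OF dual_add[OF rs(1,2)] dual_zero rs(3)] by auto
  note G = root_space_G[OF x] root_space_G[OF y] H_G[OF h(1)]
  have "B (br x h) y = B x (br h y)" by (rule B_inv[OF G(1,3,2)])
  hence "- r h * B x y = s h * B x y" using br_anti[OF G(1,3)] root_space_br[OF x h(1)] root_space_br[OF y h(1)] G
    by (simp add: B_minus_left B_scale_left B_scale_right carrier_subspace subspace_scale)
  hence "(r h + s h) * B x y = 0" by (metis add.commute add.right_inverse distrib_right mult_minus_left)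
  thus ?thesis using h(2) by simp
qed

lemma root_space_dual: assumes r: "r \<in> dual H" and x: "x \<in> root_space H r" "x \<noteq> 0"
  shows "\<exists>y\<in>root_space H (- r). B x y = 1"
proof -
  obtain z where z: "z \<in> G" "B x z \<noteq> 0" using B_nondeg[OF root_space_G[OF x(1)]] x(2) by blast
  obtain S y where S: "finite S" "S \<subseteq> dual H" "\<And>\<mu>. \<mu> \<in> S ==> y \<mu> \<in> root_space H \<mu>" "z = (\<Sum>\<mu>\<in>S. y \<mu>)"
    using root_decomp[OF z(1)] by blast
  have "B x z = (\<Sum>\<mu>\<in>S. B x (y \<mu>))" unfolding S(4) using S(3) root_space_G x(1) by (intro B_sum_right) auto
  then obtain \<mu> where \<mu>: "\<mu> \<in> S" "B x (y \<mu>) \<noteq> 0" using z(2) by (metis sum.neutral)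
  hence "r + \<mu> = 0" using B_root_spaces_orth[OF x(1) S(3)] r S(2) by blast
  hence m: "\<mu> = - r" by (simp add: eq_neg_iff_add_eq_0 add.commute)
  have yG: "y \<mu> \<in> G" using S(3)[OF \<mu>(1)] root_space_G by blast
  show ?thesis
  proof
    show "scale (inverse (B x (y \<mu>))) (y \<mu>) \<in> root_space H (- r)"
      using S(3)[OF \<mu>(1)] subspace_scale[OF adj.wsp_subspace] m by (simp add: adj_wsp)
    show "B x (scale (inverse (B x (y \<mu>))) (y \<mu>)) = 1" using \<mu>(2) root_space_G[OF x(1)] yG by (simp add: B_scale_right)
  qed
qed

lemma B_H_nondeg: assumes "z \<in> H" "\<And>h. h \<in> H ==> B z h = 0" shows "z = 0"
proof (rule ccontr)
  assume "z \<noteq> 0"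
  moreover have "z \<in> root_space H 0" using assms(1) root_space_zero by simp
  ultimately obtain y where y: "y \<in> root_space H (- 0)" "B z y = 1" using root_space_dual[OF dual_zero] by blast
  hence "y \<in> H" using root_space_zero by simp
  thus False using assms(2)[of y] y(2) by simp
qed

lemma rootsD: "r \<in> roots H ==> r \<in> dual H" "r \<in> roots H ==> r \<noteq> 0" by (auto simp: roots_def)

lemma root_vector_exists: "r \<in> roots H ==> \<exists>x\<in>root_space H r. x \<noteq> 0"
  using subspace_0[OF adj.wsp_subspace[of r]] by (auto simp: roots_def adj_wsp)

lemma root_br: assumes x: "x \<in> root_space H r" and y: "y \<in> root_space H (- r)"
  shows "br x y \<in> H" "h \<in> H ==> B (br x y) h = B x y * r h"
proof -
  show "br x y \<in> H" using adj.wsp_shift[OF x, of y "- r"] y root_space_zero by (simp add: adj_wsp)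
  assume h: "h \<in> H"
  note G = root_space_G[OF x] root_space_G[OF y] H_G[OF h]
  have "B (br x y) h = B x (br y h)" by (rule B_inv[OF G])
  also have "br y h = - br h y" by (rule br_anti[OF G(2,3)])
  finally show "B (br x y) h = B x y * r h"
    using root_space_br[OF y h] G carrier_subspace by (simp add: B_minus_right B_scale_right subspace_scale)
qed

text \<open>The bracket of two dual root vectors represents \<open>r\<close> on \<open>H\<close>, so
  existence comes from the root spaces and uniqueness from nondegeneracy on
  \<open>H\<close>.\<close>

lemma tv_ex1: "r \<in> roots H ==> \<exists>!z. z \<in> H \<and> (\<forall>h\<in>H. B z h = r h)"
proof -
  assume r: "r \<in> roots H"
  obtain x where x: "x \<in> root_space H r" "x \<noteq> 0" using root_vector_exists[OF r] by blast
  obtain y where y: "y \<in> root_space H (- r)" "B x y = 1" using root_space_dual[OF rootsD(1)[OF r] x] by blast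
  show ?thesis
  proof
    show "br x y \<in> H \<and> (\<forall>h\<in>H. B (br x y) h = r h)" using root_br[OF x(1) y(1)] y(2) by simp
    fix z assume z: "z \<in> H \<and> (\<forall>h\<in>H. B z h = r h)"
    have b: "br x y \<in> H" using root_br[OF x(1) y(1)] by simp
    have "z - br x y = 0"
    proof (rule B_H_nondeg)
      show "z - br x y \<in> H" using z b H_subspace by (simp add: subspace_diff)
      fix h assume h: "h \<in> H"
      have "B (z + - br x y) h = B z h - B (br x y) h"
        using z b h H_G carrier_subspace by (subst B_add_left) (auto simp: subspace_neg B_minus_left)
      thus "B (z - br x y) h = 0" using z root_br[OF x(1) y(1)] y(2) h by simp
    qed
    thus "z = br x y" by simp
  qed
qed

definition tv :: "('a => complex) => 'a" where "tv r = (THE z. z \<in> H \<and> (\<forall>h\<in>H. B z h = r h))"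

lemma tv: "r \<in> roots H ==> tv r \<in> H" "r \<in> roots H ==> h \<in> H ==> B (tv r) h = r h"
  using theI'[OF tv_ex1] unfolding tv_def by auto

lemma tv_unique: "r \<in> roots H ==> z \<in> H ==> (\<And>h. h \<in> H ==> B z h = r h) ==> z = tv r" using tv_ex1[of r] tv[of r] by blast

lemma root_br_tv: assumes r: "r \<in> roots H" and x: "x \<in> root_space H r" and y: "y \<in> root_space H (- r)"
  shows "br x y = scale (B x y) (tv r)"
proof -
  have "br x y - scale (B x y) (tv r) = 0"
  proof (rule B_H_nondeg)
    note H = root_br[OF x y] tv[OF r]
    show "br x y - scale (B x y) (tv r) \<in> H" using H H_subspace by (simp add: subspace_diff subspace_scale)
    fix h assume h: "h \<in> H"
    have "B (br x y + scale (- B x y) (tv r)) h = 0"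
      using H h H_G carrier_subspace by (subst B_add_left) (auto simp: subspace_scale B_scale_left simp del: scale_minus_left)
    thus "B (br x y - scale (B x y) (tv r)) h = 0" by simp
  qed
  thus ?thesis by simp
qed

lemma tv_sym: "r \<in> roots H ==> s \<in> roots H ==> r (tv s) = s (tv r)" using tv B_sym H_G by metis

lemma neg_root: "r \<in> roots H ==> - r \<in> roots H"
proof -
  assume r: "r \<in> roots H"
  obtain x where x: "x \<in> root_space H r" "x \<noteq> 0" using root_vector_exists[OF r] by blast
  obtain y where y: "y \<in> root_space H (- r)" "B x y = 1" using root_space_dual[OF rootsD(1)[OF r] x] by blast
  hence "y \<noteq> 0" using B_zero_right root_space_G[OF x(1)] by auto
  thus ?thesis using y r dual_uminus by (auto simp: roots_def)
qed

lemma tv_neg: "r \<in> roots H ==> tv (- r) = - tv r" using tv[of r] H_G H_subspace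
  by (intro tv_unique[symmetric] neg_root) (auto simp: subspace_neg B_minus_left)

lemma center_trivial: assumes z: "z \<in> G" "\<And>x. x \<in> G ==> br z x = 0" shows "z = 0"
proof -
  define Z where "Z = {z \<in> G. \<forall>x\<in>G. br z x = 0}"
  have Zs: "subspace Z" unfolding Z_def
    using carrier_subspace by (intro subspaceI) (auto simp: subspace_0 subspace_add subspace_scale br_add_left br_scale_left adj.act_zero_left)
  have "br x z \<in> Z" if "x \<in> G" "z \<in> Z" for x z
  proof -
    have "br x z = - br z x" using that br_anti[of x z] by (simp add: Z_def)
    thus ?thesis using that subspace_0[OF Zs] by (auto simp: Z_def)
  qed
  hence "ideal Z" unfolding ideal_def using Zs by (auto simp: Z_def)
  hence "Z = {0} \<or> Z = G" using simple unfolding simple_def by blast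
  moreover have "Z \<noteq> G" using simple unfolding simple_def Z_def by blast
  ultimately show ?thesis using z by (auto simp: Z_def)
qed

lemma H_separated: assumes "z \<in> H" "\<And>s. s \<in> roots H ==> s z = 0" shows "z = 0"
proof (rule center_trivial)
  show "z \<in> G" using assms(1) H_G by blast
  fix x assume x: "x \<in> G"
  obtain S y where S: "finite S" "S \<subseteq> dual H" "\<And>\<mu>. \<mu> \<in> S ==> y \<mu> \<in> root_space H \<mu>" "x = (\<Sum>\<mu>\<in>S. y \<mu>)"
    using root_decomp[OF x] by blast
  have "br z (y \<mu>) = 0" if \<mu>: "\<mu> \<in> S" for \<mu>
  proof -
    have b: "br z (y \<mu>) = scale (\<mu> z) (y \<mu>)" using root_space_br[OF S(3)[OF \<mu>] assms(1)] .
    show ?thesis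
    proof (cases "\<mu> = 0 \<or> y \<mu> = 0")
      case False
      hence "\<mu> \<in> roots H" using \<mu> S(2,3) by (auto simp: roots_def)
      thus ?thesis using b assms(2) by simp
    qed (use b in auto)
  qed
  thus "br z x = 0" unfolding S(4) using S(3) root_space_G H_G[OF assms(1)] by (subst adj.act_sum) auto
qed

text \<open>If \<open>r\<close> vanished at \<open>tv r\<close>, summing traces along root strings
  would make every root vanish there, so \<open>tv r\<close> would be central and hence
  zero.\<close>

lemma root_nonisotropic: "r \<in> roots H ==> r (tv r) \<noteq> 0"
proof
  assume r: "r \<in> roots H" and 0: "r (tv r) = 0"
  obtain x where x: "x \<in> root_space H r" "x \<noteq> 0" using root_vector_exists[OF r] by blast
  obtain y where y: "y \<in> root_space H (- r)" "B x y = 1" using root_space_dual[OF rootsD(1)[OF r] x] by blast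
  have b: "br x y = tv r" using root_br_tv[OF r x(1) y(1)] y(2) by simp
  have "s (tv r) = 0" if "s \<in> roots H" for s
    using adj.string_trace_zero[OF rootsD[OF r] x(1) y(1), of s] b tv[OF r] 0 that by (auto simp: roots_eq)
  hence "tv r = 0" using H_separated tv[OF r] by blast
  hence "r h = 0" if "h \<in> H" for h using tv(2)[OF r that] B_zero_left H_G[OF that] by simp
  hence "r = 0" using dual_neqD[OF rootsD(1)[OF r] dual_zero] by auto
  thus False using rootsD(2)[OF r] by simp
qed

text \<open>The coroot of \<open>r\<close>.\<close>

definition hv :: "('a => complex) => 'a" where "hv r = scale (2 / r (tv r)) (tv r)"

lemma hv_H: "r \<in> roots H ==> hv r \<in> H" using tv H_subspace by (auto simp: hv_def subspace_scale)

lemma apply_hv: "r \<in> roots H ==> f \<in> dual H ==> f (hv r) = 2 * f (tv r) / r (tv r)" using tv(1) by (simp add: hv_def dual_H_linear)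

lemma root_hv: "r \<in> roots H ==> r (hv r) = 2" using apply_hv[of r r] rootsD(1) root_nonisotropic by simp

lemma root_sl2: assumes r: "r \<in> roots H" and x: "x \<in> root_space H r" "x \<noteq> 0"
  shows "\<exists>f\<in>root_space H (- r). sl2_triple x f (hv r)"
proof -
  obtain y where y: "y \<in> root_space H (- r)" "B x y = 1" using root_space_dual[OF rootsD(1)[OF r] x] by blast
  let ?f = "scale (2 / r (tv r)) y"
  have f: "?f \<in> root_space H (- r)" using y subspace_scale[OF adj.wsp_subspace] by (simp add: adj_wsp)
  have "br x ?f = hv r" using root_br_tv[OF r x(1) y(1)] y root_space_G x(1) by (simp add: br_scale_right hv_def)
  moreover have "br (hv r) x = scale 2 x" "br (hv r) ?f = scale (- 2) ?f"
    using root_space_br[OF x(1) hv_H[OF r]] root_space_br[OF f hv_H[OF r]] root_hv[OF r] by simp_all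
  ultimately have "sl2_triple x ?f (hv r)" unfolding sl2_triple_def using root_space_G x(1) f hv_H[OF r] H_G by blast
  thus ?thesis using f by blast
qed

lemma root_sl2_exists: assumes r: "r \<in> roots H"
  shows "\<exists>e\<in>root_space H r. \<exists>f\<in>root_space H (- r). sl2_triple e f (hv r) \<and> e \<noteq> 0"
  using root_sl2[OF r] root_vector_exists[OF r] by blast

lemma hv_neg: "r \<in> roots H ==> hv (- r) = - hv r"
  using dual_H_linear(2)[OF rootsD(1), of r "tv r" "-1"] tv(1)[of r] by (simp add: hv_def tv_neg)

text \<open>The lowering operator of \<open>r\<close> is injective on positive weights, so a root
  vector for \<open>s\<close> is not annihilated by it.\<close>

lemma root_space_multiple_down: assumes r: "r \<in> roots H" and s: "s \<in> roots H" "s (hv r) = of_nat m" "m > 0" "s - r \<noteq> 0"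
  shows "s - r \<in> roots H"
proof -
  obtain e f where ef: "e \<in> root_space H r" "f \<in> root_space H (- r)" "sl2_triple e f (hv r)" using root_sl2_exists[OF r] by blast
  obtain x where x: "x \<in> root_space H s" "x \<noteq> 0" using root_vector_exists[OF s(1)] by blast
  have "br (hv r) x = scale (of_nat m) x" using root_space_br[OF x(1) hv_H[OF r]] s(2) by simp
  hence "br f x \<noteq> 0" using adj.f_injective[OF ef(3) root_space_G[OF x(1)]] s(3) x(2) by blast
  moreover have "br f x \<in> root_space H (s - r)" using adj.wsp_shift[OF ef(2), of x s] x(1) by (simp add: adj_wsp)
  ultimately show ?thesis using s(4) dual_diff[OF rootsD(1)[OF s(1)] rootsD(1)[OF r]] by (auto simp: roots_def)
qed

text \<open>Subtract from \<open>y\<close> the multiple of \<open>x\<close> that makes the form with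
  \<open>f\<close> vanish. The difference has weight 2 and is killed by \<open>f\<close>, which is
  injective there.\<close>

lemma root_space_dim_one: assumes r: "r \<in> roots H" and x: "x \<in> root_space H r" "x \<noteq> 0"
  shows "root_space H r = range (\<lambda>c. scale c x)"
proof -
  obtain f where f: "f \<in> root_space H (- r)" "sl2_triple x f (hv r)" using root_sl2[OF r x] by blast
  have fx: "B x f \<noteq> 0"
  proof
    assume "B x f = 0"
    hence "hv r = 0" using root_br_tv[OF r x(1) f(1)] f(2) by (simp add: sl2_triple_def)
    thus False using root_hv[OF r] rootsD(1)[OF r] dual_H_linear(2)[of r 0 0] subspace_0[OF H_subspace] by simp
  qed
  have "\<exists>c. y = scale c x" if y: "y \<in> root_space H r" for y
  proof -
    define z where "z = y - scale (B y f / B x f) x"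
    have z: "z \<in> root_space H r" using y x(1) subspace_scale[OF adj.wsp_subspace] subspace_diff[OF adj.wsp_subspace]
      by (simp add: adj_wsp z_def)
    note G = root_space_G[OF x(1)] root_space_G[OF y] root_space_G[OF z] root_space_G[OF f(1)]
    have "y = z + scale (B y f / B x f) x" by (simp add: z_def)
    hence "B y f = B z f + B y f / B x f * B x f" using G carrier_subspace by (metis B_add_left B_scale_left subspace_scale)
    hence "B z f = 0" using fx by simp
    hence "br z f = 0" using root_br_tv[OF r z f(1)] by simp
    hence "br f z = 0" using br_anti[OF G(4,3)] by simp
    moreover have "br (hv r) z = scale (of_nat 2) z" using root_space_br[OF z hv_H[OF r]] root_hv[OF r] by simp
    ultimately have "z = 0" using adj.f_injective[OF f(2) G(3), of 2] by simp
    thus ?thesis by (auto simp: z_def)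
  qed
  thus ?thesis using x(1) subspace_scale[OF adj.wsp_subspace] by (auto simp: adj_wsp)
qed

lemma root_wmult: "r \<in> roots H ==> adj.wmult r = 1"
proof -
  assume r: "r \<in> roots H"
  obtain x where x: "x \<in> root_space H r" "x \<noteq> 0" using root_vector_exists[OF r] by blast
  have "root_space H r = span {x}" using root_space_dim_one[OF r x] by (simp add: span_singleton)
  thus ?thesis using x(2) dim_span_eq_card_independent[of "{x}"] by (simp add: adj.wmult_def adj_wsp)
qed

text \<open>A vector \<open>y\<close> for \<open>2 r\<close> has weight 4. The vector
  \<open>f y\<close> is a multiple of \<open>e\<close>, so \<open>e f y = 0\<close> and therefore
  \<open>f e y = - 4 y\<close>, a forbidden negative eigenvalue.\<close>

lemma double_not_root: "r \<in> roots H ==> fun_scale 2 r \<notin> roots H"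
proof
  assume r: "r \<in> roots H" and r2: "fun_scale 2 r \<in> roots H"
  obtain y where y: "y \<in> root_space H (fun_scale 2 r)" "y \<noteq> 0" using root_vector_exists[OF r2] by blast
  obtain e f where ef: "e \<in> root_space H r" "e \<noteq> 0" "f \<in> root_space H (- r)" "sl2_triple e f (hv r)"
    using root_sl2_exists[OF r] by blast
  have G: "e \<in> G" "f \<in> G" "y \<in> G" using ef y root_space_G by blast+
  have hy: "br (hv r) y = scale (of_real 4) y" using root_space_br[OF y(1) hv_H[OF r]] root_hv[OF r] by (simp add: fun_scale_def)
  have "fun_scale 2 r + - r = r" by (auto simp: fun_scale_def fun_eq_iff)
  hence "br f y \<in> root_space H r" using adj.wsp_shift[OF ef(3), of y "fun_scale 2 r"] y(1) by (simp add: adj_wsp)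
  then obtain c where "br f y = scale c e" using root_space_dim_one[OF r ef(1,2)] by auto
  hence "br e (br f y) = 0" using G by (simp add: br_scale_right br_self)
  hence "br f (br e y) = scale (of_real (- 4)) y" using adj.e_f[OF ef(4) G(3) hy] by (simp add: eq_neg_iff_add_eq_0)
  hence "y = 0" using adj.fe_no_negative_eigenvalue[OF ef(4) G(3) hy, of 4] by simp
  thus False using y by simp
qed

text \<open>Lowering by \<open>r\<close> turns a root \<open>(n + 1) r\<close> into the root
  \<open>n r\<close>, down to the excluded \<open>2 r\<close>.\<close>

lemma nat_multiple_not_root: assumes r: "r \<in> roots H" and n: "n \<ge> 2" shows "fun_scale (of_nat n) r \<notin> roots H" using n
proof (induction n rule: dec_induct)
  case base
  thus ?case using double_not_root[OF r] by simp
next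
  case (step n)
  show ?case
  proof
    assume s: "fun_scale (of_nat (Suc n)) r \<in> roots H"
    have eq: "fun_scale (of_nat (Suc n)) r - r = fun_scale (of_nat n) r" by (auto simp: fun_scale_def fun_eq_iff algebra_simps)
    have "fun_scale (of_nat n) r \<noteq> 0" using rootsD(2)[OF r] step by (auto simp: fun_scale_def fun_eq_iff)
    moreover have "fun_scale (of_nat (Suc n)) r (hv r) = of_nat (2 * Suc n)" using root_hv[OF r] by (simp add: fun_scale_def)
    ultimately have "fun_scale (of_nat n) r \<in> roots H" using root_space_multiple_down[OF r s, of "2 * Suc n"] unfolding eq by simp
    thus False using step by simp
  qed
qed

definition refl :: "('a => complex) => ('a => complex) => 'a => complex" where "refl r \<mu> = \<mu> - fun_scale (\<mu> (hv r)) r"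

lemma refl_dual: "r \<in> roots H ==> \<mu> \<in> dual H ==> refl r \<mu> \<in> dual H"
  using rootsD(1) by (simp add: refl_def dual_diff dual_scale)

lemma refl_involution: "r \<in> roots H ==> refl r (refl r \<mu>) = \<mu>"
  using root_hv[of r] by (auto simp: refl_def fun_scale_def fun_eq_iff algebra_simps)

lemma refl_add: "refl r (\<mu> + \<nu>) = refl r \<mu> + refl r \<nu>" by (auto simp: refl_def fun_scale_def fun_eq_iff algebra_simps)

lemma refl_diff: "refl r (\<mu> - \<nu>) = refl r \<mu> - refl r \<nu>" by (auto simp: refl_def fun_scale_def fun_eq_iff algebra_simps)

lemma refl_uminus: "refl r (- \<mu>) = - refl r \<mu>" by (auto simp: refl_def fun_scale_def fun_eq_iff algebra_simps)

lemma refl_scale: "refl r (fun_scale c \<mu>) = fun_scale c (refl r \<mu>)" by (auto simp: refl_def fun_scale_def fun_eq_iff algebra_simps)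

lemma refl_sum: "refl r (\<Sum>i\<in>I. f i) = (\<Sum>i\<in>I. refl r (f i))"
proof (induction I rule: infinite_finite_induct)
  case (insert i I)
  thus ?case unfolding sum.insert[OF insert(1,2)] refl_add by simp
qed (auto simp: refl_def fun_scale_def fun_eq_iff)

lemma refl_self: "r \<in> roots H ==> refl r r = - r" using root_hv[of r] by (auto simp: refl_def fun_scale_def fun_eq_iff)

end

section \<open>Reflection invariance of weight multiplicities\<close>

locale form_rep = form_alg scale G br H B \<tau> + cartan_rep scale G br H sV V \<rho>
  for scale :: "complex => 'a::ab_group_add => 'a" and G and br and H and B and \<tau>
    and sV :: "complex => 'v::ab_group_add => 'v" and V and \<rho>
begin

lemma weight_hv_integral: assumes r: "r \<in> roots H" and "\<mu> \<in> weights" shows "\<mu> (hv r) \<in> \<int>"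
proof -
  obtain e f where ef: "sl2_triple e f (hv r)" using root_sl2_exists[OF r] by blast
  obtain v where "v \<in> wsp \<mu>" "v \<noteq> 0" using assms(2) M.subspace_0[OF wsp_subspace, of \<mu>] by (auto simp: weights_def)
  thus ?thesis using weight_integral[OF ef, of v] wspD hv_H[OF r] by blast
qed

text \<open>The m-th power of the lowering operator maps the weight space injectively into the
  reflected one.\<close>

lemma wmult_le_refl_pos: assumes r: "r \<in> roots H" and \<mu>: "\<mu> (hv r) = of_nat m" shows "wmult \<mu> \<le> wmult (refl r \<mu>)"
proof -
  obtain e f where ef: "f \<in> root_space H (- r)" "sl2_triple e f (hv r)" using root_sl2_exists[OF r] by blast
  have fG: "f \<in> G" using ef(1) root_space_G by blast
  have lin: "M.lin_on (wsp \<mu>) (\<rho> f ^^ m)" unfolding M.lin_on_def using pow_add pow_scale fG wsp_sub by blast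
  have pow: "(\<rho> f ^^ n) v \<in> wsp (\<mu> + fun_scale (of_nat n) (- r))" if "v \<in> wsp \<mu>" for v n
  proof (induction n)
    case 0
    have "\<mu> + fun_scale (of_nat 0) (- r) = \<mu>" by (auto simp: fun_scale_def fun_eq_iff)
    thus ?case using that by simp
  next
    case (Suc n)
    have "\<mu> + fun_scale (of_nat n) (- r) + - r = \<mu> + fun_scale (of_nat (Suc n)) (- r)"
      by (auto simp: fun_scale_def fun_eq_iff algebra_simps)
    thus ?case using wsp_shift[OF ef(1) Suc] unfolding funpow.simps o_def by metis
  qed
  have "\<mu> + fun_scale (of_nat m) (- r) = refl r \<mu>" using \<mu> by (auto simp: refl_def fun_scale_def fun_eq_iff)
  hence into: "(\<rho> f ^^ m) x \<in> wsp (refl r \<mu>)" if "x \<in> wsp \<mu>" for x using pow[OF that, of m] by simp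
  have inj: "x = 0" if "x \<in> wsp \<mu>" "(\<rho> f ^^ m) x = 0" for x
    using pow_f_injective[OF ef(2), of x m] wspD[OF that(1)] hv_H[OF r] \<mu> that(2) by simp
  show ?thesis unfolding wmult_def by (rule M.dim_le_injective[OF wsp_fin_dim wsp_fin_dim lin into inj])
qed

lemma refl_neg_root: "r \<in> roots H ==> \<mu> \<in> dual H ==> refl (- r) \<mu> = refl r \<mu>"
  using dual_H_linear(2)[of \<mu> "hv r" "-1"] hv_H[of r] by (auto simp: refl_def hv_neg fun_scale_def fun_eq_iff)

lemma wmult_le_refl: assumes r: "r \<in> roots H" and \<mu>: "\<mu> \<in> dual H" shows "wmult \<mu> \<le> wmult (refl r \<mu>)"
proof (cases "\<mu> \<in> weights")
  case True
  then obtain n where n: "\<mu> (hv r) = of_int n" using weight_hv_integral[OF r] by (auto elim: Ints_cases)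
  show ?thesis
  proof (cases "n \<ge> 0")
    case True
    thus ?thesis using wmult_le_refl_pos[OF r, of \<mu> "nat n"] n by simp
  next
    case False
    have "\<mu> (hv (- r)) = of_nat (nat (- n))" using n False dual_H_linear(2)[OF \<mu> hv_H[OF r], of "-1"] by (simp add: hv_neg[OF r])
    thus ?thesis using wmult_le_refl_pos[OF neg_root[OF r], of \<mu> "nat (- n)"] refl_neg_root[OF r \<mu>] by simp
  qed
next
  case False
  thus ?thesis using wmult_zero \<mu> by simp
qed

lemma wmult_refl: "r \<in> roots H ==> \<mu> \<in> dual H ==> wmult (refl r \<mu>) = wmult \<mu>"
  using wmult_le_refl[of r \<mu>] wmult_le_refl[of r "refl r \<mu>"] refl_dual refl_involution by force

end

section \<open>The Casimir operator\<close>

context form_alg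
begin

lemma some_basis: "finite some_basis" "independent some_basis" "span some_basis = G"
proof -
  have "\<exists>E. finite E \<and> independent E \<and> span E = G" using sub_basis[OF G_fin_dim] by blast
  hence "finite some_basis \<and> independent some_basis \<and> span some_basis = G" unfolding some_basis_def by (rule someI_ex)
  thus "finite some_basis" "independent some_basis" "span some_basis = G" by auto
qed

lemma some_basis_G: "e \<in> some_basis ==> e \<in> G" using some_basis(3) span_base by blast

lemma B_eq_on_basis: assumes "x \<in> G" "y \<in> G" "\<And>e. e \<in> some_basis ==> B x e = B y e" shows "x = y"
proof -
  have "x - y = 0"
  proof (rule B_nondeg)
    show "x - y \<in> G" using assms carrier_subspace by (simp add: subspace_diff)
    fix z assume "z \<in> G"
    hence z: "z = (\<Sum>e\<in>some_basis. scale (representation some_basis z e) e)"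
      using representation_sum_basis[OF some_basis(2,1)] some_basis(3) by simp
    have d: "B (x + - y) e = 0" if "e \<in> some_basis" for e
      using assms that some_basis_G carrier_subspace by (subst B_add_left) (auto simp: subspace_neg B_minus_left)
    have "B (x - y) (\<Sum>e\<in>some_basis. scale (representation some_basis z e) e) =
        (\<Sum>e\<in>some_basis. representation some_basis z e * B (x - y) e)" using assms(1,2) some_basis_G carrier_subspace
      by (subst B_sum_right) (auto simp: subspace_diff subspace_scale B_scale_right)
    also have "\<dots> = 0" using d by simp
    finally show "B (x - y) z = 0" using z by simp
  qed
  thus ?thesis by simp
qed

text \<open>The map \<open>\<Phi>\<close> is injective by nondegeneracy and hence onto
  \<open>G\<close> by dimension; a preimage of \<open>e\<close> has the required products with the
  basis.\<close>

lemma dual_vector_ex1: assumes e: "e \<in> some_basis"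
  shows "\<exists>!y. y \<in> G \<and> (\<forall>e'\<in>some_basis. B y e' = (if e' = e then 1 else 0))"
proof -
  define \<Phi> where "\<Phi> = (\<lambda>x. \<Sum>e\<in>some_basis. scale (B x e) e)"
  have lin: "lin_on G \<Phi>" unfolding lin_on_def \<Phi>_def
    using some_basis_G by (auto simp: B_add_left B_scale_left scale_left_distrib sum.distrib scale_sum_right)
  have into: "\<Phi> x \<in> G" for x unfolding \<Phi>_def using some_basis_G carrier_subspace by (auto intro!: subspace_sum subspace_scale)
  have inj: "x = 0" if x: "x \<in> G" "\<Phi> x = 0" for x
  proof (rule B_eq_on_basis)
    fix e assume "e \<in> some_basis"
    thus "B x e = B 0 e" using independentD[OF some_basis(2,1) order_refl, of "B x" e] x(2) B_zero_left some_basis_G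
      by (simp add: \<Phi>_def)
  qed (use x subspace_0[OF carrier_subspace] in auto)
  have W: "subspace (\<Phi> ` G)"
  proof (rule subspaceI)
    show "0 \<in> \<Phi> ` G" using lin_on_zero[OF lin subspace_0[OF carrier_subspace]] subspace_0[OF carrier_subspace] by force
  next
    fix x y assume "x \<in> \<Phi> ` G" "y \<in> \<Phi> ` G"
    then obtain a b where ab: "a \<in> G" "b \<in> G" "x = \<Phi> a" "y = \<Phi> b" by auto
    hence "x + y = \<Phi> (a + b)" using lin_on_add[OF lin] by simp
    thus "x + y \<in> \<Phi> ` G" using ab subspace_add[OF carrier_subspace] by blast
  next
    fix c x assume "x \<in> \<Phi> ` G"
    then obtain a where ab: "a \<in> G" "x = \<Phi> a" by auto
    hence "scale c x = \<Phi> (scale c a)" using lin_on_scale[OF lin] by simp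
    thus "scale c x \<in> \<Phi> ` G" using ab subspace_scale[OF carrier_subspace] by blast
  qed
  have sub: "\<Phi> ` G \<subseteq> G" using into by auto
  have "dim G \<le> dim (\<Phi> ` G)" by (rule dim_le_injective[OF G_fin_dim fin_dim_subset[OF G_fin_dim W sub] lin _ inj]) auto
  hence "\<Phi> ` G = G" by (intro fin_dim_eqI[OF G_fin_dim W sub] antisym fin_dim_dim_mono[OF G_fin_dim W sub])
  then obtain y where y: "y \<in> G" "\<Phi> y = e" using some_basis_G[OF e] by (metis imageE)
  have "B y e' = (if e' = e then 1 else 0)" if e': "e' \<in> some_basis" for e'
  proof -
    have "(\<Sum>x\<in>some_basis. scale (B y x - (if x = e then 1 else 0)) x) = \<Phi> y - (\<Sum>x\<in>some_basis. scale (if x = e then 1 else 0) x)"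
      by (simp add: \<Phi>_def scale_left_diff_distrib sum_subtractf)
    also have "(\<Sum>x\<in>some_basis. scale (if x = e then 1 else 0) x) = (\<Sum>x\<in>some_basis. if x = e then x else 0)"
      by (intro sum.cong) auto
    also have "\<dots> = e" using e some_basis(1) by simp
    finally have "B y e' - (if e' = e then 1 else 0) = 0"
      using independentD[OF some_basis(2,1) order_refl, of "\<lambda>x. B y x - (if x = e then 1 else 0)" e'] y(2) e' by simp
    thus ?thesis by simp
  qed
  hence yb: "\<forall>e'\<in>some_basis. B y e' = (if e' = e then 1 else 0)" by blast
  show ?thesis
  proof (rule ex1I[of _ y])
    show "y \<in> G \<and> (\<forall>e'\<in>some_basis. B y e' = (if e' = e then 1 else 0))" using y(1) yb by blast
    fix z assume z: "z \<in> G \<and> (\<forall>e'\<in>some_basis. B z e' = (if e' = e then 1 else 0))"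
    hence "B z e' = B y e'" if "e' \<in> some_basis" for e' using yb that by simp
    thus "z = y" using B_eq_on_basis z y(1) by blast
  qed
qed

lemma dual_vector: "e \<in> some_basis ==> dual_vector B e \<in> G"
  "e \<in> some_basis ==> e' \<in> some_basis ==> B (dual_vector B e) e' = (if e' = e then 1 else 0)"
  using theI'[OF dual_vector_ex1] unfolding dual_vector_def by auto

lemma basis_expansion: assumes x: "x \<in> G"
  shows "representation some_basis x e = (if e \<in> some_basis then B x (dual_vector B e) else 0)"
    "x = (\<Sum>e\<in>some_basis. scale (B x (dual_vector B e)) e)" "x = (\<Sum>e\<in>some_basis. scale (B x e) (dual_vector B e))"
proof -
  have *: "representation some_basis x e = B x (dual_vector B e)" if e: "e \<in> some_basis" for e
  proof -
    have "B x (dual_vector B e) = B (\<Sum>e\<in>some_basis. scale (representation some_basis x e) e) (dual_vector B e)"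
      using representation_sum_basis[OF some_basis(2,1)] some_basis(3) x by simp
    also have "\<dots> = (\<Sum>e'\<in>some_basis. representation some_basis x e' * B (dual_vector B e) e')"
      using e dual_vector(1) some_basis_G carrier_subspace B_sym[OF some_basis_G dual_vector(1)]
      by (subst B_sum_left) (auto simp: subspace_scale B_scale_left)
    also have "\<dots> = (\<Sum>e'\<in>some_basis. if e' = e then representation some_basis x e' else 0)"
      using e dual_vector by (intro sum.cong) auto
    finally show ?thesis using e some_basis(1) by simp
  qed
  thus "representation some_basis x e = (if e \<in> some_basis then B x (dual_vector B e) else 0)" using representation_ne_zero by auto
  show "x = (\<Sum>e\<in>some_basis. scale (B x (dual_vector B e)) e)"
    using representation_sum_basis[OF some_basis(2,1), of x] some_basis(3) x * by simp
  show "x = (\<Sum>e\<in>some_basis. scale (B x e) (dual_vector B e))"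
  proof (rule B_eq_on_basis[OF x])
    show "(\<Sum>e\<in>some_basis. scale (B x e) (dual_vector B e)) \<in> G"
      using dual_vector carrier_subspace by (auto intro!: subspace_sum subspace_scale)
    fix e assume e: "e \<in> some_basis"
    have "B (\<Sum>e\<in>some_basis. scale (B x e) (dual_vector B e)) e = (\<Sum>e'\<in>some_basis. B x e' * B (dual_vector B e') e)"
      using e dual_vector(1) some_basis_G carrier_subspace by (subst B_sum_left) (auto simp: subspace_scale B_scale_left)
    also have "\<dots> = (\<Sum>e'\<in>some_basis. if e' = e then B x e' else 0)" using e dual_vector by (intro sum.cong) auto
    finally show "B x e = B (\<Sum>e\<in>some_basis. scale (B x e) (dual_vector B e)) e" using e some_basis(1) by simp
  qed
qed

text \<open>Computed in dual bases, the trace becomes by invariance the form of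
  \<open>casimir B br x\<close> with \<open>y\<close>, and the normalization evaluates it.\<close>

lemma killing_form: assumes "x \<in> G" "y \<in> G" shows "trace_on G (\<lambda>z. br x (br y z)) = 2 * of_real \<tau> * B x y"
proof -
  have lin: "lin_on G (\<lambda>z. br x (br y z))" using assms br_closed by (auto simp: lin_on_def br_add_right br_scale_right)
  have "trace_on G (\<lambda>z. br x (br y z)) = (\<Sum>e\<in>some_basis. representation some_basis (br x (br y e)) e)"
    by (rule trace_on_any_basis[OF G_fin_dim some_basis(2,1,3) lin]) (use assms br_closed in auto)
  also have "\<dots> = (\<Sum>e\<in>some_basis. B (br e (br (dual_vector B e) x)) y)"
  proof (intro sum.cong refl)
    fix e assume e: "e \<in> some_basis"
    let ?d = "dual_vector B e"
    note G = assms some_basis_G[OF e] dual_vector(1)[OF e]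
    have "representation some_basis (br x (br y e)) e = B (br x (br y e)) ?d"
      using basis_expansion(1)[of "br x (br y e)" e] G e br_closed by simp
    also have "\<dots> = - B (br (br y e) x) ?d" using br_anti[of x "br y e"] G br_closed by (simp add: B_minus_left)
    also have "\<dots> = - B (br y e) (br x ?d)" using B_inv[of "br y e" x ?d] G br_closed by simp
    also have "\<dots> = - B (br e y) (br ?d x)"
      using br_anti[of x ?d] br_anti[of y e] G br_closed by (simp add: B_minus_left B_minus_right carrier_subspace subspace_neg)
    also have "\<dots> = - B (br ?d x) (br e y)" using B_sym[of "br e y" "br ?d x"] G br_closed by simp
    also have "\<dots> = - B (br (br ?d x) e) y" using B_inv[of "br ?d x" e y] G br_closed by simp
    also have "\<dots> = B (br e (br ?d x)) y" using br_anti[of e "br ?d x"] G br_closed by (simp add: B_minus_left)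
    finally show "representation some_basis (br x (br y e)) e = B (br e (br ?d x)) y" .
  qed
  also have "\<dots> = B (casimir B br x) y" unfolding casimir_def using assms some_basis_G dual_vector br_closed by (subst B_sum_left) auto
  finally show ?thesis using casimir_adj[OF assms(1)] assms by (simp add: B_scale_left)
qed

lemma killing_H: assumes "h \<in> H" "k \<in> H" shows "(\<Sum>r\<in>roots H. r h * r k) = 2 * of_real \<tau> * B h k"
proof -
  have G: "h \<in> G" "k \<in> G" using assms H_G by auto
  have lin: "lin_on G (\<lambda>z. br h (br k z))" using G br_closed by (auto simp: lin_on_def br_add_right br_scale_right)
  have "trace_on G (\<lambda>z. br h (br k z)) = (\<Sum>r\<in>adj.weights. (r h * r k) * of_nat (dim (adj.wsp r)))"
  proof (rule direct_sum_trace[OF adj.weighted_direct_sum[OF adj_weighted] lin])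
    fix r x assume "x \<in> adj.wsp r"
    thus "br h (br k x) = scale (r h * r k) x"
      using root_space_br[of x r] root_space_G[of x r] assms G by (simp add: adj_wsp br_scale_right mult.commute)
  qed
  also have "\<dots> = (\<Sum>r\<in>roots H. (r h * r k) * of_nat (dim (adj.wsp r)))"
    unfolding roots_eq using adj.finite_weights by (intro sum.mono_neutral_right) auto
  also have "\<dots> = (\<Sum>r\<in>roots H. r h * r k)" using root_wmult by (simp add: adj.wmult_def)
  finally show ?thesis using killing_form[OF G] by simp
qed

text \<open>By \<open>killing_H\<close> both sides have the same product with every element of
  \<open>H\<close>. The vectors \<open>tv r\<close> are overcomplete, and this expansion spares the
  choice of a basis of \<open>H\<close>.\<close>

lemma H_expansion: assumes h: "h \<in> H" shows "h = scale (1 / (2 * of_real \<tau>)) (\<Sum>r\<in>roots H. scale (r h) (tv r))"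
proof -
  let ?k = "scale (1 / (2 * of_real \<tau>)) (\<Sum>r\<in>roots H. scale (r h) (tv r))"
  have kH: "?k \<in> H" "(\<Sum>r\<in>roots H. scale (r h) (tv r)) \<in> H" using tv H_subspace by (auto intro!: subspace_scale subspace_sum)
  have "h - ?k = 0"
  proof (rule B_H_nondeg)
    show "h - ?k \<in> H" using h kH H_subspace by (simp add: subspace_diff)
    fix k assume k: "k \<in> H"
    have "B ?k k = 1 / (2 * of_real \<tau>) * (\<Sum>r\<in>roots H. r h * r k)" using kH k H_G tv carrier_subspace
      by (subst B_scale_left) (auto simp: B_sum_left subspace_scale B_scale_left)
    hence "B ?k k = B h k" using killing_H[OF h k] tau_pos by simp
    moreover have "B (h + - ?k) k = B h k - B ?k k"
      using h k kH H_G carrier_subspace by (subst B_add_left) (auto simp: subspace_neg B_minus_left)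
    ultimately show "B (h - ?k) k = 0" by simp
  qed
  thus ?thesis by (rule eq_iff_diff_eq_0[THEN iffD2])
qed

text \<open>The form dual to the restriction of \<open>B\<close> to \<open>H\<close>, written out
  through \<open>H_expansion\<close>. As a sum over roots it is visibly positive on functionals that
  are real on all \<open>tv r\<close>.\<close>

definition ip :: "('a => complex) => ('a => complex) => complex" where
  "ip \<mu> \<nu> = (\<Sum>r\<in>roots H. \<mu> (tv r) * \<nu> (tv r)) / (2 * of_real \<tau>)"

lemma ip_sym: "ip \<mu> \<nu> = ip \<nu> \<mu>" by (simp add: ip_def mult.commute)

lemma ip_add_left: "ip (\<mu> + \<nu>) \<kappa> = ip \<mu> \<kappa> + ip \<nu> \<kappa>"
  by (simp add: ip_def algebra_simps sum.distrib add_divide_distrib)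

lemma ip_add_right: "ip \<kappa> (\<mu> + \<nu>) = ip \<kappa> \<mu> + ip \<kappa> \<nu>" using ip_add_left ip_sym by metis

lemma ip_diff_left: "ip (\<mu> - \<nu>) \<kappa> = ip \<mu> \<kappa> - ip \<nu> \<kappa>"
  by (simp add: ip_def algebra_simps sum_subtractf diff_divide_distrib)

lemma ip_diff_right: "ip \<kappa> (\<mu> - \<nu>) = ip \<kappa> \<mu> - ip \<kappa> \<nu>" using ip_diff_left ip_sym by metis

lemma ip_scale_left: "ip (fun_scale c \<mu>) \<kappa> = c * ip \<mu> \<kappa>"
  by (simp add: ip_def fun_scale_def sum_distrib_left mult.assoc)

lemma ip_scale_right: "ip \<kappa> (fun_scale c \<mu>) = c * ip \<kappa> \<mu>" using ip_scale_left ip_sym by metis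

lemma ip_uminus_left: "ip (- \<mu>) \<nu> = - ip \<mu> \<nu>" by (simp add: ip_def sum_negf)

lemma ip_uminus_right: "ip \<mu> (- \<nu>) = - ip \<mu> \<nu>" by (simp add: ip_def sum_negf)

lemma ip_zero: "ip 0 \<mu> = 0" "ip \<mu> 0 = 0" by (simp_all add: ip_def)

lemma ip_sum_left: "ip (\<Sum>i\<in>I. f i) \<mu> = (\<Sum>i\<in>I. ip (f i) \<mu>)"
proof (induction I rule: infinite_finite_induct)
  case (insert i I)
  thus ?case unfolding sum.insert[OF insert(1,2)] ip_add_left by simp
qed (simp_all add: ip_zero[unfolded zero_fun_def] ip_zero)

lemma ip_sum_right: "ip \<mu> (\<Sum>i\<in>I. f i) = (\<Sum>i\<in>I. ip \<mu> (f i))" using ip_sum_left[of f I \<mu>] by (simp add: ip_sym)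

lemma ip_root:  assumes r: "r \<in> roots H" and \<mu>: "\<mu> \<in> dual H" shows "ip \<mu> r = \<mu> (tv r)"
proof -
  have s: "(\<Sum>s\<in>roots H. scale (s (tv r)) (tv s)) \<in> H" using tv H_subspace by (auto intro!: subspace_scale subspace_sum)
  have "\<mu> (tv r) = \<mu> (scale (1 / (2 * of_real \<tau>)) (\<Sum>s\<in>roots H. scale (s (tv r)) (tv s)))"
    by (rule arg_cong[OF H_expansion[OF tv(1)[OF r]]])
  also have "\<dots> = 1 / (2 * of_real \<tau>) * (\<Sum>s\<in>roots H. s (tv r) * \<mu> (tv s))"
    using \<mu> s tv H_subspace by (simp add: dual_H_linear dual_H_sum subspace_scale)
  also have "\<dots> = ip \<mu> r" using tv_sym[OF r] by (simp add: ip_def mult.commute)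
  finally show ?thesis by simp
qed

lemma ip_root_left: "r \<in> roots H ==> \<mu> \<in> dual H ==> ip r \<mu> = \<mu> (tv r)" using ip_root ip_sym by metis

lemma apply_hv_ip: "r \<in> roots H ==> \<mu> \<in> dual H ==> \<mu> (hv r) = 2 * ip \<mu> r / ip r r"
  using apply_hv ip_root rootsD(1) by metis

lemma ip_root_nonzero: "r \<in> roots H ==> ip r r \<noteq> 0" using ip_root root_nonisotropic rootsD(1) by metis

lemma ip_refl: assumes r: "r \<in> roots H" and \<mu>: "\<mu> \<in> dual H" "\<nu> \<in> dual H"
  shows "ip (refl r \<mu>) (refl r \<nu>) = ip \<mu> \<nu>"
proof -
  have "ip r \<nu> = ip \<nu> r" by (rule ip_sym)
  thus ?thesis
    unfolding refl_def ip_diff_left ip_diff_right ip_scale_left ip_scale_right apply_hv_ip[OF r \<mu>(1)] apply_hv_ip[OF r \<mu>(2)]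
    using ip_root_nonzero[OF r] by (simp add: field_simps)
qed

lemma root_vectors_exist: "\<exists>f. \<forall>r\<in>roots H. f r \<in> root_space H r \<and> B (f r) (f (- r)) = 1"
proof -
  have "\<exists>x. \<forall>r\<in>roots H. x r \<in> root_space H r \<and> x r \<noteq> 0" using root_vector_exists by metis
  then obtain x where x: "\<And>r. r \<in> roots H ==> x r \<in> root_space H r" "\<And>r. r \<in> roots H ==> x r \<noteq> 0" by blast
  define c where "c = (\<lambda>r. B (x r) (x (- r)))"
  have c: "c r \<noteq> 0" "c (- r) = c r" if r: "r \<in> roots H" for r
  proof -
    obtain y where y: "y \<in> root_space H (- r)" "B (x r) y = 1" using root_space_dual[OF rootsD(1)[OF r] x(1)[OF r] x(2)[OF r]] by blast
    obtain d where "y = scale d (x (- r))"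
      using y(1) root_space_dim_one[OF neg_root[OF r] x(1)[OF neg_root[OF r]] x(2)[OF neg_root[OF r]]] by auto
    hence "d * c r = 1" using y(2) B_scale_right root_space_G x(1)[OF r] x(1)[OF neg_root[OF r]] by (simp add: c_def)
    thus "c r \<noteq> 0" by auto
    show "c (- r) = c r" using B_sym root_space_G x(1)[OF r] x(1)[OF neg_root[OF r]] by (simp add: c_def)
  qed
  \<comment> \<open>Since \<open>c (- r) = c r\<close>, dividing both vectors by the same square
    root normalizes the pair without singling out one of the two signs.\<close>
  define f where "f = (\<lambda>r. scale (1 / csqrt (c r)) (x r))"
  have "f r \<in> root_space H r" if "r \<in> roots H" for r
    using x(1)[OF that] subspace_scale[OF adj.wsp_subspace] by (simp add: f_def adj_wsp)
  moreover have "B (f r) (f (- r)) = 1" if r: "r \<in> roots H" for r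
  proof -
    have "x r \<in> G" "x (- r) \<in> G" using x(1) r neg_root[OF r] root_space_G by blast+
    hence "B (f r) (f (- r)) = 1 / csqrt (c r) * (1 / csqrt (c r)) * c r"
      using c(2)[OF r] carrier_subspace by (simp add: f_def B_scale_left B_scale_right subspace_scale c_def)
    also have "\<dots> = 1"
    proof -
      have "csqrt (c r) * csqrt (c r) = c r" using power2_csqrt[of "c r"] by (simp add: power2_eq_square)
      thus ?thesis using c(1)[OF r] by (simp add: divide_simps)
    qed
    finally show ?thesis .
  qed
  ultimately show ?thesis by blast
qed

definition rv :: "('a => complex) => 'a" where
  "rv = (SOME f. \<forall>r\<in>roots H. f r \<in> root_space H r \<and> B (f r) (f (- r)) = 1)"

lemma rv: "r \<in> roots H ==> rv r \<in> root_space H r" "r \<in> roots H ==> B (rv r) (rv (- r)) = 1"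
  using someI_ex[OF root_vectors_exist] unfolding rv_def by blast+

lemma rv_G: "r \<in> roots H ==> rv r \<in> G" using rv root_space_G by blast

lemma rv_nonzero: "r \<in> roots H ==> rv r \<noteq> 0" using rv(2)[of r] B_zero_left rv_G neg_root by force

lemma rv_br: "r \<in> roots H ==> br (rv r) (rv (- r)) = tv r" using root_br_tv[OF _ rv(1) rv(1)[OF neg_root]] rv(2) by simp

text \<open>Generalizes a pair of dual bases: the families may be linearly dependent, so the part in
  \<open>H\<close> can be indexed by all roots.\<close>

definition frame :: "'i set => ('i => 'a) => ('i => 'a) => bool" where
  "frame J a b \<longleftrightarrow> finite J \<and> (\<forall>j\<in>J. a j \<in> G \<and> b j \<in> G) \<and> (\<forall>x\<in>G. x = (\<Sum>j\<in>J. scale (B x (a j)) (b j)))"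

text \<open>On root spaces the pairing of \<open>rv r\<close> with \<open>rv (- r)\<close>
  reproduces the vector, on \<open>H\<close> it is \<open>H_expansion\<close>; the mixed terms
  vanish by orthogonality.\<close>

lemma root_frame:
  "frame (roots H <+> roots H) (case_sum (\<lambda>r. rv (- r)) (\<lambda>r. scale (1 / (2 * of_real \<tau>)) (tv r))) (case_sum rv tv)"
proof -
  define F where "F = (\<lambda>x. (\<Sum>r\<in>roots H. scale (B x (rv (- r))) (rv r)) +
     scale (1 / (2 * of_real \<tau>)) (\<Sum>r\<in>roots H. scale (B x (tv r)) (tv r)))"
  have tvG: "tv r \<in> G" if "r \<in> roots H" for r using tv(1)[OF that] H_G by blast
  have lin: "lin_on G F" unfolding lin_on_def F_def using rv_G tvG neg_root
    by (auto simp: B_add_left B_scale_left scale_left_distrib sum.distrib scale_sum_right scale_right_distrib mult_ac)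
  have rootF: "F x = x" if x: "x \<in> root_space H r" "r \<in> dual H" for x r
  proof (cases "r \<in> roots H")
    case True
    obtain c where c: "x = scale c (rv r)" using root_space_dim_one[OF True rv(1)[OF True] rv_nonzero[OF True]] x(1) by auto
    have "B x (tv s) = 0" if s: "s \<in> roots H" for s
      using B_root_spaces_orth[of x r "tv s" 0] x tv(1)[OF s] root_space_zero dual_zero rootsD(2)[OF True] by simp
    moreover have "scale (B x (rv (- s))) (rv s) = (if s = r then x else 0)" if s: "s \<in> roots H" for s
    proof (cases "s = r")
      case True
      thus ?thesis using c rv(2)[OF s] rv_G s neg_root by (simp add: B_scale_left)
    next
      case False
      hence "B x (rv (- s)) = 0" using B_root_spaces_orth[OF x(1) rv(1)[OF neg_root[OF s]] x(2)] rootsD(1)[OF neg_root[OF s]] by simp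
      thus ?thesis using False by simp
    qed
    ultimately show ?thesis using True finite_roots by (simp add: F_def)
  next
    case False
    show ?thesis
    proof (cases "r = 0")
      case True
      hence xH: "x \<in> H" using x root_space_zero by simp
      have "B x (rv (- s)) = 0" if s: "s \<in> roots H" for s
        using B_root_spaces_orth[OF x(1) rv(1)[OF neg_root[OF s]] x(2)] rootsD[OF neg_root[OF s]] True by simp
      moreover have "B x (tv s) = s x" if s: "s \<in> roots H" for s using tv[OF s] xH B_sym H_G by metis
      ultimately have "F x = scale (1 / (2 * of_real \<tau>)) (\<Sum>r\<in>roots H. scale (r x) (tv r))" by (simp add: F_def)
      thus ?thesis using H_expansion[OF xH] by (rule trans[OF _ sym])
    next
      case False
      with \<open>r \<notin> roots H\<close> x have "x = 0" by (auto simp: roots_def)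
      thus ?thesis using lin_on_zero[OF lin subspace_0[OF carrier_subspace]] by simp
    qed
  qed
  have F: "F x = x" if x: "x \<in> G" for x
  proof -
    obtain S y where S: "finite S" "S \<subseteq> dual H" "\<And>\<mu>. \<mu> \<in> S ==> y \<mu> \<in> root_space H \<mu>" "x = (\<Sum>\<mu>\<in>S. y \<mu>)"
      using root_decomp[OF x] by blast
    have "F x = (\<Sum>\<mu>\<in>S. F (y \<mu>))" unfolding S(4)
      using S(3) root_space_G by (intro lin_on_sum[OF lin carrier_subspace]) blast
    also have "\<dots> = (\<Sum>\<mu>\<in>S. y \<mu>)" using S rootF by (intro sum.cong) auto
    finally show ?thesis using S(4) by simp
  qed
  have "(\<Sum>j\<in>roots H <+> roots H. scale (B x (case_sum (\<lambda>r. rv (- r)) (\<lambda>r. scale (1 / (2 * of_real \<tau>)) (tv r)) j)) (case_sum rv tv j)) = F x"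
    if "x \<in> G" for x using finite_roots that tvG by (simp add: sum.Plus F_def B_scale_right scale_sum_right)
  thus ?thesis unfolding frame_def using F finite_roots rv_G tvG neg_root carrier_subspace by (auto simp: subspace_scale)
qed

end

context form_rep
begin

text \<open>Expand the dual basis vectors in \<open>b\<close>, exchange the sums, and collect the
  basis expansion of \<open>a j\<close>.\<close>

lemma casimir_frame: assumes J: "frame J a b" and v: "v \<in> V" shows "casimir B \<rho> v = (\<Sum>j\<in>J. \<rho> (a j) (\<rho> (b j) v))"
proof -
  have fin: "finite J" and ab: "\<And>j. j \<in> J ==> a j \<in> G" "\<And>j. j \<in> J ==> b j \<in> G"
    and ex: "\<And>x. x \<in> G ==> x = (\<Sum>j\<in>J. scale (B x (a j)) (b j))" using J unfolding frame_def by blast+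
  have "casimir B \<rho> v = (\<Sum>e\<in>some_basis. \<Sum>j\<in>J. sV (B (dual_vector B e) (a j)) (\<rho> e (\<rho> (b j) v)))"
    unfolding casimir_def
  proof (intro sum.cong refl)
    fix e assume e: "e \<in> some_basis"
    have "\<rho> (dual_vector B e) v = \<rho> (\<Sum>j\<in>J. scale (B (dual_vector B e) (a j)) (b j)) v"
      by (rule arg_cong[where f="\<lambda>y. \<rho> y _", OF ex[OF dual_vector(1)[OF e]]])
    also have "\<dots> = (\<Sum>j\<in>J. sV (B (dual_vector B e) (a j)) (\<rho> (b j) v))"
      using v ab carrier_subspace by (simp add: act_sum_left subspace_scale act_scale_left)
    finally show "\<rho> e (\<rho> (dual_vector B e) v) = (\<Sum>j\<in>J. sV (B (dual_vector B e) (a j)) (\<rho> e (\<rho> (b j) v)))"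
      using v ab some_basis_G[OF e] act_in V_subspace by (simp add: act_sum M.subspace_scale act_scale)
  qed
  also have "\<dots> = (\<Sum>j\<in>J. \<Sum>e\<in>some_basis. sV (B (dual_vector B e) (a j)) (\<rho> e (\<rho> (b j) v)))"
    by (rule sum.swap)
  also have "\<dots> = (\<Sum>j\<in>J. \<rho> (a j) (\<rho> (b j) v))"
  proof (intro sum.cong refl)
    fix j assume j: "j \<in> J"
    have "(\<Sum>e\<in>some_basis. scale (B (dual_vector B e) (a j)) e) = (\<Sum>e\<in>some_basis. scale (B (a j) (dual_vector B e)) e)"
      using B_sym[OF ab(1)[OF j] dual_vector(1)] by simp
    also have "\<dots> = a j" by (rule basis_expansion(2)[OF ab(1)[OF j], symmetric])
    finally have "\<rho> (a j) (\<rho> (b j) v) = \<rho> (\<Sum>e\<in>some_basis. scale (B (dual_vector B e) (a j)) e) (\<rho> (b j) v)"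
      by simp
    also have "\<dots> = (\<Sum>e\<in>some_basis. sV (B (dual_vector B e) (a j)) (\<rho> e (\<rho> (b j) v)))"
      using v ab[OF j] act_in some_basis_G carrier_subspace by (simp add: act_sum_left subspace_scale act_scale_left)
    finally show "(\<Sum>e\<in>some_basis. sV (B (dual_vector B e) (a j)) (\<rho> e (\<rho> (b j) v))) = \<rho> (a j) (\<rho> (b j) v)" by simp
  qed
  finally show ?thesis .
qed

text \<open>In the root frame every product with the raising operator on the left is commuted into
  \<open>rv (- r)\<close> after \<open>rv r\<close>; each commutator \<open>tv r\<close> contributes
  the scalar \<open>\<mu> (tv r)\<close>.\<close>

lemma casimir_weight:
  assumes P: "roots H = P \<union> uminus ` P" "P \<inter> uminus ` P = {}" and v: "v \<in> wsp \<mu>" and \<mu>: "\<mu> \<in> dual H"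
  shows "casimir B \<rho> v = sV (ip \<mu> \<mu> + (\<Sum>r\<in>P. \<mu> (tv r))) v +
    sV 2 (\<Sum>r\<in>P. \<rho> (rv (- r)) (\<rho> (rv r) v))"
proof -
  have vV: "v \<in> V" using v wspD by blast
  have tvG: "tv r \<in> G" if "r \<in> roots H" for r using tv(1)[OF that] H_G by blast
  have finP: "finite P" using finite_roots P(1) by (metis finite_Un)
  have PR: "r \<in> roots H" if "r \<in> P" for r using P(1) that by blast
  have "casimir B \<rho> v = (\<Sum>r\<in>roots H. \<rho> (rv (- r)) (\<rho> (rv r) v)) +
      (\<Sum>r\<in>roots H. \<rho> (scale (1 / (2 * of_real \<tau>)) (tv r)) (\<rho> (tv r) v))"
    using casimir_frame[OF root_frame vV] finite_roots by (simp add: sum.Plus)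
  also have "(\<Sum>r\<in>roots H. \<rho> (scale (1 / (2 * of_real \<tau>)) (tv r)) (\<rho> (tv r) v)) = sV (ip \<mu> \<mu>) v"
  proof -
    have "\<rho> (scale (1 / (2 * of_real \<tau>)) (tv r)) (\<rho> (tv r) v) = sV (\<mu> (tv r) * \<mu> (tv r) / (2 * of_real \<tau>)) v"
      if r: "r \<in> roots H" for r using wspD(2)[OF v tv(1)[OF r]] act_scale_left[OF tvG[OF r]] act_scale[OF tvG[OF r]] vV V_subspace
      by (simp add: M.subspace_scale)
    thus ?thesis unfolding ip_def sum_divide_distrib M.scale_sum_left by (intro sum.cong) auto
  qed
  also have "(\<Sum>r\<in>roots H. \<rho> (rv (- r)) (\<rho> (rv r) v)) =
     (\<Sum>r\<in>P. \<rho> (rv (- r)) (\<rho> (rv r) v)) + (\<Sum>r\<in>uminus ` P. \<rho> (rv (- r)) (\<rho> (rv r) v))"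
    using finP P(2) by (subst P(1), intro sum.union_disjoint) auto
  also have "(\<Sum>r\<in>uminus ` P. \<rho> (rv (- r)) (\<rho> (rv r) v)) = (\<Sum>r\<in>P. \<rho> (rv r) (\<rho> (rv (- r)) v))"
    by (subst sum.reindex) (auto simp: inj_on_def)
  also have "\<dots> = (\<Sum>r\<in>P. \<rho> (rv (- r)) (\<rho> (rv r) v)) + (\<Sum>r\<in>P. sV (\<mu> (tv r)) v)"
    unfolding sum.distrib[symmetric]
  proof (intro sum.cong refl)
    fix r assume "r \<in> P"
    hence r: "r \<in> roots H" by (rule PR)
    show "\<rho> (rv r) (\<rho> (rv (- r)) v) = \<rho> (rv (- r)) (\<rho> (rv r) v) + sV (\<mu> (tv r)) v"
      using act_br[OF rv_G[OF r] rv_G[OF neg_root[OF r]] vV] rv_br[OF r] wspD(2)[OF v tv(1)[OF r]] by (simp add: algebra_simps)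
  qed
  finally have eq: "casimir B \<rho> v = (\<Sum>r\<in>P. \<rho> (rv (- r)) (\<rho> (rv r) v)) +
      ((\<Sum>r\<in>P. \<rho> (rv (- r)) (\<rho> (rv r) v)) + (\<Sum>r\<in>P. sV (\<mu> (tv r)) v)) + sV (ip \<mu> \<mu>) v" .
  have two: "sV 2 x = x + x" for x using M.scale_left_distrib[of 1 1 x] by simp
  show ?thesis unfolding eq two M.scale_left_distrib M.scale_sum_left by (simp only: ac_simps)
qed

lemma casimir_lin: "M.lin_on V (casimir B \<rho>)" unfolding M.lin_on_def casimir_def using some_basis_G dual_vector(1) act_in
  by (auto simp: act_add act_scale sum.distrib M.scale_sum_right)

text \<open>The commutator is a double sum whose coefficients are
  \<open>B (br x e) e' + B (br x e') e\<close> with \<open>e'\<close> in the dual basis; they vanish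
  by invariance.\<close>

lemma casimir_commutes: assumes x: "x \<in> G" and v: "v \<in> V" shows "casimir B \<rho> (\<rho> x v) = \<rho> x (casimir B \<rho> v)"
proof -
  let ?d = "dual_vector B" and ?E = "some_basis"
  note eG = some_basis_G and dG = dual_vector(1)
  have brx: "br x y \<in> G" if "y \<in> G" for y using x that br_closed by blast
  have 1: "\<rho> (br x e) (\<rho> (?d e) v) = (\<Sum>e'\<in>?E. sV (B (br x e) (?d e')) (\<rho> e' (\<rho> (?d e) v)))"
    if e: "e \<in> ?E" for e
  proof -
    have "\<rho> (br x e) (\<rho> (?d e) v) = \<rho> (\<Sum>e'\<in>?E. scale (B (br x e) (?d e')) e') (\<rho> (?d e) v)"
      by (rule arg_cong[where f="\<lambda>y. \<rho> y _", OF basis_expansion(2)[OF brx[OF eG[OF e]]]])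
    thus ?thesis using act_in[OF dG[OF e] v] eG carrier_subspace by (simp add: act_sum_left subspace_scale act_scale_left)
  qed
  have 2: "\<rho> e (\<rho> (br x (?d e)) v) = (\<Sum>e'\<in>?E. sV (B (br x (?d e)) e') (\<rho> e (\<rho> (?d e') v)))"
    if e: "e \<in> ?E" for e
  proof -
    have "\<rho> (br x (?d e)) v = \<rho> (\<Sum>e'\<in>?E. scale (B (br x (?d e)) e') (?d e')) v"
      by (rule arg_cong[where f="\<lambda>y. \<rho> y _", OF basis_expansion(3)[OF brx[OF dG[OF e]]]])
    also have "\<dots> = (\<Sum>e'\<in>?E. sV (B (br x (?d e)) e') (\<rho> (?d e') v))"
      using v dG carrier_subspace by (simp add: act_sum_left subspace_scale act_scale_left)
    finally show ?thesis using v dG eG[OF e] act_in V_subspace by (simp add: act_sum M.subspace_scale act_scale)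
  qed
  have "\<rho> x (casimir B \<rho> v) - casimir B \<rho> (\<rho> x v) =
     (\<Sum>e\<in>?E. \<rho> x (\<rho> e (\<rho> (?d e) v)) - \<rho> e (\<rho> (?d e) (\<rho> x v)))"
    unfolding casimir_def using x v eG dG act_in by (simp add: act_sum sum_subtractf)
  also have "\<dots> = (\<Sum>e\<in>?E. \<rho> (br x e) (\<rho> (?d e) v) + \<rho> e (\<rho> (br x (?d e)) v))"
  proof (intro sum.cong refl)
    fix e assume e: "e \<in> ?E"
    note G = eG[OF e] dG[OF e]
    have "\<rho> (br x e) (\<rho> (?d e) v) = \<rho> x (\<rho> e (\<rho> (?d e) v)) - \<rho> e (\<rho> x (\<rho> (?d e) v))"
      using act_br[OF x G(1)] act_in G v by simp
    moreover have "\<rho> e (\<rho> (br x (?d e)) v) = \<rho> e (\<rho> x (\<rho> (?d e) v)) - \<rho> e (\<rho> (?d e) (\<rho> x v))"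
      using act_br[OF x G(2) v] act_in G x v by (simp add: act_diff)
    ultimately show "\<rho> x (\<rho> e (\<rho> (?d e) v)) - \<rho> e (\<rho> (?d e) (\<rho> x v)) =
      \<rho> (br x e) (\<rho> (?d e) v) + \<rho> e (\<rho> (br x (?d e)) v)" by simp
  qed
  also have "\<dots> = (\<Sum>e\<in>?E. \<Sum>e'\<in>?E. sV (B (br x e) (?d e')) (\<rho> e' (\<rho> (?d e) v))) +
      (\<Sum>e\<in>?E. \<Sum>e'\<in>?E. sV (B (br x (?d e)) e') (\<rho> e (\<rho> (?d e') v)))" using 1 2 by (simp add: sum.distrib)
  also have "(\<Sum>e\<in>?E. \<Sum>e'\<in>?E. sV (B (br x (?d e)) e') (\<rho> e (\<rho> (?d e') v))) =
     (\<Sum>e\<in>?E. \<Sum>e'\<in>?E. sV (B (br x (?d e')) e) (\<rho> e' (\<rho> (?d e) v)))" by (rule sum.swap)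
  also have "(\<Sum>e\<in>?E. \<Sum>e'\<in>?E. sV (B (br x e) (?d e')) (\<rho> e' (\<rho> (?d e) v))) + \<dots> =
     (\<Sum>e\<in>?E. \<Sum>e'\<in>?E. sV (B (br x e) (?d e') + B (br x (?d e')) e) (\<rho> e' (\<rho> (?d e) v)))"
    by (simp add: M.scale_left_distrib sum.distrib)
  also have "\<dots> = 0"
  proof (intro sum.neutral ballI)
    fix e e' assume e: "e \<in> ?E" "e' \<in> ?E"
    note G = eG[OF e(1)] dG[OF e(2)]
    have "B (br x (?d e')) e = B x (br (?d e') e)" by (rule B_inv[OF x G(2,1)])
    also have "br (?d e') e = - br e (?d e')" by (rule br_anti[OF G(2,1)])
    finally have "B (br x (?d e')) e = - B x (br e (?d e'))" using x br_closed[OF G] by (simp add: B_minus_right)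
    thus "sV (B (br x e) (?d e') + B (br x (?d e')) e) (\<rho> e' (\<rho> (?d e) v)) = 0" using B_inv[OF x G] by simp
  qed
  finally show ?thesis by simp
qed

end

section \<open>Bases of the root system\<close>

context form_alg
begin

lemma root_hv_int: "r \<in> roots H ==> s \<in> roots H ==> s (hv r) \<in> \<int>"
proof -
  interpret form_rep scale G br H B \<tau> scale G br ..
  assume "r \<in> roots H" "s \<in> roots H"
  thus ?thesis using weight_hv_integral by (simp add: roots_eq)
qed

text \<open>Roots are the nonzero weights of the adjoint module, whose multiplicities are invariant
  under reflections.\<close>

lemma refl_root: "r \<in> roots H ==> s \<in> roots H ==> refl r s \<in> roots H"
proof -
  interpret form_rep scale G br H B \<tau> scale G br ..
  assume rs: "r \<in> roots H" "s \<in> roots H"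
  have d: "refl r s \<in> dual H" using refl_dual rs rootsD by blast
  have "adj.wmult (refl r s) \<noteq> 0" using wmult_refl[OF rs(1) rootsD(1)[OF rs(2)]] root_wmult[OF rs(2)] by simp
  hence "adj.wsp (refl r s) \<noteq> {0}" unfolding adj.wsp_zero_dim .
  moreover have "refl r s \<noteq> 0"
  proof
    assume 0: "refl r s = 0"
    have "s = refl r (refl r s)" using refl_involution rs by simp
    also have "\<dots> = 0" unfolding 0 by (auto simp: refl_def fun_scale_def fun_eq_iff)
    finally show False using rootsD(2) rs by blast
  qed
  ultimately show ?thesis using d by (simp add: roots_def adj_wsp)
qed

text \<open>Put c = (r, r). Since \<open>s (tv r)\<close> is \<open>s (hv r)\<close> times c / 2,
  the definition of \<open>ip\<close> reads \<open>2 \<tau> c = c^2 N / 4\<close> with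
  \<open>N\<close> a sum of squares of integers, so c is a positive real.\<close>

lemma ip_root_pos: "r \<in> roots H ==> ip r r \<in> \<real> \<and> Re (ip r r) > 0"
proof -
  assume r: "r \<in> roots H"
  define N where "N = (\<Sum>s\<in>roots H. (s (hv r))\<^sup>2)"
  have "(s (hv r))\<^sup>2 \<in> \<real> \<and> Re ((s (hv r))\<^sup>2) \<ge> 0" if "s \<in> roots H" for s
    using root_hv_int[OF r that] by (auto elim!: Ints_cases)
  hence N: "N \<in> \<real>" "Re N \<ge> 0" unfolding N_def by (auto intro!: sum_nonneg sum_in_Reals)
  have "s (tv r) = s (hv r) * ip r r / 2" if s: "s \<in> roots H" for s
    using apply_hv_ip[OF r rootsD(1)[OF s]] ip_root_nonzero[OF r] ip_root[OF r rootsD(1)[OF s]] by simp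
  hence "r (tv s) = s (hv r) * ip r r / 2" if s: "s \<in> roots H" for s using tv_sym[OF r s] that by simp
  hence "(\<Sum>s\<in>roots H. r (tv s) * r (tv s)) = (\<Sum>s\<in>roots H. (s (hv r))\<^sup>2 * ((ip r r)\<^sup>2 / 4))"
    by (intro sum.cong refl) (simp only: power2_eq_square, simp add: algebra_simps)
  hence "ip r r * (2 * of_real \<tau>) = (ip r r)\<^sup>2 / 4 * N"
    using tau_pos unfolding N_def sum_distrib_right[symmetric] by (subst (1) ip_def) simp
  hence "8 * of_real \<tau> = ip r r * N" using ip_root_nonzero[OF r] by (simp add: power2_eq_square field_simps)
  hence *: "ip r r = of_real (8 * \<tau> / Re N)" "Re N \<noteq> 0" using N tau_pos by (auto elim!: Reals_cases simp: field_simps)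
  thus ?thesis using N(2) tau_pos by auto
qed

text \<open>The real form of the dual space of \<open>H\<close> on which \<open>ip\<close> is real
  and positive definite; all roots and all weights lie in it.\<close>

definition XR :: "('a => complex) set" where "XR = {\<mu> \<in> dual H. \<forall>r\<in>roots H. \<mu> (tv r) \<in> \<real>}"

lemma XR_dual: "\<mu> \<in> XR ==> \<mu> \<in> dual H" by (simp add: XR_def)

lemma XR_add: "\<mu> \<in> XR ==> \<nu> \<in> XR ==> \<mu> + \<nu> \<in> XR" by (auto simp: XR_def dual_add)

lemma XR_diff: "\<mu> \<in> XR ==> \<nu> \<in> XR ==> \<mu> - \<nu> \<in> XR" by (auto simp: XR_def dual_diff)

lemma XR_zero: "0 \<in> XR" by (auto simp: XR_def dual_zero)

lemma XR_scale: "\<mu> \<in> XR ==> c \<in> \<real> ==> fun_scale c \<mu> \<in> XR"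
  by (auto simp: XR_def dual_scale) (auto simp: fun_scale_def)

lemma XR_sum: "(\<And>i. i \<in> I ==> f i \<in> XR) ==> (\<Sum>i\<in>I. f i) \<in> XR"
  by (induction I rule: infinite_finite_induct) (use XR_zero XR_add in auto)

lemma XR_intI: assumes "\<mu> \<in> dual H" "\<And>r. r \<in> roots H ==> \<mu> (hv r) \<in> \<real>" shows "\<mu> \<in> XR"
proof -
  have "\<mu> (tv r) \<in> \<real>" if r: "r \<in> roots H" for r
  proof -
    have "\<mu> (tv r) = \<mu> (hv r) * ip r r / 2" using apply_hv_ip[OF r assms(1)] ip_root_nonzero[OF r] ip_root[OF r assms(1)] by simp
    thus ?thesis using assms(2)[OF r] ip_root_pos[OF r] by (simp only:) (intro Reals_divide Reals_mult; simp)
  qed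
  thus ?thesis using assms(1) by (simp add: XR_def)
qed

lemma XR_root: "s \<in> roots H ==> s \<in> XR"
proof (rule XR_intI)
  assume s: "s \<in> roots H"
  fix r assume r: "r \<in> roots H"
  obtain n where "s (hv r) = of_int n" using root_hv_int[OF r s] by (auto elim: Ints_cases)
  thus "s (hv r) \<in> \<real>" by simp
qed (rule rootsD)

lemma hv_sign: assumes r: "r \<in> roots H" and \<mu>: "\<mu> \<in> dual H"
  shows "Re (\<mu> (hv r)) > 0 \<longleftrightarrow> Re (ip \<mu> r) > 0" "Re (\<mu> (hv r)) < 0 \<longleftrightarrow> Re (ip \<mu> r) < 0"
proof -
  obtain c where c: "ip r r = of_real c" "c > 0" using ip_root_pos[OF r] by (auto elim!: Reals_cases)
  show "Re (\<mu> (hv r)) > 0 \<longleftrightarrow> Re (ip \<mu> r) > 0" "Re (\<mu> (hv r)) < 0 \<longleftrightarrow> Re (ip \<mu> r) < 0"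
    unfolding apply_hv_ip[OF r \<mu>] c(1) using c(2) by (simp_all add: zero_less_divide_iff divide_less_0_iff)
qed

lemma ip_real: "\<mu> \<in> XR ==> \<nu> \<in> XR ==> ip \<mu> \<nu> \<in> \<real>"
  unfolding ip_def XR_def by (auto intro!: sum_in_Reals Reals_divide Reals_mult)

lemma dual_zeroI: assumes \<mu>: "\<mu> \<in> dual H" and 0: "\<And>r. r \<in> roots H ==> \<mu> (tv r) = 0" shows "\<mu> = 0"
proof (rule ccontr)
  assume "\<mu> \<noteq> 0"
  then obtain h where h: "h \<in> H" "\<mu> h \<noteq> 0" using dual_neqD[OF \<mu> dual_zero] by auto
  have s: "(\<Sum>s\<in>roots H. scale (s h) (tv s)) \<in> H" using tv H_subspace by (auto intro!: subspace_scale subspace_sum)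
  have "\<mu> h = \<mu> (scale (1 / (2 * of_real \<tau>)) (\<Sum>s\<in>roots H. scale (s h) (tv s)))"
    by (rule arg_cong[OF H_expansion[OF h(1)]])
  also have "\<dots> = 1 / (2 * of_real \<tau>) * (\<Sum>s\<in>roots H. s h * \<mu> (tv s))"
    using \<mu> s tv H_subspace by (simp add: dual_H_linear dual_H_sum subspace_scale)
  also have "\<dots> = 0" using 0 by simp
  finally show False using h(2) by simp
qed

lemma ip_pos: assumes \<mu>: "\<mu> \<in> XR" shows "Re (ip \<mu> \<mu>) \<ge> 0" "Re (ip \<mu> \<mu>) = 0 ==> \<mu> = 0"
proof -
  define a where "a = (\<lambda>r. Re (\<mu> (tv r)))"
  have "\<mu> (tv r) = of_real (a r)" if "r \<in> roots H" for r using \<mu> that by (auto simp: XR_def a_def elim!: Reals_cases)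
  hence "(\<Sum>r\<in>roots H. \<mu> (tv r) * \<mu> (tv r)) = of_real (\<Sum>r\<in>roots H. (a r)\<^sup>2)" by (simp add: power2_eq_square)
  hence "ip \<mu> \<mu> = of_real ((\<Sum>r\<in>roots H. (a r)\<^sup>2) / (2 * \<tau>))" by (simp add: ip_def)
  hence eq: "Re (ip \<mu> \<mu>) = (\<Sum>r\<in>roots H. (a r)\<^sup>2) / (2 * \<tau>)" by (simp only: Re_complex_of_real)
  show "Re (ip \<mu> \<mu>) \<ge> 0" unfolding eq using tau_pos by (simp add: sum_nonneg)
  assume "Re (ip \<mu> \<mu>) = 0"
  hence "\<forall>r\<in>roots H. a r = 0" using tau_pos finite_roots by (simp add: eq sum_nonneg_eq_0_iff)
  thus "\<mu> = 0" using \<open>\<And>r. r \<in> roots H ==> \<mu> (tv r) = of_real (a r)\<close> \<mu> by (intro dual_zeroI) (auto simp: XR_def)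
qed

end

lemma fun_sum_apply: "(\<Sum>i\<in>I. f i) x = (\<Sum>i\<in>I. f i x)" for f :: "'i => 'b => complex"
  by (induction I rule: infinite_finite_induct) auto

context lie_algebra
begin

lemma nat_combination_add: assumes "nat_combination D x" "nat_combination D y" shows "nat_combination D (x + y)"
proof -
  obtain c e where "x = (\<Sum>d\<in>D. fun_scale (of_nat (c d)) d)" "y = (\<Sum>d\<in>D. fun_scale (of_nat (e d)) d)"
    using assms unfolding nat_combination_def by blast
  hence "x + y = (\<Sum>d\<in>D. fun_scale (of_nat (c d + e d)) d)"
    by (simp add: fun_eq_iff fun_sum_apply fun_scale_def sum.distrib algebra_simps)
  thus ?thesis unfolding nat_combination_def by (rule exI[of _ "\<lambda>d. c d + e d"])
qed

lemma nat_combination_member: assumes "finite D" "d \<in> D" shows "nat_combination D d"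
proof -
  have "d = (\<Sum>e\<in>D. fun_scale (of_nat (if e = d then 1 else 0)) e)"
  proof
    fix x
    have "(\<Sum>e\<in>D. fun_scale (of_nat (if e = d then 1 else 0)) e) x = (\<Sum>e\<in>D. if e = d then e x else 0)"
      unfolding fun_sum_apply fun_scale_def by (intro sum.cong) auto
    thus "d x = (\<Sum>e\<in>D. fun_scale (of_nat (if e = d then 1 else 0)) e) x" using assms by simp
  qed
  thus ?thesis unfolding nat_combination_def by (rule exI[of _ "\<lambda>e. if e = d then 1 else 0"])
qed

end

locale based_alg = form_alg + fixes \<Delta> assumes base: "root_base H \<Delta>"
begin

abbreviation "Pos \<equiv> positive_roots H \<Delta>"
abbreviation "natc \<equiv> nat_combination \<Delta>"

lemma Delta_root: "d \<in> \<Delta> ==> d \<in> roots H" and Delta_finite: "finite \<Delta>"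
  and Delta_indep: "fun_space.independent \<Delta>" and root_natc: "r \<in> roots H ==> natc r \<or> natc (- r)"
  using base unfolding root_base_def by blast+

lemma Pos_root: "r \<in> Pos ==> r \<in> roots H" by (simp add: positive_roots_def)

lemmas natc_add = nat_combination_add[of \<Delta>]

lemma natc_zero: "natc 0"
  unfolding nat_combination_def by (rule exI[of _ "\<lambda>_. 0"]) (simp add: fun_eq_iff fun_sum_apply fun_scale_def)

lemmas natc_Delta = nat_combination_member[OF Delta_finite]

lemma coeff_unique: assumes "(\<Sum>d\<in>\<Delta>. fun_scale (a d) d) = (\<Sum>d\<in>\<Delta>. fun_scale (b d) d)" "d \<in> \<Delta>"
  shows "a d = b d"
proof -
  have "(\<Sum>d\<in>\<Delta>. fun_scale (a d - b d) d) = 0"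
    using assms(1) by (simp add: fun_eq_iff fun_sum_apply fun_scale_def algebra_simps sum_subtractf)
  hence "a d - b d = 0" using fun_space.independentD[OF Delta_indep Delta_finite order_refl, of "\<lambda>d. a d - b d" d] assms(2) by blast
  thus ?thesis by simp
qed

lemma natc_antisym: "natc x ==> natc (- x) ==> x = 0"
proof -
  assume "natc x" "natc (- x)"
  then obtain c e where ce: "x = (\<Sum>d\<in>\<Delta>. fun_scale (of_nat (c d)) d)" "- x = (\<Sum>d\<in>\<Delta>. fun_scale (of_nat (e d)) d)"
    unfolding nat_combination_def by blast
  have "(\<Sum>d\<in>\<Delta>. fun_scale (of_nat (c d)) d) = (\<Sum>d\<in>\<Delta>. fun_scale (- of_nat (e d)) d)"
    unfolding ce(1)[symmetric] using ce(2) by (simp add: fun_eq_iff fun_sum_apply fun_scale_def sum_negf eq_neg_iff_add_eq_0 neg_eq_iff_add_eq_0)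
  hence "of_nat (c d) = - (of_nat (e d) :: complex)" if "d \<in> \<Delta>" for d
    using coeff_unique[of "\<lambda>d. of_nat (c d)" "\<lambda>d. - of_nat (e d)" d] that by simp
  hence "of_nat (c d + e d) = (0 :: complex)" if "d \<in> \<Delta>" for d using that by simp
  hence "c d = 0" if "d \<in> \<Delta>" for d using that of_nat_eq_0_iff by (metis add_is_0)
  thus "x = 0" unfolding ce(1) by (simp add: fun_eq_iff fun_sum_apply fun_scale_def)
qed

lemma roots_Pos: "roots H = Pos \<union> uminus ` Pos" "Pos \<inter> uminus ` Pos = {}"
proof -
  show "roots H = Pos \<union> uminus ` Pos"
  proof (intro equalityI subsetI)
    fix r assume r: "r \<in> roots H"
    show "r \<in> Pos \<union> uminus ` Pos"
    proof (cases "natc r")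
      case False
      hence "- r \<in> Pos" using r root_natc neg_root by (auto simp: positive_roots_def)
      moreover have "r = - (- r)" by simp
      ultimately show ?thesis by blast
    qed (use r in \<open>auto simp: positive_roots_def\<close>)
  next
    fix r assume "r \<in> Pos \<union> uminus ` Pos"
    thus "r \<in> roots H" using neg_root Pos_root by auto
  qed
  show "Pos \<inter> uminus ` Pos = {}"
  proof (rule ccontr)
    assume "Pos \<inter> uminus ` Pos \<noteq> {}"
    then obtain r s where "r \<in> Pos" "s \<in> Pos" "r = - s" by blast
    hence "natc s" "natc (- s)" "s \<noteq> 0" using rootsD(2) by (auto simp: positive_roots_def)
    thus False using natc_antisym by blast
  qed
qed

lemma finite_Pos: "finite Pos" using finite_roots by (auto simp: positive_roots_def)

lemma Delta_Pos: "d \<in> \<Delta> ==> d \<in> Pos" using Delta_root natc_Delta by (simp add: positive_roots_def)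

text \<open>Since no proper multiple of \<open>d\<close> is a root, \<open>r\<close> has a positive
  coefficient at another simple root. The reflection does not change that coefficient, so the image
  cannot be negative.\<close>

lemma refl_Pos: assumes d: "d \<in> \<Delta>" and r: "r \<in> Pos" "r \<noteq> d" shows "refl d r \<in> Pos" "refl d r \<noteq> d"
proof -
  note dR = Delta_root[OF d] and rR = Pos_root[OF r(1)]
  obtain c where c: "r = (\<Sum>e\<in>\<Delta>. fun_scale (of_nat (c e)) e)"
    using r(1) unfolding positive_roots_def nat_combination_def by auto
  obtain n where n: "r (hv d) = of_int n" using root_hv_int[OF dR rR] by (auto elim: Ints_cases)
  have R: "refl d r \<in> roots H" using refl_root dR rR by blast
  have "\<exists>e\<in>\<Delta>. e \<noteq> d \<and> c e \<noteq> 0"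
  proof (rule ccontr)
    assume no: "\<not> ?thesis"
    have "r = fun_scale (of_nat (c d)) d"
    proof
      fix x
      have "r x = (\<Sum>e\<in>\<Delta>. of_nat (c e) * e x)" unfolding c by (simp add: fun_sum_apply fun_scale_def)
      also have "\<dots> = (\<Sum>e\<in>\<Delta>. if e = d then of_nat (c e) * e x else 0)" using no by (intro sum.cong) auto
      also have "\<dots> = of_nat (c d) * d x" using d Delta_finite by simp
      finally show "r x = fun_scale (of_nat (c d)) d x" by (simp add: fun_scale_def)
    qed
    moreover have "c d \<noteq> 0" using calculation rootsD(2)[OF rR] by (auto simp: fun_scale_def fun_eq_iff)
    moreover have "c d \<noteq> 1" using calculation r(2) by (auto simp: fun_scale_def fun_eq_iff)
    ultimately show False using nat_multiple_not_root[OF dR, of "c d"] rR by (cases "c d \<ge> 2") auto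
  qed
  then obtain e where e: "e \<in> \<Delta>" "e \<noteq> d" "c e \<noteq> 0" by blast
  have rf: "refl d r = (\<Sum>e\<in>\<Delta>. fun_scale (of_nat (c e) - (if e = d then of_int n else 0)) e)"
  proof
    fix x
    have "(\<Sum>e\<in>\<Delta>. (if e = d then of_int n else 0) * e x) = (\<Sum>e\<in>\<Delta>. if e = d then of_int n * e x else 0)"
      by (intro sum.cong) auto
    also have "\<dots> = of_int n * d x" using d Delta_finite by simp
    finally show "refl d r x = (\<Sum>e\<in>\<Delta>. fun_scale (of_nat (c e) - (if e = d then of_int n else 0)) e) x"
      unfolding refl_def n by (simp add: fun_sum_apply fun_scale_def left_diff_distrib sum_subtractf c)
  qed
  have "\<not> natc (- refl d r)"
  proof
    assume "natc (- refl d r)"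
    then obtain b where "- refl d r = (\<Sum>e\<in>\<Delta>. fun_scale (of_nat (b e)) e)" unfolding nat_combination_def by blast
    hence "refl d r = (\<Sum>e\<in>\<Delta>. fun_scale (- of_nat (b e)) e)"
      by (simp add: fun_eq_iff fun_sum_apply fun_scale_def sum_negf) (metis neg_eq_iff_add_eq_0 add.commute eq_neg_iff_add_eq_0)
    with rf have "(\<Sum>e\<in>\<Delta>. fun_scale (of_nat (c e) - (if e = d then of_int n else 0)) e) =
        (\<Sum>e\<in>\<Delta>. fun_scale (- of_nat (b e)) e)" by (rule trans[OF sym])
    from coeff_unique[of "\<lambda>e. of_nat (c e) - (if e = d then of_int n else 0)" "\<lambda>e. - of_nat (b e)", OF this e(1)]
    have "of_nat (c e) - (if e = d then of_int n else 0) = - (of_nat (b e) :: complex)" .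
    hence "of_nat (c e + b e) = (0 :: complex)" using e(2) by simp
    thus False using e(3) by (metis add_is_0 of_nat_eq_0_iff)
  qed
  thus "refl d r \<in> Pos" using R root_natc by (auto simp: positive_roots_def)
  show "refl d r \<noteq> d"
  proof
    assume "refl d r = d"
    hence "r = - d" using refl_involution[OF dR, of r] refl_self[OF dR] by simp
    hence "- d \<in> Pos" using r by simp
    moreover have "- d \<in> uminus ` Pos" using Delta_Pos[OF d] by (rule imageI)
    ultimately show False using roots_Pos(2) by blast
  qed
qed

lemma refl_Pos_bij: "d \<in> \<Delta> ==> bij_betw (refl d) (Pos - {d}) (Pos - {d})" by (rule bij_betw_byWitness[of _ "refl d"])
    (use refl_Pos refl_involution Delta_root in auto)

definition wrho :: "'a => complex" where "wrho = fun_scale (1 / 2) (\<Sum>r\<in>Pos. r)"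

lemma wrho_XR: "wrho \<in> XR" unfolding wrho_def by (intro XR_scale XR_sum XR_root Pos_root) auto

lemma two_wrho: "(\<Sum>r\<in>Pos. r) = fun_scale 2 wrho" by (auto simp: wrho_def fun_scale_def fun_eq_iff)

text \<open>The reflection permutes the positive roots other than \<open>d\<close> and negates
  \<open>d\<close>.\<close>

lemma refl_wrho: "d \<in> \<Delta> ==> refl d wrho = wrho - d"
proof -
  assume d: "d \<in> \<Delta>"
  have s: "(\<Sum>r\<in>Pos. r) = d + (\<Sum>r\<in>Pos - {d}. r)" using sum.remove[OF finite_Pos Delta_Pos[OF d], of "\<lambda>r. r"] .
  have "refl d (\<Sum>r\<in>Pos - {d}. r) = (\<Sum>r\<in>Pos - {d}. refl d r)" by (rule refl_sum)
  also have "\<dots> = (\<Sum>r\<in>Pos - {d}. r)" by (rule sum.reindex_bij_betw[OF refl_Pos_bij[OF d]])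
  finally have "refl d (\<Sum>r\<in>Pos. r) = - d + (\<Sum>r\<in>Pos - {d}. r)"
    unfolding s refl_add using refl_self[OF Delta_root[OF d]] by simp
  hence "refl d wrho = fun_scale (1 / 2) (- d + (\<Sum>r\<in>Pos - {d}. r))" unfolding wrho_def refl_scale by simp
  also have "\<dots> = wrho - d" unfolding wrho_def s by (auto simp: fun_eq_iff fun_scale_def field_simps)
  finally show ?thesis .
qed

lemma wrho_hv: "d \<in> \<Delta> ==> wrho (hv d) = 1"
proof -
  assume d: "d \<in> \<Delta>"
  obtain h where h: "d h \<noteq> 0" using rootsD(2)[OF Delta_root[OF d]] by (auto simp: fun_eq_iff)
  have "(wrho - fun_scale (wrho (hv d)) d) h = (wrho - d) h" using refl_wrho[OF d] by (simp add: refl_def)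
  thus ?thesis using h by (simp add: fun_scale_def)
qed

lemma ip_wrho_Delta: "d \<in> \<Delta> ==> ip wrho d = ip d d / 2"
  using wrho_hv[of d] apply_hv_ip[OF Delta_root XR_dual[OF wrho_XR], of d] ip_root_nonzero[OF Delta_root, of d] by (simp add: field_simps)

lemma wrho_Delta_pos: "d \<in> \<Delta> ==> Re (ip d wrho) > 0"
  using ip_root_pos[OF Delta_root, of d] unfolding ip_sym[of d wrho] by (simp only: ip_wrho_Delta) simp

text \<open>Pairing with \<open>wrho\<close> serves as the height function in the maximality and
  induction arguments below.\<close>

lemma wrho_pos_natc: assumes "natc x" shows "Re (ip x wrho) \<ge> 0" "x \<noteq> 0 ==> Re (ip x wrho) > 0"
proof -
  obtain c where c: "x = (\<Sum>d\<in>\<Delta>. fun_scale (of_nat (c d)) d)" using assms unfolding nat_combination_def by blast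
  have pos: "Re (ip d wrho) > 0" if "d \<in> \<Delta>" for d using wrho_Delta_pos[OF that] .
  have eq: "Re (ip x wrho) = (\<Sum>d\<in>\<Delta>. of_nat (c d) * Re (ip d wrho))" unfolding c by (simp add: ip_sum_left ip_scale_left)
  thus "Re (ip x wrho) \<ge> 0" using pos by (auto intro!: sum_nonneg mult_nonneg_nonneg simp: less_imp_le)
  assume "x \<noteq> 0"
  moreover have "x = 0" if "\<And>d. d \<in> \<Delta> ==> c d = 0"
    unfolding c using that by (simp add: fun_eq_iff fun_sum_apply fun_scale_def)
  ultimately obtain d where d: "d \<in> \<Delta>" "c d \<noteq> 0" by blast
  show "Re (ip x wrho) > 0" unfolding eq by (rule sum_pos2[OF Delta_finite d(1)]) (use pos d in \<open>auto simp: less_imp_le\<close>)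
qed

lemma natc_XR: "natc x ==> x \<in> XR"
proof -
  assume "natc x"
  then obtain c where c: "x = (\<Sum>d\<in>\<Delta>. fun_scale (of_nat (c d)) d)" unfolding nat_combination_def by blast
  show ?thesis unfolding c by (rule XR_sum, rule XR_scale, rule XR_root, erule Delta_root) simp
qed

definition dominant :: "('a => complex) => bool" where
  "dominant \<mu> \<longleftrightarrow> \<mu> \<in> XR \<and> (\<forall>d\<in>\<Delta>. Re (ip \<mu> d) \<ge> 0)"

text \<open>The Casimir eigenvalue at a highest weight vector of weight \<open>\<mu>\<close>, see
  \<open>casimir_highest\<close>.\<close>

definition cas :: "('a => complex) => complex" where "cas \<mu> = ip \<mu> \<mu> + 2 * ip \<mu> wrho"

text \<open>The difference of the two values is (l - m, l + m + 2 rho). Here l - m is a natural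
  combination of simple roots, each of which has a positive product with the dominant second
  argument.\<close>

lemma cas_compare: assumes l: "dominant l" and m: "dominant m" and lm: "natc (l - m)"
  shows "Re (cas m) \<le> Re (cas l)" "cas m = cas l ==> m = l"
proof -
  obtain c where c: "l - m = (\<Sum>d\<in>\<Delta>. fun_scale (of_nat (c d)) d)" using lm unfolding nat_combination_def by blast
  define p where "p = (\<lambda>d. Re (ip d (l + m + fun_scale 2 wrho)))"
  have pos: "p d > 0" if d: "d \<in> \<Delta>" for d
  proof -
    have "Re (ip d l) \<ge> 0" "Re (ip d m) \<ge> 0" using l m d by (auto simp: dominant_def ip_sym[of d l] ip_sym[of d m])
    moreover have "Re (ip d wrho) > 0" using wrho_Delta_pos[OF d] .
    ultimately show ?thesis by (simp add: p_def ip_add_right ip_scale_right)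
  qed
  have "ip (l - m) (l + m + fun_scale 2 wrho) = cas l - cas m"
    by (simp add: cas_def ip_diff_left ip_add_right ip_scale_right ip_sym[of m l] algebra_simps)
  hence "cas l - cas m = (\<Sum>d\<in>\<Delta>. of_nat (c d) * ip d (l + m + fun_scale 2 wrho))"
    unfolding c ip_sum_left ip_scale_left by (rule sym)
  hence "Re (cas l - cas m) = (\<Sum>d\<in>\<Delta>. of_nat (c d) * p d)" unfolding p_def by simp
  hence eq: "Re (cas l) - Re (cas m) = (\<Sum>d\<in>\<Delta>. of_nat (c d) * p d)" by simp
  have "0 \<le> (\<Sum>d\<in>\<Delta>. of_nat (c d) * p d)" using pos by (auto intro!: sum_nonneg mult_nonneg_nonneg simp: less_imp_le)
  thus "Re (cas m) \<le> Re (cas l)" using eq by simp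
  assume "cas m = cas l"
  hence "(\<Sum>d\<in>\<Delta>. of_nat (c d) * p d) = 0" using eq by simp
  hence "\<forall>d\<in>\<Delta>. of_nat (c d) * p d = 0"
    using pos Delta_finite by (subst (asm) sum_nonneg_eq_0_iff) (auto simp: less_imp_le)
  hence "c d = 0" if "d \<in> \<Delta>" for d using pos[OF that] that by auto
  hence "l - m = 0" unfolding c by (simp add: fun_eq_iff fun_sum_apply fun_scale_def)
  thus "m = l" by simp
qed

end

section \<open>Highest weight modules\<close>

locale based_rep = based_alg scale G br H B \<tau> \<Delta> + form_rep scale G br H B \<tau> sV V \<rho>
  for scale :: "complex => 'a::ab_group_add => 'a" and G and br and H and B and \<tau> and \<Delta>
    and sV :: "complex => 'v::ab_group_add => 'v" and V and \<rho>
begin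

abbreviation "submod \<equiv> submodule sV V \<rho>"

lemma submodD: "submod W ==> M.subspace W" "submod W ==> W \<subseteq> V" "submod W ==> x \<in> G ==> w \<in> W ==> \<rho> x w \<in> W"
  by (auto simp: submodule_def)

lemma submod_zero: "submod {0}" unfolding submodule_def using act_zero M.subspace_0[OF V_subspace] by auto

lemma submod_all: "submod V" unfolding submodule_def using V_subspace act_in by auto

lemma weight_XR: "\<mu> \<in> weights ==> \<mu> \<in> XR"
proof (rule XR_intI)
  assume m: "\<mu> \<in> weights"
  thus "\<mu> \<in> dual H" by (simp add: weights_def)
  fix r assume r: "r \<in> roots H"
  obtain n where "\<mu> (hv r) = of_int n" using weight_hv_integral[OF r m] by (auto elim: Ints_cases)
  thus "\<mu> (hv r) \<in> \<real>" by simp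
qed

lemma submod_weight_component: assumes W: "submod W" and U: "submod U" and w: "weighted" "w \<in> W" "w \<notin> U"
  shows "\<exists>\<mu>\<in>dual H. \<exists>v\<in>wsp \<mu>. v \<in> W \<and> v \<notin> U"
proof -
  have wV: "w \<in> V" using submodD(2)[OF W] w(2) by blast
  obtain S y where S0: "finite S \<and> S \<subseteq> dual H \<and> (\<forall>\<mu>\<in>S. y \<mu> \<in> wsp \<mu>) \<and> w = (\<Sum>\<mu>\<in>S. y \<mu>)"
    using weighted_decomp[OF w(1) wV] by metis
  hence S: "finite S" "S \<subseteq> dual H" "\<And>\<mu>. \<mu> \<in> S ==> y \<mu> \<in> wsp \<mu>" "w = (\<Sum>\<mu>\<in>S. y \<mu>)"
    by auto
  have yW: "y \<mu> \<in> W" if "\<mu> \<in> S" for \<mu>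
    by (rule wsp_components[OF submodD(1,2)[OF W] submodD(3)[OF W H_G] S(1,2,3)]) (use w(2) S(4) that in auto)
  have "\<exists>\<mu>\<in>S. y \<mu> \<notin> U"
  proof (rule ccontr)
    assume "\<not> ?thesis"
    hence "w \<in> U" unfolding S(4) by (intro M.subspace_sum[OF submodD(1)[OF U]]) blast
    thus False using w(3) by blast
  qed
  thus ?thesis using S(2,3) yW by blast
qed

text \<open>Represents a highest weight vector of \<open>W / U\<close>.\<close>

lemma relative_highest_weight_vector: assumes W: "submod W" and U: "submod U" and w: "weighted" "w \<in> W" "w \<notin> U"
  obtains \<mu> v where "\<mu> \<in> weights" "v \<in> wsp \<mu>" "v \<in> W" "v \<notin> U"
    "\<And>r x. r \<in> Pos ==> x \<in> root_space H r ==> \<rho> x v \<in> U"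
proof -
  define A where "A = {\<mu> \<in> weights. \<exists>v\<in>wsp \<mu>. v \<in> W \<and> v \<notin> U}"
  have U0: "0 \<in> U" using M.subspace_0[OF submodD(1)[OF U]] .
  have inA: "\<mu> \<in> A" if "\<mu> \<in> dual H" "v \<in> wsp \<mu>" "v \<in> W" "v \<notin> U" for \<mu> v
  proof -
    have "v \<noteq> 0" using U0 that(4) by blast
    hence "wsp \<mu> \<noteq> {0}" using that(2) by blast
    thus ?thesis using that by (auto simp: A_def weights_def)
  qed
  have finA: "finite A" using finite_weights by (auto simp: A_def)
  have neA: "A \<noteq> {}" using submod_weight_component[OF assms] inA by blast
  \<comment> \<open>A positive root vector raises this height, so at a weight of maximal height in
    \<open>A\<close> it must send \<open>v\<close> into \<open>U\<close>.\<close>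
  define f where "f = (\<lambda>\<mu>. Re (ip \<mu> wrho))"
  have "Max (f ` A) \<in> f ` A" using finA neA by (intro Max_in) auto
  then obtain \<mu> where \<mu>: "\<mu> \<in> A" "f \<mu> = Max (f ` A)" by auto
  have max: "f \<nu> \<le> f \<mu>" if "\<nu> \<in> A" for \<nu> unfolding \<mu>(2) using finA that by (intro Max_ge) auto
  obtain v where v: "\<mu> \<in> weights" "v \<in> wsp \<mu>" "v \<in> W" "v \<notin> U" using \<mu>(1) by (auto simp: A_def)
  have "\<rho> x v \<in> U" if r: "r \<in> Pos" and x: "x \<in> root_space H r" for r x
  proof (rule ccontr)
    assume no: "\<rho> x v \<notin> U"
    have "\<mu> + r \<in> A"
    proof (rule inA[OF _ wsp_shift[OF x v(2)] _ no])
      show "\<mu> + r \<in> dual H" using v(1) rootsD(1)[OF Pos_root[OF r]] by (simp add: weights_def dual_add)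
      show "\<rho> x v \<in> W" using submodD(3)[OF W root_space_G[OF x] v(3)] .
    qed
    hence "f (\<mu> + r) \<le> f \<mu>" by (rule max)
    moreover have "Re (ip r wrho) > 0" using r wrho_pos_natc(2)[of r] rootsD(2)[OF Pos_root[OF r]] by (auto simp: positive_roots_def)
    ultimately show False by (simp add: f_def ip_add_left)
  qed
  thus ?thesis using that v by blast
qed

lemma relative_hw_dominant: assumes U: "submod U" and v: "\<mu> \<in> weights" "v \<in> wsp \<mu>" "v \<notin> U"
    "\<And>r x. r \<in> Pos ==> x \<in> root_space H r ==> \<rho> x v \<in> U"
  shows "r \<in> Pos ==> \<exists>n::nat. \<mu> (hv r) = of_nat n" "dominant \<mu>"
proof -
  have *: "\<exists>n::nat. \<mu> (hv r) = of_nat n" if r: "r \<in> Pos" for r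
  proof -
    obtain e f where ef: "e \<in> root_space H r" "sl2_triple e f (hv r)" using root_sl2_exists[OF Pos_root[OF r]] by blast
    have G: "e \<in> G" "f \<in> G" using ef(2) by (auto simp: sl2_triple_def)
    show ?thesis by (rule highest_weight_dominant[OF ef(2) submodD(1,2)[OF U] submodD(3)[OF U G(1)] submodD(3)[OF U G(2)]
            wspD(1)[OF v(2)] v(3) wspD(2)[OF v(2) hv_H[OF Pos_root[OF r]]] v(4)[OF r ef(1)]])
  qed
  thus "r \<in> Pos ==> \<exists>n::nat. \<mu> (hv r) = of_nat n" .
  show "dominant \<mu>" unfolding dominant_def
  proof (intro conjI ballI)
    show X: "\<mu> \<in> XR" using weight_XR v(1) by blast
    fix d assume d: "d \<in> \<Delta>"
    obtain n :: nat where n: "\<mu> (hv d) = of_nat n" using *[OF Delta_Pos[OF d]] by blast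
    note dR = Delta_root[OF d]
    show "Re (ip \<mu> d) \<ge> 0" using hv_sign(2)[OF dR XR_dual[OF X]] n by (simp add: not_less[symmetric])
  qed
qed

lemma casimir_highest: assumes U: "submod U" and v: "\<mu> \<in> weights" "v \<in> wsp \<mu>"
    "\<And>r x. r \<in> Pos ==> x \<in> root_space H r ==> \<rho> x v \<in> U" shows "casimir B \<rho> v - sV (cas \<mu>) v \<in> U"
proof -
  have \<mu>: "\<mu> \<in> dual H" using v(1) by (simp add: weights_def)
  have "(\<Sum>r\<in>Pos. \<mu> (tv r)) = ip \<mu> (\<Sum>r\<in>Pos. r)" unfolding ip_sum_right using ip_root[OF Pos_root \<mu>] by simp
  also have "\<dots> = 2 * ip \<mu> wrho" unfolding two_wrho ip_scale_right ..
  finally have "casimir B \<rho> v = sV (cas \<mu>) v + sV 2 (\<Sum>r\<in>Pos. \<rho> (rv (- r)) (\<rho> (rv r) v))"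
    using casimir_weight[OF roots_Pos v(2) \<mu>] by (simp add: cas_def)
  hence "casimir B \<rho> v - sV (cas \<mu>) v = sV 2 (\<Sum>r\<in>Pos. \<rho> (rv (- r)) (\<rho> (rv r) v))" by simp
  also have "\<dots> \<in> U" using submodD(3)[OF U rv_G[OF neg_root[OF Pos_root]] v(3)[OF _ rv(1)[OF Pos_root]]]
    by (intro M.subspace_scale[OF submodD(1)[OF U]] M.subspace_sum[OF submodD(1)[OF U]]) blast
  finally show ?thesis .
qed

lemma relative_hw_cas: assumes U: "submod U" and v: "\<mu> \<in> weights" "v \<in> wsp \<mu>" "v \<notin> U"
    "\<And>r x. r \<in> Pos ==> x \<in> root_space H r ==> \<rho> x v \<in> U" and c: "casimir B \<rho> v = sV c v" shows "c = cas \<mu>"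
proof (rule ccontr)
  assume "c \<noteq> cas \<mu>"
  moreover have "sV (c - cas \<mu>) v \<in> U" using casimir_highest[OF U v(1,2,4)] unfolding c by (simp add: M.scale_left_diff_distrib)
  ultimately show False using M.subspace_scale_cancel[OF submodD(1)[OF U]] v(3) by simp
qed

text \<open>Whenever a submodule \<open>W\<close> is not contained in a submodule \<open>U\<close>,
  a highest weight vector modulo \<open>U\<close> exists in \<open>W\<close>; its Casimir eigenvalue
  forces the weight \<open>l\<close>, whose space is a line. So \<open>W\<close> contains
  \<open>v0\<close> and \<open>U\<close> does not. For a proper nonzero submodule, comparing it with
  \<open>{0}\<close> and with \<open>V\<close> gives a contradiction.\<close>

lemma irreducible_by_casimir: assumes w: weighted and le: "\<And>\<mu>. \<mu> \<in> weights ==> natc (l - \<mu>)" and l: "dominant l"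
    and c: "\<And>v. v \<in> V ==> casimir B \<rho> v = sV (cas l) v"
    and v0: "v0 \<in> wsp l" "v0 \<noteq> 0" "\<And>v. v \<in> wsp l ==> \<exists>a. v = sV a v0" shows "irreducible_module sV V \<rho>"
proof -
  have key: "v0 \<in> W \<and> (\<exists>a. sV a v0 \<notin> U)" if W: "submod W" and U: "submod U" and x: "x \<in> W" "x \<notin> U" for W U x
  proof -
    obtain \<mu> v where v: "\<mu> \<in> weights" "v \<in> wsp \<mu>" "v \<in> W" "v \<notin> U"
      "\<And>r x. r \<in> Pos ==> x \<in> root_space H r ==> \<rho> x v \<in> U" using relative_highest_weight_vector[OF W U w x] by metis
    have "cas l = cas \<mu>"
    proof (rule relative_hw_cas[OF U v(1,2,4)])
      show "\<rho> x v \<in> U" if "r \<in> Pos" "x \<in> root_space H r" for r x using v(5) that .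
      show "casimir B \<rho> v = sV (cas l) v" using c submodD(2)[OF W] v(3) by blast
    qed
    moreover have "dominant \<mu>" by (rule relative_hw_dominant(2)[OF U v(1,2,4)], rule v(5))
    ultimately have "\<mu> = l" using cas_compare(2)[OF l _ le[OF v(1)]] by simp
    then obtain a where a: "v = sV a v0" using v0(3) v(2) by blast
    have "a \<noteq> 0" using a v(4) M.subspace_0[OF submodD(1)[OF U]] by auto
    hence "v0 \<in> W" using M.subspace_scale_cancel[OF submodD(1)[OF W], of a v0] a v(3) by simp
    thus ?thesis using a v(4) by blast
  qed
  have "W = {0} \<or> W = V" if W: "submod W" for W
  proof (rule ccontr)
    assume no: "\<not> ?thesis"
    then obtain x where "x \<in> W" "x \<notin> {0}" using M.subspace_0[OF submodD(1)[OF W]] by blast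
    hence v0W: "v0 \<in> W" using key[OF W submod_zero] by blast
    obtain y where "y \<in> V" "y \<notin> W" using no submodD(2)[OF W] by blast
    then obtain a where "sV a v0 \<notin> W" using key[OF submod_all W] by blast
    thus False using v0W M.subspace_scale[OF submodD(1)[OF W]] by blast
  qed
  moreover have "V \<noteq> {0}" using v0 wspD(1) by blast
  ultimately show ?thesis unfolding irreducible_module_def using module by blast
qed

lemma weights_subset: assumes "V \<subseteq> M.span (\<Union>\<mu>\<in>I. wsp \<mu>)" "I \<subseteq> dual H"
  shows "weights \<subseteq> I" weighted
proof -
  show weighted unfolding weighted_def
    using assms M.span_mono[of "\<Union>\<mu>\<in>I. wsp \<mu>" "\<Union>\<mu>\<in>dual H. wsp \<mu>"] by blast
  show "weights \<subseteq> I"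
  proof
    fix \<mu> assume m: "\<mu> \<in> weights"
    hence md: "\<mu> \<in> dual H" by (simp add: weights_def)
    obtain v where v: "v \<in> wsp \<mu>" "v \<noteq> 0" using m M.subspace_0[OF wsp_subspace, of \<mu>] by (auto simp: weights_def)
    have "v \<in> M.span (\<Union>\<mu>\<in>I. wsp \<mu>)" using assms(1) wspD(1)[OF v(1)] by blast
    then obtain S y where S: "finite S" "S \<subseteq> I" "\<And>i. i \<in> S ==> y i \<in> wsp i" "v = (\<Sum>i\<in>S. y i)"
      using M.span_Union_decomp[of I wsp v, OF wsp_subspace] by blast
    show "\<mu> \<in> I"
    proof (rule ccontr)
      assume "\<mu> \<notin> I"
      hence nS: "\<mu> \<notin> S" using S(2) by blast
      define z where "z = (\<lambda>i. if i = \<mu> then - v else y i)"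
      have "(\<Sum>i\<in>insert \<mu> S. z i) = - v + (\<Sum>i\<in>S. y i)"
        unfolding sum.insert[OF S(1) nS] using nS by (auto simp: z_def intro!: sum.cong)
      hence "(\<Sum>i\<in>insert \<mu> S. z i) = 0" using S(4) by simp
      moreover have "z i \<in> wsp i" if "i \<in> insert \<mu> S" for i
        using that S(3) v(1) M.subspace_neg[OF wsp_subspace] by (auto simp: z_def)
      ultimately have "z \<mu> = 0" using wsp_sum_zero[of "insert \<mu> S" z \<mu>] S(1,2) assms(2) md by blast
      thus False using v(2) by (simp add: z_def)
    qed
  qed
qed

text \<open>By uniqueness of weight components, a spanning family of subspaces of the weight spaces
  already exhausts each of them. Applied with a line at the highest weight, it shows that this
  weight has multiplicity one.\<close>

lemma wsp_component: assumes V: "V \<subseteq> M.span (\<Union>\<mu>\<in>I. E \<mu>)" and I: "I \<subseteq> dual H" "l \<in> I"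
    and E: "\<And>\<mu>. M.subspace (E \<mu>)" "\<And>\<mu>. E \<mu> \<subseteq> wsp \<mu>" and u: "u \<in> wsp l" shows "u \<in> E l"
proof -
  have "u \<in> M.span (\<Union>\<mu>\<in>I. E \<mu>)" using u wspD(1) V by blast
  then obtain S y where S: "finite S" "S \<subseteq> I" "\<And>i. i \<in> S ==> y i \<in> E i" "u = (\<Sum>i\<in>S. y i)"
    using M.span_Union_decomp[of I E u, OF E(1)] by blast
  define y' where "y' = (\<lambda>i. if i \<in> S then y i else 0)"
  define z where "z = (\<lambda>i. y' i - (if i = l then u else 0))"
  have "(\<Sum>i\<in>insert l S. y' i) = (\<Sum>i\<in>S. y i)" using S(1) by (intro sum.mono_neutral_cong_right) (auto simp: y'_def)
  hence "(\<Sum>i\<in>insert l S. z i) = 0" unfolding z_def sum_subtractf using S(1,4) by simp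
  moreover have "z i \<in> wsp i" if "i \<in> insert l S" for i
  proof -
    have y': "y' i \<in> wsp i" using S(3)[of i] E(2)[of i] M.subspace_0[OF wsp_subspace] by (auto simp: y'_def)
    show ?thesis
    proof (cases "i = l")
      case True
      thus ?thesis using y' u M.subspace_diff[OF wsp_subspace, of "y' i" i u] by (simp add: z_def)
    next
      case False
      thus ?thesis using y' by (simp add: z_def)
    qed
  qed
  ultimately have "z l = 0" using wsp_sum_zero[of "insert l S" z l] S(1,2) I by blast
  hence "u = y' l" by (simp add: z_def)
  moreover have "y' l \<in> E l" using S(3)[of l] M.subspace_0[OF E(1)] by (auto simp: y'_def)
  ultimately show ?thesis by simp
qed

subsection \<open>Irreducible modules are spanned by words in the lowering operators\<close>

text \<open>The index is the sum of the roots by which the vector has been lowered. It is zero only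
  for the empty word, so \<open>v\<close> is the only word of weight \<open>l\<close>.\<close>

inductive word :: "'v => ('a => complex) => 'v => bool" for v where
  word_base: "word v 0 v"
| word_step: "word v q w ==> s \<in> Pos ==> word v (q + s) (\<rho> (rv (- s)) w)"

context fixes l v
  assumes irr: "irreducible_module sV V \<rho>" and v: "v \<in> V" and hw: "highest_weight_vector H \<Delta> sV \<rho> l v" and ld: "l \<in> dual H"
begin

lemma v_wsp: "v \<in> wsp l" "v \<noteq> 0" using v hw by (auto simp: highest_weight_vector_def wsp_def)

lemma v_highest: "r \<in> Pos ==> x \<in> root_space H r ==> \<rho> x v = 0" using hw by (auto simp: highest_weight_vector_def)

lemma word_props: "word v q w ==> natc q \<and> w \<in> wsp (l - q) \<and> (q = 0 \<longrightarrow> w = v)"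
proof (induction rule: word.induct)
  case word_base
  have l0: "l - 0 = l" by simp
  show ?case unfolding l0 using v_wsp natc_zero by blast
next
  case (word_step q w s)
  have s: "s \<in> roots H" "natc s" "s \<noteq> 0" using word_step(2) rootsD(2) by (auto simp: positive_roots_def)
  have "\<rho> (rv (- s)) w \<in> wsp (l - q + - s)" using word_step wsp_shift[OF rv(1)[OF neg_root[OF s(1)]]] by blast
  moreover have eq: "l - q + - s = l - (q + s)" by (simp add: algebra_simps)
  moreover have "q + s \<noteq> 0"
  proof
    assume "q + s = 0"
    hence "- s = q" by (metis add.commute eq_neg_iff_add_eq_0)
    thus False using natc_antisym[OF s(2)] s(3) word_step by simp
  qed
  ultimately show ?case using word_step.IH natc_add[OF _ s(2)] unfolding eq by blast
qed

definition "words = {w. \<exists>q. word v q w}"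

lemma words_V: "words \<subseteq> V" using word_props wspD(1) by (auto simp: words_def)

lemma span_words_V: "M.span words \<subseteq> V" by (rule M.span_minimal[OF words_V V_subspace])

lemma lin_span_words: assumes x: "x \<in> G" and w: "\<And>w. w \<in> words ==> \<rho> x w \<in> M.span words" and u: "u \<in> M.span words"
  shows "\<rho> x u \<in> M.span words"
proof -
  have "M.subspace {u \<in> V. \<rho> x u \<in> M.span words}" using V_subspace x by (intro M.subspaceI)
      (auto simp: M.subspace_0 M.subspace_add M.subspace_scale act_add act_scale act_zero M.span_zero M.span_add M.span_scale)
  hence "M.span words \<subseteq> {u \<in> V. \<rho> x u \<in> M.span words}" using w words_V by (intro M.span_minimal) auto
  thus ?thesis using u by blast
qed

lemma lower_words: "s \<in> Pos ==> w \<in> words ==> \<rho> (rv (- s)) w \<in> words" unfolding words_def using word_step by blast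

text \<open>Commute \<open>y\<close> past the outermost lowering operator. The bracket is again a
  vector of some root space or of \<open>H\<close>, so the induction must keep \<open>r\<close> and
  \<open>y\<close> arbitrary.\<close>

lemma root_words: assumes "word v q w" "r \<in> dual H" "y \<in> root_space H r" shows "\<rho> y w \<in> M.span words" using assms
proof (induction arbitrary: r y rule: word.induct)
  case word_base
  consider "r \<in> Pos" | "- r \<in> Pos" | "r = 0" | "r \<notin> roots H" "r \<noteq> 0" using roots_Pos(1) by force
  thus ?case
  proof cases
    case 1
    thus ?thesis using v_highest word_base by (simp add: M.span_zero)
  next
    case 2
    hence "r \<in> roots H" using neg_root[OF Pos_root[OF 2]] by simp
    then obtain c where c: "y = scale c (rv r)" using root_space_dim_one[OF _ rv(1) rv_nonzero] word_base by blast
    have "\<rho> (rv (- (- r))) v \<in> words" using lower_words[OF 2] word.word_base by (auto simp: words_def)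
    thus ?thesis using c act_scale_left[OF rv_G[OF \<open>r \<in> roots H\<close>] v] by (simp add: M.span_base M.span_scale)
  next
    case 3
    have "y \<in> root_space H 0" using word_base(2) unfolding 3 .
    hence "\<rho> y v = sV (l y) v" unfolding root_space_zero by (rule wspD(2)[OF v_wsp(1)])
    moreover have "v \<in> words" using word.word_base by (auto simp: words_def)
    ultimately show ?thesis by (simp add: M.span_base M.span_scale)
  next
    case 4
    hence "y = 0" using word_base by (auto simp: roots_def)
    thus ?thesis using act_zero_left[OF v] by (simp add: M.span_zero)
  qed
next
  case (word_step q w s)
  have s: "s \<in> roots H" using word_step Pos_root by blast
  have sd: "- s \<in> dual H" using rootsD(1)[OF neg_root[OF s]] .
  have wW: "w \<in> words" using word_step by (auto simp: words_def)
  hence wV: "w \<in> V" using words_V by blast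
  have f: "rv (- s) \<in> G" "rv (- s) \<in> root_space H (- s)" using rv_G rv(1) neg_root[OF s] by blast+
  have y: "y \<in> G" using word_step root_space_G by blast
  have "\<rho> y (\<rho> (rv (- s)) w) = \<rho> (rv (- s)) (\<rho> y w) + \<rho> (br y (rv (- s))) w" using act_br[OF y f(1) wV] by simp
  moreover have "\<rho> (rv (- s)) (\<rho> y w) \<in> M.span words"
    using lin_span_words[OF f(1) _ word_step.IH[OF word_step.prems]] lower_words[OF word_step(2)] M.span_base by blast
  moreover have "\<rho> (br y (rv (- s))) w \<in> M.span words"
  proof (rule word_step.IH)
    show "- s + r \<in> dual H" using sd word_step by (intro dual_add)
    show "br y (rv (- s)) \<in> root_space H (- s + r)"
      using adj.wsp_shift[OF word_step.prems(2), of "rv (- s)" "- s"] f(2) unfolding adj_wsp by blast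
  qed
  ultimately show ?case by (simp add: M.span_add)
qed

lemma words_span: "M.span words = V"
proof -
  have stable: "\<rho> x u \<in> M.span words" if x: "x \<in> G" and u: "u \<in> M.span words" for x u
  proof -
    obtain S y where S: "finite S" "S \<subseteq> dual H" "\<And>\<mu>. \<mu> \<in> S ==> y \<mu> \<in> root_space H \<mu>" "x = (\<Sum>\<mu>\<in>S. y \<mu>)"
      using root_decomp[OF x] by blast
    have uV: "u \<in> V" using u span_words_V by blast
    have yu: "\<rho> (y \<mu>) u \<in> M.span words" if m: "\<mu> \<in> S" for \<mu>
    proof (rule lin_span_words[OF root_space_G[OF S(3)[OF m]] _ u])
      fix w assume "w \<in> words"
      thus "\<rho> (y \<mu>) w \<in> M.span words" using root_words S(2,3) m by (auto simp: words_def)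
    qed
    have "\<rho> x u = (\<Sum>\<mu>\<in>S. \<rho> (y \<mu>) u)" unfolding S(4) using S(3) root_space_G by (intro act_sum_left[OF uV]) blast
    thus ?thesis using yu by (simp add: M.span_sum)
  qed
  have "submod (M.span words)" unfolding submodule_def using span_words_V stable by auto
  moreover have "v \<in> M.span words" using word.word_base by (intro M.span_base) (auto simp: words_def)
  hence "M.span words \<noteq> {0}" using v_wsp(2) by blast
  ultimately show ?thesis using irr unfolding irreducible_module_def by blast
qed

lemma hw_weighted: weighted and hw_weights: "\<mu> \<in> weights ==> natc (l - \<mu>)"
proof -
  let ?I = "{l - q | q. natc q}"
  have "words \<subseteq> (\<Union>\<mu>\<in>?I. wsp \<mu>)" using word_props by (auto simp: words_def)
  hence sp: "V \<subseteq> M.span (\<Union>\<mu>\<in>?I. wsp \<mu>)" using words_span M.span_mono by blast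
  have Id: "?I \<subseteq> dual H" using ld XR_dual[OF natc_XR] dual_diff by blast
  show weighted using weights_subset(2)[OF sp Id] .
  assume "\<mu> \<in> weights"
  hence "\<mu> \<in> ?I" using weights_subset(1)[OF sp Id] by blast
  then obtain q where "\<mu> = l - q" "natc q" by blast
  moreover have "l - (l - q) = q" by simp
  ultimately show "natc (l - \<mu>)" by simp
qed

lemma hw_space: "u \<in> wsp l ==> \<exists>a. u = sV a v"
proof -
  assume u: "u \<in> wsp l"
  define E where "E = (\<lambda>\<mu>. if \<mu> = l then M.span {v} else wsp \<mu>)"
  let ?I = "{l - q | q. natc q}"
  have Id: "?I \<subseteq> dual H" using ld XR_dual[OF natc_XR] dual_diff by blast
  have "words \<subseteq> (\<Union>\<mu>\<in>?I. E \<mu>)"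
  proof
    fix w assume "w \<in> words"
    then obtain q where q: "word v q w" by (auto simp: words_def)
    note p = word_props[OF q]
    have "w \<in> E (l - q)"
    proof (cases "q = 0")
      case True
      hence "w = v" "l - q = l" using p by auto
      thus ?thesis by (simp add: E_def M.span_base)
    next
      case False
      hence "l - q \<noteq> l" by simp
      thus ?thesis using p by (simp add: E_def)
    qed
    thus "w \<in> (\<Union>\<mu>\<in>?I. E \<mu>)" using p by blast
  qed
  hence "V \<subseteq> M.span (\<Union>\<mu>\<in>?I. E \<mu>)" using words_span M.span_mono by blast
  note sp = this
  have sE: "M.subspace (E i)" for i using wsp_subspace by (simp add: E_def)
  have El: "E i \<subseteq> wsp i" for i using v_wsp(1) M.span_minimal[of "{v}" "wsp l", OF _ wsp_subspace] by (auto simp: E_def)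
  have "l - 0 = l" by simp
  hence "l \<in> ?I" using natc_zero by (metis (mono_tags, lifting) mem_Collect_eq)
  hence "u \<in> E l" by (rule wsp_component[OF sp Id _ sE El u])
  thus ?thesis by (auto simp: E_def M.span_singleton)
qed

lemma l_weight: "l \<in> weights" using v_wsp ld by (auto simp: weights_def)

lemma hw_wmult: "wmult l = 1"
proof -
  have "wsp l = M.span {v}" using hw_space v_wsp(1) M.subspace_scale[OF wsp_subspace] by (auto simp: M.span_singleton)
  thus ?thesis using v_wsp(2) M.dim_span_eq_card_independent[of "{v}"] by (simp add: wmult_def)
qed

lemma hw_dominant: "dominant l" and hw_integral: "r \<in> Pos ==> \<exists>n::nat. l (hv r) = of_nat n"
  using relative_hw_dominant[OF submod_zero l_weight v_wsp(1)] v_wsp(2) v_highest by auto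

text \<open>The eigenspace of the Casimir operator is a submodule containing the highest weight
  vector.\<close>

lemma hw_casimir: "u \<in> V ==> casimir B \<rho> u = sV (cas l) u"
proof -
  assume u: "u \<in> V"
  let ?W = "{u \<in> V. casimir B \<rho> u = sV (cas l) u}"
  have s: "M.subspace ?W" by (rule M.subspace_eigenspace[OF V_subspace casimir_lin])
  have "submod ?W" unfolding submodule_def using s casimir_commutes act_in act_scale by auto
  moreover have "v \<in> ?W" using casimir_highest[OF submod_zero l_weight v_wsp(1)] v_highest v by auto
  hence "?W \<noteq> {0}" using v_wsp(2) by blast
  ultimately have "?W = V" using irr unfolding irreducible_module_def by blast
  thus ?thesis using u by blast
qed

end

end

section \<open>The group ring of the weight space\<close>

abbreviation "lkp \<equiv> Poly_Mapping.lookup"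
abbreviation "sgl \<equiv> Poly_Mapping.single"
abbreviation "pkeys \<equiv> Poly_Mapping.keys"

lemma pm_sum_monomials: fixes p :: "'w \<Rightarrow>\<^sub>0 'c::comm_monoid_add" assumes "finite S" "pkeys p \<subseteq> S"
  shows "p = (\<Sum>k\<in>S. sgl k (lkp p k))"
proof (rule poly_mapping_eqI)
  fix k
  have "lkp (\<Sum>k\<in>S. sgl k (lkp p k)) k = (\<Sum>j\<in>S. if j = k then lkp p j else 0)"
    unfolding lookup_sum by (intro sum.cong) (auto simp: lookup_single when_def)
  also have "\<dots> = lkp p k" using assms by (auto simp: in_keys_iff)
  finally show "lkp p k = lkp (\<Sum>k\<in>S. sgl k (lkp p k)) k" by simp
qed

lemma pm_induct: fixes p :: "'w \<Rightarrow>\<^sub>0 'c::comm_monoid_add"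
  assumes sgl: "\<And>k v. P (sgl k v)" and add: "\<And>p q. P p ==> P q ==> P (p + q)" shows "P p"
proof -
  have zero: "P 0" using sgl[of undefined 0] by simp
  have "P (\<Sum>k\<in>S. sgl k (lkp p k))" if "finite S" for S using that by induction (auto simp: zero sgl add)
  hence "P (\<Sum>k\<in>pkeys p. sgl k (lkp p k))" by simp
  moreover have "(\<Sum>k\<in>pkeys p. sgl k (lkp p k)) = p" by (rule pm_sum_monomials[symmetric]) auto
  ultimately show ?thesis by (rule subst[rotated])
qed

text \<open>One construction for two purposes: with values in the group ring it gives reflections
  and differential operators, with complex values it gives evaluation of exponentials.\<close>

definition lext :: "(complex => 'r::comm_ring_1) => ('w => 'r) => ('w \<Rightarrow>\<^sub>0 complex) => 'r" where
  "lext s F p = (\<Sum>k\<in>pkeys p. s (lkp p k) * F k)"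

locale scalar_hom = fixes s :: "complex => 'r::comm_ring_1"
  assumes s_add: "s (a + b) = s a + s b" and s_mult: "s (a * b) = s a * s b" and s_one: "s 1 = 1"
begin

lemma s_zero: "s 0 = 0" using s_add[of 0 0] by simp

lemma lext_superset: assumes "finite S" "pkeys p \<subseteq> S" shows "lext s F p = (\<Sum>k\<in>S. s (lkp p k) * F k)"
  unfolding lext_def using assms by (intro sum.mono_neutral_left) (auto simp: in_keys_iff s_zero)

lemma lext_add: "lext s F (p + q) = lext s F p + lext s F q"
proof -
  let ?S = "pkeys p \<union> pkeys q"
  have "pkeys (p + q) \<subseteq> ?S" by (rule Poly_Mapping.keys_add)
  thus ?thesis using lext_superset[of ?S p F] lext_superset[of ?S q F] lext_superset[of ?S "p + q" F]
    by (simp add: lookup_add s_add distrib_right sum.distrib)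
qed

lemma lext_single: "lext s F (sgl k c) = s c * F k" using lext_superset[of "{k}" "sgl k c" F] by (simp add: lookup_single)

lemma lext_zero: "lext s F 0 = 0" by (simp add: lext_def)

lemma lext_uminus: "lext s F (- p) = - lext s F p" using lext_add[of F p "- p"] by (simp add: lext_zero eq_neg_iff_add_eq_0 add.commute)

lemma lext_diff: "lext s F (p - q) = lext s F p - lext s F q" using lext_add[of F p "- q"] by (simp add: lext_uminus)

lemma lext_mult: assumes F: "\<And>k j. F (k + j) = F k * F j" shows "lext s F (p * q) = lext s F p * lext s F q"
proof (induction p rule: pm_induct)
  case (1 k v)
  show ?case by (induction q rule: pm_induct) (auto simp: lext_single mult_single F s_mult distrib_left lext_add algebra_simps)
next
  case (2 p1 p2)
  thus ?case by (simp add: distrib_right lext_add)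
qed

lemma lext_one: "F 0 = 1 ==> lext s F 1 = 1" using lext_single[of F 0 1] s_one by simp

lemma lext_prod: assumes F: "\<And>k j. F (k + j) = F k * F j" "F 0 = 1"
  shows "lext s F (\<Prod>i\<in>I. f i) = (\<Prod>i\<in>I. lext s F (f i))"
  by (induction I rule: infinite_finite_induct) (auto simp: lext_one F lext_mult[OF F(1)])

end

abbreviation c0 :: "complex => ('w::ab_group_add \<Rightarrow>\<^sub>0 complex)" where "c0 \<equiv> sgl 0"

text \<open>The formal exponential with exponent \<open>\<mu>\<close>; \<open>c0\<close> embeds the
  scalars.\<close>

abbreviation ex :: "'w => ('w::ab_group_add \<Rightarrow>\<^sub>0 complex)" where "ex \<mu> \<equiv> sgl \<mu> 1"

interpretation GR: scalar_hom "c0 :: complex => ('w::ab_group_add \<Rightarrow>\<^sub>0 complex)"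
  by unfold_locales (auto simp: single_add mult_single)

interpretation CC: scalar_hom "\<lambda>x. x :: complex" by unfold_locales auto

lemma lookup_c0_mult: "lkp (c0 a * p) k = a * lkp p k"
proof (induction p rule: pm_induct)
  case (1 j v)
  thus ?case by (simp add: mult_single lookup_single when_def)
next
  case (2 p q)
  thus ?case by (simp add: distrib_left lookup_add)
qed

lemma lookup_mult_ex: "lkp (p * ex \<nu>) \<mu> = lkp p (\<mu> - \<nu>)"
proof (induction p rule: pm_induct)
  case (1 k v)
  have "k + \<nu> = \<mu> \<longleftrightarrow> k = \<mu> - \<nu>" by (auto simp: algebra_simps)
  thus ?case by (simp add: mult_single lookup_single when_def)
next
  case (2 p q)
  thus ?case by (simp add: distrib_right lookup_add)
qed

definition smap :: "('w => 'w) => ('w::ab_group_add \<Rightarrow>\<^sub>0 complex) => ('w \<Rightarrow>\<^sub>0 complex)" where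
  "smap \<sigma> = lext c0 (\<lambda>\<mu>. ex (\<sigma> \<mu>))"

lemma lookup_smap: assumes "\<And>\<mu>. \<sigma> (\<sigma> \<mu>) = \<mu>" shows "lkp (smap \<sigma> p) \<mu> = lkp p (\<sigma> \<mu>)"
proof (induction p rule: pm_induct)
  case (1 k v)
  have "\<sigma> k = \<mu> \<longleftrightarrow> k = \<sigma> \<mu>" using assms by metis
  thus ?case by (simp add: smap_def GR.lext_single mult_single lookup_single when_def)
next
  case (2 p q)
  thus ?case by (simp add: smap_def GR.lext_add lookup_add)
qed

section \<open>The Laplacian of a symmetric bilinear form\<close>

locale bilin = fixes bf :: "'w::ab_group_add => 'w => complex"
  assumes bf_sym: "bf x y = bf y x" and bf_add: "bf (x + y) z = bf x z + bf y z"
begin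

lemma bf_add_right: "bf z (x + y) = bf z x + bf z y" using bf_add[of x y z] by (simp only: bf_sym[of z])

lemma bf_zero: "bf 0 x = 0" "bf x 0 = 0" using bf_add[of 0 0 x] bf_add_right[of x 0 0] by simp_all

definition Lap :: "('w \<Rightarrow>\<^sub>0 complex) => ('w \<Rightarrow>\<^sub>0 complex)" where
  "Lap = lext c0 (\<lambda>\<mu>. sgl \<mu> (bf \<mu> \<mu>))"

definition Dv :: "'w => ('w \<Rightarrow>\<^sub>0 complex) => ('w \<Rightarrow>\<^sub>0 complex)" where
  "Dv \<nu> = lext c0 (\<lambda>\<mu>. sgl \<mu> (bf \<mu> \<nu>))"

text \<open>The product of gradients, which is the mixed term in the product rule
  \<open>Lap_mult\<close>: on exponentials with exponents mu and nu it is (mu, nu) times the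
  exponential of mu + nu.\<close>

definition Gam :: "('w \<Rightarrow>\<^sub>0 complex) => ('w \<Rightarrow>\<^sub>0 complex) => ('w \<Rightarrow>\<^sub>0 complex)" where
  "Gam p q = lext c0 (\<lambda>\<mu>. ex \<mu> * Dv \<mu> q) p"

lemma Lap_single: "Lap (sgl \<mu> c) = sgl \<mu> (c * bf \<mu> \<mu>)" by (simp add: Lap_def GR.lext_single mult_single)

lemma Dv_single: "Dv \<nu> (sgl \<mu> c) = sgl \<mu> (c * bf \<mu> \<nu>)" by (simp add: Dv_def GR.lext_single mult_single)

lemma lookup_Lap: "lkp (Lap p) \<mu> = bf \<mu> \<mu> * lkp p \<mu>"
proof (induction p rule: pm_induct)
  case (1 k v)
  thus ?case by (auto simp: Lap_single lookup_single when_def)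
next
  case (2 p q)
  thus ?case by (simp add: Lap_def GR.lext_add lookup_add algebra_simps)
qed

lemma lookup_Dv: "lkp (Dv \<nu> p) \<mu> = bf \<mu> \<nu> * lkp p \<mu>"
proof (induction p rule: pm_induct)
  case (1 k v)
  thus ?case by (auto simp: Dv_single lookup_single when_def)
next
  case (2 p q)
  thus ?case by (simp add: Dv_def GR.lext_add lookup_add algebra_simps)
qed

lemma Dv_add: "Dv (\<mu> + \<nu>) p = Dv \<mu> p + Dv \<nu> p"
  by (rule poly_mapping_eqI) (simp add: lookup_Dv lookup_add bf_add_right algebra_simps)

lemma Dv_zero: "Dv 0 p = 0" by (rule poly_mapping_eqI) (simp add: lookup_Dv bf_zero)

lemma Dv_uminus: "Dv (- \<mu>) p = - Dv \<mu> p" using Dv_add[of \<mu> "- \<mu>" p] by (simp add: Dv_zero eq_neg_iff_add_eq_0 add.commute)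

lemma Dv_pm_add: "Dv \<nu> (p + q) = Dv \<nu> p + Dv \<nu> q" by (simp add: Dv_def GR.lext_add)

lemma Gam_add_left: "Gam (p + q) r = Gam p r + Gam q r" by (simp add: Gam_def GR.lext_add)

lemma Gam_single: "Gam (sgl \<mu> c) q = sgl \<mu> c * Dv \<mu> q" by (simp add: Gam_def GR.lext_single mult_single flip: mult.assoc)

lemma Gam_ex: "Gam (ex \<mu>) q = ex \<mu> * Dv \<mu> q" by (rule Gam_single)

lemma Gam_add_right: "Gam p (q + r) = Gam p q + Gam p r"
proof (induction p rule: pm_induct)
  case (1 k v)
  thus ?case by (simp add: Gam_single Dv_pm_add distrib_left)
next
  case (2 p q)
  thus ?case by (simp add: Gam_add_left)
qed

lemma Lap_mult: "Lap (p * q) = Lap p * q + p * Lap q + c0 2 * Gam p q"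
proof (induction p rule: pm_induct)
  case (1 k v)
  show ?case
  proof (induction q rule: pm_induct)
    case (1 j w)
    have "bf (k + j) (k + j) = bf k k + bf j j + 2 * bf j k" using bf_sym[of k j] by (simp add: bf_add bf_add_right)
    hence "v * w * bf (k + j) (k + j) = v * bf k k * w + v * (w * bf j j) + 2 * (v * (w * bf j k))" by (simp add: algebra_simps)
    thus ?case by (simp only: mult_single Lap_single Gam_single Dv_single single_add[symmetric] add_0_left)
  next
    case (2 q r)
    thus ?case by (simp add: distrib_left Lap_def GR.lext_add Gam_add_right algebra_simps)
  qed
next
  case (2 p q)
  thus ?case by (simp add: distrib_right Lap_def GR.lext_add Gam_add_left algebra_simps)
qed

lemma Gam_mult: "Gam (p * q) r = p * Gam q r + q * Gam p r"
proof (induction p rule: pm_induct)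
  case (1 k v)
  show ?case
  proof (induction q rule: pm_induct)
    case (1 j w)
    have "Gam (sgl k v * sgl j w) r = (sgl k v * sgl j w) * Dv (k + j) r" unfolding mult_single by (rule Gam_single)
    thus ?case unfolding Dv_add Gam_single by (simp only: algebra_simps)
  next
    case (2 q s)
    thus ?case by (simp add: distrib_left Gam_add_left algebra_simps)
  qed
next
  case (2 p s)
  thus ?case by (simp add: distrib_right distrib_left Gam_add_left algebra_simps)
qed

lemma Gam_one: "Gam 1 q = 0" using Gam_ex[of 0 q] by (simp add: Dv_zero)

lemma Gam_uminus: "Gam (- p) q = - Gam p q" by (simp add: Gam_def GR.lext_uminus)

lemma Gam_factor: "Gam (1 - ex (- r)) q = ex (- r) * Dv r q"
  using Gam_add_left[of 1 "- ex (- r)" q] by (simp add: Gam_one Gam_uminus Gam_ex Dv_uminus)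

text \<open>Logarithmic differentiation of a product. \<open>\<Theta> r\<close> stands for the
  quotient of \<open>ex (- r) * Dv r q\<close> by \<open>1 - ex (- r)\<close>, which in the group
  ring has to be supplied as a solution of the equation.\<close>

lemma Gam_prod: assumes "finite P" and \<Theta>: "\<And>r. r \<in> P ==> (1 - ex (- r)) * \<Theta> r = ex (- r) * Dv r q"
  shows "Gam (\<Prod>r\<in>P. 1 - ex (- r)) q = (\<Prod>r\<in>P. 1 - ex (- r)) * (\<Sum>r\<in>P. \<Theta> r)" using assms
proof (induction P)
  case (insert r P)
  have "Gam ((1 - ex (- r)) * (\<Prod>r\<in>P. 1 - ex (- r))) q =
      (1 - ex (- r)) * ((\<Prod>r\<in>P. 1 - ex (- r)) * (\<Sum>r\<in>P. \<Theta> r)) +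
      (\<Prod>r\<in>P. 1 - ex (- r)) * ((1 - ex (- r)) * \<Theta> r)"
    unfolding Gam_mult using insert by (simp only: Gam_factor insert_iff simp_thms)
  also have "\<dots> = ((1 - ex (- r)) * (\<Prod>r\<in>P. 1 - ex (- r))) * (\<Theta> r + (\<Sum>r\<in>P. \<Theta> r))"
    by (simp only: algebra_simps)
  finally show ?case using insert.hyps by simp
qed (simp add: Gam_one)

end

section \<open>The Weyl group\<close>

context based_alg
begin

sublocale bl: bilin ip by unfold_locales (auto intro: ip_sym ip_add_left)

text \<open>Weyl group elements are represented by words in simple reflections; different words may
  act in the same way, and the sign is the parity of the length.\<close>

primrec act :: "('a => complex) list => ('a => complex) => 'a => complex" where "act [] \<mu> = \<mu>"
| "act (d # w) \<mu> = refl d (act w \<mu>)"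

lemma act_append: "act (u @ w) \<mu> = act u (act w \<mu>)" by (induction u) auto

lemma act_dual: "set w \<subseteq> \<Delta> ==> \<mu> \<in> dual H ==> act w \<mu> \<in> dual H"
  by (induction w) (auto intro: refl_dual Delta_root)

lemma act_rev: "set w \<subseteq> \<Delta> ==> act (rev w) (act w \<mu>) = \<mu>" "set w \<subseteq> \<Delta> ==> act w (act (rev w) \<mu>) = \<mu>"
proof -
  show "act (rev w) (act w \<mu>) = \<mu>" if "set w \<subseteq> \<Delta>" for w \<mu>
    using that by (induction w arbitrary: \<mu>) (auto simp: act_append refl_involution Delta_root)
  from this[of "rev w"] show "set w \<subseteq> \<Delta> ==> act w (act (rev w) \<mu>) = \<mu>" by simp
qed

lemma act_ip: "set w \<subseteq> \<Delta> ==> \<mu> \<in> dual H ==> \<nu> \<in> dual H ==> ip (act w \<mu>) (act w \<nu>) = ip \<mu> \<nu>"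
  by (induction w) (auto simp: ip_refl Delta_root act_dual)

lemma act_ip_rev: "set w \<subseteq> \<Delta> ==> \<mu> \<in> dual H ==> \<nu> \<in> dual H ==> ip (act w \<mu>) \<nu> = ip \<mu> (act (rev w) \<nu>)"
  using act_ip[of w \<mu> "act (rev w) \<nu>"] act_dual[of "rev w" \<nu>] act_rev(2)[of w \<nu>] by simp

lemma act_root: "set w \<subseteq> \<Delta> ==> r \<in> roots H ==> act w r \<in> roots H"
  by (induction w) (auto intro: refl_root Delta_root)

lemma act_uminus: "act w (- \<mu>) = - act w \<mu>"
proof (induction w)
  case (Cons d w)
  show ?case unfolding act.simps Cons refl_uminus ..
qed simp

lemma act_diff_scale: "act w (\<mu> - fun_scale c \<nu>) = act w \<mu> - fun_scale c (act w \<nu>)"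
proof (induction w)
  case (Cons d w)
  show ?case unfolding act.simps Cons refl_diff refl_scale ..
qed simp

lemma act_refl: assumes w: "set w \<subseteq> \<Delta>" and a: "a \<in> roots H" and \<mu>: "\<mu> \<in> dual H"
  shows "act w (refl a \<mu>) = refl (act w a) (act w \<mu>)"
proof -
  have "(act w \<mu>) (hv (act w a)) = \<mu> (hv a)"
    using apply_hv_ip[OF act_root[OF w a] act_dual[OF w \<mu>]] apply_hv_ip[OF a \<mu>] act_ip[OF w \<mu> rootsD(1)[OF a]]
      act_ip[OF w rootsD(1)[OF a] rootsD(1)[OF a]] by simp
  thus ?thesis unfolding refl_def act_diff_scale by simp
qed

lemma not_Pos: "r \<in> roots H ==> r \<notin> Pos ==> - r \<in> Pos" using roots_Pos(1) by force

text \<open>Reading the word from the right, the image of \<open>a\<close> becomes negative at some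
  letter \<open>d\<close>. Just before it the image equals \<open>d\<close>, so the reflection in
  \<open>a\<close> can be moved left to \<open>d\<close> and cancels it.\<close>

lemma deletion: assumes "set u \<subseteq> \<Delta>" "a \<in> \<Delta>" "act u a \<notin> Pos"
  shows "\<exists>u'. set u' \<subseteq> \<Delta> \<and> length u' < length u \<and> (\<forall>\<mu>\<in>dual H. act u (refl a \<mu>) = act u' \<mu>)"
  using assms(1,3)
proof (induction u)
  case Nil
  thus ?case using Delta_Pos[OF assms(2)] by simp
next
  case (Cons d u)
  have u: "set u \<subseteq> \<Delta>" and d: "d \<in> \<Delta>" using Cons.prems by auto
  show ?case
  proof (cases "act u a \<in> Pos")
    case False
    then obtain u' where "set u' \<subseteq> \<Delta>" "length u' < length u" "\<forall>\<mu>\<in>dual H. act u (refl a \<mu>) = act u' \<mu>"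
      using Cons.IH[OF u] by blast
    thus ?thesis using d by (intro exI[of _ "d # u'"]) auto
  next
    case True
    hence da: "act u a = d" using refl_Pos(1)[OF d] Cons.prems(2) by auto
    have "act (d # u) (refl a \<mu>) = act u \<mu>" if "\<mu> \<in> dual H" for \<mu>
      using act_refl[OF u Delta_root[OF assms(2)] that] refl_involution[OF Delta_root[OF d]] by (simp add: da)
    thus ?thesis using u by (intro exI[of _ u]) auto
  qed
qed

text \<open>If the word ends in \<open>a\<close>, then \<open>act w a\<close> being positive means
  that the rest of the word makes \<open>a\<close> negative, so \<open>deletion\<close> yields a
  shorter word with the same action.\<close>

lemma act_positive_trivial: assumes "set w \<subseteq> \<Delta>" "\<And>d. d \<in> \<Delta> ==> act w d \<in> Pos" "\<mu> \<in> dual H"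
  shows "act w \<mu> = \<mu>" using assms
proof (induction "length w" arbitrary: w \<mu> rule: less_induct)
  case less
  show ?case
  proof (cases w rule: rev_cases)
    case (snoc u a)
    have u: "set u \<subseteq> \<Delta>" "a \<in> \<Delta>" using less.prems snoc by auto
    have "act w a = - act u a" using snoc refl_self[OF Delta_root[OF u(2)]] by (simp add: act_append act_uminus)
    hence "act u a \<notin> Pos" using less.prems(2)[OF u(2)] roots_Pos(2) by (metis IntI empty_iff imageI)
    then obtain u' where u': "set u' \<subseteq> \<Delta>" "length u' < length u" "\<And>\<mu>. \<mu> \<in> dual H ==> act u (refl a \<mu>) = act u' \<mu>"
      using deletion[OF u] by blast
    have w: "act w \<mu> = act u' \<mu>" if "\<mu> \<in> dual H" for \<mu> using u'(3)[OF that] snoc by (simp add: act_append)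
    have "act u' \<mu> = \<mu>"
    proof (rule less.hyps)
      show "length u' < length w" using u'(2) snoc by simp
      show "act u' d \<in> Pos" if "d \<in> \<Delta>" for d using w[OF rootsD(1)[OF Delta_root[OF that]]] less.prems(2)[OF that] by simp
    qed (use u' less.prems in auto)
    thus ?thesis using w less.prems(3) by simp
  qed simp
qed

definition sdom :: "('a => complex) => bool" where "sdom x \<longleftrightarrow> x \<in> XR \<and> (\<forall>r\<in>Pos. Re (ip x r) > 0)"

lemma sdom_stabilizer: assumes x: "sdom x" and w: "set w \<subseteq> \<Delta>" "act w x = x" and \<mu>: "\<mu> \<in> dual H"
  shows "act w \<mu> = \<mu>"
proof (rule act_positive_trivial[OF w(1) _ \<mu>])
  fix d assume d: "d \<in> \<Delta>"
  have xd: "x \<in> dual H" using x XR_dual by (simp add: sdom_def)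
  have "ip x (act w d) = ip x d" using act_ip[OF w(1) xd rootsD(1)[OF Delta_root[OF d]]] w(2) by simp
  hence "Re (ip x (act w d)) > 0" using x Delta_Pos[OF d] by (simp add: sdom_def)
  hence "- act w d \<notin> Pos" using x by (auto simp: sdom_def ip_uminus_right)
  thus "act w d \<in> Pos" using not_Pos[OF act_root[OF w(1) Delta_root[OF d]]] by blast
qed

text \<open>A word fixing a strictly dominant point keeps the simple roots positive and so acts
  trivially. Hence the points of such an orbit can stand for the elements of the Weyl group.\<close>

lemma sdom_act_eq:
  assumes x: "sdom x" and w: "set u \<subseteq> \<Delta>" "set w \<subseteq> \<Delta>" "act u x = act w x" and \<mu>: "\<mu> \<in> dual H"
  shows "act u \<mu> = act w \<mu>" "act (rev u) \<mu> = act (rev w) \<mu>"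
proof -
  have "act (rev w @ u) x = x" using w act_rev(1) by (simp add: act_append)
  moreover have s: "set (rev w @ u) \<subseteq> \<Delta>" using w by auto
  ultimately have 1: "act (rev w) (act u \<nu>) = \<nu>" if "\<nu> \<in> dual H" for \<nu>
    using sdom_stabilizer[OF x s _ that] by (simp add: act_append)
  show "act u \<mu> = act w \<mu>" using arg_cong[OF 1[OF \<mu>], of "act w"] act_rev(2)[OF w(2)] by simp
  show "act (rev u) \<mu> = act (rev w) \<mu>"
    using 1[of "act (rev u) \<mu>"] act_rev(2)[OF w(1)] act_dual[of "rev u" \<mu>] w(1) \<mu> by simp
qed

lemma sdomI_Delta: assumes "x \<in> XR" "\<And>d. d \<in> \<Delta> ==> Re (ip x d) > 0" shows "sdom x" unfolding sdom_def
proof (intro conjI ballI)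
  fix r assume r: "r \<in> Pos"
  then obtain c where c: "r = (\<Sum>d\<in>\<Delta>. fun_scale (of_nat (c d)) d)" unfolding positive_roots_def nat_combination_def by auto
  have eq: "Re (ip x r) = (\<Sum>d\<in>\<Delta>. of_nat (c d) * Re (ip x d))" unfolding c by (simp add: ip_sum_right ip_scale_right)
  have "\<exists>d\<in>\<Delta>. c d \<noteq> 0"
  proof (rule ccontr)
    assume "\<not> ?thesis"
    hence "r = 0" unfolding c by (simp add: fun_eq_iff fun_sum_apply fun_scale_def)
    thus False using rootsD(2)[OF Pos_root[OF r]] by simp
  qed
  then obtain d where d: "d \<in> \<Delta>" "c d \<noteq> 0" by blast
  show "Re (ip x r) > 0" unfolding eq by (rule sum_pos2[OF Delta_finite d(1)]) (use assms(2) d in \<open>auto simp: less_imp_le\<close>)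
qed (rule assms)

lemma sdom_wrho: "sdom wrho" using wrho_Delta_pos wrho_XR by (intro sdomI_Delta) (auto simp: ip_sym[of wrho])

lemma sdom_dominant_add: "dominant l ==> sdom (l + wrho)"
proof (rule sdomI_Delta)
  assume l: "dominant l"
  thus "l + wrho \<in> XR" using wrho_XR XR_add by (simp add: dominant_def)
  fix d assume d: "d \<in> \<Delta>"
  have "Re (ip l d) \<ge> 0" using l d by (simp add: dominant_def)
  moreover have "Re (ip wrho d) > 0" using wrho_Delta_pos[OF d] ip_sym[of wrho d] by simp
  ultimately show "Re (ip (l + wrho) d) > 0" unfolding ip_add_left by simp
qed

text \<open>An element that changes sign under all simple reflections is determined by its strictly
  dominant part: every exponent can be reflected upwards.\<close>

lemma antisymmetric_support: fixes p :: "('a => complex) \<Rightarrow>\<^sub>0 complex"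
  assumes anti: "\<And>d \<mu>. d \<in> \<Delta> ==> lkp p (refl d \<mu>) = - lkp p \<mu>" and XR: "pkeys p \<subseteq> XR"
    and top: "\<And>\<mu>. \<mu> \<in> pkeys p ==> (\<And>d. d \<in> \<Delta> ==> Re (ip \<mu> d) > 0) ==> \<mu> = \<Lambda>"
    and \<mu>: "\<mu> \<in> pkeys p" shows "\<exists>w. set w \<subseteq> \<Delta> \<and> \<mu> = act w \<Lambda>" using \<mu>
proof (induction "card {\<nu> \<in> pkeys p. Re (ip \<nu> wrho) > Re (ip \<mu> wrho)}" arbitrary: \<mu> rule: less_induct)
  case less
  show ?case
  proof (cases "\<forall>d\<in>\<Delta>. Re (ip \<mu> d) > 0")
    case True
    thus ?thesis using top[OF less.prems] by (intro exI[of _ "[]"]) auto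
  next
    case False
    then obtain d where d: "d \<in> \<Delta>" "Re (ip \<mu> d) \<le> 0" by auto
    have mX: "\<mu> \<in> XR" using XR less.prems by blast
    note dR = Delta_root[OF d(1)]
    obtain a where a: "ip \<mu> d = of_real a" using ip_real[OF mX XR_root[OF dR]] by (auto elim: Reals_cases)
    obtain c where c: "ip d d = of_real c" "c > 0" using ip_root_pos[OF dR] by (auto elim!: Reals_cases)
    have hv: "\<mu> (hv d) = of_real (2 * a / c)" using apply_hv_ip[OF dR XR_dual[OF mX]] a c by simp
    have key: "refl d \<mu> \<in> pkeys p" using anti[OF d(1), of \<mu>] less.prems by (simp add: in_keys_iff)
    \<comment> \<open>An exponent fixed by the reflection would have a coefficient equal to its own
      negative.\<close>
    have "a \<noteq> 0"
    proof
      assume "a = 0"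
      hence "\<mu> (hv d) = 0" unfolding hv by simp
      hence "refl d \<mu> = \<mu>" by (auto simp: refl_def fun_scale_def fun_eq_iff)
      hence "lkp p \<mu> = - lkp p \<mu>" using anti[OF d(1), of \<mu>] by simp
      thus False using less.prems by (simp add: in_keys_iff eq_neg_iff_add_eq_0)
    qed
    hence a0: "a < 0" using d(2) a by simp
    have "ip (refl d \<mu>) wrho = ip \<mu> wrho - of_real (2 * a / c) * ip d wrho" unfolding refl_def hv ip_diff_left ip_scale_left ..
    hence "Re (ip (refl d \<mu>) wrho) = Re (ip \<mu> wrho) - 2 * a / c * Re (ip d wrho)"
      by (simp only: minus_complex.sel Re_complex_of_real times_complex.sel Im_complex_of_real mult_zero_left diff_zero)
    moreover have "2 * a / c * Re (ip d wrho) < 0" by (rule mult_neg_pos[OF divide_neg_pos wrho_Delta_pos[OF d(1)]]) (use a0 c(2) in auto)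
    ultimately have gt: "Re (ip (refl d \<mu>) wrho) > Re (ip \<mu> wrho)" by simp
    have "card {\<nu> \<in> pkeys p. Re (ip \<nu> wrho) > Re (ip (refl d \<mu>) wrho)} < card {\<nu> \<in> pkeys p. Re (ip \<nu> wrho) > Re (ip \<mu> wrho)}"
      by (rule psubset_card_mono) (use gt key in auto)
    from less.hyps[OF this key] obtain w where w: "set w \<subseteq> \<Delta>" "refl d \<mu> = act w \<Lambda>" by blast
    hence "\<mu> = act (d # w) \<Lambda>" using refl_involution[OF dR, of \<mu>] by simp
    thus ?thesis using w(1) d(1) by (intro exI[of _ "d # w"]) auto
  qed
qed

lemma antisymmetric_act: fixes p :: "('a => complex) \<Rightarrow>\<^sub>0 complex"
  assumes anti: "\<And>d \<mu>. d \<in> \<Delta> ==> lkp p (refl d \<mu>) = - lkp p \<mu>" and w: "set w \<subseteq> \<Delta>"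
  shows "lkp p (act w \<mu>) = (- 1) ^ length w * lkp p \<mu>" using w by (induction w) (auto simp: anti)

end

section \<open>Weyl's dimension formula\<close>

context based_alg
begin

definition den0 :: "('a => complex) \<Rightarrow>\<^sub>0 complex" where "den0 = (\<Prod>r\<in>Pos. 1 - ex (- r))"

text \<open>The Weyl denominator; \<open>den0\<close> is its quotient by the top
  exponential.\<close>

definition den :: "('a => complex) \<Rightarrow>\<^sub>0 complex" where "den = ex wrho * den0"

lemma lkp_refl: "d \<in> \<Delta> ==> lkp (smap (refl d) p) \<mu> = lkp p (refl d \<mu>)"
  by (rule lookup_smap) (rule refl_involution[OF Delta_root])

lemma smap_refl_mult: "smap (refl d) (p * q) = smap (refl d) p * smap (refl d) q"
  unfolding smap_def by (rule GR.lext_mult) (simp only: refl_add mult_single mult_1)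

lemma smap_refl_single: "smap (refl d) (ex \<mu>) = ex (refl d \<mu>)" unfolding smap_def GR.lext_single by (simp add: mult_single)

lemma refl_zero: "refl d 0 = 0" by (auto simp: refl_def fun_scale_def fun_eq_iff)

lemma smap_refl_prod: "smap (refl d) (\<Prod>i\<in>I. f i) = (\<Prod>i\<in>I. smap (refl d) (f i))" unfolding smap_def
proof (rule GR.lext_prod)
  show "ex (refl d (k + j)) = ex (refl d k) * ex (refl d j)" for k j by (simp only: refl_add mult_single mult_1)
  show "ex (refl d 0) = 1" unfolding refl_zero by simp
qed

lemma smap_refl_factor: "smap (refl d) (1 - ex (- r)) = 1 - ex (- refl d r)"
proof -
  have "smap (refl d) 1 = 1" unfolding smap_def by (rule GR.lext_one) (simp only: refl_zero single_one)
  moreover have "smap (refl d) (1 - ex (- r)) = smap (refl d) 1 - smap (refl d) (ex (- r))" unfolding smap_def by (rule GR.lext_diff)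
  ultimately show ?thesis unfolding smap_refl_single refl_uminus by simp
qed

text \<open>The factors other than the one at \<open>d\<close> are permuted. The remaining part
  changes from \<open>ex wrho * (1 - ex (- d))\<close> to \<open>ex (wrho - d) * (1 - ex d)\<close>,
  its negative.\<close>

lemma den_antisym: assumes d: "d \<in> \<Delta>" shows "smap (refl d) den = - den"
proof -
  have split: "den0 = (1 - ex (- d)) * (\<Prod>r\<in>Pos - {d}. 1 - ex (- r))"
    unfolding den0_def by (rule prod.remove[OF finite_Pos Delta_Pos[OF d]])
  have "smap (refl d) (\<Prod>r\<in>Pos - {d}. 1 - ex (- r)) = (\<Prod>r\<in>Pos - {d}. 1 - ex (- refl d r))"
    unfolding smap_refl_prod smap_refl_factor ..
  also have "\<dots> = (\<Prod>r\<in>Pos - {d}. 1 - ex (- r))"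
    by (rule prod.reindex_bij_betw[OF refl_Pos_bij[OF d], of "\<lambda>r. 1 - ex (- r)"])
  finally have "smap (refl d) den = ex (wrho - d) * ((1 - ex (- (- d))) * (\<Prod>r\<in>Pos - {d}. 1 - ex (- r)))"
    unfolding den_def split smap_refl_mult smap_refl_single smap_refl_factor refl_wrho[OF d] refl_self[OF Delta_root[OF d]] by simp
  also have "ex (wrho - d) = ex wrho * ex (- d)" by (simp add: mult_single)
  also have "ex wrho * ex (- d) * ((1 - ex (- (- d))) * (\<Prod>r\<in>Pos - {d}. 1 - ex (- r))) =
    ex wrho * ((ex (- d) - ex (- d) * ex (- (- d))) * (\<Prod>r\<in>Pos - {d}. 1 - ex (- r)))"
    by (simp only: algebra_simps mult_1_left mult_1_right)
  also have "ex (- d) * ex (- (- d)) = (1 :: ('a => complex) \<Rightarrow>\<^sub>0 complex)"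
    by (simp only: mult_single mult_1 ab_left_minus minus_minus single_one)
  also have "ex wrho * ((ex (- d) - 1) * (\<Prod>r\<in>Pos - {d}. 1 - ex (- r))) = - den" unfolding den_def split
    by (simp only: mult_1_left mult_1_right left_diff_distrib right_diff_distrib minus_diff_eq ac_simps)
  finally show ?thesis .
qed

lemma den_lkp_refl: "d \<in> \<Delta> ==> lkp den (refl d \<mu>) = - lkp den \<mu>" using lkp_refl[of d den \<mu>] den_antisym[of d] by simp

lemma natc_neg_zero: "natc q ==> natc r ==> q + r = 0 ==> r = 0" using natc_antisym[of r] by (metis add.commute eq_neg_iff_add_eq_0)

text \<open>Each new factor only adds exponents \<open>- (q + r)\<close> with \<open>q\<close> and
  \<open>r\<close> natural combinations and \<open>r\<close> nonzero; such an exponent is never 0,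
  so the constant coefficient stays 1.\<close>

lemma den0_keys: assumes "finite P" "P \<subseteq> Pos"
  shows "pkeys (\<Prod>r\<in>P. 1 - ex (- r)) \<subseteq> {- q | q. natc q} \<and> lkp (\<Prod>r\<in>P. 1 - ex (- r)) 0 = 1"
proof -
  define K where "K = (\<lambda>P. pkeys (\<Prod>r\<in>P. 1 - ex (- r)) \<subseteq> {- q | q. natc q} \<and>
    lkp (\<Prod>r\<in>P. 1 - ex (- r)) 0 = 1)"
  have "(0 :: 'a => complex) \<in> {- q | q. natc q}" using natc_zero minus_zero[symmetric] by blast
  hence K0: "K {}" unfolding K_def prod.empty Poly_Mapping.keys_one lookup_one_zero by blast
  have "K (insert r P)" if "K P" "finite P" "r \<notin> P" "r \<in> Pos" for r P
  proof -
  let ?p = "\<Prod>r\<in>P. 1 - ex (- r)"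
    have r: "natc r" "r \<noteq> 0" using that(4) rootsD(2)[OF Pos_root] by (auto simp: positive_roots_def)
  have IH: "pkeys ?p \<subseteq> {- q | q. natc q}" "lkp ?p 0 = 1" using that(1) unfolding K_def by blast+
  have eq: "(\<Prod>r\<in>insert r P. 1 - ex (- r)) = ?p - ?p * ex (- r)" using that(2,3) by (simp add: algebra_simps)
  have lk: "lkp (\<Prod>r\<in>insert r P. 1 - ex (- r)) \<mu> = lkp ?p \<mu> - lkp ?p (\<mu> + r)" for \<mu>
    unfolding eq lookup_minus lookup_mult_ex by simp
  have "pkeys (\<Prod>r\<in>insert r P. 1 - ex (- r)) \<subseteq> {- q | q. natc q}"
  proof
    fix \<mu> assume "\<mu> \<in> pkeys (\<Prod>r\<in>insert r P. 1 - ex (- r))"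
    hence "lkp ?p \<mu> \<noteq> 0 \<or> lkp ?p (\<mu> + r) \<noteq> 0" unfolding in_keys_iff lk by auto
    thus "\<mu> \<in> {- q | q. natc q}"
    proof
      assume "lkp ?p \<mu> \<noteq> 0"
      thus ?thesis using IH(1) by (auto simp: in_keys_iff)
    next
      assume "lkp ?p (\<mu> + r) \<noteq> 0"
      then obtain q where "\<mu> + r = - q" "natc q" using IH(1) by (auto simp: in_keys_iff)
      hence "\<mu> = - (q + r)" "natc (q + r)" using natc_add r(1) by (auto simp: algebra_simps eq_neg_iff_add_eq_0)
      thus ?thesis by blast
    qed
  qed
  moreover have "lkp ?p (0 + r) = 0"
  proof (rule ccontr)
    assume "lkp ?p (0 + r) \<noteq> 0"
    hence "r \<in> pkeys ?p" by (simp add: in_keys_iff)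
    then obtain q where "r = - q" "natc q" using IH(1) by blast
    thus False using natc_neg_zero[of q r] r by simp
  qed
  ultimately show ?thesis unfolding K_def using IH(2) lk[of 0] by simp
  qed
  note step = this
  have "K P" using assms by (induction P rule: finite_induct) (use K0 step in auto)
  thus ?thesis unfolding K_def .
qed

lemma den_lookup: "lkp den \<mu> = lkp den0 (\<mu> - wrho)"
  unfolding den_def using lookup_mult_ex[of den0 wrho \<mu>] by (simp add: mult.commute)

lemma den_keys: "\<mu> \<in> pkeys den ==> natc (wrho - \<mu>)"
proof -
  assume "\<mu> \<in> pkeys den"
  hence "\<mu> - wrho \<in> pkeys den0" by (simp add: in_keys_iff den_lookup)
  then obtain q where q: "\<mu> - wrho = - q" "natc q" using den0_keys[OF finite_Pos order_refl] unfolding den0_def by blast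
  have "wrho - \<mu> = - (\<mu> - wrho)" by simp
  thus ?thesis using q by simp
qed

lemma den_top: "lkp den wrho = 1" using den_lookup[of wrho] den0_keys[OF finite_Pos order_refl] unfolding den0_def by simp

lemma natc_hv_int: "natc q ==> d \<in> \<Delta> ==> \<exists>n::int. q (hv d) = of_int n"
proof -
  assume "natc q" and d: "d \<in> \<Delta>"
  then obtain c where c: "q = (\<Sum>e\<in>\<Delta>. fun_scale (of_nat (c e)) e)" unfolding nat_combination_def by blast
  have "q (hv d) \<in> \<int>" unfolding c fun_sum_apply fun_scale_def
    by (intro Ints_sum Ints_mult Ints_of_nat root_hv_int[OF Delta_root[OF d] Delta_root])
  thus ?thesis by (auto elim: Ints_cases)
qed

text \<open>With \<open>q = wrho - \<mu>\<close>, the value of \<open>\<mu>\<close> on a simple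
  coroot is the positive number \<open>1 - n\<close> for the integer value \<open>n\<close> of
  \<open>q\<close>, so \<open>n\<close> is at most 0. As \<open>q\<close> is a natural combination
  of simple roots, (q, q) is then at most 0.\<close>

lemma den_strictly_dominant: assumes \<mu>: "\<mu> \<in> pkeys den" and pos: "\<And>d. d \<in> \<Delta> ==> Re (ip \<mu> d) > 0"
  shows "\<mu> = wrho"
proof -
  define q where "q = wrho - \<mu>"
  have q: "natc q" using den_keys[OF \<mu>] by (simp add: q_def)
  then obtain c where c: "q = (\<Sum>e\<in>\<Delta>. fun_scale (of_nat (c e)) e)" unfolding nat_combination_def by blast
  have qX: "q \<in> XR" using natc_XR[OF q] .
  have mX: "\<mu> \<in> XR" using XR_diff[OF wrho_XR qX] by (simp add: q_def)
  have "Re (ip q d) \<le> 0" if d: "d \<in> \<Delta>" for d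
  proof -
    note dR = Delta_root[OF d]
    obtain n :: int where n: "q (hv d) = of_int n" using natc_hv_int[OF q d] by blast
    have "\<mu> (hv d) = 1 - of_int n" using wrho_hv[OF d] n by (simp add: q_def algebra_simps)
    hence "1 - real_of_int n > 0" using hv_sign(1)[OF dR XR_dual[OF mX]] pos[OF d] by simp
    thus ?thesis using hv_sign(1)[OF dR XR_dual[OF qX]] n by simp
  qed
  hence "Re (ip q q) \<le> 0" by (subst (2) c) (auto simp: ip_sum_right ip_scale_right intro!: sum_nonpos mult_nonneg_nonpos)
  hence "q = 0" using ip_pos[OF qX] by simp
  thus ?thesis by (simp add: q_def)
qed

lemma den_XR: "pkeys den \<subseteq> XR"
proof
  fix \<mu> assume "\<mu> \<in> pkeys den"
  hence "wrho - (wrho - \<mu>) \<in> XR" using XR_diff[OF wrho_XR natc_XR[OF den_keys]] by blast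
  thus "\<mu> \<in> XR" by simp
qed

lemma den_support: "\<mu> \<in> pkeys den ==> \<exists>w. set w \<subseteq> \<Delta> \<and> \<mu> = act w wrho"
  by (rule antisymmetric_support[OF den_lkp_refl den_XR den_strictly_dominant])

text \<open>All exponents of the denominator lie in the Weyl orbit of rho and so have the same
  length.\<close>

lemma Lap_den: "bl.Lap den = c0 (ip wrho wrho) * den"
proof (rule poly_mapping_eqI)
  fix \<mu>
  show "lkp (bl.Lap den) \<mu> = lkp (c0 (ip wrho wrho) * den) \<mu>"
  proof (cases "\<mu> \<in> pkeys den")
    case True
    then obtain w where "set w \<subseteq> \<Delta>" "\<mu> = act w wrho" using den_support by blast
    hence "ip \<mu> \<mu> = ip wrho wrho" using act_ip XR_dual[OF wrho_XR] by simp
    thus ?thesis by (simp add: bl.lookup_Lap lookup_c0_mult)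
  next
    case False
    thus ?thesis by (simp add: bl.lookup_Lap lookup_c0_mult in_keys_iff)
  qed
qed

text \<open>Evaluation along the line through \<open>y\<close>: a character tends to the dimension
  as \<open>t\<close> tends to 0.\<close>

definition ev :: "('a => complex) => complex => (('a => complex) \<Rightarrow>\<^sub>0 complex) => complex" where
  "ev y t = lext (\<lambda>x. x) (\<lambda>\<mu>. exp (t * ip \<mu> y))"

lemma ev_mult: "ev y t (p * q) = ev y t p * ev y t q" unfolding ev_def by (rule CC.lext_mult) (simp add: ip_add_left distrib_left exp_add)

lemma ev_den: "ev y t den = exp (t * ip wrho y) * (\<Prod>r\<in>Pos. 1 - exp (- t * ip r y))"
proof -
  have "ev y t (\<Prod>r\<in>Pos. 1 - ex (- r)) = (\<Prod>r\<in>Pos. ev y t (1 - ex (- r)))"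
    unfolding ev_def by (rule CC.lext_prod) (simp_all add: ip_add_left distrib_left exp_add ip_zero)
  moreover have "ev y t (1 - ex (- r)) = 1 - exp (- t * ip r y)" for r
  proof -
    have "ev y t 1 = 1" unfolding ev_def by (rule CC.lext_one) (simp add: ip_zero)
    moreover have "ev y t (1 - ex (- r)) = ev y t 1 - ev y t (ex (- r))" unfolding ev_def by (rule CC.lext_diff)
    moreover have "ev y t (ex (- r)) = exp (- t * ip r y)" unfolding ev_def CC.lext_single by (simp add: ip_uminus_left)
    ultimately show ?thesis by (simp only:)
  qed
  moreover have "ev y t (ex wrho) = exp (t * ip wrho y)" unfolding ev_def CC.lext_single by simp
  ultimately show ?thesis unfolding den_def den0_def ev_mult by (simp only:)
qed

lemma ev_sum: "ev y t p = (\<Sum>\<mu>\<in>pkeys p. lkp p \<mu> * exp (t * ip \<mu> y))" by (simp add: ev_def lext_def)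

text \<open>The symmetry \<open>\<Sum>\<^sub>w \<epsilon>(w) e\<^bsup>(w \<Lambda>, \<rho>)\<^esup> = \<Sum>\<^sub>w \<epsilon>(w) e\<^bsup>(\<Lambda>, w \<rho>)\<^esup>\<close>, where the sums over the
  Weyl group are written as sums over the supports of the alternating elements.\<close>

lemma ev_symmetry: fixes p :: "('a => complex) \<Rightarrow>\<^sub>0 complex"
  assumes \<Lambda>: "sdom \<Lambda>" and anti: "\<And>d \<mu>. d \<in> \<Delta> ==> lkp p (refl d \<mu>) = - lkp p \<mu>"
    and supp: "\<And>\<mu>. \<mu> \<in> pkeys p ==> \<exists>w. set w \<subseteq> \<Delta> \<and> \<mu> = act w \<Lambda>" and top: "lkp p \<Lambda> = 1"
  shows "ev wrho t p = ev \<Lambda> t den"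
proof -
  have Ld: "\<Lambda> \<in> dual H" using \<Lambda> XR_dual by (simp add: sdom_def)
  have rd: "wrho \<in> dual H" using XR_dual wrho_XR by blast
  obtain W where W: "\<And>\<mu>. \<mu> \<in> pkeys p ==> set (W \<mu>) \<subseteq> \<Delta>" "\<And>\<mu>. \<mu> \<in> pkeys p ==> act (W \<mu>) \<Lambda> = \<mu>"
    using supp by metis
  \<comment> \<open>If \<open>\<mu>\<close> is the image of \<open>\<Lambda>\<close> under w, this
    is the image of rho under the inverse of w. Strict dominance of both points makes the
    correspondence of exponents bijective.\<close>
  define g where "g = (\<lambda>\<mu>. act (rev (W \<mu>)) wrho)"
  have lkden: "lkp den (act w wrho) = (- 1) ^ length w" if "set w \<subseteq> \<Delta>" for w
    using antisymmetric_act[OF den_lkp_refl that, of wrho] den_top by simp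
  have lkp': "lkp p (act w \<Lambda>) = (- 1) ^ length w" if "set w \<subseteq> \<Delta>" for w
    using antisymmetric_act[OF anti that, of \<Lambda>] top by simp
  have g1: "lkp den (g \<mu>) = lkp p \<mu>" "ip \<Lambda> (g \<mu>) = ip \<mu> wrho" if "\<mu> \<in> pkeys p" for \<mu>
  proof -
    show "lkp den (g \<mu>) = lkp p \<mu>" using lkden[of "rev (W \<mu>)"] lkp'[of "W \<mu>"] W[OF that] by (simp add: g_def)
    show "ip \<Lambda> (g \<mu>) = ip \<mu> wrho" using act_ip_rev[OF W(1)[OF that] Ld rd] W(2)[OF that] by (simp add: g_def)
  qed
  have bij: "bij_betw g (pkeys p) (pkeys den)"
  proof (rule bij_betwI')
    fix \<mu> \<nu> assume m: "\<mu> \<in> pkeys p" "\<nu> \<in> pkeys p"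
    show "g \<mu> = g \<nu> \<longleftrightarrow> \<mu> = \<nu>"
    proof
      assume "g \<mu> = g \<nu>"
      hence "act (rev (rev (W \<mu>))) \<Lambda> = act (rev (rev (W \<nu>))) \<Lambda>"
        using W m by (intro sdom_act_eq(2)[OF sdom_wrho _ _ _ Ld]) (auto simp: g_def)
      thus "\<mu> = \<nu>" using W m by simp
    qed simp
  next
    fix \<mu> assume "\<mu> \<in> pkeys p"
    thus "g \<mu> \<in> pkeys den" using g1 by (simp add: in_keys_iff)
  next
    fix \<nu> assume "\<nu> \<in> pkeys den"
    then obtain v where v: "set v \<subseteq> \<Delta>" "\<nu> = act v wrho" using den_support by blast
    define \<mu> where "\<mu> = act (rev v) \<Lambda>"
    have m: "\<mu> \<in> pkeys p" using lkp'[of "rev v"] v(1) by (simp add: \<mu>_def in_keys_iff)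
    have "act (rev (W \<mu>)) wrho = act (rev (rev v)) wrho"
      using W[OF m] v(1) by (intro sdom_act_eq(2)[OF \<Lambda> _ _ _ rd]) (auto simp: \<mu>_def)
    thus "\<exists>\<mu>\<in>pkeys p. \<nu> = g \<mu>" using m v(2) by (intro bexI[of _ \<mu>]) (auto simp: g_def)
  qed
  have "ev wrho t p = (\<Sum>\<mu>\<in>pkeys p. lkp den (g \<mu>) * exp (t * ip (g \<mu>) \<Lambda>))"
    unfolding ev_sum using g1 ip_sym[of \<Lambda>] by (intro sum.cong) auto
  also have "\<dots> = ev \<Lambda> t den"
    unfolding ev_sum by (rule sum.reindex_bij_betw[OF bij, of "\<lambda>\<nu>. lkp den \<nu> * exp (t * ip \<nu> \<Lambda>)"])
  finally show ?thesis .
qed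

end

lemma exp_quotient_limit: "((\<lambda>t::complex. (1 - exp (- t * a)) / t) \<longlongrightarrow> a) (at 0)"
proof -
  have "((\<lambda>t. - exp (- t * a)) has_field_derivative a) (at 0)" by (auto intro!: derivative_eq_intros)
  thus ?thesis by (simp add: has_field_derivative_iff)
qed

lemma prod_exp_quotient_limit: assumes "finite P"
  shows "((\<lambda>t::complex. (\<Prod>r\<in>P. 1 - exp (- t * a r)) / t ^ card P) \<longlongrightarrow> (\<Prod>r\<in>P. a r)) (at 0)"
proof -
  have "(\<Prod>r\<in>P. 1 - exp (- t * a r)) / t ^ card P = (\<Prod>r\<in>P. (1 - exp (- t * a r)) / t)" for t
    using assms by (simp add: prod_dividef)
  thus ?thesis using tendsto_prod[of P "\<lambda>r t. (1 - exp (- t * a r)) / t" a "at 0"] exp_quotient_limit by simp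
qed

section \<open>Characters and Freudenthal's identity\<close>

context based_rep
begin

definition ch :: "('a => complex) \<Rightarrow>\<^sub>0 complex" where "ch = (\<Sum>\<mu>\<in>weights. sgl \<mu> (of_nat (wmult \<mu>)))"

lemma lkp_ch: "lkp ch \<mu> = (if \<mu> \<in> weights then of_nat (wmult \<mu>) else 0)"
proof -
  have "lkp ch \<mu> = (\<Sum>\<nu>\<in>weights. if \<nu> = \<mu> then of_nat (wmult \<nu>) else 0)"
    unfolding ch_def lookup_sum by (intro sum.cong) (auto simp: lookup_single when_def)
  thus ?thesis using finite_weights by simp
qed

lemma lkp_ch_dual: "\<mu> \<in> dual H ==> lkp ch \<mu> = of_nat (wmult \<mu>)" using wmult_zero by (auto simp: lkp_ch)

lemma ch_refl: "d \<in> \<Delta> ==> lkp ch (refl d \<mu>) = lkp ch \<mu>"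
proof -
  assume d: "d \<in> \<Delta>"
  note dR = Delta_root[OF d]
  show ?thesis
  proof (cases "\<mu> \<in> dual H")
    case True
    thus ?thesis using refl_dual[OF dR] wmult_refl[OF dR] by (simp add: lkp_ch_dual)
  next
    case False
    hence "refl d \<mu> \<notin> dual H" using refl_dual[OF dR, of "refl d \<mu>"] refl_involution[OF dR] by auto
    thus ?thesis using False by (simp add: lkp_ch weights_def)
  qed
qed

lemma smap_ch: "d \<in> \<Delta> ==> smap (refl d) ch = ch" by (rule poly_mapping_eqI) (simp add: lkp_refl ch_refl)

definition Th :: "('a => complex) => ('a => complex) \<Rightarrow>\<^sub>0 complex" where
  "Th r = (\<Sum>\<mu>\<in>weights. sgl \<mu> (tr2 (rv (- r)) (rv r) \<mu>))"

lemma lkp_Th: "lkp (Th r) \<mu> = (if \<mu> \<in> weights then tr2 (rv (- r)) (rv r) \<mu> else 0)"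
proof -
  have "lkp (Th r) \<mu> = (\<Sum>\<nu>\<in>weights. if \<nu> = \<mu> then tr2 (rv (- r)) (rv r) \<nu> else 0)"
    unfolding Th_def lookup_sum by (intro sum.cong) (auto simp: lookup_single when_def)
  thus ?thesis using finite_weights by simp
qed

lemma lkp_Th_dual: "\<mu> \<in> dual H ==> lkp (Th r) \<mu> = tr2 (rv (- r)) (rv r) \<mu>" using tr2_zero by (auto simp: lkp_Th weights_def)

text \<open>This is \<open>tr2_recursion\<close> for all weights at once. \<open>Th r\<close> is the
  finite element that replaces a geometric series for the quotient by
  \<open>1 - ex (- r)\<close>.\<close>

lemma Th_recursion: assumes r: "r \<in> roots H" shows "(1 - ex (- r)) * Th r = ex (- r) * bl.Dv r ch"
proof (rule poly_mapping_eqI)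
  fix \<nu>
  define \<mu> where "\<mu> = \<nu> + r"
  have eq: "\<nu> - - r = \<mu>" "\<nu> = \<mu> - r" by (simp_all add: \<mu>_def)
  have L: "lkp ((1 - ex (- r)) * Th r) \<nu> = lkp (Th r) (\<mu> - r) - lkp (Th r) \<mu>"
  proof -
    have "(1 - ex (- r)) * Th r = Th r - Th r * ex (- r)" by (simp add: algebra_simps)
    thus ?thesis unfolding lookup_minus eq(2)[symmetric] by (simp only: lookup_minus lookup_mult_ex eq(1))
  qed
  have R: "lkp (ex (- r) * bl.Dv r ch) \<nu> = ip \<mu> r * lkp ch \<mu>"
    using lookup_mult_ex[of "bl.Dv r ch" "- r" \<nu>] unfolding eq(1) by (simp add: mult.commute bl.lookup_Dv)
  note rd = rootsD(1)[OF r]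
  show "lkp ((1 - ex (- r)) * Th r) \<nu> = lkp (ex (- r) * bl.Dv r ch) \<nu>"
  proof (cases "\<mu> \<in> dual H")
    case True
    have "br (rv r) (rv (- r)) = tv r" by (rule rv_br[OF r])
    hence "tr2 (rv (- r)) (rv r) (\<mu> - r) = tr2 (rv (- r)) (rv r) \<mu> + \<mu> (tv r) * of_nat (wmult \<mu>)"
      using tr2_recursion[OF rv(1)[OF r] rv(1)[OF neg_root[OF r]], of \<mu>] tv(1)[OF r] by simp
    thus ?thesis unfolding L R using True dual_diff[OF True rd] ip_root[OF r True] by (simp add: lkp_Th_dual lkp_ch_dual)
  next
    case False
    hence "\<mu> - r \<notin> dual H" using dual_add[OF _ rd, of "\<mu> - r"] by auto
    thus ?thesis unfolding L R using False by (simp add: lkp_Th lkp_ch weights_def)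
  qed
qed

context fixes l assumes cas_scalar: "\<And>v. v \<in> V ==> casimir B \<rho> v = sV (cas l) v"
    and l_dom: "dominant l" and weights_le: "\<And>\<mu>. \<mu> \<in> weights ==> natc (l - \<mu>)"
    and l_mult: "wmult l = 1" and wtd: weighted
begin

text \<open>On each weight space the trace of the Casimir operator is computed twice: as the scalar
  \<open>cas l\<close>, and by \<open>casimir_weight\<close>.\<close>

lemma freudenthal: "c0 (cas l) * ch = bl.Lap ch + c0 2 * bl.Dv wrho ch + c0 2 * (\<Sum>r\<in>Pos. Th r)"
proof (rule poly_mapping_eqI)
  fix \<mu>
  show "lkp (c0 (cas l) * ch) \<mu> = lkp (bl.Lap ch + c0 2 * bl.Dv wrho ch + c0 2 * (\<Sum>r\<in>Pos. Th r)) \<mu>"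
  proof (cases "\<mu> \<in> weights")
    case True
    hence \<mu>: "\<mu> \<in> dual H" by (simp add: weights_def)
    have in_w: "\<rho> (rv (- r)) (\<rho> (rv r) v) \<in> wsp \<mu>" if "v \<in> wsp \<mu>" "r \<in> Pos" for v r
    proof -
      have r: "r \<in> roots H" using that Pos_root by blast
      have "\<mu> + r + - r = \<mu>" by simp
      thus ?thesis using wsp_shift[OF rv(1)[OF neg_root[OF r]] wsp_shift[OF rv(1)[OF r] that(1)]] by metis
    qed
    have rho2: "(\<Sum>r\<in>Pos. \<mu> (tv r)) = 2 * ip \<mu> wrho"
    proof -
      have "(\<Sum>r\<in>Pos. \<mu> (tv r)) = ip \<mu> (\<Sum>r\<in>Pos. r)" unfolding ip_sum_right using ip_root[OF Pos_root \<mu>] by simp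
      thus ?thesis unfolding two_wrho ip_scale_right .
    qed
    note wS = M.subspace_scale[OF wsp_subspace] M.subspace_sum[OF wsp_subspace]
    have "cas l * of_nat (wmult \<mu>) = M.trace_on (wsp \<mu>) (\<lambda>v. sV (cas l) v)"
      using wsp_fin_dim wS by (simp add: M.trace_on_scale M.trace_on_id wmult_def)
    also have "\<dots> = M.trace_on (wsp \<mu>) (\<lambda>v. sV (cas \<mu>) v + sV 2 (\<Sum>r\<in>Pos. \<rho> (rv (- r)) (\<rho> (rv r) v)))"
    proof (rule M.trace_on_cong[OF wsp_fin_dim])
      fix v assume v: "v \<in> wsp \<mu>"
      show "sV (cas l) v = sV (cas \<mu>) v + sV 2 (\<Sum>r\<in>Pos. \<rho> (rv (- r)) (\<rho> (rv r) v))"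
        using cas_scalar[OF wspD(1)[OF v]] casimir_weight[OF roots_Pos v \<mu>] unfolding rho2 by (simp add: cas_def)
    qed
    also have "\<dots> = M.trace_on (wsp \<mu>) (\<lambda>v. sV (cas \<mu>) v) +
       M.trace_on (wsp \<mu>) (\<lambda>v. sV 2 (\<Sum>r\<in>Pos. \<rho> (rv (- r)) (\<rho> (rv r) v)))"
      by (rule M.trace_on_add[OF wsp_fin_dim]) (auto intro!: wS in_w)
    also have "M.trace_on (wsp \<mu>) (\<lambda>v. sV (cas \<mu>) v) = cas \<mu> * of_nat (wmult \<mu>)"
      using wsp_fin_dim wS by (simp add: M.trace_on_scale M.trace_on_id wmult_def)
    also have "M.trace_on (wsp \<mu>) (\<lambda>v. sV 2 (\<Sum>r\<in>Pos. \<rho> (rv (- r)) (\<rho> (rv r) v))) =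
       2 * M.trace_on (wsp \<mu>) (\<lambda>v. \<Sum>r\<in>Pos. \<rho> (rv (- r)) (\<rho> (rv r) v))"
      by (rule M.trace_on_scale[OF wsp_fin_dim]) (auto intro!: wS in_w)
    also have "M.trace_on (wsp \<mu>) (\<lambda>v. \<Sum>r\<in>Pos. \<rho> (rv (- r)) (\<rho> (rv r) v)) = (\<Sum>r\<in>Pos. tr2 (rv (- r)) (rv r) \<mu>)"
      unfolding tr2_def by (rule M.trace_on_sum[OF wsp_fin_dim finite_Pos]) (auto intro!: in_w)
    finally show ?thesis
      using True by (simp only: lookup_add lookup_c0_mult bl.lookup_Lap bl.lookup_Dv lookup_sum lkp_ch lkp_Th if_True cas_def)
        (simp add: algebra_simps)
  next
    case False
    thus ?thesis by (simp only: lookup_add lookup_c0_mult bl.lookup_Lap bl.lookup_Dv lookup_sum lkp_ch lkp_Th if_False) simp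
  qed
qed

definition "J = den * ch"

text \<open>By \<open>Gam_prod\<close> the mixed term of the product rule is the denominator times
  the traces \<open>Th\<close> and the derivative along rho, which are exactly the terms of
  \<open>freudenthal\<close>. What remains is (rho, rho) + \<open>cas l\<close>, the squared length
  of l + rho.\<close>

lemma Lap_J: "bl.Lap J = c0 (ip (l + wrho) (l + wrho)) * J"
proof -
  have "bl.Gam den ch = ex wrho * bl.Gam den0 ch + den0 * bl.Gam (ex wrho) ch" unfolding den_def by (rule bl.Gam_mult)
  also have "bl.Gam den0 ch = den0 * (\<Sum>r\<in>Pos. Th r)"
    unfolding den0_def by (rule bl.Gam_prod[OF finite_Pos Th_recursion[OF Pos_root]])
  finally have G: "bl.Gam den ch = den * ((\<Sum>r\<in>Pos. Th r) + bl.Dv wrho ch)"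
    unfolding bl.Gam_ex den_def by (simp only: algebra_simps)
  have "bl.Lap J = c0 (ip wrho wrho) * den * ch + den * (bl.Lap ch + c0 2 * bl.Dv wrho ch + c0 2 * (\<Sum>r\<in>Pos. Th r))"
    unfolding J_def bl.Lap_mult Lap_den G by (simp only: algebra_simps)
  also have "\<dots> = (c0 (ip wrho wrho) + c0 (cas l)) * J" unfolding freudenthal[symmetric] J_def by (simp only: algebra_simps)
  also have "c0 (ip wrho wrho) + c0 (cas l) = c0 (ip (l + wrho) (l + wrho))"
    unfolding single_add[symmetric] cas_def ip_add_left ip_add_right using ip_sym[of wrho l] by (simp add: algebra_simps)
  finally show ?thesis .
qed

lemma J_lkp_refl: "d \<in> \<Delta> ==> lkp J (refl d \<mu>) = - lkp J \<mu>"
  using lkp_refl[of d J \<mu>] unfolding J_def smap_refl_mult by (simp add: den_antisym smap_ch)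

lemma J_keys: "\<mu> \<in> pkeys J ==> natc (l + wrho - \<mu>)"
proof -
  assume "\<mu> \<in> pkeys J"
  then obtain a b where ab: "\<mu> = a + b" "a \<in> pkeys den" "b \<in> pkeys ch"
    unfolding J_def using Poly_Mapping.keys_mult[of den ch] by blast
  have "b \<in> weights" using ab(3) by (auto simp: in_keys_iff lkp_ch split: if_splits)
  hence "natc ((l - b) + (wrho - a))" using weights_le den_keys[OF ab(2)] natc_add by blast
  moreover have "(l - b) + (wrho - a) = l + wrho - \<mu>" using ab(1) by (simp add: algebra_simps)
  ultimately show ?thesis by simp
qed

lemma J_top: "lkp J (l + wrho) = 1"
proof -
  have "J = (\<Sum>\<mu>\<in>weights. c0 (of_nat (wmult \<mu>)) * (den * ex \<mu>))"
  proof -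
    have "sgl \<mu> (of_nat (wmult \<mu>)) = c0 (of_nat (wmult \<mu>)) * ex \<mu>" for \<mu> :: "'a => complex"
      by (simp only: mult_single add_0_left mult_1_right)
    thus ?thesis unfolding J_def ch_def sum_distrib_left by (simp only: ac_simps)
  qed
  hence "lkp J (l + wrho) = (\<Sum>\<mu>\<in>weights. of_nat (wmult \<mu>) * lkp den (l + wrho - \<mu>))"
    by (simp only: lookup_sum lookup_c0_mult lookup_mult_ex)
  also have "\<dots> = (\<Sum>\<mu>\<in>weights. if \<mu> = l then 1 else 0)"
  proof (rule sum.cong[OF refl])
    fix \<mu> assume m: "\<mu> \<in> weights"
    show "of_nat (wmult \<mu>) * lkp den (l + wrho - \<mu>) = (if \<mu> = l then 1 else 0)"
    proof (cases "\<mu> = l")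
      case True
      thus ?thesis using l_mult den_top by simp
    next
      case False
      have "l + wrho - \<mu> \<notin> pkeys den"
      proof
        assume "l + wrho - \<mu> \<in> pkeys den"
        hence "natc (wrho - (l + wrho - \<mu>))" by (rule den_keys)
        moreover have "wrho - (l + wrho - \<mu>) = - (l - \<mu>)" by simp
        ultimately have "l - \<mu> = 0" using natc_antisym[OF weights_le[OF m]] by simp
        thus False using False by simp
      qed
      thus ?thesis using False by (simp add: in_keys_iff)
    qed
  qed
  also have "\<dots> = 1"
  proof -
    have "wsp l \<noteq> {0}" using l_mult wsp_zero_dim[of l] by simp
    hence "l \<in> weights" using l_dom XR_dual by (simp add: weights_def dominant_def)
    thus ?thesis using finite_weights by simp
  qed
  finally show ?thesis .
qed

lemma J_XR: "pkeys J \<subseteq> XR"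
proof
  fix \<mu> assume "\<mu> \<in> pkeys J"
  hence "l + wrho - (l + wrho - \<mu>) \<in> XR"
    using XR_diff[OF XR_add[OF _ wrho_XR] natc_XR[OF J_keys]] l_dom by (simp only: dominant_def)
  thus "\<mu> \<in> XR" by simp
qed

text \<open>By \<open>Lap_J\<close> an exponent mu of \<open>J\<close> has the length of L = l +
  rho, so (L - mu, L + mu) = 0. But L - mu is a natural combination of simple roots, each with a
  positive product with L + mu.\<close>

lemma J_strictly_dominant: assumes \<mu>: "\<mu> \<in> pkeys J" and pos: "\<And>d. d \<in> \<Delta> ==> Re (ip \<mu> d) > 0"
  shows "\<mu> = l + wrho"
proof -
  let ?L = "l + wrho"
  have L: "sdom ?L" using sdom_dominant_add[OF l_dom] .
  have "ip \<mu> \<mu> * lkp J \<mu> = ip ?L ?L * lkp J \<mu>"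
    using arg_cong[OF Lap_J, of "\<lambda>p. lkp p \<mu>"] unfolding bl.lookup_Lap lookup_c0_mult .
  hence eq: "ip \<mu> \<mu> = ip ?L ?L" using \<mu> by (simp add: in_keys_iff)
  obtain c where c: "?L - \<mu> = (\<Sum>e\<in>\<Delta>. fun_scale (of_nat (c e)) e)"
    using J_keys[OF \<mu>] unfolding nat_combination_def by blast
  have "ip (?L - \<mu>) (?L + \<mu>) = 0"
    unfolding ip_diff_left ip_add_right[of ?L ?L \<mu>] ip_add_right[of \<mu> ?L \<mu>] eq ip_sym[of \<mu> ?L] by simp
  hence "(\<Sum>e\<in>\<Delta>. of_nat (c e) * ip e (?L + \<mu>)) = 0" unfolding c ip_sum_left ip_scale_left .
  hence "Re (\<Sum>e\<in>\<Delta>. of_nat (c e) * ip e (?L + \<mu>)) = 0" by (simp only: zero_complex.sel)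
  hence z: "(\<Sum>e\<in>\<Delta>. of_nat (c e) * Re (ip e (?L + \<mu>))) = 0" by simp
  have p: "Re (ip e (?L + \<mu>)) > 0" if e: "e \<in> \<Delta>" for e
  proof -
    have "Re (ip ?L e) > 0" using L Delta_Pos[OF e] by (simp only: sdom_def)
    thus ?thesis using pos[OF e] unfolding ip_add_right[of e ?L \<mu>] ip_sym[of e ?L] ip_sym[of e \<mu>] by simp
  qed
  have "\<forall>e\<in>\<Delta>. of_nat (c e) * Re (ip e (?L + \<mu>)) = 0"
    using z p Delta_finite by (subst (asm) sum_nonneg_eq_0_iff) (auto simp: less_imp_le)
  hence "c e = 0" if "e \<in> \<Delta>" for e using p[OF that] that by auto
  hence "?L - \<mu> = 0" unfolding c by (simp add: fun_eq_iff fun_sum_apply fun_scale_def)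
  thus ?thesis by simp
qed

lemma ev_J: "ev wrho t J = ev (l + wrho) t den" by (rule ev_symmetry[OF sdom_dominant_add[OF l_dom] J_lkp_refl
        antisymmetric_support[OF J_lkp_refl J_XR J_strictly_dominant] J_top])

text \<open>Divide \<open>ev_J\<close> by the power of t given by the number of positive roots and
  let t tend to 0: each factor of the denominator contributes the product of its root with the
  evaluation point, and the character contributes the dimension.\<close>

theorem weyl_dimension: "(\<Prod>r\<in>Pos. ip r wrho) * of_nat (M.dim V) = (\<Prod>r\<in>Pos. ip r (l + wrho))"
proof -
  let ?L = "l + wrho" and ?n = "card Pos"
  define f where "f = (\<lambda>t. exp (t * ip wrho wrho) * ((\<Prod>r\<in>Pos. 1 - exp (- t * ip r wrho)) / t ^ ?n) * ev wrho t ch)"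
  define g where "g = (\<lambda>t. exp (t * ip wrho ?L) * ((\<Prod>r\<in>Pos. 1 - exp (- t * ip r ?L)) / t ^ ?n))"
  have "f t = ev wrho t J / t ^ ?n" for t unfolding f_def J_def ev_mult ev_den by simp
  moreover have "g t = ev ?L t den / t ^ ?n" for t unfolding g_def ev_den by simp
  ultimately have fg: "f = g" using ev_J by auto
  have "((\<lambda>t. ev wrho t ch) \<longlongrightarrow> (\<Sum>\<mu>\<in>pkeys ch. lkp ch \<mu> * exp (0 * ip \<mu> wrho))) (at 0)"
    unfolding ev_sum by (intro tendsto_intros)
  also have "(\<Sum>\<mu>\<in>pkeys ch. lkp ch \<mu> * exp (0 * ip \<mu> wrho)) = (\<Sum>\<mu>\<in>weights. of_nat (wmult \<mu>))"
    by (rule sum.mono_neutral_cong_left) (auto simp: finite_weights in_keys_iff lkp_ch split: if_splits)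
  also have "\<dots> = of_nat (M.dim V)" unfolding weighted_dim[OF wtd] by simp
  finally have chl: "((\<lambda>t. ev wrho t ch) \<longlongrightarrow> of_nat (M.dim V)) (at 0)" .
  have e: "((\<lambda>t. exp (t * a)) \<longlongrightarrow> 1) (at 0)" for a :: complex
  proof -
    have "((\<lambda>t. exp (t * a)) \<longlongrightarrow> exp (0 * a)) (at 0)" by (intro tendsto_intros)
    thus ?thesis by simp
  qed
  have "(f \<longlongrightarrow> 1 * (\<Prod>r\<in>Pos. ip r wrho) * of_nat (M.dim V)) (at 0)"
    unfolding f_def by (intro tendsto_mult e chl prod_exp_quotient_limit finite_Pos)
  moreover have "(g \<longlongrightarrow> 1 * (\<Prod>r\<in>Pos. ip r ?L)) (at 0)"
    unfolding g_def by (intro tendsto_mult e prod_exp_quotient_limit finite_Pos)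
  ultimately have "1 * (\<Prod>r\<in>Pos. ip r wrho) * of_nat (M.dim V) = 1 * (\<Prod>r\<in>Pos. ip r ?L)"
    unfolding fg by (intro tendsto_unique[of "at (0::complex)" g]) auto
  thus ?thesis by simp
qed

end

end

section \<open>Symmetric powers of the adjoint module\<close>

context lie_algebra
begin

lemma tensor_power_induct: assumes "T \<in> tensor_power k" "fun_space.subspace {T. P T}"
    and "\<And>xs. length xs = k ==> set xs \<subseteq> G ==> P (tensor xs)" shows "P T"
proof -
  have "tensor_power k \<subseteq> {T. P T}" unfolding tensor_power_def using assms(2,3) by (intro fun_space.span_minimal) auto
  thus ?thesis using assms(1) by blast
qed

lemma eq_subspace: fixes F :: "('c => complex) => 'd => complex"
  assumes "\<And>S T. F (S + T) = F S + F T" "\<And>c T. F (fun_scale c T) = fun_scale c (F T)"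
    and "\<And>S T. F' (S + T) = F' S + F' T" "\<And>c T. F' (fun_scale c T) = fun_scale c (F' T)"
  shows "fun_space.subspace {T. F T = F' T}"
proof (rule fun_space.subspaceI)
  have "F (fun_scale 0 0) = fun_scale 0 (F 0)" "F' (fun_scale 0 0) = fun_scale 0 (F' 0)" by (rule assms)+
  thus "0 \<in> {T. F T = F' T}" by simp
qed (simp_all add: assms)

lemma ta_add: "tensor_action k x (S + T) = tensor_action k x S + tensor_action k x T"
  by (rule ext) (simp add: tensor_action_def sum.distrib)

lemma ta_scale: "tensor_action k x (fun_scale c T) = fun_scale c (tensor_action k x T)"
  by (rule ext) (simp add: tensor_action_def fun_scale_def sum_distrib_left)

lemma tensor_slot: assumes "length xs = k" "i < k" "fs \<in> dual_lists k"
  shows "tensor (xs[i := a]) fs = (fs ! i) a * (\<Prod>j\<in>{..<k} - {i}. (fs ! j) (xs ! j))"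
proof -
  have "tensor (xs[i := a]) fs = (\<Prod>j<k. (fs ! j) (xs[i := a] ! j))" using assms by (simp add: tensor_def)
  also have "\<dots> = (fs ! i) (xs[i := a] ! i) * (\<Prod>j\<in>{..<k} - {i}. (fs ! j) (xs[i := a] ! j))"
    using assms by (intro prod.remove) auto
  also have "\<dots> = (fs ! i) a * (\<Prod>j\<in>{..<k} - {i}. (fs ! j) (xs ! j))" using assms by (auto intro!: prod.cong)
  finally show ?thesis .
qed

lemma tensor_outside: "length xs = k ==> fs \<notin> dual_lists k ==> tensor xs fs = 0" by (simp add: tensor_def)

lemma tensor_slot_add: assumes "length xs = k" "i < k" "a \<in> G" "b \<in> G"
  shows "tensor (xs[i := a + b]) = tensor (xs[i := a]) + tensor (xs[i := b])"
proof
  fix fs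
  show "tensor (xs[i := a + b]) fs = (tensor (xs[i := a]) + tensor (xs[i := b])) fs"
  proof (cases "fs \<in> dual_lists k")
    case True
    hence "fs ! i \<in> dual G" using assms by (auto simp: dual_lists_def)
    hence "(fs ! i) (a + b) = (fs ! i) a + (fs ! i) b" using assms by (simp add: dual_def)
    thus ?thesis using tensor_slot[OF assms(1,2) True] by (simp add: distrib_right)
  next
    case False
    thus ?thesis using assms(1) by (simp add: tensor_outside)
  qed
qed

lemma tensor_slot_scale: assumes "length xs = k" "i < k" "a \<in> G" shows "tensor (xs[i := scale c a]) = fun_scale c (tensor (xs[i := a]))"
proof
  fix fs
  show "tensor (xs[i := scale c a]) fs = fun_scale c (tensor (xs[i := a])) fs"
  proof (cases "fs \<in> dual_lists k")
    case True
    hence "fs ! i \<in> dual G" using assms by (auto simp: dual_lists_def)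
    hence "(fs ! i) (scale c a) = c * (fs ! i) a" using assms by (simp add: dual_def)
    thus ?thesis using tensor_slot[OF assms(1,2) True] by (simp add: fun_scale_def)
  next
    case False
    thus ?thesis using assms(1) by (simp add: tensor_outside fun_scale_def)
  qed
qed

lemma tensor_slot_diff: assumes "length xs = k" "i < k" "a \<in> G" "b \<in> G"
  shows "tensor (xs[i := a - b]) = tensor (xs[i := a]) - tensor (xs[i := b])"
proof -
  have "tensor (xs[i := (a - b) + b]) = tensor (xs[i := a - b]) + tensor (xs[i := b])"
    using assms carrier_subspace by (intro tensor_slot_add) (auto simp: subspace_diff)
  thus ?thesis by simp
qed

lemma tensor_in: "length xs = k ==> set xs \<subseteq> G ==> tensor xs \<in> tensor_power k"
  unfolding tensor_power_def by (rule fun_space.span_base) blast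

lemma tensor_span: assumes S: "S \<subseteq> G" "G \<subseteq> span S"
  shows "tensor_power k \<subseteq> fun_space.span {tensor ys | ys. length ys = k \<and> set ys \<subseteq> S}" (is "_ \<subseteq> ?X")
proof -
  \<comment> \<open>The number \<open>n\<close> counts the leading entries still allowed to be
    arbitrary elements of \<open>G\<close>; they are replaced one at a time by
    multilinearity.\<close>
  have "tensor xs \<in> ?X" if "length xs = k" "set xs \<subseteq> G" "\<And>i. n \<le> i ==> i < k ==> xs ! i \<in> S" for n xs using that
  proof (induction n arbitrary: xs)
    case 0
    hence "set xs \<subseteq> S" by (auto simp: in_set_conv_nth)
    thus ?case using 0 by (intro fun_space.span_base) blast
  next
    case (Suc n)
    show ?case
    proof (cases "n < k")
      case True
      let ?A = "{x \<in> G. tensor (xs[n := x]) \<in> ?X}"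
      have "subspace ?A"
      proof (rule subspaceI)
        have "tensor (xs[n := scale 0 0]) = fun_scale 0 (tensor (xs[n := 0]))"
          using Suc.prems True subspace_0[OF carrier_subspace] by (intro tensor_slot_scale)
        thus "0 \<in> ?A"
          using subspace_0[OF carrier_subspace] fun_space.span_zero by (simp only: scale_zero_left fun_space.scale_zero_left mem_Collect_eq) simp
      next
        fix x y assume "x \<in> ?A" "y \<in> ?A"
        thus "x + y \<in> ?A" using Suc.prems True subspace_add[OF carrier_subspace]
          by (auto simp only: mem_Collect_eq tensor_slot_add intro!: fun_space.span_add)
      next
        fix c x assume "x \<in> ?A"
        thus "scale c x \<in> ?A" using Suc.prems True subspace_scale[OF carrier_subspace]
          by (auto simp only: mem_Collect_eq tensor_slot_scale intro!: fun_space.span_scale)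
      qed
      moreover have "S \<subseteq> ?A"
      proof
        fix s assume s: "s \<in> S"
        have "tensor (xs[n := s]) \<in> ?X"
        proof (rule Suc.IH)
          show "set (xs[n := s]) \<subseteq> G" using Suc.prems s S(1) set_update_subset_insert[of xs n s] by blast
          show "xs[n := s] ! i \<in> S" if "n \<le> i" "i < k" for i using that Suc.prems s by (cases "i = n") auto
        qed (use Suc.prems in simp)
        thus "s \<in> ?A" using s S(1) by blast
      qed
      ultimately have "span S \<subseteq> ?A" by (intro span_minimal)
      moreover have "xs ! n \<in> G" using Suc.prems True by auto
      ultimately have "tensor (xs[n := xs ! n]) \<in> ?X" using S(2) by blast
      thus ?thesis by simp
    next
      case False
      thus ?thesis using Suc.prems by (intro Suc.IH) auto
    qed
  qed
  from this[of _ k] show ?thesis unfolding tensor_power_def by (intro fun_space.span_minimal fun_space.subspace_span) auto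
qed

lemma br_update: "x \<in> G ==> set xs \<subseteq> G ==> i < length xs ==> set (xs[i := br x (xs ! i)]) \<subseteq> G"
proof -
  assume x: "x \<in> G" "set xs \<subseteq> G" "i < length xs"
  hence "br x (xs ! i) \<in> G" by (intro br_closed) auto
  thus ?thesis using set_update_subset_insert[of xs i "br x (xs ! i)"] x by blast
qed

lemma ta_sum: "tensor_action k x (\<Sum>i\<in>I. f i) = (\<Sum>i\<in>I. tensor_action k x (f i))"
proof
  fix fs
  show "tensor_action k x (\<Sum>i\<in>I. f i) fs = (\<Sum>i\<in>I. tensor_action k x (f i)) fs"
  proof (cases "fs \<in> dual_lists k")
    case True
    thus ?thesis unfolding tensor_action_def fun_sum_apply by simp (rule sum.swap)
  next
    case False
    thus ?thesis unfolding tensor_action_def fun_sum_apply by simp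
  qed
qed

lemma ta_in: assumes x: "x \<in> G" and T: "T \<in> tensor_power k" shows "tensor_action k x T \<in> tensor_power k"
proof (rule tensor_power_induct[OF T])
  have S: "fun_space.subspace (tensor_power k)" unfolding tensor_power_def by (rule fun_space.subspace_span)
  show "fun_space.subspace {T. tensor_action k x T \<in> tensor_power k}"
  proof (rule fun_space.subspaceI)
    have "tensor_action k x (fun_scale 0 0) = fun_scale 0 (tensor_action k x 0)" by (rule ta_scale)
    thus "0 \<in> {T. tensor_action k x T \<in> tensor_power k}" using fun_space.subspace_0[OF S] by simp
  qed (simp_all add: ta_add ta_scale fun_space.subspace_add[OF S] fun_space.subspace_scale[OF S])
  fix xs assume xs: "length xs = k" "set xs \<subseteq> G"
  show "tensor_action k x (tensor xs) \<in> tensor_power k" unfolding tensor_action_tensor[OF x xs]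
    using br_update[OF x xs(2)] xs by (intro fun_space.subspace_sum[OF S] tensor_in) auto
qed

lemma ta_add_left: assumes x: "x \<in> G" "y \<in> G" and T: "T \<in> tensor_power k"
  shows "tensor_action k (x + y) T = tensor_action k x T + tensor_action k y T"
proof (rule tensor_power_induct[OF T])
  show "fun_space.subspace {T. tensor_action k (x + y) T = tensor_action k x T + tensor_action k y T}"
    by (rule eq_subspace) (simp_all add: ta_add ta_scale fun_space.scale_right_distrib)
  fix xs assume xs: "length xs = k" "set xs \<subseteq> G"
  have xG: "i < k ==> xs ! i \<in> G" for i using xs by auto
  have xy: "x + y \<in> G" using x carrier_subspace by (simp add: subspace_add)
  show "tensor_action k (x + y) (tensor xs) = tensor_action k x (tensor xs) + tensor_action k y (tensor xs)"
    unfolding tensor_action_tensor[OF x(1) xs] tensor_action_tensor[OF x(2) xs] tensor_action_tensor[OF xy xs]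
      sum.distrib[symmetric] using x xs(1) xG br_closed by (intro sum.cong refl) (simp add: br_add_left tensor_slot_add)
qed

lemma ta_scale_left: assumes x: "x \<in> G" and T: "T \<in> tensor_power k"
  shows "tensor_action k (scale c x) T = fun_scale c (tensor_action k x T)"
proof (rule tensor_power_induct[OF T])
  show "fun_space.subspace {T. tensor_action k (scale c x) T = fun_scale c (tensor_action k x T)}"
    by (rule eq_subspace) (simp_all add: ta_add ta_scale fun_space.scale_right_distrib mult.commute)
  fix xs assume xs: "length xs = k" "set xs \<subseteq> G"
  have xG: "i < k ==> xs ! i \<in> G" for i using xs by auto
  have cx: "scale c x \<in> G" using x carrier_subspace by (simp add: subspace_scale)
  show "tensor_action k (scale c x) (tensor xs) = fun_scale c (tensor_action k x (tensor xs))"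
    unfolding tensor_action_tensor[OF x xs] tensor_action_tensor[OF cx xs] fun_space.scale_sum_right
    using x xs(1) xG br_closed by (intro sum.cong refl) (simp add: br_scale_left tensor_slot_scale)
qed

lemma ta_br: assumes x: "x \<in> G" and y: "y \<in> G" and T: "T \<in> tensor_power k"
  shows "tensor_action k (br x y) T = tensor_action k x (tensor_action k y T) - tensor_action k y (tensor_action k x T)"
proof (rule tensor_power_induct[OF T])
  show "fun_space.subspace {T. tensor_action k (br x y) T =
      tensor_action k x (tensor_action k y T) - tensor_action k y (tensor_action k x T)}"
    by (rule eq_subspace) (simp_all only: ta_add ta_scale fun_space.scale_right_diff_distrib add_diff_add)
  fix xs assume xs: "length xs = k" "set xs \<subseteq> G"
  have xG: "i < k ==> xs ! i \<in> G" for i using xs by auto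
  define D where "D = (\<lambda>u v i j. tensor ((xs[i := br v (xs ! i)])[j := br u (xs[i := br v (xs ! i)] ! j)]))"
  have comp: "tensor_action k u (tensor_action k v (tensor xs)) = (\<Sum>i<k. \<Sum>j<k. D u v i j)" if uv: "u \<in> G" "v \<in> G" for u v
    unfolding tensor_action_tensor[OF uv(2) xs] ta_sum D_def
    using xs br_update[OF uv(2) xs(2)] by (intro sum.cong refl tensor_action_tensor[OF uv(1)]) auto
  \<comment> \<open>Actions in different slots commute and cancel in the commutator; only the terms
    with both actions in the same slot remain.\<close>
  have off: "D x y i j = D y x j i" if "i < k" "j < k" "i \<noteq> j" for i j using that by (simp add: D_def list_update_swap)
  have diag: "D x y i i - D y x i i = tensor (xs[i := br (br x y) (xs ! i)])" if i: "i < k" for i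
  proof -
    have "D x y i i - D y x i i = tensor (xs[i := br x (br y (xs ! i))]) - tensor (xs[i := br y (br x (xs ! i))])"
      using i xs by (simp add: D_def)
    also have "\<dots> = tensor (xs[i := br x (br y (xs ! i)) - br y (br x (xs ! i))])"
      using i xs xG br_closed x y by (intro tensor_slot_diff[symmetric]) auto
    also have "br x (br y (xs ! i)) - br y (br x (xs ! i)) = br (br x y) (xs ! i)"
      using adjoint_module x y xG[OF i] unfolding lie_module_def by metis
    finally show ?thesis .
  qed
  have "tensor_action k x (tensor_action k y (tensor xs)) - tensor_action k y (tensor_action k x (tensor xs)) =
     (\<Sum>i<k. \<Sum>j<k. D x y i j) - (\<Sum>i<k. \<Sum>j<k. D y x j i)" unfolding comp[OF x y] comp[OF y x] by (subst (2) sum.swap) simp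
  also have "\<dots> = (\<Sum>i<k. \<Sum>j<k. D x y i j - D y x j i)" by (simp only: sum_subtractf)
  also have "\<dots> = (\<Sum>i<k. tensor (xs[i := br (br x y) (xs ! i)]))"
  proof (intro sum.cong refl)
    fix i assume "i \<in> {..<k}"
    hence i: "i < k" by simp
    have "(\<Sum>j<k. D x y i j - D y x j i) = (\<Sum>j\<in>{i}. D x y i j - D y x j i)" using i off by (intro sum.mono_neutral_right) auto
    thus "(\<Sum>j<k. D x y i j - D y x j i) = tensor (xs[i := br (br x y) (xs ! i)])" using diag[OF i] by simp
  qed
  finally show "tensor_action k (br x y) (tensor xs) =
     tensor_action k x (tensor_action k y (tensor xs)) - tensor_action k y (tensor_action k x (tensor xs))"
    unfolding tensor_action_tensor[OF br_closed[OF x y] xs] by (rule sym)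
qed

lemma tensor_module: "lie_module fun_scale (tensor_power k) (tensor_action k)"
proof -
  note E = sub_basis[OF G_fin_dim]
  let ?L = "{ys. set ys \<subseteq> sub_basis G \<and> length ys = k}"
  have L: "{tensor ys | ys. length ys = k \<and> set ys \<subseteq> sub_basis G} = tensor ` ?L" by blast
  have "tensor_power k \<subseteq> fun_space.span (tensor ` ?L)" unfolding L[symmetric] by (rule tensor_span[OF E(1)]) (simp add: E(3))
  moreover have "fun_space.span (tensor ` ?L) \<subseteq> tensor_power k"
    unfolding tensor_power_def using E(1) by (intro fun_space.span_mono) blast
  ultimately have "\<exists>E. finite E \<and> fun_space.span E = tensor_power k"
    using finite_lists_length_eq[OF E(4)] by (intro exI[of _ "tensor ` ?L"] conjI finite_imageI equalityI)
  moreover have "fun_space.subspace (tensor_power k)" unfolding tensor_power_def by (rule fun_space.subspace_span)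
  ultimately show ?thesis unfolding lie_module_def by (intro conjI ballI allI)
      (assumption | rule fun_space.vector_space_axioms ta_in ta_add ta_scale ta_add_left ta_scale_left ta_br)+
qed

lemma sym_power_tensor: "T \<in> sym_power k ==> T \<in> tensor_power k" unfolding sym_power_def by (drule CollectD) (rule conjunct1)

lemma sym_power_subspace: "fun_space.subspace (sym_power k)"
proof -
  have tp: "fun_space.subspace (tensor_power k)" unfolding tensor_power_def by (rule fun_space.subspace_span)
  have s: "fun_space.subspace {T. T fs = T gs}" for fs gs :: "('a => complex) list"
    unfolding fun_space.subspace_def by (simp add: fun_scale_def)
  have eq: "sym_power k = tensor_power k \<inter> (\<Inter>p\<in>{(fs, gs). mset fs = mset gs}. case p of (fs, gs) => {T. T fs = T gs})"
    by (auto simp: sym_power_def)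
  show ?thesis unfolding eq
  proof (rule fun_space.subspace_inter[OF tp fun_space.subspace_Int])
    fix p :: "('a => complex) list \<times> ('a => complex) list"
    show "fun_space.subspace (case p of (fs, gs) => {T. T fs = T gs})" by (cases p) (simp only: prod.case s)
  qed
qed

text \<open>A symmetric tensor is a function \<open>T'\<close> of the multiset of its arguments.
  Written this way, the action is a sum over that multiset, hence symmetric again.\<close>

lemma sym_power_stable: assumes x: "x \<in> G" and T: "T \<in> sym_power k" shows "tensor_action k x T \<in> sym_power k"
proof -
  define T' where "T' = (\<lambda>M. T (SOME l. mset l = M))"
  have Tsym: "T fs = T gs" if "mset fs = mset gs" for fs gs using T that unfolding sym_power_def by blast
  have T': "T l = T' (mset l)" for l
  proof -
    have "mset (SOME l'. mset l' = mset l) = mset l" by (rule someI[where P="\<lambda>l'. mset l' = mset l"]) (rule refl)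
    thus ?thesis unfolding T'_def by (intro Tsym) (rule sym)
  qed
  define \<psi> where "\<psi> = (\<lambda>M f. T' (add_mset (pullback_ad x f) (M - {#f#})))"
  have ta: "tensor_action k x T fs = (if fs \<in> dual_lists k then sum_mset (image_mset (\<psi> (mset fs)) (mset fs)) else 0)" for fs
  proof (cases "fs \<in> dual_lists k")
    case True
    hence len: "length fs = k" by (simp add: dual_lists_def)
    have "tensor_action k x T fs = (\<Sum>i<k. \<psi> (mset fs) (fs ! i))"
      using True len by (simp add: tensor_action_def T' mset_update \<psi>_def)
    also have "\<dots> = sum_list (map (\<psi> (mset fs)) fs)" using len by (simp add: sum_list_sum_nth atLeast0LessThan)
    also have "\<dots> = sum_mset (image_mset (\<psi> (mset fs)) (mset fs))" by (simp flip: sum_mset_sum_list)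
    finally show ?thesis using True by simp
  qed (simp add: tensor_action_def)
  have "tensor_action k x T fs = tensor_action k x T gs" if m: "mset fs = mset gs" for fs gs
  proof -
    have "fs \<in> dual_lists k \<longleftrightarrow> gs \<in> dual_lists k"
      using mset_eq_length[OF m] mset_eq_setD[OF m] by (simp add: dual_lists_def)
    thus ?thesis unfolding ta m by simp
  qed
  hence "\<forall>fs gs. mset fs = mset gs \<longrightarrow> tensor_action k x T fs = tensor_action k x T gs" by blast
  with ta_in[OF x sym_power_tensor[OF T]] show ?thesis unfolding sym_power_def by (intro CollectI conjI)
qed

lemma sym_power_submodule: "submodule fun_scale (tensor_power k) (tensor_action k) (sym_power k)"
  unfolding submodule_def using sym_power_subspace sym_power_stable sym_power_tensor by blast

end

context lie_rep
begin

lemma submodule_module: assumes "submodule sV V \<rho> W" shows "lie_module sV W \<rho>"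
proof -
  have W: "M.subspace W" "W \<subseteq> V" "\<And>x w. x \<in> G ==> w \<in> W ==> \<rho> x w \<in> W"
    using assms by (auto simp: submodule_def)
  have "\<exists>E. finite E \<and> M.span E = W" using M.sub_basis[OF M.fin_dim_subset[OF V_fin_dim W(1,2)]] by blast
  thus ?thesis unfolding lie_module_def using W(1) by (intro conjI ballI allI)
      (assumption | rule M.vector_space_axioms W(3) act_add act_scale act_add_left act_scale_left act_br
        subsetD[OF W(2)])+
qed

end

section \<open>Cartan powers inside the symmetric powers\<close>

context based_rep
begin

lemma hw_weyl: assumes "irreducible_with_highest_weight H \<Delta> l sV V \<rho>" and ld: "l \<in> dual H"
  shows "(\<Prod>r\<in>Pos. ip r wrho) * of_nat (M.dim V) = (\<Prod>r\<in>Pos. ip r (l + wrho))"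
proof -
  obtain v where v: "irreducible_module sV V \<rho>" "v \<in> V" "highest_weight_vector H \<Delta> sV \<rho> l v"
    using assms(1) unfolding irreducible_with_highest_weight_def by blast
  show ?thesis by (rule weyl_dimension[OF hw_casimir[OF v ld] hw_dominant[OF v ld] hw_weights[OF v ld] hw_wmult[OF v ld]
          hw_weighted[OF v ld]])
qed

lemma submod_span: assumes W: "submod W" and w: weighted shows "W \<subseteq> M.span (\<Union>\<mu>\<in>weights. wsp \<mu> \<inter> W)"
proof
  fix v assume v: "v \<in> W"
  hence "v \<in> V" using submodD(2)[OF W] by blast
  then obtain S y where "finite S \<and> S \<subseteq> dual H \<and> (\<forall>\<mu>\<in>S. y \<mu> \<in> wsp \<mu>) \<and> v = (\<Sum>\<mu>\<in>S. y \<mu>)"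
    using weighted_decomp[OF w] by metis
  hence S: "finite S" "S \<subseteq> dual H" "\<And>\<mu>. \<mu> \<in> S ==> y \<mu> \<in> wsp \<mu>" "v = (\<Sum>\<mu>\<in>S. y \<mu>)" by auto
  have "y \<mu> \<in> M.span (\<Union>\<mu>\<in>weights. wsp \<mu> \<inter> W)" if m: "\<mu> \<in> S" for \<mu>
  proof (cases "\<mu> \<in> weights")
    case True
    have "y \<mu> \<in> W" by (rule wsp_components[OF submodD(1,2)[OF W] submodD(3)[OF W H_G] S(1,2,3)]) (use v S(4) m in auto)
    thus ?thesis using True S(3)[OF m] by (intro M.span_base) blast
  next
    case False
    hence "y \<mu> = 0" using S(2,3) m by (auto simp: weights_def)
    thus ?thesis by (simp add: M.span_zero)
  qed
  thus "v \<in> M.span (\<Union>\<mu>\<in>weights. wsp \<mu> \<inter> W)" unfolding S(4) by (rule M.span_sum)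
qed

end

definition (in lie_algebra) cas_space :: "('a => 'a => complex) => nat => complex => (('a => complex) list => complex) set" where
  "cas_space B k c = {T \<in> sym_power k. casimir B (tensor_action k) T = fun_scale c T}"

locale highest_alg = based_alg + fixes \<theta> assumes highest: "highest_root H \<Delta> \<theta>"
begin

lemma theta_root: "\<theta> \<in> roots H" and theta_natc: "r \<in> roots H ==> natc (\<theta> - r)"
  using highest by (auto simp: highest_root_def)

text \<open>If \<open>- \<theta>\<close> were positive, then both twice \<open>\<theta>\<close>,
  which is \<open>\<theta>\<close> minus the root \<open>- \<theta>\<close>, and its negative would
  be natural combinations.\<close>

lemma theta_Pos: "\<theta> \<in> Pos"
proof (rule ccontr)
  assume "\<theta> \<notin> Pos"
  hence "natc (- \<theta>)" using not_Pos[OF theta_root] by (simp add: positive_roots_def)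
  hence "natc (- \<theta> + - \<theta>)" using natc_add by blast
  moreover have "- \<theta> + - \<theta> = - (\<theta> - - \<theta>)" by simp
  ultimately have "\<theta> - - \<theta> = 0" using natc_antisym[OF theta_natc[OF neg_root[OF theta_root]]] by metis
  hence "\<theta> h + \<theta> h = 0" for h by (simp add: fun_eq_iff)
  hence "\<theta> = 0" by (auto simp: fun_eq_iff mult_2[symmetric])
  thus False using rootsD(2)[OF theta_root] by blast
qed

lemma theta_weight_natc: "\<mu> \<in> adj.weights ==> natc (\<theta> - \<mu>)"
proof (cases "\<mu> = 0")
  case True
  hence "\<theta> - \<mu> = \<theta>" by simp
  thus ?thesis using theta_Pos by (simp add: positive_roots_def)
next
  case False
  assume "\<mu> \<in> adj.weights"
  thus ?thesis using False theta_natc by (simp add: roots_eq)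
qed

lemma theta_highest: "r \<in> Pos ==> x \<in> root_space H r ==> br x (rv \<theta>) = 0"
proof (rule ccontr)
  assume r: "r \<in> Pos" and x: "x \<in> root_space H r" and n: "br x (rv \<theta>) \<noteq> 0"
  have "br x (rv \<theta>) \<in> adj.wsp (\<theta> + r)"
    using adj.wsp_shift[OF x, of "rv \<theta>" \<theta>] rv(1)[OF theta_root] unfolding adj_wsp by blast
  moreover have "\<theta> + r \<in> dual H" by (rule dual_add[OF rootsD(1)[OF theta_root] rootsD(1)[OF Pos_root[OF r]]])
  ultimately have "\<theta> + r \<in> adj.weights" using n unfolding adj.weights_def by blast
  hence "natc (\<theta> - (\<theta> + r))" by (rule theta_weight_natc)
  moreover have "\<theta> - (\<theta> + r) = - r" by simp
  ultimately have "natc (- r)" by simp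
  hence "r = 0" using natc_antisym[of r] r by (simp add: positive_roots_def)
  thus False using rootsD(2)[OF Pos_root[OF r]] by blast
qed

text \<open>The root vector of theta is a highest weight vector of the adjoint module, where the
  Casimir operator acts by the prescribed scalar.\<close>

lemma theta_dominant: "dominant \<theta>" and cas_theta: "cas \<theta> = 2 * of_real \<tau>"
proof -
  interpret A: based_rep scale G br H B \<tau> \<Delta> scale G br ..
  have w: "\<theta> \<in> adj.weights" using theta_root by (simp add: roots_eq)
  have v: "rv \<theta> \<in> adj.wsp \<theta>" using rv(1)[OF theta_root] by (simp add: adj_wsp)
  have v0: "rv \<theta> \<notin> {0}" using rv_nonzero[OF theta_root] by simp
  have h: "br x (rv \<theta>) \<in> {0}" if "r \<in> Pos" "x \<in> root_space H r" for r x using theta_highest[OF that] by simp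
  show "dominant \<theta>" by (rule A.relative_hw_dominant(2)[OF A.submod_zero w v v0 h])
  show "cas \<theta> = 2 * of_real \<tau>"
    by (rule A.relative_hw_cas[OF A.submod_zero w v v0 h casimir_adj[OF rv_G[OF theta_root]], symmetric])
qed

context fixes k :: nat
begin

definition "ktheta = fun_scale (of_nat k) \<theta>"

definition "ek = tensor (replicate k (rv \<theta>))"

lemma ktheta_dual: "ktheta \<in> dual H" unfolding ktheta_def by (rule dual_scale[OF rootsD(1)[OF theta_root]])

lemma ktheta_dominant: "dominant ktheta"
proof -
  have X: "ktheta \<in> XR" unfolding ktheta_def by (rule XR_scale[OF XR_root[OF theta_root]]) simp
  moreover have "Re (ip ktheta d) \<ge> 0" if "d \<in> \<Delta>" for d
    using theta_dominant that unfolding ktheta_def ip_scale_left by (simp add: dominant_def)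
  ultimately show ?thesis unfolding dominant_def by blast
qed

text \<open>\<open>cas_theta\<close> is used to eliminate the product of theta with rho.\<close>

lemma cas_ktheta: "cas ktheta = 2 * of_nat k * of_real \<tau> + ((of_nat k)\<^sup>2 - of_nat k) * ip \<theta> \<theta>"
proof -
  have "2 * ip \<theta> wrho = 2 * of_real \<tau> - ip \<theta> \<theta>" using cas_theta by (simp add: cas_def algebra_simps)
  moreover have "cas ktheta = (of_nat k)\<^sup>2 * ip \<theta> \<theta> + of_nat k * (2 * ip \<theta> wrho)"
    by (simp add: cas_def ktheta_def ip_scale_left ip_scale_right power2_eq_square)
  ultimately have "cas ktheta = (of_nat k)\<^sup>2 * ip \<theta> \<theta> + of_nat k * (2 * of_real \<tau> - ip \<theta> \<theta>)"
    by (simp only:)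
  thus ?thesis by (simp add: algebra_simps)
qed

interpretation T: based_rep scale G br H B \<tau> \<Delta> fun_scale "tensor_power k" "tensor_action k"
  using tensor_module by unfold_locales

lemma tensor_wsp: assumes xs: "length xs = k" "\<And>i. i < k ==> xs ! i \<in> root_space H (m i)"
  shows "tensor xs \<in> T.wsp (\<Sum>i<k. m i)"
proof -
  have G: "set xs \<subseteq> G" using xs(1) root_space_G[OF xs(2)] by (auto simp: in_set_conv_nth)
  have "tensor_action k h (tensor xs) = fun_scale ((\<Sum>i<k. m i) h) (tensor xs)" if h: "h \<in> H" for h
  proof -
    have "tensor (xs[i := br h (xs ! i)]) = fun_scale (m i h) (tensor xs)" if i: "i < k" for i
    proof -
      have "tensor (xs[i := scale (m i h) (xs ! i)]) = fun_scale (m i h) (tensor (xs[i := xs ! i]))"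
        using xs i root_space_G by (intro tensor_slot_scale) auto
      thus ?thesis using root_space_br[OF xs(2)[OF i] h] by simp
    qed
    thus ?thesis unfolding tensor_action_tensor[OF H_G[OF h] xs(1) G] fun_sum_apply fun_space.scale_sum_left by simp
  qed
  thus ?thesis unfolding T.wsp_def using tensor_in[OF xs(1) G] by blast
qed

lemma ek_wsp: "ek \<in> T.wsp ktheta"
proof -
  have "ktheta = (\<Sum>i<k. \<theta>)" by (rule ext) (simp add: ktheta_def fun_sum_apply fun_scale_def)
  thus ?thesis unfolding ek_def using tensor_wsp[of "replicate k (rv \<theta>)" "\<lambda>_. \<theta>"] rv(1)[OF theta_root] by simp
qed

lemma ek_nonzero: "ek \<noteq> 0"
proof
  assume 0: "ek = 0"
  \<comment> \<open>The functional pairing with the opposite root vector takes the value 1 on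
    \<open>rv \<theta>\<close>, so the power of it detects \<open>ek\<close>.\<close>
  define f where "f = (\<lambda>x. if x \<in> G then B (rv (- \<theta>)) x else 0)"
  have eG: "rv (- \<theta>) \<in> G" "rv \<theta> \<in> G" using rv_G theta_root neg_root by blast+
  have "f \<in> dual G" unfolding dual_def f_def
    using eG carrier_subspace by (auto simp: B_add_right B_scale_right subspace_add subspace_scale)
  hence "replicate k f \<in> dual_lists k" by (auto simp: dual_lists_def)
  hence "ek (replicate k f) = (\<Prod>i<k. f (rv \<theta>))" by (simp add: ek_def tensor_def)
  moreover have "f (rv \<theta>) = 1" using rv(2)[OF neg_root[OF theta_root]] eG by (simp add: f_def)
  ultimately show False using 0 by simp
qed

lemma ek_sym: "ek \<in> sym_power k"
proof -
  have "ek fs = ek gs" if m: "mset fs = mset gs" for fs gs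
  proof -
    have d: "fs \<in> dual_lists k \<longleftrightarrow> gs \<in> dual_lists k"
      using mset_eq_length[OF m] mset_eq_setD[OF m] by (simp add: dual_lists_def)
    have p: "ek fs = prod_mset (image_mset (\<lambda>f. f (rv \<theta>)) (mset fs))" if "fs \<in> dual_lists k" for fs
    proof -
      have l: "length fs = k" using that by (simp add: dual_lists_def)
      have "ek fs = (\<Prod>i<k. (map (\<lambda>f. f (rv \<theta>)) fs) ! i)" using that l by (simp add: ek_def tensor_def)
      also have "\<dots> = prod_list (map (\<lambda>f. f (rv \<theta>)) fs)" using l by (simp add: prod.list_conv_set_nth atLeast0LessThan)
      also have "\<dots> = prod_mset (image_mset (\<lambda>f. f (rv \<theta>)) (mset fs))" by (simp flip: prod_mset_prod_list)
      finally show ?thesis .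
    qed
    show ?thesis
    proof (cases "fs \<in> dual_lists k")
      case True
      thus ?thesis using p[of fs] p[of gs] d m by simp
    next
      case False
      thus ?thesis using d by (simp add: ek_def tensor_def)
    qed
  qed
  moreover have "ek \<in> tensor_power k" using T.wspD(1)[OF ek_wsp] .
  ultimately show ?thesis unfolding sym_power_def by blast
qed

definition "Iset = {ktheta - q | q. natc q}"

text \<open>Agrees with the weight spaces except at the top weight, where it is only the line
  through \<open>ek\<close>; \<open>tensor_power_cover\<close> with \<open>T.wsp_component\<close>
  then identifies the top weight space.\<close>

definition "Ecomp \<mu> = (if \<mu> = ktheta then fun_space.span {ek} else T.wsp \<mu>)"

lemma Iset_dual: "Iset \<subseteq> dual H" unfolding Iset_def using ktheta_dual XR_dual[OF natc_XR] dual_diff by blast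

lemma Ecomp: "fun_space.subspace (Ecomp \<mu>)" "Ecomp \<mu> \<subseteq> T.wsp \<mu>"
  unfolding Ecomp_def using T.wsp_subspace fun_space.span_minimal[of "{ek}" "T.wsp ktheta"] ek_wsp by auto

lemma natc_sum_zero: assumes "finite A" "\<And>i. i \<in> A ==> natc (q i)" "(\<Sum>i\<in>A. q i) = 0" "i \<in> A" shows "q i = 0"
proof -
  have "(\<Sum>i\<in>A. Re (ip (q i) wrho)) = Re (ip (\<Sum>i\<in>A. q i) wrho)" unfolding ip_sum_left by simp
  also have "\<dots> = 0" unfolding assms(3) ip_zero by simp
  finally have "\<forall>i\<in>A. Re (ip (q i) wrho) = 0"
    using wrho_pos_natc(1)[OF assms(2)] assms(1) by (subst (asm) sum_nonneg_eq_0_iff) auto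
  thus ?thesis using wrho_pos_natc(2)[OF assms(2)[OF assms(4)]] assms(4) by fastforce
qed

lemma natc_sum: "finite A ==> (\<And>i. i \<in> A ==> natc (q i)) ==> natc (\<Sum>i\<in>A. q i)"
proof -
  assume A: "finite A" and q: "\<And>i. i \<in> A ==> natc (q i)"
  define K where "K = (\<lambda>A. natc (\<Sum>i\<in>A. q i))"
  have K0: "K {}" unfolding K_def sum.empty by (rule natc_zero)
  have Ki: "K (insert i A)" if "finite A" "i \<notin> A" "natc (q i)" "K A" for i A
    using that unfolding K_def by (simp only: sum.insert natc_add simp_thms)
  have "K A" using A q by (induction A rule: finite_induct) (use K0 Ki in auto)
  thus ?thesis unfolding K_def .
qed

text \<open>A tensor of root vectors of weights m_i has weight k theta minus the sum of all theta -
  m_i, each a natural combination. If the sum is zero, all m_i equal theta and the tensor is a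
  multiple of \<open>ek\<close>.\<close>

lemma tensor_power_cover: "tensor_power k \<subseteq> fun_space.span (\<Union>\<mu>\<in>Iset. Ecomp \<mu>)"
proof -
  let ?S = "\<Union>\<mu>\<in>adj.weights. root_space H \<mu>"
  have "G \<subseteq> span ?S" using adj.weighted_direct_sum[OF adj_weighted] unfolding direct_sum_def adj_wsp by blast
  moreover have "?S \<subseteq> G" using root_space_G by blast
  ultimately have "tensor_power k \<subseteq> fun_space.span {tensor ys | ys. length ys = k \<and> set ys \<subseteq> ?S}"
    by (intro tensor_span)
  moreover have "{tensor ys | ys. length ys = k \<and> set ys \<subseteq> ?S} \<subseteq> (\<Union>\<mu>\<in>Iset. Ecomp \<mu>)"
  proof
    fix T assume "T \<in> {tensor ys | ys. length ys = k \<and> set ys \<subseteq> ?S}"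
    then obtain ys where ys: "T = tensor ys" "length ys = k" "set ys \<subseteq> ?S" by blast
    have "\<exists>\<mu>. \<mu> \<in> adj.weights \<and> ys ! i \<in> root_space H \<mu>" if "i < k" for i
    proof -
      have "ys ! i \<in> ?S" using ys(2,3) that nth_mem by blast
      thus ?thesis by blast
    qed
    then obtain m where m: "\<And>i. i < k ==> m i \<in> adj.weights" "\<And>i. i < k ==> ys ! i \<in> root_space H (m i)" by metis
    define q where "q = (\<Sum>i<k. \<theta> - m i)"
    have nq: "natc (\<theta> - m i)" if "i \<in> {..<k}" for i using theta_weight_natc m(1) that by simp
    have "natc q" unfolding q_def by (rule natc_sum) (use nq in auto)
    moreover have s: "(\<Sum>i<k. m i) = ktheta - q" by (rule ext) (simp add: q_def ktheta_def fun_sum_apply fun_scale_def sum_subtractf)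
    ultimately have I: "ktheta - q \<in> Iset" unfolding Iset_def by blast
    have "T \<in> Ecomp (ktheta - q)"
    proof (cases "q = 0")
      case False
      hence "ktheta - q \<noteq> ktheta" by simp
      thus ?thesis unfolding Ecomp_def ys(1) using tensor_wsp[OF ys(2) m(2)] s by simp
    next
      case True
      have "\<theta> - m i = 0" if "i < k" for i by (rule natc_sum_zero[OF finite_lessThan nq, of k id for k, unfolded id_def])
          (use True that q_def in auto)
      hence "m i = \<theta>" if "i < k" for i using that by simp
      hence "\<exists>c. ys ! i = scale c (rv \<theta>)" if "i < k" for i
        using m(2)[OF that] root_space_dim_one[OF theta_root rv(1)[OF theta_root] rv_nonzero[OF theta_root]] that by auto
      then obtain c where c: "\<And>i. i < k ==> ys ! i = scale (c i) (rv \<theta>)" by metis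
      have "tensor ys = fun_scale (\<Prod>i<k. c i) ek"
      proof
        fix fs
        show "tensor ys fs = fun_scale (\<Prod>i<k. c i) ek fs"
        proof (cases "fs \<in> dual_lists k")
          case True
          hence "(fs ! i) (scale (c i) (rv \<theta>)) = c i * (fs ! i) (rv \<theta>)" if "i < k" for i
          proof -
            have "fs ! i \<in> dual G" using True that by (auto simp: dual_lists_def)
            thus ?thesis using rv_G[OF theta_root] by (simp add: dual_def)
          qed
          thus ?thesis using True ys(2) c by (simp add: ek_def tensor_def fun_scale_def prod.distrib)
        next
          case False
          thus ?thesis using ys(2) by (simp add: ek_def tensor_def fun_scale_def)
        qed
      qed
      moreover have "ktheta - q = ktheta" using True by simp
      ultimately show ?thesis unfolding Ecomp_def ys(1) by (simp add: fun_space.span_base fun_space.span_scale)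
    qed
    thus "T \<in> (\<Union>\<mu>\<in>Iset. Ecomp \<mu>)" using I by blast
  qed
  ultimately show ?thesis using fun_space.span_mono by blast
qed

lemma tensor_weights: "T.weighted" "\<mu> \<in> T.weights ==> natc (ktheta - \<mu>)" "T.wsp ktheta \<subseteq> fun_space.span {ek}"
proof -
  have "(\<Union>\<mu>\<in>Iset. Ecomp \<mu>) \<subseteq> (\<Union>\<mu>\<in>Iset. T.wsp \<mu>)" using Ecomp(2) by blast
  hence c: "tensor_power k \<subseteq> fun_space.span (\<Union>\<mu>\<in>Iset. T.wsp \<mu>)"
    using tensor_power_cover fun_space.span_mono by blast
  show "T.weighted" by (rule T.weights_subset(2)[OF c Iset_dual])
  show "natc (ktheta - \<mu>)" if "\<mu> \<in> T.weights"
  proof -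
    have "\<mu> \<in> Iset" using T.weights_subset(1)[OF c Iset_dual] that by blast
    then obtain q where q: "\<mu> = ktheta - q" "natc q" unfolding Iset_def by blast
    have "ktheta - (ktheta - q) = q" by simp
    thus ?thesis using q by simp
  qed
  have "ktheta - 0 = ktheta" by simp
  hence "ktheta \<in> Iset" unfolding Iset_def using natc_zero by (metis (mono_tags, lifting) mem_Collect_eq)
  hence "T.wsp ktheta \<subseteq> Ecomp ktheta" using T.wsp_component[OF tensor_power_cover Iset_dual _ Ecomp] by blast
  thus "T.wsp ktheta \<subseteq> fun_space.span {ek}" by (simp add: Ecomp_def)
qed

lemma ek_highest: "r \<in> Pos ==> x \<in> root_space H r ==> tensor_action k x ek = 0"
proof (rule ccontr)
  assume r: "r \<in> Pos" and x: "x \<in> root_space H r" and n: "tensor_action k x ek \<noteq> 0"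
  have "tensor_action k x ek \<in> T.wsp (ktheta + r)" by (rule T.wsp_shift[OF x ek_wsp])
  moreover have "ktheta + r \<in> dual H" by (rule dual_add[OF ktheta_dual rootsD(1)[OF Pos_root[OF r]]])
  ultimately have "ktheta + r \<in> T.weights" using n unfolding T.weights_def by blast
  hence "natc (ktheta - (ktheta + r))" by (rule tensor_weights(2))
  moreover have "ktheta - (ktheta + r) = - r" by simp
  ultimately have "natc (- r)" by simp
  hence "r = 0" using natc_antisym[of r] r by (simp add: positive_roots_def)
  thus False using rootsD(2)[OF Pos_root[OF r]] by blast
qed

lemma ek_hwv: "highest_weight_vector H \<Delta> fun_scale (tensor_action k) ktheta ek"
  unfolding highest_weight_vector_def using ek_nonzero T.wspD(2)[OF ek_wsp] ek_highest by blast

lemma cas_space_submod: "T.submod (cas_space B k c)"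
proof -
  note sp = sym_power_submodule[of k]
  have sub: "sym_power k \<subseteq> tensor_power k" using sym_power_tensor by blast
  have eq: "cas_space B k c = sym_power k \<inter> {T \<in> tensor_power k. casimir B (tensor_action k) T = fun_scale c T}"
    using sub by (auto simp: cas_space_def)
  have "fun_space.subspace (cas_space B k c)"
    unfolding eq by (rule fun_space.subspace_inter[OF sym_power_subspace T.M.subspace_eigenspace[OF T.V_subspace T.casimir_lin]])
  moreover have "tensor_action k x T \<in> cas_space B k c" if x: "x \<in> G" and T: "T \<in> cas_space B k c" for x T
  proof -
    have T': "T \<in> sym_power k" "casimir B (tensor_action k) T = fun_scale c T" using T by (auto simp: cas_space_def)
    have "casimir B (tensor_action k) (tensor_action k x T) = fun_scale c (tensor_action k x T)"
      using T.casimir_commutes[OF x sym_power_tensor[OF T'(1)]] unfolding T'(2) ta_scale .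
    thus ?thesis using sym_power_stable[OF x T'(1)] by (simp add: cas_space_def)
  qed
  ultimately show ?thesis unfolding submodule_def using sub by (auto simp: cas_space_def)
qed

lemma ek_casimir: "casimir B (tensor_action k) ek = fun_scale (cas ktheta) ek"
proof -
  have "ktheta \<in> T.weights" unfolding T.weights_def using ek_wsp ek_nonzero ktheta_dual by blast
  hence "casimir B (tensor_action k) ek - fun_scale (cas ktheta) ek \<in> {0}"
    by (rule T.casimir_highest[OF T.submod_zero _ ek_wsp]) (use ek_highest in simp)
  thus ?thesis by simp
qed

lemma ek_cas_space: "ek \<in> cas_space B k (cas ktheta)" unfolding cas_space_def using ek_sym ek_casimir by blast

text \<open>A nonzero eigenspace contains a highest weight vector, whose weight is dominant and
  below k theta. For k = 2 this bound later recovers the length of theta from the algebra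
  alone.\<close>

lemma cas_space_bound: assumes T: "T \<in> cas_space B k c" "T \<noteq> 0" shows "Re c \<le> Re (cas ktheta)"
proof -
  have n: "T \<notin> {0}" using T by simp
  obtain \<mu> v where v: "\<mu> \<in> T.weights" "v \<in> T.wsp \<mu>" "v \<in> cas_space B k c" "v \<notin> {0}"
    "\<And>r x. r \<in> Pos ==> x \<in> root_space H r ==> tensor_action k x v \<in> {0}"
    using T.relative_highest_weight_vector[OF cas_space_submod T.submod_zero tensor_weights(1) T(1) n] by metis
  have cv: "casimir B (tensor_action k) v = fun_scale c v" using v(3) by (simp add: cas_space_def)
  have "c = cas \<mu>" by (rule T.relative_hw_cas[OF T.submod_zero v(1,2,4) _ cv]) (rule v(5))
  moreover have "dominant \<mu>" by (rule T.relative_hw_dominant(2)[OF T.submod_zero v(1,2,4)]) (rule v(5))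
  ultimately show ?thesis using cas_compare(1)[OF ktheta_dominant _ tensor_weights(2)[OF v(1)]] by simp
qed

lemma cartan_power_cas_space: "cartan_power H \<Delta> \<theta> k fun_scale (cas_space B k (cas ktheta)) (tensor_action k)"
proof -
  let ?E = "cas_space B k (cas ktheta)"
  interpret E: based_rep scale G br H B \<tau> \<Delta> fun_scale ?E "tensor_action k"
    using T.submodule_module[OF cas_space_submod] by unfold_locales
  have sub: "?E \<subseteq> tensor_power k" using cas_space_submod by (auto simp: submodule_def)
  have wsp: "E.wsp \<mu> = T.wsp \<mu> \<inter> ?E" for \<mu> using sub by (auto simp: E.wsp_def T.wsp_def)
  have "?E \<subseteq> fun_space.span (\<Union>\<mu>\<in>T.weights. E.wsp \<mu>)"
    unfolding wsp by (rule T.submod_span[OF cas_space_submod tensor_weights(1)])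
  moreover have Td: "T.weights \<subseteq> dual H" by (auto simp: T.weights_def)
  ultimately have w: "E.weighted" "E.weights \<subseteq> T.weights" using E.weights_subset by blast+
  have "irreducible_module fun_scale ?E (tensor_action k)"
  proof (rule E.irreducible_by_casimir[OF w(1) _ ktheta_dominant _ _ ek_nonzero])
    show "natc (ktheta - \<mu>)" if "\<mu> \<in> E.weights" for \<mu> using tensor_weights(2) w(2) that by blast
    show "casimir B (tensor_action k) v = fun_scale (cas ktheta) v" if "v \<in> ?E" for v using that by (simp add: cas_space_def)
    show "ek \<in> E.wsp ktheta" unfolding wsp using ek_wsp ek_cas_space by blast
    show "\<exists>a. v = fun_scale a ek" if "v \<in> E.wsp ktheta" for v
    proof -
      have "v \<in> fun_space.span {ek}" using tensor_weights(3) that unfolding wsp by blast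
      thus ?thesis by (auto simp: fun_space.span_singleton)
    qed
  qed
  thus ?thesis unfolding cartan_power_def irreducible_with_highest_weight_def ktheta_def[symmetric] using ek_cas_space ek_hwv by blast
qed

lemma cartan_power_dim: assumes "cartan_power H \<Delta> \<theta> k sV V \<rho>"
  shows "(\<Prod>r\<in>Pos. ip r wrho) * of_nat (vector_space.dim sV V) = (\<Prod>r\<in>Pos. ip r (ktheta + wrho))"
proof -
  have i: "irreducible_with_highest_weight H \<Delta> ktheta sV V \<rho>" using assms unfolding cartan_power_def ktheta_def .
  then interpret R: based_rep scale G br H B \<tau> \<Delta> sV V \<rho>
    by unfold_locales (auto simp: irreducible_with_highest_weight_def irreducible_module_def)
  show ?thesis by (rule R.hw_weyl[OF i ktheta_dual])
qed

end

end

section \<open>Bases from regular elements\<close>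

text \<open>For an explicitly given Cartan subalgebra the roots are known but a base is not. It is
  obtained from an element at which all roots are real and nonzero: the positive roots are those
  positive at it, the simple ones those that are not sums of two positive ones.\<close>

locale regular_alg = form_alg + fixes h0 :: 'a and \<xi> :: "('a => complex) => real"
  assumes regular: "r \<in> roots H ==> r h0 = of_real (\<xi> r) \<and> \<xi> r \<noteq> 0"
begin

definition "RP = {r \<in> roots H. \<xi> r > 0}"

definition "SR = {r \<in> RP. \<nexists>s t. s \<in> RP \<and> t \<in> RP \<and> r = s + t}"

lemma RP_root: "r \<in> RP ==> r \<in> roots H" by (simp add: RP_def)

lemma SR_RP: "r \<in> SR ==> r \<in> RP" by (simp add: SR_def)

lemma finite_SR: "finite SR" using finite_roots by (auto simp: SR_def RP_def)

lemma xi_unique: "r \<in> roots H ==> r h0 = of_real a ==> \<xi> r = a" using regular[of r] by simp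

lemma RP_neg: "r \<in> roots H ==> r \<in> RP \<or> - r \<in> RP"
proof -
  assume r: "r \<in> roots H"
  have "\<xi> (- r) = - \<xi> r" using regular[OF r] by (intro xi_unique[OF neg_root[OF r]]) simp
  thus ?thesis using regular[OF r] r neg_root[OF r] by (auto simp: RP_def)
qed

lemma RP_natc: "r \<in> RP ==> nat_combination SR r"
proof (induction "card {s \<in> RP. \<xi> s < \<xi> r}" arbitrary: r rule: less_induct)
  case less
  show ?case
  proof (cases "r \<in> SR")
    case True
    thus ?thesis by (rule nat_combination_member[OF finite_SR])
  next
    case False
    then obtain s t where st: "s \<in> RP" "t \<in> RP" "r = s + t" using less.prems unfolding SR_def by blast
    have "\<xi> r = \<xi> s + \<xi> t" using regular[OF RP_root[OF st(1)]] regular[OF RP_root[OF st(2)]] st(3)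
      by (intro xi_unique[OF RP_root[OF less.prems]]) simp
    hence lt: "\<xi> s < \<xi> r" "\<xi> t < \<xi> r" using st by (auto simp: RP_def)
    have fin: "finite {s \<in> RP. \<xi> s < \<xi> r}" using finite_roots by (simp add: RP_def)
    have "nat_combination SR s" by (rule less.hyps[OF psubset_card_mono[OF fin] st(1)]) (use lt st in auto)
    moreover have "nat_combination SR t" by (rule less.hyps[OF psubset_card_mono[OF fin] st(2)]) (use lt st in auto)
    ultimately show ?thesis unfolding st(3) by (rule nat_combination_add)
  qed
qed

text \<open>If the product were positive, \<open>e - d\<close> would be a root. It or its negative
  is positive, so \<open>e\<close> or \<open>d\<close> would be a sum of two positive roots.\<close>

lemma SR_obtuse: "d \<in> SR ==> e \<in> SR ==> d \<noteq> e ==> Re (ip d e) \<le> 0"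
proof (rule ccontr)
  assume d: "d \<in> SR" and e: "e \<in> SR" and ne: "d \<noteq> e" and "\<not> Re (ip d e) \<le> 0"
  hence pos: "Re (ip e d) > 0" by (simp add: ip_sym[of e d])
  have dR: "d \<in> roots H" and eR: "e \<in> roots H" using d e SR_RP RP_root by blast+
  obtain n where n: "e (hv d) = of_int n" using root_hv_int[OF dR eR] by (auto elim: Ints_cases)
  have n0: "n > 0" using hv_sign(1)[OF dR rootsD(1)[OF eR]] pos n by simp
  have "e - d \<in> roots H" using root_space_multiple_down[OF dR eR, of "nat n"] n n0 ne by simp
  then consider "e - d \<in> RP" | "- (e - d) \<in> RP" using RP_neg by blast
  thus False
  proof cases
    case 1
    have "e = (e - d) + d" by simp
    thus False using e 1 SR_RP[OF d] unfolding SR_def by blast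
  next
    case 2
    have "d = - (e - d) + e" by simp
    thus False using d 2 SR_RP[OF e] unfolding SR_def by blast
  qed
qed

text \<open>Move the terms with nonpositive coefficients to the other side. The common value
  \<open>u\<close> has (u, u) at most 0 because distinct simple roots are obtuse, so
  \<open>u = 0\<close>; but the positive part is positive at \<open>h0\<close>.\<close>

lemma SR_real_independent: fixes a :: "('a => complex) => real"
  assumes 0: "(\<Sum>d\<in>SR. fun_scale (of_real (a d)) d) = 0" and d: "d \<in> SR" shows "a d \<le> 0"
proof (rule ccontr)
  assume "\<not> a d \<le> 0"
  define P where "P = {d \<in> SR. a d > 0}"
  define u where "u = (\<Sum>d\<in>P. fun_scale (of_real (a d)) d)"
  have dP: "d \<in> P" using d \<open>\<not> a d \<le> 0\<close> by (simp add: P_def)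
  have finP: "finite P" using finite_SR by (simp add: P_def)
  have PS: "P \<subseteq> SR" by (auto simp: P_def)
  have "(\<Sum>d\<in>SR. fun_scale (of_real (a d)) d) = u + (\<Sum>d\<in>SR - P. fun_scale (of_real (a d)) d)"
    unfolding u_def using sum.subset_diff[OF PS finite_SR] by (simp add: add.commute)
  hence w: "u = - (\<Sum>d\<in>SR - P. fun_scale (of_real (a d)) d)" using 0 by (metis eq_neg_iff_add_eq_0)
  have uX: "u \<in> XR" unfolding u_def using PS SR_RP RP_root by (intro XR_sum XR_scale XR_root) auto
  have "ip u u = - (\<Sum>d\<in>P. \<Sum>e\<in>SR - P. of_real (a d) * (of_real (a e) * ip d e))" by (subst (2) w, subst u_def)
      (simp only: ip_uminus_right ip_sum_left ip_sum_right ip_scale_left ip_scale_right sum_distrib_left,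
        subst sum.swap, simp only: mult.left_commute)
  hence eq: "Re (ip u u) = (\<Sum>d\<in>P. \<Sum>e\<in>SR - P. - (a d * (a e * Re (ip d e))))" by (simp add: sum_negf)
  have "(\<Sum>d\<in>P. \<Sum>e\<in>SR - P. - (a d * (a e * Re (ip d e)))) \<le> 0"
  proof (intro sum_nonpos)
    fix d e assume de: "d \<in> P" "e \<in> SR - P"
    hence "a d > 0" "a e \<le> 0" "Re (ip d e) \<le> 0" using SR_obtuse[of d e] PS by (auto simp: P_def)
    thus "- (a d * (a e * Re (ip d e))) \<le> 0" by (simp add: mult_nonpos_nonpos)
  qed
  hence "u = 0" using ip_pos[OF uX] eq by simp
  hence "0 = u h0" by simp
  also have "u h0 = (\<Sum>d\<in>P. of_real (a d) * of_real (\<xi> d))"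
    unfolding u_def fun_sum_apply fun_scale_def using regular PS SR_RP RP_root by (intro sum.cong refl) auto
  finally have "(\<Sum>d\<in>P. a d * \<xi> d) = 0" by (simp flip: of_real_mult of_real_sum)
  moreover have "(\<Sum>d\<in>P. a d * \<xi> d) > 0"
  proof (rule sum_pos2[OF finP dP])
    have x: "\<xi> d > 0" if "d \<in> P" for d using that PS SR_RP by (auto simp: RP_def)
    show "a d * \<xi> d > 0" using x[OF dP] dP by (simp add: P_def)
    show "a e * \<xi> e \<ge> 0" if "e \<in> P" for e using x[OF that] that by (simp add: P_def)
  qed
  ultimately show False by simp
qed

text \<open>Roots take real values on all \<open>tv e\<close>, so a complex relation splits into the
  relations of its real and imaginary parts; the real statement is applied to the coefficients and
  to their negatives.\<close>

lemma SR_independent: "fun_space.independent SR"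
proof (rule fun_space.independent_if_scalars_zero[OF finite_SR])
  fix c d assume 0: "(\<Sum>x\<in>SR. fun_scale (c x) x) = 0" and d: "d \<in> SR"
  have SX: "x \<in> XR" if "x \<in> SR" for x using XR_root[OF RP_root[OF SR_RP[OF that]]] .
  have real_zero: "(\<Sum>x\<in>SR. fun_scale (of_real (a x)) x) = 0"
    if a: "\<And>e. e \<in> roots H ==> (\<Sum>x\<in>SR. of_real (a x) * x (tv e)) = (0 :: complex)" for a :: "('a => complex) => real"
  proof (rule dual_zeroI)
    show "(\<Sum>x\<in>SR. fun_scale (of_real (a x)) x) \<in> dual H" using XR_dual[OF SX] by (intro dual_sum dual_scale)
    show "(\<Sum>x\<in>SR. fun_scale (of_real (a x)) x) (tv r) = 0" if "r \<in> roots H" for r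
      unfolding fun_sum_apply fun_scale_def by (rule a[OF that])
  qed
  have re_im: "(\<Sum>x\<in>SR. of_real (Re (c x)) * x (tv e)) = 0 \<and> (\<Sum>x\<in>SR. of_real (Im (c x)) * x (tv e)) = 0"
    if e: "e \<in> roots H" for e
  proof -
    define y where "y = (\<lambda>x. Re (x (tv e)))"
    have xy: "x (tv e) = of_real (y x)" if "x \<in> SR" for x using SX[OF that] e by (auto simp: XR_def y_def elim!: Reals_cases)
    have "0 = (\<Sum>x\<in>SR. fun_scale (c x) x) (tv e)" unfolding 0 by simp
    also have "\<dots> = (\<Sum>x\<in>SR. c x * of_real (y x))" unfolding fun_sum_apply fun_scale_def using xy by simp
    finally have z: "(\<Sum>x\<in>SR. c x * of_real (y x)) = 0" by simp
    have "(\<Sum>x\<in>SR. Re (c x) * y x) = 0" using arg_cong[OF z, of Re] by simp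
    moreover have "(\<Sum>x\<in>SR. Im (c x) * y x) = 0" using arg_cong[OF z, of Im] by simp
    moreover have "(\<Sum>x\<in>SR. of_real (a x) * x (tv e)) = of_real (\<Sum>x\<in>SR. a x * y x)" for a :: "('a => complex) => real"
      using xy by simp
    ultimately show ?thesis by (simp only: of_real_0 simp_thms)
  qed
  have zero: "a d = 0" if "(\<Sum>x\<in>SR. fun_scale (of_real (a x)) x) = 0" for a :: "('a => complex) => real"
  proof -
    have "(\<Sum>x\<in>SR. fun_scale (of_real (- a x)) x) = - (\<Sum>x\<in>SR. fun_scale (of_real (a x)) x)"
      by (simp add: fun_eq_iff fun_sum_apply fun_scale_def sum_negf)
    hence "(\<Sum>x\<in>SR. fun_scale (of_real (- a x)) x) = 0" unfolding that by simp
    from SR_real_independent[OF this d] SR_real_independent[OF that d] show ?thesis by simp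
  qed
  have "Re (c d) = 0" by (rule zero[of "\<lambda>x. Re (c x)", OF real_zero]) (use re_im in blast)
  moreover have "Im (c d) = 0" by (rule zero[of "\<lambda>x. Im (c x)", OF real_zero]) (use re_im in blast)
  ultimately show "c d = 0" by (simp add: complex_eq_iff)
qed

lemma SR_base: "root_base H SR" unfolding root_base_def
proof (intro conjI ballI)
  show "SR \<subseteq> roots H" using SR_RP RP_root by blast
  show "nat_combination SR r \<or> nat_combination SR (- r)" if "r \<in> roots H" for r using RP_neg[OF that] RP_natc by blast
qed (rule finite_SR SR_independent)+

lemma xi_natc_pos: assumes "nat_combination SR x" "x \<noteq> 0" shows "Re (x h0) > 0"
proof -
  obtain c where c: "x = (\<Sum>d\<in>SR. fun_scale (of_nat (c d)) d)" using assms(1) unfolding nat_combination_def by blast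
  have pos: "\<xi> d > 0" "d h0 = of_real (\<xi> d)" if "d \<in> SR" for d
    using regular[OF RP_root[OF SR_RP[OF that]]] SR_RP[OF that] by (auto simp: RP_def)
  have "x h0 = (\<Sum>d\<in>SR. of_nat (c d) * of_real (\<xi> d))"
    unfolding c fun_sum_apply fun_scale_def using pos by (intro sum.cong) auto
  hence eq: "Re (x h0) = (\<Sum>d\<in>SR. of_nat (c d) * \<xi> d)" by simp
  have "x = 0" if "\<And>d. d \<in> SR ==> c d = 0" unfolding c using that by (simp add: fun_eq_iff fun_sum_apply fun_scale_def)
  then obtain d where d: "d \<in> SR" "c d \<noteq> 0" using assms(2) by blast
  show ?thesis unfolding eq by (rule sum_pos2[OF finite_SR d(1)]) (use pos d in \<open>auto simp: less_imp_le\<close>)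
qed

lemma positive_roots_SR: "positive_roots H SR = RP"
proof (intro equalityI subsetI)
  fix r assume "r \<in> positive_roots H SR"
  hence r: "r \<in> roots H" "nat_combination SR r" by (auto simp: positive_roots_def)
  thus "r \<in> RP" using xi_natc_pos[OF r(2) rootsD(2)[OF r(1)]] regular[OF r(1)] by (simp add: RP_def)
next
  fix r assume "r \<in> RP"
  thus "r \<in> positive_roots H SR" using RP_root RP_natc by (simp add: positive_roots_def)
qed

end

context regular_alg
begin

text \<open>By maximality the root vector of \<open>\<theta>\<close> is killed by all positive root
  vectors. The adjoint module of a simple algebra is irreducible, so all its weights lie below this
  highest weight.\<close>

lemma highest_root_argmax: assumes \<theta>: "\<theta> \<in> roots H" and max: "\<And>r. r \<in> roots H ==> \<xi> r \<le> \<xi> \<theta>"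
  shows "highest_root H SR \<theta>"
proof -
  interpret b: based_alg scale G br H B \<tau> SR by unfold_locales (rule SR_base)
  interpret A: based_rep scale G br H B \<tau> SR scale G br ..
  have irr: "irreducible_module scale G br" unfolding irreducible_module_def
  proof (intro conjI allI impI)
    show "lie_module scale G br" by (rule adjoint_module)
    show "G \<noteq> {0}" using simple br_self unfolding simple_def by blast
    fix W assume "submodule scale G br W"
    hence "ideal W" unfolding ideal_def submodule_def .
    thus "W = {0} \<or> W = G" using simple unfolding simple_def by blast
  qed
  have v: "rv \<theta> \<in> adj.wsp \<theta>" unfolding adj_wsp by (rule rv(1)[OF \<theta>])
  have zero: "br x (rv \<theta>) = 0" if r: "r \<in> positive_roots H SR" and x: "x \<in> root_space H r" for r x
  proof (rule ccontr)
    assume n: "br x (rv \<theta>) \<noteq> 0"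
    have rR: "r \<in> roots H" and pos: "\<xi> r > 0" using r by (auto simp: positive_roots_SR RP_def)
    have "br x (rv \<theta>) \<in> root_space H (\<theta> + r)" using adj.wsp_shift[OF x v] unfolding adj_wsp .
    moreover have "\<theta> + r \<in> dual H" by (rule dual_add[OF rootsD(1)[OF \<theta>] rootsD(1)[OF rR]])
    moreover have h: "(\<theta> + r) h0 = of_real (\<xi> \<theta> + \<xi> r)" using regular[OF \<theta>] regular[OF rR] by simp
    have "\<xi> \<theta> + \<xi> r \<noteq> 0" using max[OF rR] pos by simp
    hence "(\<theta> + r) h0 \<noteq> 0" unfolding h of_real_eq_0_iff .
    hence "\<theta> + r \<noteq> 0" by force
    ultimately have "\<theta> + r \<in> roots H" using n unfolding roots_def by blast
    hence "\<xi> (\<theta> + r) = \<xi> \<theta> + \<xi> r" "\<xi> (\<theta> + r) \<le> \<xi> \<theta>" by (rule xi_unique[of "\<theta> + r" "\<xi> \<theta> + \<xi> r", OF _ h], rule max)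
    thus False using pos by simp
  qed
  have hw: "highest_weight_vector H SR scale br \<theta> (rv \<theta>)"
    unfolding highest_weight_vector_def using zero rv_nonzero[OF \<theta>] adj.wspD(2)[OF v] by blast
  show ?thesis unfolding highest_root_def
    using \<theta> A.hw_weights[OF irr rv_G[OF \<theta>] hw rootsD(1)[OF \<theta>]] by (auto simp: roots_eq)
qed

end

section \<open>Evaluation of the dimension formula\<close>

definition bin :: "nat => complex => complex" where "bin k x = ((x + of_nat k) gchoose k)"

text \<open>The factor (r, k theta + rho) / (r, rho) of Weyl's formula, where \<open>v\<close> is
  the quotient of (r, rho) by (r, theta).\<close>

definition fac :: "nat => complex => complex" where "fac k v = (of_nat k + v) / v"

definition cartan_dim :: "complex => complex => nat => complex" where
  "cartan_dim \<beta> \<gamma> k = (\<beta> + \<gamma> - 3 + 2 * of_nat k) / (\<beta> + \<gamma> - 3) *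
     (bin k (\<beta> + \<gamma> / 2 - 3) * bin k (\<gamma> + \<beta> / 2 - 3) * bin k (\<beta> + \<gamma> - 4)) /
     (bin k (- 1 + \<beta> / 2) * bin k (- 1 + \<gamma> / 2))"

lemma bin_pochhammer: "bin k x = pochhammer (x + 1) k / fact k" unfolding bin_def gbinomial_pochhammer' by simp

lemma bin_zero: "bin k 0 = 1" unfolding bin_pochhammer by (simp add: pochhammer_fact[symmetric])

lemma bin_nonzero: assumes "Re x > -1" shows "bin k x \<noteq> 0"
proof
  assume "bin k x = 0"
  hence "pochhammer (x + 1) k = 0" by (simp add: bin_pochhammer)
  then obtain n where "x + 1 = - of_nat n" by (auto simp: pochhammer_eq_0_iff)
  hence "Re (x + 1) = Re (- of_nat n)" by (rule arg_cong)
  thus False using assms by simp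
qed

lemma bin_step: assumes "x + 1 \<noteq> 0" shows "bin k (x + 1) = bin k x * fac k (x + 1)"
proof -
  have "(x + 1) * pochhammer (x + 1 + 1) k = pochhammer (x + 1) (Suc k)" by (rule pochhammer_rec[symmetric])
  also have "\<dots> = (x + 1 + of_nat k) * pochhammer (x + 1) k" by (rule pochhammer_rec')
  finally have "pochhammer (x + 1 + 1) k = (x + 1 + of_nat k) * pochhammer (x + 1) k / (x + 1)" using assms by (simp add: field_simps)
  thus ?thesis unfolding bin_pochhammer fac_def by (simp add: add_ac mult_ac)
qed

text \<open>A product of Weyl factors over an arithmetic progression with step 1 is a quotient of
  two generalized binomial coefficients; this is how binomials arise in the dimension
  formula.\<close>

lemma bin_steps: assumes "Re x > -1" shows "bin k (x + of_nat n) = bin k x * (\<Prod>j\<in>{1..n}. fac k (x + of_nat j))"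
proof (induction n)
  case (Suc n)
  have "x + of_nat n + 1 \<noteq> 0"
  proof
    assume "x + of_nat n + 1 = 0"
    hence "Re (x + of_nat n + 1) = Re 0" by (rule arg_cong)
    thus False using assms by simp
  qed
  hence "bin k (x + of_nat (Suc n)) = bin k (x + of_nat n) * fac k (x + of_nat (Suc n))"
    using bin_step[of "x + of_nat n" k] by (simp add: add_ac)
  thus ?case using Suc by simp
qed simp

lemma bin_nat: "bin k (of_nat n) = (\<Prod>j\<in>{1..n}. fac k (of_nat j))" using bin_steps[of 0 k n] by (simp add: bin_zero)

lemma fac_nonzero: "Re v > 0 ==> fac k v \<noteq> 0"
proof
  assume v: "Re v > 0" and 0: "fac k v = 0"
  hence "v = 0 \<or> of_nat k + v = 0" by (auto simp: fac_def)
  hence "Re v = 0 \<or> Re (of_nat k + v) = Re 0" by (metis zero_complex.sel(1))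
  thus False using v by auto
qed

lemma fac_two: "fac k (v / 2) = (v + 2 * of_nat k) / v" by (cases "v = 0") (simp_all add: fac_def field_simps)

lemma cartan_dim_sl: assumes "N \<ge> 2"
  shows "cartan_dim 2 (of_nat N) k = fac k ((of_nat N - 1) / 2) * (\<Prod>j\<in>{1..N - 2}. fac k (of_nat j)) ^ 2"
proof -
  obtain n where n: "N = n + 2" using assms by (metis add.commute le_Suc_ex)
  have e: "2 + complex_of_nat N - 3 = of_nat N - 1" "2 + complex_of_nat N / 2 - 3 = of_nat N / 2 - 1"
    "complex_of_nat N + 2 / 2 - 3 = of_nat n" "2 + complex_of_nat N - 4 = of_nat n"
    "- 1 + 2 / 2 = (0 :: complex)" "- 1 + complex_of_nat N / 2 = of_nat N / 2 - 1" by (simp_all add: n)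
  have "bin k (of_nat N / 2 - 1) \<noteq> 0" by (rule bin_nonzero) (simp add: n)
  thus ?thesis unfolding cartan_dim_def e bin_zero bin_nat fac_two using n by (simp add: power2_eq_square)
qed

lemma prod_fac_half: "(\<Prod>j\<in>{1..2 * n}. fac k (of_nat j / 2)) =
   (\<Prod>j\<in>{1..n}. fac k (- 1 / 2 + of_nat j)) * (\<Prod>j\<in>{1..n}. fac k (of_nat j))"
proof (induction n)
  case (Suc n)
  have "{1..2 * Suc n} = insert (2 * n + 2) (insert (2 * n + 1) {1..2 * n})" by auto
  hence "(\<Prod>j\<in>{1..2 * Suc n}. fac k (of_nat j / 2)) =
     fac k (of_nat (2 * n + 2) / 2) * (fac k (of_nat (2 * n + 1) / 2) * (\<Prod>j\<in>{1..2 * n}. fac k (of_nat j / 2)))" by simp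
  moreover have "complex_of_nat (2 * n + 2) / 2 = of_nat (Suc n)" "complex_of_nat (2 * n + 1) / 2 = - 1 / 2 + of_nat (Suc n)"
    by (simp_all add: field_simps)
  ultimately have "(\<Prod>j\<in>{1..2 * Suc n}. fac k (of_nat j / 2)) = fac k (of_nat (Suc n)) *
     (fac k (- 1 / 2 + of_nat (Suc n)) * (\<Prod>j\<in>{1..2 * n}. fac k (of_nat j / 2)))" by (simp only:)
  moreover have "(\<Prod>j\<in>{1..Suc n}. f j) = f (Suc n) * (\<Prod>j\<in>{1..n}. f j)" for f :: "nat => complex"
    by (simp add: mult.commute)
  ultimately show ?case unfolding Suc by (simp only: mult_ac)
qed simp

text \<open>Together with the leading factor at n / 2, the gap in the second product is filled, so
  the values are j / 2 for all j from 1 to 2n - 1. The odd j give one binomial quotient and the even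
  j the other.\<close>

lemma cartan_dim_sp: assumes "n \<ge> 1" shows "cartan_dim 1 (of_nat n + 2) k =
    fac k (of_nat n / 2) * (\<Prod>j\<in>{1..2 * n - 2}. fac k ((if j < n then of_nat j else of_nat j + 1) / 2))"  (is "_ = ?W")
proof -
  obtain m where m: "n = Suc m" using assms by (cases n) auto
  have e: "1 + (complex_of_nat n + 2) - 3 = of_nat n" "1 + (complex_of_nat n + 2) / 2 - 3 = of_nat n / 2 - 1"
    "complex_of_nat n + 2 + 1 / 2 - 3 = - 1 / 2 + of_nat n" "1 + (complex_of_nat n + 2) - 4 = of_nat m"
    "- 1 + 1 / 2 = (- 1 / 2 :: complex)" "- 1 + (complex_of_nat n + 2) / 2 = of_nat n / 2 - 1 + 1" by (simp_all add: m field_simps)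
  have n0: "Re (of_nat n / 2) > 0" using m by simp
  have b1: "bin k (- 1 / 2 + of_nat n) = bin k (- 1 / 2) * (\<Prod>j\<in>{1..n}. fac k (- 1 / 2 + of_nat j))" by (rule bin_steps) simp
  have b2: "bin k (of_nat n / 2 - 1 + 1) = bin k (of_nat n / 2 - 1) * fac k (of_nat n / 2)"
  proof -
    have "of_nat n / 2 - 1 + 1 \<noteq> (0 :: complex)" using assms by simp
    from bin_step[OF this] show ?thesis by (simp only: diff_add_cancel)
  qed
  have nz: "bin k (- 1 / 2) \<noteq> 0" "bin k (of_nat n / 2 - 1) \<noteq> 0" "fac k (of_nat n / 2) \<noteq> 0"
    using n0 by (auto intro!: bin_nonzero fac_nonzero)
  have f2: "(of_nat n + 2 * of_nat k) / of_nat n = fac k (of_nat n / 2)" by (rule fac_two[symmetric])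
  let ?O = "\<Prod>j\<in>{1..n}. fac k (- 1 / 2 + of_nat j)" and ?V = "\<Prod>j\<in>{1..m}. fac k (of_nat j)"
  have "cartan_dim 1 (of_nat n + 2) k = ?O * ?V" unfolding cartan_dim_def e b1 b2 bin_nat f2 using nz by simp
  moreover have "?W = ?O * ?V"
  proof -
    have s1: "{1..2 * n - 2} = {1..m} \<union> {n..2 * m}" "{1..m} \<inter> {n..2 * m} = {}" using m by auto
    have s2: "{1..2 * m + 1} = {1..m} \<union> ({n} \<union> {n + 1..2 * m + 1})" "{1..m} \<inter> ({n} \<union> {n + 1..2 * m + 1}) = {}" using m by auto
    have sh: "(\<Prod>j\<in>{n..2 * m}. fac k ((of_nat j + 1) / 2)) = (\<Prod>j\<in>{n + 1..2 * m + 1}. fac k (of_nat j / 2))"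
      by (rule prod.reindex_bij_witness[of _ "\<lambda>j. j - 1" "\<lambda>j. j + 1"]) (auto simp: add.commute)
    have "(\<Prod>j\<in>{1..2 * n - 2}. fac k ((if j < n then of_nat j else of_nat j + 1) / 2)) =
       (\<Prod>j\<in>{1..m}. fac k (of_nat j / 2)) * (\<Prod>j\<in>{n..2 * m}. fac k ((of_nat j + 1) / 2))"
      unfolding s1(1) using s1(2) m by (subst prod.union_disjoint) (auto intro!: arg_cong2[where f="(*)"] prod.cong)
    hence "?W =
       (\<Prod>j\<in>{1..m}. fac k (of_nat j / 2)) * (fac k (of_nat n / 2) * (\<Prod>j\<in>{n + 1..2 * m + 1}. fac k (of_nat j / 2)))"
      unfolding sh by (simp only: mult_ac)
    also have "fac k (of_nat n / 2) * (\<Prod>j\<in>{n + 1..2 * m + 1}. fac k (of_nat j / 2)) =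
        (\<Prod>j\<in>{n} \<union> {n + 1..2 * m + 1}. fac k (of_nat j / 2))" by (subst prod.union_disjoint) auto
    also have "(\<Prod>j\<in>{1..m}. fac k (of_nat j / 2)) * \<dots> = (\<Prod>j\<in>{1..2 * m + 1}. fac k (of_nat j / 2))"
      unfolding s2(1) using s2(2) by (subst (2) prod.union_disjoint) auto
    finally have l: "?W = (\<Prod>j\<in>{1..2 * m + 1}. fac k (of_nat j / 2))" .
    have "{1..2 * m + 1} = insert (2 * m + 1) {1..2 * m}" by auto
    hence "(\<Prod>j\<in>{1..2 * m + 1}. fac k (of_nat j / 2)) =
      fac k (of_nat (2 * m + 1) / 2) * ((\<Prod>j\<in>{1..m}. fac k (- 1 / 2 + of_nat j)) * ?V)" unfolding prod_fac_half[symmetric] by simp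
    also have "complex_of_nat (2 * m + 1) / 2 = - 1 / 2 + of_nat n" using m by (simp add: field_simps)
    also have "fac k (- 1 / 2 + of_nat n) * ((\<Prod>j\<in>{1..m}. fac k (- 1 / 2 + of_nat j)) * ?V) = ?O * ?V"
      using m by (simp add: mult_ac)
    finally show ?thesis using l by simp
  qed
  ultimately show ?thesis by simp
qed

text \<open>The heights \<open>v j\<close> of the roots \<open>\<epsilon>\<^sub>0 - \<epsilon>\<^sub>j\<close> of \<open>so\<^sub>N\<close> run through \<open>2, \<dots>, N - 4\<close> and
  additionally \<open>N / 2 - 1\<close>.\<close>

definition so_height :: "nat => nat => complex" where
  "so_height N j = (if 2 * j < N - 1 then of_nat j else if 2 * j > N - 1 then of_nat j - 1 else of_nat j - 1 / 2)"

text \<open>Let m be the integer part of N / 2. For even N the extra value is m - 1, taken both at j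
  = m - 1 and at j = m; for odd N it is the half-integer taken at the middle index j = m.\<close>

lemma prod_so_height: assumes N: "N \<ge> 5"
  shows "(\<Prod>j\<in>{2..N - 3}. f (so_height N j)) = f (of_nat N / 2 - 1) * (\<Prod>j\<in>{2..N - 4}. f (of_nat j))"
proof -
  define m where "m = N div 2"
  have lo: "(\<Prod>j\<in>{2..m - 1}. f (so_height N j)) = (\<Prod>j\<in>{2..m - 1}. f (of_nat j))"
    using N by (intro prod.cong) (auto simp: so_height_def m_def)
  show ?thesis
  proof (cases "even N")
    case True
    hence m: "N = 2 * m" "m \<ge> 3" using N by (auto simp: m_def)
    have s1: "{2..N - 3} = {2..m - 1} \<union> {m..N - 3}" "{2..m - 1} \<inter> {m..N - 3} = {}" using m by auto
    have s2: "{2..N - 4} = {2..m - 1} \<union> {m..N - 4}" "{2..m - 1} \<inter> {m..N - 4} = {}" using m by auto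
    have hi: "(\<Prod>j\<in>{m..N - 3}. f (so_height N j)) = (\<Prod>j\<in>{m - 1..N - 4}. f (of_nat j))"
      using m by (intro prod.reindex_bij_witness[of _ "\<lambda>j. j + 1" "\<lambda>j. j - 1"]) (auto simp: so_height_def of_nat_diff)
    have i: "{m - 1..N - 4} = insert (m - 1) {m..N - 4}" using m by auto
    have "complex_of_nat N / 2 - 1 = of_nat (m - 1)" using m by (simp add: of_nat_diff)
    hence "(\<Prod>j\<in>{m..N - 3}. f (so_height N j)) = f (of_nat N / 2 - 1) * (\<Prod>j\<in>{m..N - 4}. f (of_nat j))"
      unfolding hi i using m by (subst prod.insert) auto
    thus ?thesis unfolding s1(1) s2(1) prod.union_disjoint[OF finite_atLeastAtMost finite_atLeastAtMost s1(2)]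
        prod.union_disjoint[OF finite_atLeastAtMost finite_atLeastAtMost s2(2)] lo by (simp only: mult_ac)
  next
    case False
    hence m: "N = 2 * m + 1" "m \<ge> 2" using N by (auto simp: m_def elim!: oddE)
    have s1: "{2..N - 3} = {2..m - 1} \<union> insert m {m + 1..N - 3}" "{2..m - 1} \<inter> insert m {m + 1..N - 3} = {}" using m by auto
    have s2: "{2..N - 4} = {2..m - 1} \<union> {m..N - 4}" "{2..m - 1} \<inter> {m..N - 4} = {}" using m by auto
    have hi: "(\<Prod>j\<in>{m + 1..N - 3}. f (so_height N j)) = (\<Prod>j\<in>{m..N - 4}. f (of_nat j))"
      using m by (intro prod.reindex_bij_witness[of _ "\<lambda>j. j + 1" "\<lambda>j. j - 1"]) (auto simp: so_height_def of_nat_diff)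
    have "so_height N m = of_nat N / 2 - 1" using m by (simp add: so_height_def field_simps)
    hence "(\<Prod>j\<in>insert m {m + 1..N - 3}. f (so_height N j)) = f (of_nat N / 2 - 1) * (\<Prod>j\<in>{m..N - 4}. f (of_nat j))"
      unfolding hi[symmetric] by (subst prod.insert) auto
    thus ?thesis unfolding s1(1) s2(1) by (subst prod.union_disjoint[OF finite_atLeastAtMost _ s1(2)], simp,
          subst prod.union_disjoint[OF finite_atLeastAtMost finite_atLeastAtMost s2(2)]) (simp only: lo mult_ac)
  qed
qed

lemma cartan_dim_so: assumes N: "N \<ge> 5" shows "cartan_dim 4 (of_nat N - 4) k = fac k ((of_nat N - 3) / 2) *
    (\<Prod>j\<in>{2..N - 3}. fac k (so_height N j) * fac k (so_height N j - 1))"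
proof -
  obtain n where n: "N = n + 5" using assms by (metis add.commute le_Suc_ex)
  have e: "4 + (complex_of_nat N - 4) - 3 = of_nat N - 3" "4 + (complex_of_nat N - 4) / 2 - 3 = of_nat N / 2 - 3 + 1 + 1"
    "complex_of_nat N - 4 + 4 / 2 - 3 = of_nat n" "4 + (complex_of_nat N - 4) - 4 = of_nat (Suc n)"
    "- 1 + 4 / 2 = (of_nat 1 :: complex)" "- 1 + (complex_of_nat N - 4) / 2 = of_nat N / 2 - 3" by (simp_all add: n field_simps)
  have x1: "of_nat N / 2 - 3 + 1 \<noteq> (0 :: complex)" "of_nat N / 2 - 3 + 1 + 1 \<noteq> (0 :: complex)"
  proof -
    have "Re (of_nat N / 2 - 3 + 1) \<noteq> 0" "Re (of_nat N / 2 - 3 + 1 + 1) \<noteq> 0" by (simp_all add: n)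
    thus "of_nat N / 2 - 3 + 1 \<noteq> (0 :: complex)" "of_nat N / 2 - 3 + 1 + 1 \<noteq> (0 :: complex)" by (metis zero_complex.sel(1))+
  qed
  have b: "bin k (of_nat N / 2 - 3 + 1 + 1) = bin k (of_nat N / 2 - 3) * fac k (of_nat N / 2 - 2) * fac k (of_nat N / 2 - 1)"
    unfolding bin_step[OF x1(2)] bin_step[OF x1(1)] by simp
  have nz: "bin k (of_nat N / 2 - 3) \<noteq> 0" by (rule bin_nonzero) (simp add: n)
  have f1: "fac k 1 \<noteq> 0" by (rule fac_nonzero) simp
  have b1: "bin k (of_nat 1) = fac k 1" unfolding bin_nat by simp
  have bS: "bin k (of_nat (Suc n)) = fac k 1 * (\<Prod>j\<in>{2..Suc n}. fac k (of_nat j))"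
  proof -
    have "{1..Suc n} = insert 1 {2..Suc n}" by auto
    thus ?thesis unfolding bin_nat by simp
  qed
  have sh: "(\<Prod>j\<in>{2..N - 4}. fac k (of_nat j - 1)) = bin k (of_nat n)" unfolding bin_nat using n
    by (intro prod.reindex_bij_witness[of _ "\<lambda>j. j + 1" "\<lambda>j. j - 1"]) (auto simp: of_nat_diff)
  have "(\<Prod>j\<in>{2..N - 3}. fac k (so_height N j) * fac k (so_height N j - 1)) =
     (fac k (of_nat N / 2 - 1) * (\<Prod>j\<in>{2..N - 4}. fac k (of_nat j))) *
     (fac k (of_nat N / 2 - 1 - 1) * (\<Prod>j\<in>{2..N - 4}. fac k (of_nat j - 1)))"
    unfolding prod.distrib prod_so_height[OF N, of "\<lambda>v. fac k v"] prod_so_height[OF N, of "\<lambda>v. fac k (v - 1)"] ..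
  moreover have "N - 4 = Suc n" using n by simp
  moreover have "complex_of_nat N / 2 - 1 - 1 = of_nat N / 2 - 2" by simp
  ultimately have R: "(\<Prod>j\<in>{2..N - 3}. fac k (so_height N j) * fac k (so_height N j - 1)) =
     fac k (of_nat N / 2 - 1) * (\<Prod>j\<in>{2..Suc n}. fac k (of_nat j)) * (fac k (of_nat N / 2 - 2) * bin k (of_nat n))"
    using sh by (simp only:)
  have c: "F * (a * b * c * Q * (g * P)) / (g * a) = F * (c * P * (b * Q))" if "a \<noteq> 0" "g \<noteq> 0" for F a b c Q g P :: complex
    using that by simp
  have "fac k ((of_nat N - 3) / 2) = (of_nat N - 3 + 2 * of_nat k) / (of_nat N - 3)" by (rule fac_two)
  thus ?thesis unfolding R cartan_dim_def e b b1 bS using c[OF nz f1] by (simp only:)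
qed

section \<open>Diagonal Cartan subalgebras of matrix Lie algebras\<close>

definition diag_mat_of :: "nat => (nat => complex) => complex mat" where
  "diag_mat_of N d = mat N N (\<lambda>(i, j). if i = j then d i else 0)"

abbreviation diag_diff :: "complex mat => nat \<times> nat => complex" where
  "diag_diff A p \<equiv> A $$ (fst p, fst p) - A $$ (snd p, snd p)"

definition (in lie_algebra) mat_iso :: "('a => complex mat) => complex mat set => bool" where
  "mat_iso \<phi> L \<longleftrightarrow> bij_betw \<phi> G L \<and> (\<forall>x\<in>G. \<forall>y\<in>G. \<phi> (x + y) = \<phi> x + \<phi> y) \<and>
     (\<forall>c. \<forall>x\<in>G. \<phi> (scale c x) = c \<cdot>\<^sub>m \<phi> x) \<and> (\<forall>x\<in>G. \<forall>y\<in>G. \<phi> (br x y) = \<phi> x * \<phi> y - \<phi> y * \<phi> x)"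

lemma (in lie_algebra) isomorphic_mat_iso: "isomorphic_to_mat L \<longleftrightarrow> (\<exists>\<phi>. mat_iso \<phi> L)"
  unfolding isomorphic_to_mat_def mat_iso_def ..

text \<open>\<open>R\<close> indexes the roots by one matrix position each; the entry at the position \<open>opp p\<close> is
  determined by the entry at \<open>p\<close>.\<close>

locale matrix_alg = lie_algebra + fixes \<phi> :: "'a => complex mat" and L :: "complex mat set" and N :: nat
    and R :: "(nat \<times> nat) set" and opp :: "nat \<times> nat => nat \<times> nat" and c :: "nat \<times> nat => complex"
  assumes iso: "mat_iso \<phi> L" and L_carrier: "L \<subseteq> carrier_mat N N"
    and R_range: "p \<in> R ==> fst p < N \<and> snd p < N \<and> fst p \<noteq> snd p"
    and opp_R: "p \<in> R ==> q \<in> R ==> opp q = p ==> q = p" and opp_inj: "p \<in> R ==> q \<in> R ==> opp q = opp p ==> q = p"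
    and opp_entry: "A \<in> L ==> p \<in> R ==> A $$ opp p = c p * A $$ p" and opp_diag: "A \<in> L ==> p \<in> R ==> diag_diff A (opp p) =
      diag_diff A p" and elem_L: "p \<in> R ==> mat N N (\<lambda>q. if q = p then 1 else if q = opp p then c p else 0) \<in> L"
    and cover: "fst q < N ==> snd q < N ==> fst q \<noteq> snd q ==> q \<in> R \<or> (\<exists>p\<in>R. q = opp p) \<or> (\<forall>A\<in>L. A $$ q = 0)"
    and diag_L: "(\<And>i. i < N ==> d (N - 1 - i) = - d i) ==> diag_mat_of N d \<in> L"
begin

lemma phi_bij: "bij_betw \<phi> G L" and phi_add: "x \<in> G ==> y \<in> G ==> \<phi> (x + y) = \<phi> x + \<phi> y"
  and phi_scale: "x \<in> G ==> \<phi> (scale a x) = a \<cdot>\<^sub>m \<phi> x"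
  and phi_br: "x \<in> G ==> y \<in> G ==> \<phi> (br x y) = \<phi> x * \<phi> y - \<phi> y * \<phi> x"
  using iso unfolding mat_iso_def by blast+

definition "Hd = {x \<in> G. \<forall>i<N. \<forall>j<N. i \<noteq> j \<longrightarrow> \<phi> x $$ (i, j) = 0}"

definition "el A = inv_into G \<phi> A"

lemma el: "A \<in> L ==> el A \<in> G" "A \<in> L ==> \<phi> (el A) = A"
  unfolding el_def using phi_bij by (auto simp: bij_betw_def inv_into_into f_inv_into_f)

lemma phi_L: "x \<in> G ==> \<phi> x \<in> L" using phi_bij by (auto simp: bij_betw_def)

lemma phi_carrier: "x \<in> G ==> \<phi> x \<in> carrier_mat N N" using phi_L L_carrier by blast

lemma entries_eqI: assumes "x \<in> G" "y \<in> G" "\<And>i j. i < N ==> j < N ==> \<phi> x $$ (i, j) = \<phi> y $$ (i, j)" shows "x = y"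
proof -
  have "\<phi> x = \<phi> y" using phi_carrier[OF assms(1)] phi_carrier[OF assms(2)] assms(3) by (intro eq_matI) auto
  thus ?thesis using phi_bij assms(1,2) by (auto simp: bij_betw_def inj_on_def)
qed

lemma entry_add: "x \<in> G ==> y \<in> G ==> i < N ==> j < N ==> \<phi> (x + y) $$ (i, j) = \<phi> x $$ (i, j) + \<phi> y $$ (i, j)"
  using phi_carrier[of x] phi_carrier[of y] by (simp add: phi_add)

lemma entry_scale: "x \<in> G ==> i < N ==> j < N ==> \<phi> (scale a x) $$ (i, j) = a * \<phi> x $$ (i, j)"
  using phi_carrier[of x] by (simp add: phi_scale)

lemma entry_zero: "i < N ==> j < N ==> \<phi> 0 $$ (i, j) = 0" using entry_scale[of 0 i j 0] subspace_0[OF carrier_subspace] by simp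

lemma entry_diff: "x \<in> G ==> y \<in> G ==> i < N ==> j < N ==> \<phi> (x - y) $$ (i, j) = \<phi> x $$ (i, j) - \<phi> y $$ (i, j)"
  using entry_add[of "x - y" y i j] carrier_subspace by (simp add: subspace_diff)

lemma entry_sum: assumes "finite I" "\<And>p. p \<in> I ==> f p \<in> G" "i < N" "j < N"
  shows "\<phi> (\<Sum>p\<in>I. f p) $$ (i, j) = (\<Sum>p\<in>I. \<phi> (f p) $$ (i, j))" using assms(1,2)
proof (induction I)
  case (insert p I)
  hence "(\<Sum>p\<in>I. f p) \<in> G" by (intro subspace_sum[OF carrier_subspace]) auto
  thus ?case using insert assms(3,4) entry_add by simp
qed (simp add: entry_zero assms)

lemma Hd_subspace: "subspace Hd" unfolding subspace_def Hd_def
  using carrier_subspace by (auto simp: subspace_0 subspace_add subspace_scale entry_zero entry_add entry_scale)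

lemma Hd_G: "h \<in> Hd ==> h \<in> G" by (simp add: Hd_def)

lemma entry_br: assumes h: "h \<in> Hd" and x: "x \<in> G" and kl: "k < N" "l < N"
  shows "\<phi> (br h x) $$ (k, l) = (\<phi> h $$ (k, k) - \<phi> h $$ (l, l)) * \<phi> x $$ (k, l)"
proof -
  have c: "\<phi> h \<in> carrier_mat N N" "\<phi> x \<in> carrier_mat N N" using phi_carrier Hd_G h x by auto
  have h0: "\<phi> h $$ (i, j) = 0" if "i < N" "j < N" "i \<noteq> j" for i j using h that by (simp add: Hd_def)
  have "\<phi> (br h x) $$ (k, l) = (\<Sum>i<N. \<phi> h $$ (k, i) * \<phi> x $$ (i, l)) - (\<Sum>i<N. \<phi> x $$ (k, i) * \<phi> h $$ (i, l))"
    using c kl by (simp add: phi_br[OF Hd_G[OF h] x] scalar_prod_def atLeast0LessThan)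
  also have "(\<Sum>i<N. \<phi> h $$ (k, i) * \<phi> x $$ (i, l)) = (\<Sum>i<N. if i = k then \<phi> h $$ (k, k) * \<phi> x $$ (k, l) else 0)"
    using h0 kl by (intro sum.cong) auto
  also have "(\<Sum>i<N. \<phi> x $$ (k, i) * \<phi> h $$ (i, l)) = (\<Sum>i<N. if i = l then \<phi> x $$ (k, l) * \<phi> h $$ (l, l) else 0)"
    using h0 kl by (intro sum.cong) auto
  finally show ?thesis using kl by (simp add: algebra_simps)
qed

definition "Xm p = el (mat N N (\<lambda>q. if q = p then 1 else if q = opp p then c p else 0))"

lemma Xm_G: "p \<in> R ==> Xm p \<in> G" unfolding Xm_def by (rule el(1)[OF elem_L])

lemma Xm_entry: "p \<in> R ==> i < N ==> j < N ==> \<phi> (Xm p) $$ (i, j) = (if (i, j) = p then 1 else if (i, j) = opp p then c p else 0)"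
  unfolding Xm_def using el(2)[OF elem_L, of p] by simp

lemma Xm_nonzero: "p \<in> R ==> Xm p \<noteq> 0" using Xm_entry[of p "fst p" "snd p"] R_range[of p] entry_zero[of "fst p" "snd p"] by auto

lemma br_Xm: assumes h: "h \<in> Hd" and p: "p \<in> R" shows "br h (Xm p) = scale (diag_diff (\<phi> h) p) (Xm p)"
proof (rule entries_eqI)
  show "br h (Xm p) \<in> G" using br_closed[OF Hd_G[OF h] Xm_G[OF p]] .
  show "scale (diag_diff (\<phi> h) p) (Xm p) \<in> G" by (rule subspace_scale[OF carrier_subspace Xm_G[OF p]])
  fix i j assume ij: "i < N" "j < N"
  have "(i, j) = opp p ==> \<phi> h $$ (i, i) - \<phi> h $$ (j, j) = diag_diff (\<phi> h) p"
    using opp_diag[OF phi_L[OF Hd_G[OF h]] p] by (metis fst_conv snd_conv)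
  thus "\<phi> (br h (Xm p)) $$ (i, j) = \<phi> (scale (diag_diff (\<phi> h) p) (Xm p)) $$ (i, j)"
    unfolding entry_br[OF h Xm_G[OF p] ij] entry_scale[OF Xm_G[OF p] ij] Xm_entry[OF p ij] by auto
qed

lemma finite_R: "finite R" by (rule finite_subset[of _ "{..<N} \<times> {..<N}"]) (use R_range in \<open>auto simp: mem_Times_iff\<close>)

text \<open>By \<open>cover\<close> an off-diagonal position lies in \<open>R\<close>, is opposite
  to one in \<open>R\<close>, or carries only zeros, so the combination of the \<open>Xm p\<close>
  reproduces all off-diagonal entries.\<close>

lemma diagonal_part: assumes x: "x \<in> G" shows "x - (\<Sum>p\<in>R. scale (\<phi> x $$ p) (Xm p)) \<in> Hd"
proof -
  let ?s = "\<Sum>p\<in>R. scale (\<phi> x $$ p) (Xm p)"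
  have t: "scale (\<phi> x $$ p) (Xm p) \<in> G" if "p \<in> R" for p using subspace_scale[OF carrier_subspace Xm_G[OF that]] .
  have s: "?s \<in> G" by (rule subspace_sum[OF carrier_subspace t])
  have "\<phi> ?s $$ (i, j) = \<phi> x $$ (i, j)" if ij: "i < N" "j < N" "i \<noteq> j" for i j
  proof -
    have e: "\<phi> ?s $$ (i, j) = (\<Sum>p\<in>R. \<phi> x $$ p * (if (i, j) = p then 1 else if (i, j) = opp p then c p else 0))"
      by (rule trans[OF entry_sum[OF finite_R t ij(1,2)]], assumption, rule sum.cong)
        (simp_all only: entry_scale[OF Xm_G ij(1,2)] Xm_entry ij(1,2))
    have "(i, j) \<in> R \<or> (\<exists>p\<in>R. (i, j) = opp p) \<or> (\<forall>A\<in>L. A $$ (i, j) = 0)"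
      by (rule cover) (use ij in simp_all)
    then consider "(i, j) \<in> R" | p where "p \<in> R" "(i, j) = opp p" "(i, j) \<notin> R" | "(i, j) \<notin> R" "\<And>p. p \<in> R ==> (i, j) \<noteq> opp p" "\<phi> x $$ (i, j) = 0"
      using phi_L[OF x] by metis
    thus ?thesis
    proof cases
      case 1
      have "(\<Sum>p\<in>R. \<phi> x $$ p * (if (i, j) = p then 1 else if (i, j) = opp p then c p else 0)) =
          (\<Sum>p\<in>R. if p = (i, j) then \<phi> x $$ (i, j) else 0)" using opp_R[OF 1] by (intro sum.cong) auto
      thus ?thesis unfolding e using finite_R 1 by simp
    next
      case 2
      have "(\<Sum>q\<in>R. \<phi> x $$ q * (if (i, j) = q then 1 else if (i, j) = opp q then c q else 0)) =
          (\<Sum>q\<in>R. if q = p then c p * \<phi> x $$ p else 0)" using 2 opp_inj[OF 2(1)] by (intro sum.cong) auto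
      thus ?thesis unfolding e using finite_R 2 opp_entry[OF phi_L[OF x] 2(1)] by simp
    next
      case 3
      hence "(\<Sum>p\<in>R. \<phi> x $$ p * (if (i, j) = p then 1 else if (i, j) = opp p then c p else 0)) = 0" by (intro sum.neutral) auto
      thus ?thesis unfolding e using 3 by simp
    qed
  qed
  thus ?thesis unfolding Hd_def using entry_diff[OF x s] x s subspace_diff[OF carrier_subspace] by simp
qed

text \<open>The entries are distinct and decreasing and change sign under i to N - 1 - i. So the
  matrix lies in all the classical algebras in their antidiagonal form, and a root is positive at it
  exactly when its position is above the diagonal.\<close>

definition "h0 = el (diag_mat_of N (\<lambda>i. of_nat N - 1 - 2 * of_nat i))"

lemma el_diag: assumes "\<And>i. i < N ==> d (N - 1 - i) = - d i"
  shows "el (diag_mat_of N d) \<in> Hd" "i < N ==> \<phi> (el (diag_mat_of N d)) $$ (i, i) = d i"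
  using el[OF diag_L[of d, OF assms]] by (auto simp: Hd_def diag_mat_of_def)

lemma h0: "h0 \<in> Hd" "i < N ==> \<phi> h0 $$ (i, i) = of_nat N - 1 - 2 * of_nat i"
proof -
  have "of_nat N - 1 - 2 * of_nat (N - 1 - i) = - (of_nat N - 1 - 2 * of_nat i :: complex)" if "i < N" for i
    using that by (simp add: of_nat_diff)
  from el_diag[of "\<lambda>i. of_nat N - 1 - 2 * of_nat i", OF this]
  show "h0 \<in> Hd" "i < N ==> \<phi> h0 $$ (i, i) = of_nat N - 1 - 2 * of_nat i" unfolding h0_def by auto
qed

text \<open>\<open>Hd\<close> is self-centralizing because \<open>h0\<close> has distinct diagonal
  entries; the vectors \<open>Xm p\<close> together with diagonal parts supply the
  eigenvectors.\<close>

lemma cartan_Hd: "cartan_subalgebra Hd" unfolding cartan_subalgebra_def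
proof (intro conjI ballI impI)
  show "subspace Hd" by (rule Hd_subspace)
  show "Hd \<subseteq> G" using Hd_G by blast
  show "br x y = 0" if "x \<in> Hd" "y \<in> Hd" for x y
  proof (rule entries_eqI)
    show "br x y \<in> G" using br_closed Hd_G that by blast
    fix i j assume ij: "i < N" "j < N"
    show "\<phi> (br x y) $$ (i, j) = \<phi> 0 $$ (i, j)"
      using entry_br[OF that(1) Hd_G[OF that(2)] ij] entry_zero[OF ij] that(2) ij by (cases "i = j") (auto simp: Hd_def)
  qed (rule subspace_0[OF carrier_subspace])
  show "x \<in> Hd" if x: "x \<in> G" and 0: "\<forall>h\<in>Hd. br h x = 0" for x
  proof -
    have "\<phi> x $$ (i, j) = 0" if ij: "i < N" "j < N" "i \<noteq> j" for i j
    proof -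
      have "(\<phi> h0 $$ (i, i) - \<phi> h0 $$ (j, j)) * \<phi> x $$ (i, j) = 0"
        using 0 h0(1) entry_br[OF h0(1) x ij(1,2)] entry_zero[OF ij(1,2)] by simp
      moreover have "\<phi> h0 $$ (i, i) - \<phi> h0 $$ (j, j) \<noteq> 0" using ij by (simp add: h0)
      ultimately show ?thesis by simp
    qed
    thus ?thesis using x by (simp add: Hd_def)
  qed
  show "G \<subseteq> span {x \<in> G. \<exists>a. br h x = scale a x}" if h: "h \<in> Hd" for h
  proof
    fix x assume x: "x \<in> G"
    let ?S = "{x \<in> G. \<exists>a. br h x = scale a x}"
    have "Xm p \<in> ?S" if "p \<in> R" for p using br_Xm[OF h that] Xm_G[OF that] by blast
    hence 1: "(\<Sum>p\<in>R. scale (\<phi> x $$ p) (Xm p)) \<in> span ?S" by (intro span_sum span_scale span_base) auto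
    let ?y = "x - (\<Sum>p\<in>R. scale (\<phi> x $$ p) (Xm p))"
    have y: "?y \<in> Hd" by (rule diagonal_part[OF x])
    have "br h ?y = scale 0 ?y"
    proof (rule entries_eqI)
      show "br h ?y \<in> G" by (rule br_closed[OF Hd_G[OF h] Hd_G[OF y]])
      fix i j assume ij: "i < N" "j < N"
      show "\<phi> (br h ?y) $$ (i, j) = \<phi> (scale 0 ?y) $$ (i, j)"
        using entry_br[OF h Hd_G[OF y] ij] entry_scale[OF Hd_G[OF y] ij, of 0] y ij by (cases "i = j") (auto simp: Hd_def)
    qed (rule subspace_scale[OF carrier_subspace Hd_G[OF y]])
    hence "?y \<in> ?S" using Hd_G[OF y] by blast
    hence "?y + (\<Sum>p\<in>R. scale (\<phi> x $$ p) (Xm p)) \<in> span ?S" by (rule span_add[OF span_base 1])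
    thus "x \<in> span ?S" by simp
  qed
qed

end

section \<open>Roots of the diagonal Cartan subalgebra\<close>

locale matrix_form = matrix_alg + fixes B :: "'a => 'a => complex" and \<tau> :: real
  assumes simple': "simple" and normalized': "casimir_normalized B (of_real \<tau>)" and tau_pos': "\<tau> > 0"

sublocale matrix_form \<subseteq> form_alg scale G br Hd B \<tau> by unfold_locales (rule cartan_Hd simple' normalized' tau_pos')+

context matrix_form
begin

definition rt :: "nat \<times> nat => 'a => complex" where "rt p = (\<lambda>h. if h \<in> Hd then diag_diff (\<phi> h) p else 0)"

lemma rt_dual: "p \<in> R ==> rt p \<in> dual Hd" using Hd_subspace R_range[of p] unfolding dual_def rt_def
  by (auto simp: subspace_add subspace_scale entry_add entry_scale Hd_G algebra_simps)

lemma rt_h0: "p \<in> R ==> rt p h0 = 2 * (of_nat (snd p) - of_nat (fst p))" using R_range[of p] by (simp add: rt_def h0)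

lemma Xm_root_space: "p \<in> R ==> Xm p \<in> root_space Hd (rt p)" using br_Xm Xm_G by (auto simp: root_space_def rt_def)

lemma rt_root: "p \<in> R ==> rt p \<in> roots Hd"
  using rt_dual[of p] rt_h0[of p] Xm_root_space[of p] Xm_nonzero[of p] R_range[of p] unfolding roots_def by auto

text \<open>A root vector has a nonzero entry, and the position of that entry determines the
  root.\<close>

lemma roots_rt: "roots Hd = rt ` R"
proof (intro equalityI subsetI)
  fix r assume r: "r \<in> roots Hd"
  obtain x where x: "x \<in> root_space Hd r" "x \<noteq> 0" using root_vector_exists[OF r] by blast
  have xG: "x \<in> G" using x by (simp add: root_space_def)
  obtain i j where ij: "i < N" "j < N" "\<phi> x $$ (i, j) \<noteq> 0"
    using entries_eqI[OF xG subspace_0[OF carrier_subspace]] entry_zero x(2) by metis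
  have e: "r h = \<phi> h $$ (i, i) - \<phi> h $$ (j, j)" if "h \<in> Hd" for h
    using x(1) that entry_br[OF that xG ij(1,2)] entry_scale[OF xG ij(1,2), of "r h"] ij(3) by (simp add: root_space_def)
  have out: "r h = 0" if "h \<notin> Hd" for h using rootsD(1)[OF r] that by (simp add: dual_def)
  have "i \<noteq> j"
  proof
    assume "i = j"
    hence "r h = 0" for h using e out by (cases "h \<in> Hd") simp_all
    thus False using rootsD(2)[OF r] by (auto simp: fun_eq_iff)
  qed
  then consider "(i, j) \<in> R" | p where "p \<in> R" "(i, j) = opp p" using cover[of "(i, j)"] ij phi_L[OF xG] by auto
  thus "r \<in> rt ` R"
  proof cases
    case 1
    have "r = rt (i, j)" using e out by (auto simp: rt_def fun_eq_iff)
    thus ?thesis using 1 by blast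
  next
    case 2
    hence f: "fst (opp p) = i" "snd (opp p) = j" by (metis fst_conv, metis snd_conv)
    have "r = rt p" using e out opp_diag[OF phi_L[OF Hd_G] 2(1)] unfolding f by (auto simp: rt_def fun_eq_iff)
    thus ?thesis using 2 by blast
  qed
qed (use rt_root in auto)

text \<open>Equal roots would make \<open>Xm q\<close> a multiple of \<open>Xm p\<close>, since root
  spaces are lines; comparing entries leaves only the same or the opposite position.\<close>

lemma rt_inj: "inj_on rt R"
proof (rule inj_onI)
  fix p q assume p: "p \<in> R" and q: "q \<in> R" and eq: "rt p = rt q"
  have "Xm q \<in> root_space Hd (rt p)" using Xm_root_space[OF q] eq by simp
  then obtain a where a: "Xm q = scale a (Xm p)" using root_space_dim_one[OF rt_root[OF p] Xm_root_space[OF p] Xm_nonzero[OF p]] by auto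
  have r: "fst q < N" "snd q < N" using R_range[OF q] by auto
  have "\<phi> (Xm p) $$ (fst q, snd q) \<noteq> 0" using entry_scale[OF Xm_G[OF p] r, of a] Xm_entry[OF q r] a by auto
  hence "q = p \<or> q = opp p" using Xm_entry[OF p r] by (auto split: if_splits)
  thus "p = q" using opp_R[OF q p] by auto
qed

end

sublocale matrix_form \<subseteq> reg: regular_alg scale G br Hd B \<tau> h0 "\<lambda>r. Re (r h0)"
proof unfold_locales
  fix r assume "r \<in> roots Hd"
  then obtain p where p: "p \<in> R" "r = rt p" unfolding roots_rt by blast
  have "rt p h0 = of_real (2 * (real (snd p) - real (fst p)))" using rt_h0[OF p(1)] by simp
  thus "r h0 = of_real (Re (r h0)) \<and> Re (r h0) \<noteq> 0" using R_range[OF p(1)] unfolding p(2) by simp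
qed

context matrix_form
begin

lemma RP_rt: "reg.RP = rt ` {p \<in> R. fst p < snd p}" unfolding reg.RP_def roots_rt using rt_h0 by auto

lemma sum_roots: "(\<Sum>r\<in>roots Hd. f r) = (\<Sum>p\<in>R. f (rt p))" unfolding roots_rt by (simp add: sum.reindex[OF rt_inj])

lemma killing_diag: "h \<in> Hd ==> k \<in> Hd ==> 2 * of_real \<tau> * B h k =
   (\<Sum>(i, j)\<in>R. (\<phi> h $$ (i, i) - \<phi> h $$ (j, j)) * (\<phi> k $$ (i, i) - \<phi> k $$ (j, j)))"
  unfolding killing_H[symmetric] sum_roots by (auto simp: rt_def intro!: sum.cong)

lemma ip_represented: assumes \<mu>: "\<mu> \<in> dual Hd" and z: "z \<in> Hd" "\<And>h. h \<in> Hd ==> \<mu> h = B z h" and p: "p \<in> R"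
  shows "ip (rt p) \<mu> = diag_diff (\<phi> z) p"
proof -
  have r: "rt p \<in> roots Hd" by (rule rt_root[OF p])
  have "ip (rt p) \<mu> = \<mu> (tv (rt p))" by (rule ip_root_left[OF r \<mu>])
  also have "\<dots> = B z (tv (rt p))" by (rule z(2)[OF tv(1)[OF r]])
  also have "\<dots> = B (tv (rt p)) z" by (rule B_sym[OF Hd_G[OF z(1)] Hd_G[OF tv(1)[OF r]]])
  also have "\<dots> = rt p z" by (rule tv(2)[OF r z(1)])
  finally show ?thesis using z(1) by (simp add: rt_def)
qed

end

section \<open>Statements free of a Cartan subalgebra\<close>

context lie_algebra
begin

abbreviation top_eig :: "real => nat => complex" where
  "top_eig \<tau> k \<equiv> 2 * of_nat k * of_real \<tau> + ((of_nat k)\<^sup>2 - of_nat k) * 2"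

text \<open>The interface between the convenient Cartan subalgebra and the given one. The last two
  clauses make 4 tau + 4 the largest Casimir eigenvalue in degree two, from which
  \<open>top_spaces_norm\<close> recovers the length of theta.\<close>

definition top_spaces :: "('a => 'a => complex) => real => complex => complex => bool" where
  "top_spaces B \<tau> \<beta> \<gamma> \<longleftrightarrow> (\<forall>k. of_nat (fun_space.dim (cas_space B k (top_eig \<tau> k))) =
        cartan_dim \<beta> \<gamma> k) \<and>
     (\<forall>T c. T \<in> cas_space B 2 c \<longrightarrow> T \<noteq> 0 \<longrightarrow> Re c \<le> 4 * \<tau> + 4) \<and>
     (\<exists>T\<in>cas_space B 2 (4 * of_real \<tau> + 4). T \<noteq> 0)"

end

context highest_alg
begin

lemma ip_wrho_nonzero: "r \<in> Pos ==> ip r wrho \<noteq> 0"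
proof
  assume r: "r \<in> Pos" "ip r wrho = 0"
  hence "natc r" "r \<noteq> 0" using rootsD(2) by (auto simp: positive_roots_def)
  thus False using wrho_pos_natc(2)[of r] r(2) by simp
qed

lemma dim_product: "(\<Prod>r\<in>Pos. ip r (ktheta k + wrho)) =
   (\<Prod>r\<in>{r \<in> Pos. ip r \<theta> \<noteq> 0}. fac k (ip r wrho / ip r \<theta>)) * (\<Prod>r\<in>Pos. ip r wrho)"
proof -
  have "ip r (ktheta k + wrho) = (if ip r \<theta> \<noteq> 0 then fac k (ip r wrho / ip r \<theta>) else 1) * ip r wrho" if r: "r \<in> Pos" for r
    using ip_wrho_nonzero[OF r] unfolding ip_add_right ktheta_def ip_scale_right by (auto simp: fac_def field_simps)
  hence "(\<Prod>r\<in>Pos. ip r (ktheta k + wrho)) =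
     (\<Prod>r\<in>Pos. if ip r \<theta> \<noteq> 0 then fac k (ip r wrho / ip r \<theta>) else 1) * (\<Prod>r\<in>Pos. ip r wrho)"
    unfolding prod.distrib[symmetric] by (rule prod.cong[OF refl])
  also have "(\<Prod>r\<in>Pos. if ip r \<theta> \<noteq> 0 then fac k (ip r wrho / ip r \<theta>) else 1) =
     (\<Prod>r\<in>{r \<in> Pos. ip r \<theta> \<noteq> 0}. fac k (ip r wrho / ip r \<theta>))"
    by (rule prod.inter_filter[OF finite_Pos, symmetric])
  finally show ?thesis .
qed

lemma top_spacesI: assumes n: "ip \<theta> \<theta> = 2"
    and p: "\<And>k. (\<Prod>r\<in>{r \<in> Pos. ip r \<theta> \<noteq> 0}. fac k (ip r wrho / ip r \<theta>)) = cartan_dim \<beta> \<gamma> k"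
  shows "top_spaces B \<tau> \<beta> \<gamma>"
proof -
  have c: "cas (ktheta k) = top_eig \<tau> k" for k using cas_ktheta[of k] n by simp
  have c2: "cas (ktheta 2) = 4 * of_real \<tau> + 4" using c[of 2] by simp
  have z: "(\<Prod>r\<in>Pos. ip r wrho) \<noteq> 0" using ip_wrho_nonzero finite_Pos by (simp add: prod_zero_iff)
  show ?thesis unfolding top_spaces_def
  proof (intro conjI allI impI)
    fix k
    have "(\<Prod>r\<in>Pos. ip r wrho) * of_nat (fun_space.dim (cas_space B k (cas (ktheta k)))) =
       (\<Prod>r\<in>Pos. ip r wrho) * cartan_dim \<beta> \<gamma> k"
      unfolding cartan_power_dim[OF cartan_power_cas_space] dim_product p by (rule mult.commute)
    thus "of_nat (fun_space.dim (cas_space B k (top_eig \<tau> k))) =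
        cartan_dim \<beta> \<gamma> k" using z unfolding c by simp
  next
    show "\<exists>T\<in>cas_space B 2 (4 * of_real \<tau> + 4). T \<noteq> 0"
      using ek_cas_space[of 2] ek_nonzero[of 2] unfolding c2 by blast
    show "Re c \<le> 4 * \<tau> + 4" if "T \<in> cas_space B 2 c" "T \<noteq> 0" for T c using cas_space_bound[OF that] unfolding c2 by simp
  qed
qed

end

context matrix_form
begin

text \<open>\<open>a\<close> and \<open>b\<close> are the diagonals of the matrices in
  \<open>Hd\<close> that represent theta and rho with respect to \<open>B\<close>, and
  \<open>\<kappa>\<close> is the ratio of \<open>B\<close> to the trace form. The highest root
  belongs to the position \<open>p0\<close> farthest above the diagonal, because
  \<open>rt p h0\<close> is twice the distance.\<close>

lemma top_spaces_diag:
  assumes p0: "p0 \<in> R" "fst p0 < snd p0" and max: "\<And>p. p \<in> R ==> fst p < snd p ==> snd p - fst p \<le> snd p0 - fst p0"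
    and B: "\<And>h k. h \<in> Hd ==> k \<in> Hd ==> B h k = \<kappa> * (\<Sum>i<N. \<phi> h $$ (i, i) * \<phi> k $$ (i, i))"
    and a: "\<And>i. i < N ==> a (N - 1 - i) = - a i" and b: "\<And>i. i < N ==> b (N - 1 - i) = - b i"
    and \<theta>: "\<And>h. h \<in> Hd ==> diag_diff (\<phi> h) p0 = \<kappa> * (\<Sum>i<N. a i * \<phi> h $$ (i, i))"
    and \<rho>: "\<And>h. h \<in> Hd ==> (\<Sum>(i, j)\<in>{p \<in> R. fst p < snd p}. \<phi> h $$ (i, i) - \<phi> h $$ (j, j)) = 2 * \<kappa> * (\<Sum>i<N. b i * \<phi> h $$ (i, i))"
    and norm: "a (fst p0) - a (snd p0) = 2"
    and dims: "\<And>k. (\<Prod>(i, j)\<in>{p \<in> R. fst p < snd p \<and> a (fst p) \<noteq> a (snd p)}. fac k ((b i - b j) / (a i - a j))) = cartan_dim \<beta> \<gamma> k"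
  shows "top_spaces B \<tau> \<beta> \<gamma>"
proof -
  have hi: "highest_root Hd reg.SR (rt p0)"
  proof (rule reg.highest_root_argmax[OF rt_root[OF p0(1)]])
    fix r assume "r \<in> roots Hd"
    then obtain p where p: "p \<in> R" "r = rt p" unfolding roots_rt by blast
    have "real (snd p) - real (fst p) \<le> real (snd p0) - real (fst p0)" using max[OF p(1)] p0(2) by (cases "fst p < snd p") auto
    thus "Re (r h0) \<le> Re (rt p0 h0)" using rt_h0[OF p(1)] rt_h0[OF p0(1)] p(2) by simp
  qed
  interpret h: highest_alg scale G br Hd B \<tau> reg.SR "rt p0" by unfold_locales (rule reg.SR_base hi)+
  let ?a = "el (diag_mat_of N a)" and ?b = "el (diag_mat_of N b)"
  have ea: "?a \<in> Hd" "\<phi> ?a $$ (i, i) = a i" if "i < N" for i using el_diag[of a, OF a] that by auto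
  have eb: "?b \<in> Hd" "\<phi> ?b $$ (i, i) = b i" if "i < N" for i using el_diag[of b, OF b] that by auto
  have N0: "0 < N" using R_range[OF p0(1)] by auto
  have ipa: "ip (rt p) (rt p0) = a (fst p) - a (snd p)" if "p \<in> R" for p
  proof -
    have "ip (rt p) (rt p0) = diag_diff (\<phi> ?a) p"
    proof (rule ip_represented[OF rt_dual[OF p0(1)] ea(1)[OF N0] _ that])
      fix h assume h: "h \<in> Hd"
      show "rt p0 h = B ?a h" unfolding B[OF ea(1)[OF N0] h] using \<theta>[OF h] h ea(2) by (simp add: rt_def)
    qed
    thus ?thesis using ea(2) R_range[OF that] by simp
  qed
  have ipb: "ip (rt p) h.wrho = b (fst p) - b (snd p)" if "p \<in> R" for p
  proof -
    have "ip (rt p) h.wrho = diag_diff (\<phi> ?b) p"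
    proof (rule ip_represented[OF XR_dual[OF h.wrho_XR] eb(1)[OF N0] _ that])
      fix h assume h: "h \<in> Hd"
      have "2 * h.wrho h = (\<Sum>r\<in>reg.RP. r h)" unfolding h.wrho_def reg.positive_roots_SR fun_scale_def fun_sum_apply by simp
      also have "\<dots> = (\<Sum>p\<in>{p \<in> R. fst p < snd p}. rt p h)"
        unfolding RP_rt by (rule sum.reindex[THEN trans]) (auto intro: inj_on_subset[OF rt_inj])
      also have "\<dots> = (\<Sum>(i, j)\<in>{p \<in> R. fst p < snd p}. \<phi> h $$ (i, i) - \<phi> h $$ (j, j))"
        using h by (intro sum.cong) (auto simp: rt_def)
      finally show "h.wrho h = B ?b h" unfolding B[OF eb(1)[OF N0] h] \<rho>[OF h] using eb(2) by simp
    qed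
    thus ?thesis using eb(2) R_range[OF that] by simp
  qed
  show ?thesis
  proof (rule h.top_spacesI)
    show "ip (rt p0) (rt p0) = 2" using ipa[OF p0(1)] norm by simp
    fix k
    have s: "{r \<in> positive_roots Hd reg.SR. ip r (rt p0) \<noteq> 0} = rt ` {p \<in> R. fst p < snd p \<and> a (fst p) \<noteq> a (snd p)}"
      unfolding reg.positive_roots_SR RP_rt using ipa by auto
    have "(\<Prod>r\<in>{r \<in> positive_roots Hd reg.SR. ip r (rt p0) \<noteq> 0}. fac k (ip r h.wrho / ip r (rt p0))) =
       (\<Prod>p\<in>{p \<in> R. fst p < snd p \<and> a (fst p) \<noteq> a (snd p)}. fac k (ip (rt p) h.wrho / ip (rt p) (rt p0)))"
      unfolding s by (rule prod.reindex[THEN trans]) (auto intro: inj_on_subset[OF rt_inj])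
    also have "\<dots> = (\<Prod>(i, j)\<in>{p \<in> R. fst p < snd p \<and> a (fst p) \<noteq> a (snd p)}. fac k ((b i - b j) / (a i - a j)))"
      using ipa ipb by (intro prod.cong) auto
    finally show "(\<Prod>r\<in>{r \<in> positive_roots Hd reg.SR. ip r (rt p0) \<noteq> 0}. fac k (ip r h.wrho / ip r (rt p0))) = cartan_dim \<beta> \<gamma> k"
      unfolding dims .
  qed
qed

end

lemma double_sum_diff:  fixes f g :: "nat => complex" assumes "(\<Sum>i<N. f i) = 0"
  shows "(\<Sum>i<N. \<Sum>j<N. (f i - f j) * (g i - g j)) = 2 * of_nat N * (\<Sum>i<N. f i * g i)"
proof -
  have "(\<Sum>i<N. \<Sum>j<N. (f i - f j) * (g i - g j)) =
    (\<Sum>i<N. \<Sum>j<N. f i * g i) - (\<Sum>i<N. \<Sum>j<N. f i * g j) - (\<Sum>i<N. \<Sum>j<N. f j * g i) + (\<Sum>i<N. \<Sum>j<N. f j * g j)"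
    by (simp add: sum.distrib sum_subtractf algebra_simps)
  also have "(\<Sum>i<N. \<Sum>j<N. f i * g j) = 0" unfolding sum_product[symmetric] using assms by simp
  also have "(\<Sum>i<N. \<Sum>j<N. f j * g i) = 0" by (subst sum.swap) (simp only: sum_product[symmetric] assms mult_zero_left)
  finally show ?thesis by (simp add: sum_distrib_left algebra_simps)
qed

lemma double_sum_less: fixes f :: "nat => complex"
  shows "(\<Sum>i<N. \<Sum>j<N. if i < j then f i - f j else 0) = (\<Sum>i<N. (of_nat N - 1 - 2 * of_nat i) * f i)"
proof -
  have "(\<Sum>i<N. \<Sum>j<N. if i < j then f i - f j else 0) =
     (\<Sum>i<N. \<Sum>j<N. if i < j then f i else 0) - (\<Sum>i<N. \<Sum>j<N. if i < j then f j else 0)"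
    unfolding sum_subtractf[symmetric] by (intro sum.cong) auto
  also have "(\<Sum>i<N. \<Sum>j<N. if i < j then f j else 0) = (\<Sum>i<N. \<Sum>j<N. if j < i then f i else 0)" by (rule sum.swap)
  also have "(\<Sum>i<N. \<Sum>j<N. if i < j then f i else 0) = (\<Sum>i<N. (of_nat N - 1 - of_nat i) * f i)"
  proof (intro sum.cong refl)
    fix i assume "i \<in> {..<N}"
    hence i: "i < N" by simp
    have "{j \<in> {..<N}. i < j} = {i<..<N}" by auto
    thus "(\<Sum>j<N. if i < j then f i else 0) = (of_nat N - 1 - of_nat i) * f i"
      using i by (simp add: sum.inter_filter[symmetric] of_nat_diff)
  qed
  also have "(\<Sum>i<N. \<Sum>j<N. if j < i then f i else 0) = (\<Sum>i<N. of_nat i * f i)"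
  proof (intro sum.cong refl)
    fix i assume "i \<in> {..<N}"
    hence "{j \<in> {..<N}. j < i} = {..<i}" by auto
    thus "(\<Sum>j<N. if j < i then f i else 0) = of_nat i * f i" by (simp add: sum.inter_filter[symmetric])
  qed
  finally show ?thesis unfolding sum_subtractf[symmetric] by (simp add: algebra_simps)
qed

lemma sum_reflect: "(\<Sum>i<N. f (N - 1 - i)) = (\<Sum>i<N. f i :: complex)" for N :: nat
  by (rule sum.reindex_bij_witness[of _ "\<lambda>i. N - 1 - i" "\<lambda>i. N - 1 - i"]) auto

lemma sum_antidiagonal: fixes F :: "nat => nat => complex" assumes F: "\<And>i j. i < N ==> j < N ==> F (N - 1 - j) (N - 1 - i) = F i j"
  shows "(\<Sum>i<N. \<Sum>j<N. F i j) = 2 * (\<Sum>(i, j)\<in>{(i, j). i < N \<and> j < N \<and> i + j < N - 1}. F i j) + (\<Sum>i<N. F i (N - 1 - i))"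
proof -
  let ?A = "{(i, j). i < N \<and> j < N \<and> i + j < N - 1}" and ?C = "{(i, j). i < N \<and> j < N \<and> i + j > N - 1}"
    and ?D = "{(i, j). i < N \<and> j < N \<and> i + j = N - 1}"
  have F': "F (N - Suc j) (N - Suc i) = F i j" if "i < N" "j < N" for i j using F[OF that] by simp
  have fin: "finite ?A" "finite ?C" "finite ?D" by (rule finite_subset[of _ "{..<N} \<times> {..<N}"]; auto)+
  have "(\<Sum>i<N. \<Sum>j<N. F i j) = (\<Sum>(i, j)\<in>{..<N} \<times> {..<N}. F i j)" by (rule sum.cartesian_product)
  also have "{..<N} \<times> {..<N} = ?A \<union> (?C \<union> ?D)" by auto
  also have "(\<Sum>(i, j)\<in>?A \<union> (?C \<union> ?D). F i j) = (\<Sum>(i, j)\<in>?A. F i j) + ((\<Sum>(i, j)\<in>?C. F i j) + (\<Sum>(i, j)\<in>?D. F i j))"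
    by (subst sum.union_disjoint, use fin in simp, use fin in simp, force, subst sum.union_disjoint, use fin in simp, use fin in simp, force, simp)
  also have "(\<Sum>(i, j)\<in>?C. F i j) = (\<Sum>(i, j)\<in>?A. F i j)"
    by (rule sum.reindex_bij_witness[of _ "\<lambda>(i, j). (N - 1 - j, N - 1 - i)" "\<lambda>(i, j). (N - 1 - j, N - 1 - i)"]) (auto simp: F')
  also have "(\<Sum>(i, j)\<in>?D. F i j) = (\<Sum>i<N. F i (N - 1 - i))"
    by (rule sum.reindex_bij_witness[of _ "\<lambda>i. (i, N - 1 - i)" fst]) (auto intro!: arg_cong[of _ _ "F _"])
  finally show ?thesis by simp
qed

section \<open>The classical Lie algebras\<close>

context lie_algebra
begin

lemma isomorphic_to_mat_conj: assumes iso: "isomorphic_to_mat L" and L: "L \<subseteq> carrier_mat N N" "L' \<subseteq> carrier_mat N N"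
    and P: "P \<in> carrier_mat N N" "Q \<in> carrier_mat N N" "P * Q = 1\<^sub>m N" "Q * P = 1\<^sub>m N"
    and fwd: "\<And>A. A \<in> L ==> P * A * Q \<in> L'" and bwd: "\<And>A. A \<in> L' ==> Q * A * P \<in> L" shows "isomorphic_to_mat L'"
proof -
  obtain \<phi> where "mat_iso \<phi> L" using iso unfolding isomorphic_mat_iso by blast
  note \<phi> = this[unfolded mat_iso_def, THEN conjunct1] this[unfolded mat_iso_def, THEN conjunct2]
  have c: "\<phi> x \<in> carrier_mat N N" if "x \<in> G" for x using \<phi>(1) L(1) that by (auto simp: bij_betw_def)
  have cancel: "Q * (P * A * Q) * P = A" "P * (Q * A * P) * Q = A" if A: "A \<in> carrier_mat N N" for A
  proof -
    have "Q * (P * A * Q) * P = (Q * P) * A * (Q * P)" using A P(1,2) by (simp add: assoc_mult_mat[of _ N N _ N _ N])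
    thus "Q * (P * A * Q) * P = A" using A P(4) by simp
    have "P * (Q * A * P) * Q = (P * Q) * A * (P * Q)" using A P(1,2) by (simp add: assoc_mult_mat[of _ N N _ N _ N])
    thus "P * (Q * A * P) * Q = A" using A P(3) by simp
  qed
  have mult: "P * (A * A') * Q = (P * A * Q) * (P * A' * Q)" if A: "A \<in> carrier_mat N N" "A' \<in> carrier_mat N N" for A A'
  proof -
    have "(P * A * Q) * (P * A' * Q) = P * (A * ((Q * P) * A')) * Q" using A P(1,2) by (simp add: assoc_mult_mat[of _ N N _ N _ N])
    thus ?thesis using A P(4) by simp
  qed
  have b: "bij_betw (\<lambda>A. P * A * Q) L L'"
    by (rule bij_betw_byWitness[where f' = "\<lambda>A. Q * A * P"]) (use cancel L fwd bwd in auto)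
  show ?thesis unfolding isomorphic_to_mat_def
  proof (intro exI[of _ "\<lambda>x. P * \<phi> x * Q"] conjI allI ballI)
    show "bij_betw (\<lambda>x. P * \<phi> x * Q) G L'" using bij_betw_trans[OF \<phi>(1) b] by (simp add: comp_def)
    fix x y a assume x: "x \<in> G"
    show "P * \<phi> (scale a x) * Q = a \<cdot>\<^sub>m (P * \<phi> x * Q)"
      using c[OF x] P(1,2) \<phi>(2) x by (simp add: mult_smult_distrib[of _ N N _ N] mult_smult_assoc_mat[of _ N N _ N])
    assume y: "y \<in> G"
    show "P * \<phi> (x + y) * Q = P * \<phi> x * Q + P * \<phi> y * Q" using c[OF x] c[OF y] P(1,2) \<phi>(2) x y
      by (simp add: mult_add_distrib_mat[of _ N N _ N] add_mult_distrib_mat[of _ N N _ _ N])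
    have "P * (\<phi> x * \<phi> y - \<phi> y * \<phi> x) * Q = P * (\<phi> x * \<phi> y) * Q - P * (\<phi> y * \<phi> x) * Q"
      using c[OF x] c[OF y] P(1,2) by (simp add: mult_minus_distrib_mat[of _ N N _ N] minus_mult_distrib_mat[of _ N N _ _ N])
    thus "P * \<phi> (br x y) * Q = P * \<phi> x * Q * (P * \<phi> y * Q) - P * \<phi> y * Q * (P * \<phi> x * Q)"
      using \<phi>(2) x y by (simp add: mult[OF c[OF x] c[OF y]] mult[OF c[OF y] c[OF x]])
  qed
qed

end

text \<open>The orthogonal and symplectic algebras of a form concentrated on the antidiagonal, with
  signs \<open>s\<close>. In these coordinates the diagonal matrices form a Cartan subalgebra,
  whereas the only diagonal matrix in \<open>so_mat\<close> is zero.\<close>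

definition split_mat :: "(nat => complex) => nat => complex mat set" where
  "split_mat s N = {A \<in> carrier_mat N N. \<forall>i<N. \<forall>j<N. A $$ (i, j) = - (s i * s j) * A $$ (N - 1 - j, N - 1 - i)}"

definition bidiag_mat :: "nat => complex => complex => complex mat" where
  "bidiag_mat N u v = mat N N (\<lambda>(i, j). (if j = i then u else 0) + (if j = N - 1 - i then v else 0))"

lemma bidiag_carrier: "bidiag_mat N u v \<in> carrier_mat N N" by (simp add: bidiag_mat_def)

lemma bidiag_mult: assumes "A \<in> carrier_mat N N" "i < N" "j < N"
  shows "(bidiag_mat N u v * A) $$ (i, j) = u * A $$ (i, j) + v * A $$ (N - 1 - i, j)"
    and "(A * bidiag_mat N u v) $$ (i, j) = u * A $$ (i, j) + v * A $$ (i, N - 1 - j)"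
proof -
  have "(bidiag_mat N u v * A) $$ (i, j) = (\<Sum>l<N. ((if l = i then u else 0) + (if l = N - 1 - i then v else 0)) * A $$ (l, j))"
    using assms by (simp add: bidiag_mat_def scalar_prod_def atLeast0LessThan)
  also have "\<dots> = (\<Sum>l<N. (if l = i then u * A $$ (i, j) else 0) + (if l = N - 1 - i then v * A $$ (N - 1 - i, j) else 0))"
    by (intro sum.cong) (auto simp: algebra_simps)
  finally show "(bidiag_mat N u v * A) $$ (i, j) = u * A $$ (i, j) + v * A $$ (N - 1 - i, j)" using assms by (simp add: sum.distrib)
  have e: "j = N - 1 - l \<longleftrightarrow> l = N - 1 - j" if "l < N" for l using assms that by auto
  have "(A * bidiag_mat N u v) $$ (i, j) = (\<Sum>l<N. A $$ (i, l) * ((if j = l then u else 0) + (if j = N - 1 - l then v else 0)))"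
    using assms by (simp add: bidiag_mat_def scalar_prod_def atLeast0LessThan)
  also have "\<dots> = (\<Sum>l<N. (if l = j then u * A $$ (i, j) else 0) + (if l = N - 1 - j then v * A $$ (i, N - 1 - j) else 0))"
  proof (intro sum.cong refl)
    fix l assume "l \<in> {..<N}"
    hence "l < N" by simp
    show "A $$ (i, l) * ((if j = l then u else 0) + (if j = N - 1 - l then v else 0)) =
      (if l = j then u * A $$ (i, j) else 0) + (if l = N - 1 - j then v * A $$ (i, N - 1 - j) else 0)"
      unfolding e[OF \<open>l < N\<close>] by (simp add: algebra_simps)
  qed
  finally show "(A * bidiag_mat N u v) $$ (i, j) = u * A $$ (i, j) + v * A $$ (i, N - 1 - j)" using assms by (simp add: sum.distrib)
qed

lemma bidiag_inverse: assumes "u * x + v * y = 1" "u * y + v * x = 0" shows "bidiag_mat N u v * bidiag_mat N x y = 1\<^sub>m N"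
proof (rule eq_matI)
  fix i j assume "i < dim_row (1\<^sub>m N :: complex mat)" "j < dim_col (1\<^sub>m N :: complex mat)"
  hence ij: "i < N" "j < N" by auto
  show "(bidiag_mat N u v * bidiag_mat N x y) $$ (i, j) = 1\<^sub>m N $$ (i, j)"
    unfolding bidiag_mult(1)[OF bidiag_carrier ij] using ij assms by (auto simp: bidiag_mat_def algebra_simps)
qed (auto simp: bidiag_mat_def)

lemma bidiag_conj: assumes A: "A \<in> carrier_mat N N" and ij: "i < N" "j < N" shows "(bidiag_mat N u v * A * bidiag_mat N x y) $$ (i, j) =
    u * x * A $$ (i, j) + v * x * A $$ (N - 1 - i, j) + u * y * A $$ (i, N - 1 - j) + v * y * A $$ (N - 1 - i, N - 1 - j)"
proof -
  have PA: "bidiag_mat N u v * A \<in> carrier_mat N N" by (rule mult_carrier_mat[OF bidiag_carrier A])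
  have j': "N - 1 - j < N" using ij by simp
  show ?thesis unfolding bidiag_mult(2)[OF PA ij] bidiag_mult(1)[OF A ij] bidiag_mult(1)[OF A ij(1) j'] by (simp add: algebra_simps)
qed

lemma (in lie_algebra) so_split: assumes "isomorphic_to_mat (so_mat N)" shows "isomorphic_to_mat (split_mat (\<lambda>i. 1) N)"
proof (rule isomorphic_to_mat_conj[OF assms])
  \<comment> \<open>\<open>?P\<close> is symmetric with square - 2 i times the antidiagonal
    permutation matrix, so conjugation by it turns skewness for the standard form into skewness for
    the antidiagonal form.\<close>
  let ?P = "bidiag_mat N 1 (- \<i>)" and ?Q = "bidiag_mat N (1 / 2) (\<i> / 2)"
  show "so_mat N \<subseteq> carrier_mat N N" "split_mat (\<lambda>i. 1) N \<subseteq> carrier_mat N N" by (auto simp: so_mat_def split_mat_def)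
  show c: "?P \<in> carrier_mat N N" "?Q \<in> carrier_mat N N" by (rule bidiag_carrier)+
  show "?P * ?Q = 1\<^sub>m N" "?Q * ?P = 1\<^sub>m N" by (rule bidiag_inverse; simp)+
  have r: "N - 1 - i < N" "N - 1 - (N - 1 - i) = i" if "i < N" for i using that by auto
  show "?P * A * ?Q \<in> split_mat (\<lambda>i. 1) N" if A: "A \<in> so_mat N" for A
  proof -
    have Ac: "A \<in> carrier_mat N N" using A by (simp add: so_mat_def)
    have anti: "A $$ (j, i) = - A $$ (i, j)" if "i < N" "j < N" for i j
    proof -
      have "transpose_mat A $$ (i, j) = (- A) $$ (i, j)" using A by (simp add: so_mat_def)
      thus ?thesis using Ac that by simp
    qed
    have "(?P * A * ?Q) $$ (i, j) = - (1 * 1) * (?P * A * ?Q) $$ (N - 1 - j, N - 1 - i)" if ij: "i < N" "j < N" for i j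
      unfolding bidiag_conj[OF Ac ij] bidiag_conj[OF Ac r(1)[OF ij(2)] r(1)[OF ij(1)]] r(2)[OF ij(1)] r(2)[OF ij(2)]
      using anti[OF ij] anti[OF r(1)[OF ij(1)] ij(2)] anti[OF ij(1) r(1)[OF ij(2)]] anti[OF r(1)[OF ij(1)] r(1)[OF ij(2)]]
      by (simp add: field_simps)
    moreover have "?P * A * ?Q \<in> carrier_mat N N" using Ac c by simp
    ultimately show ?thesis unfolding split_mat_def by blast
  qed
  show "?Q * A * ?P \<in> so_mat N" if A: "A \<in> split_mat (\<lambda>i. 1) N" for A
  proof -
    have Ac: "A \<in> carrier_mat N N" using A by (simp add: split_mat_def)
    have anti: "A $$ (i, j) = - A $$ (N - 1 - j, N - 1 - i)" if "i < N" "j < N" for i j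
    proof -
      have "A $$ (i, j) = - (1 * 1) * A $$ (N - 1 - j, N - 1 - i)" using A that unfolding split_mat_def by blast
      thus ?thesis by simp
    qed
    define M where "M = ?Q * A * ?P"
    have M: "M \<in> carrier_mat N N" using Ac c by (simp add: M_def)
    have tr: "transpose_mat M $$ (i, j) = (- M) $$ (i, j)" if ij: "i < N" "j < N" for i j
    proof -
      have "M $$ (j, i) = - M $$ (i, j)" unfolding M_def bidiag_conj[OF Ac ij] bidiag_conj[OF Ac ij(2,1)]
        using anti[OF ij(2,1)] anti[OF r(1)[OF ij(2)] ij(1)] anti[OF ij(2) r(1)[OF ij(1)]] anti[OF r(1)[OF ij(2)] r(1)[OF ij(1)]]
        unfolding r(2)[OF ij(1)] r(2)[OF ij(2)] by (simp add: field_simps)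
      thus ?thesis using M ij by simp
    qed
    have "dim_row (- M) = N" "dim_col (- M) = N" using M by auto
    hence "transpose_mat M = - M" by (intro eq_matI tr) (use M in simp_all)
    thus ?thesis using M unfolding M_def so_mat_def by blast
  qed
qed

definition perm_mat :: "nat => (nat => nat) => complex mat" where
  "perm_mat N \<pi> = mat N N (\<lambda>(i, j). if j = \<pi> i then 1 else 0)"

lemma perm_mat_mult:
  assumes "A \<in> carrier_mat N N" "i < N" "j < N" and \<pi>: "\<And>i. i < N ==> \<pi> i < N \<and> \<pi> (\<pi> i) = i"
  shows "(perm_mat N \<pi> * A) $$ (i, j) = A $$ (\<pi> i, j)" and "(A * perm_mat N \<pi>) $$ (i, j) = A $$ (i, \<pi> j)"
proof -
  have "(perm_mat N \<pi> * A) $$ (i, j) = (\<Sum>l<N. (if l = \<pi> i then 1 else 0) * A $$ (l, j))"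
    using assms by (simp add: perm_mat_def scalar_prod_def atLeast0LessThan)
  also have "\<dots> = (\<Sum>l<N. if l = \<pi> i then A $$ (\<pi> i, j) else 0)" by (intro sum.cong) auto
  finally show "(perm_mat N \<pi> * A) $$ (i, j) = A $$ (\<pi> i, j)" using \<pi>[OF assms(2)] by simp
  have "(A * perm_mat N \<pi>) $$ (i, j) = (\<Sum>l<N. A $$ (i, l) * (if j = \<pi> l then 1 else 0))"
    using assms by (simp add: perm_mat_def scalar_prod_def atLeast0LessThan)
  also have "\<dots> = (\<Sum>l<N. if l = \<pi> j then A $$ (i, \<pi> j) else 0)" using \<pi> assms(3) by (intro sum.cong) auto
  finally show "(A * perm_mat N \<pi>) $$ (i, j) = A $$ (i, \<pi> j)" using \<pi>[OF assms(3)] by simp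
qed

definition sp_sign :: "nat => nat => complex" where "sp_sign n i = (if i < n then 1 else - 1)"

definition half_shift :: "nat => nat => nat" where "half_shift n i = (if i < n then i + n else i - n)"

text \<open>Brings the defining equation into the shape of \<open>split_mat\<close>, with the
  exchange of the two halves in place of the reflection of indices.\<close>

lemma sp_mat_iff: "A \<in> sp_mat n \<longleftrightarrow> A \<in> carrier_mat (2 * n) (2 * n) \<and>
   (\<forall>i<2 * n. \<forall>j<2 * n. A $$ (i, j) = - (sp_sign n i * sp_sign n j) * A $$ (half_shift n j, half_shift n i))"
proof (cases "A \<in> carrier_mat (2 * n) (2 * n)")
  case True
  let ?s = "sp_sign n" and ?t = "half_shift n" and ?J = "symplectic_form n"
  have Jc: "?J \<in> carrier_mat (2 * n) (2 * n)" unfolding symplectic_form_def mult_2 by (intro four_block_carrier_mat) auto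
  have J: "?J $$ (i, j) = (if j = ?t i then ?s i else 0)" if "i < 2 * n" "j < 2 * n" for i j
    using that unfolding symplectic_form_def by (subst index_mat_four_block) (auto simp: sp_sign_def half_shift_def)
  have t: "?t i < 2 * n" "?t (?t i) = i" "?s (?t i) = - ?s i" "?s i * ?s i = 1" if "i < 2 * n" for i
    using that by (auto simp: half_shift_def sp_sign_def)
  have e1: "(transpose_mat A * ?J) $$ (i, j) = - ?s j * A $$ (?t j, i)" if ij: "i < 2 * n" "j < 2 * n" for i j
  proof -
    have "(transpose_mat A * ?J) $$ (i, j) = (\<Sum>l<2 * n. A $$ (l, i) * (if j = ?t l then ?s l else 0))"
      using True Jc ij J by (simp add: scalar_prod_def atLeast0LessThan)
    also have "\<dots> = (\<Sum>l<2 * n. if l = ?t j then A $$ (?t j, i) * ?s (?t j) else 0)" using t ij by (intro sum.cong) auto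
    finally show ?thesis using t ij by simp
  qed
  have e2: "(?J * A) $$ (i, j) = ?s i * A $$ (?t i, j)" if ij: "i < 2 * n" "j < 2 * n" for i j
  proof -
    have "(?J * A) $$ (i, j) = (\<Sum>l<2 * n. (if l = ?t i then ?s i else 0) * A $$ (l, j))"
      using True Jc ij J by (simp add: scalar_prod_def atLeast0LessThan)
    also have "\<dots> = (\<Sum>l<2 * n. if l = ?t i then ?s i * A $$ (?t i, j) else 0)" by (intro sum.cong) auto
    finally show ?thesis using t ij by simp
  qed
  have "A \<in> sp_mat n \<longleftrightarrow> (\<forall>i<2 * n. \<forall>j<2 * n. (transpose_mat A * ?J + ?J * A) $$ (i, j) = 0)"
  proof -
    have z: "M = 0\<^sub>m k k \<longleftrightarrow> (\<forall>i<k. \<forall>j<k. M $$ (i, j) = 0)" if "M \<in> carrier_mat k k" for M :: "complex mat" and k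
      using that by (auto intro!: eq_matI)
    have "transpose_mat A * ?J + ?J * A \<in> carrier_mat (2 * n) (2 * n)" using True Jc by simp
    from z[OF this] show ?thesis using True unfolding sp_mat_def by simp
  qed
  also have "\<dots> \<longleftrightarrow> (\<forall>i<2 * n. \<forall>j<2 * n. - ?s j * A $$ (?t j, i) + ?s i * A $$ (?t i, j) = 0)"
    using True Jc e1 e2 by simp
  also have "\<dots> \<longleftrightarrow> (\<forall>i<2 * n. \<forall>j<2 * n. A $$ (i, j) = - (?s i * ?s j) * A $$ (?t j, ?t i))"
  proof safe
    fix i j assume ij: "i < 2 * n" "j < 2 * n" and h: "\<forall>i<2 * n. \<forall>j<2 * n. - ?s j * A $$ (?t j, i) + ?s i * A $$ (?t i, j) = 0"
    have "- ?s j * A $$ (?t j, ?t i) + - ?s i * A $$ (i, j) = 0" using h ij t by metis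
    moreover have "x = - (a * b) * y" if "a * a = 1" "- b * y + - a * x = 0" for a b x y :: complex
    proof -
      have "- (a * b) * y = a * (- b * y + - a * x) + (a * a) * x" by (simp add: algebra_simps)
      thus ?thesis unfolding that by simp
    qed
    ultimately show "A $$ (i, j) = - (?s i * ?s j) * A $$ (?t j, ?t i)" using t(4)[OF ij(1)] by blast
  next
    fix i j assume ij: "i < 2 * n" "j < 2 * n" and h: "\<forall>i<2 * n. \<forall>j<2 * n. A $$ (i, j) = - (?s i * ?s j) * A $$ (?t j, ?t i)"
    have "A $$ (?t i, j) = ?s i * ?s j * A $$ (?t j, i)" using h t ij by (metis mult_minus_left minus_minus)
    hence "?s i * A $$ (?t i, j) = (?s i * ?s i) * ?s j * A $$ (?t j, i)" by simp
    thus "- ?s j * A $$ (?t j, i) + ?s i * A $$ (?t i, j) = 0" using t(4)[OF ij(1)] by simp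
  qed
  finally show ?thesis using True by simp
qed (simp add: sp_mat_def)

lemma (in lie_algebra) sp_split: assumes "isomorphic_to_mat (sp_mat n)" shows "isomorphic_to_mat (split_mat (sp_sign n) (2 * n))"
proof -
  \<comment> \<open>Reversing the second half of the indices turns the pairing of i with i + n into
    the pairing of i with 2n - 1 - i.\<close>
  define \<pi> where "\<pi> i = (if i < n then i else 3 * n - 1 - i)" for i
  let ?N = "2 * n" and ?P = "perm_mat (2 * n) \<pi>"
  have \<pi>: "\<pi> i < ?N \<and> \<pi> (\<pi> i) = i" if "i < ?N" for i using that by (auto simp: \<pi>_def)
  have \<pi>t: "half_shift n (\<pi> i) = \<pi> (?N - 1 - i)" "sp_sign n (\<pi> i) = sp_sign n i" "\<pi> (half_shift n i) = ?N - 1 - \<pi> i" if "i < ?N" for i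
    using that by (auto simp: \<pi>_def half_shift_def sp_sign_def)
  have c: "?P \<in> carrier_mat ?N ?N" by (simp add: perm_mat_def)
  have PP: "?P * ?P = 1\<^sub>m ?N"
  proof (rule eq_matI)
    fix i j assume "i < dim_row (1\<^sub>m ?N :: complex mat)" "j < dim_col (1\<^sub>m ?N :: complex mat)"
    hence ij: "i < ?N" "j < ?N" by auto
    show "(?P * ?P) $$ (i, j) = 1\<^sub>m ?N $$ (i, j)"
      using perm_mat_mult(1)[OF c ij \<pi>] \<pi>[OF ij(1)] ij by (auto simp: perm_mat_def)
  qed (use c in auto)
  have e: "(?P * A * ?P) $$ (i, j) = A $$ (\<pi> i, \<pi> j)" if A: "A \<in> carrier_mat ?N ?N" and ij: "i < ?N" "j < ?N" for A i j
  proof -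
    have "?P * A \<in> carrier_mat ?N ?N" using c A by simp
    from perm_mat_mult(2)[OF this ij \<pi>] perm_mat_mult(1)[OF A ij(1), of "\<pi> j" \<pi>] \<pi> ij show ?thesis by simp
  qed
  show ?thesis
  proof (rule isomorphic_to_mat_conj[OF assms _ _ c c PP PP])
    show "sp_mat n \<subseteq> carrier_mat ?N ?N" "split_mat (sp_sign n) ?N \<subseteq> carrier_mat ?N ?N"
      by (auto simp: sp_mat_def split_mat_def)
    have conj: "(?P * A * ?P) $$ (i, j) = - (sp_sign n i * sp_sign n j) * (?P * A * ?P) $$ (\<tau> j, \<tau> i)"
      if A: "A \<in> carrier_mat ?N ?N" and h: "\<forall>i<?N. \<forall>j<?N. A $$ (i, j) = - (sp_sign n i * sp_sign n j) * A $$ (\<sigma> j, \<sigma> i)"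
        and \<tau>: "\<And>i. i < ?N ==> \<tau> i < ?N \<and> \<pi> (\<tau> i) = \<sigma> (\<pi> i)" and ij: "i < ?N" "j < ?N" for A i j \<sigma> \<tau>
    proof -
      have r: "\<tau> j < ?N" "\<tau> i < ?N" "\<pi> i < ?N" "\<pi> j < ?N" using \<tau> \<pi> ij by blast+
      have "A $$ (\<pi> i, \<pi> j) = - (sp_sign n (\<pi> i) * sp_sign n (\<pi> j)) * A $$ (\<sigma> (\<pi> j), \<sigma> (\<pi> i))" using h r by blast
      thus ?thesis unfolding e[OF A ij] e[OF A r(1,2)] using \<tau> \<pi>t(2) ij by simp
    qed
    show "?P * A * ?P \<in> split_mat (sp_sign n) ?N" if A: "A \<in> sp_mat n" for A
    proof -
      have Ac: "A \<in> carrier_mat ?N ?N" using A unfolding sp_mat_iff by blast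
      have "?P * A * ?P \<in> carrier_mat ?N ?N" using Ac c by simp
      moreover have "?N - 1 - i < ?N \<and> \<pi> (?N - 1 - i) = half_shift n (\<pi> i)" if "i < ?N" for i using \<pi>t(1)[OF that] that by simp
      ultimately show ?thesis using conj[OF Ac, of "half_shift n" "\<lambda>i. ?N - 1 - i"] A unfolding split_mat_def sp_mat_iff by blast
    qed
    show "?P * A * ?P \<in> sp_mat n" if A: "A \<in> split_mat (sp_sign n) ?N" for A
    proof -
      have Ac: "A \<in> carrier_mat ?N ?N" using A unfolding split_mat_def by blast
      have "?P * A * ?P \<in> carrier_mat ?N ?N" using Ac c by simp
      moreover have "half_shift n i < ?N \<and> \<pi> (half_shift n i) = ?N - 1 - \<pi> i" if "i < ?N" for i
        using \<pi>t(3)[OF that] that unfolding half_shift_def by auto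
      ultimately show ?thesis using conj[OF Ac, of "\<lambda>i. ?N - 1 - i" "half_shift n"] A unfolding split_mat_def sp_mat_iff by blast
    qed
  qed
qed

lemma prod_insert_rows:
  assumes "finite S" "finite T" "inj_on f S" "inj_on g T" "f ` S \<inter> g ` T = {}" "x \<notin> f ` S \<union> g ` T"
  shows "(\<Prod>p\<in>insert x (f ` S \<union> g ` T). F p) = F x * ((\<Prod>i\<in>S. F (f i)) * (\<Prod>i\<in>T. F (g i)))"
  using assms by (simp add: prod.union_disjoint prod.reindex)

context lie_algebra
begin

lemma sl_top_spaces: assumes iso: "isomorphic_to_mat (sl_mat N)" and N: "N \<ge> 2" and form: "simple" "casimir_normalized B (of_nat N)"
  shows "top_spaces B (real N) 2 (of_nat N)"
proof -
  obtain \<phi> where \<phi>: "mat_iso \<phi> (sl_mat N)" using iso unfolding isomorphic_mat_iso by blast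
  define R where "R = {(i, j). i < N \<and> j < N \<and> i \<noteq> j}"
  interpret matrix_form scale G br \<phi> "sl_mat N" N R "\<lambda>p. p" "\<lambda>p. 1" B "real N"
  proof unfold_locales
    fix p assume "p \<in> R"
    thus "mat N N (\<lambda>q. if q = p then 1 else if q = p then 1 else 0) \<in> sl_mat N"
      by (auto simp: sl_mat_def R_def intro!: sum.neutral)
  next
    fix d :: "nat => complex" assume d: "\<And>i. i < N ==> d (N - 1 - i) = - d i"
    have "(\<Sum>i<N. d i) = (\<Sum>i<N. d (N - 1 - i))" by (rule sum_reflect[symmetric])
    also have "\<dots> = (\<Sum>i<N. - d i)" using d by (intro sum.cong) auto
    finally have "(\<Sum>i<N. d i) = 0" by (simp add: sum_negf)
    thus "diag_mat_of N d \<in> sl_mat N" by (simp add: sl_mat_def diag_mat_of_def)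
  qed (use \<phi> form N in \<open>auto simp: R_def sl_mat_def\<close>)
  have trace: "(\<Sum>i<N. \<phi> h $$ (i, i)) = 0" if "h \<in> Hd" for h using phi_L[OF Hd_G[OF that]] by (simp add: sl_mat_def)
  have R_sum: "(\<Sum>(i, j)\<in>R. F i j) = (\<Sum>i<N. \<Sum>j<N. F i j)" if "\<And>i. F i i = 0" for F :: "nat => nat => complex"
  proof -
    have "(\<Sum>i<N. \<Sum>j<N. F i j) = (\<Sum>(i, j)\<in>{..<N} \<times> {..<N}. F i j)" by (rule sum.cartesian_product)
    also have "\<dots> = (\<Sum>(i, j)\<in>R. F i j)" by (rule sum.mono_neutral_right) (auto simp: R_def that)
    finally show ?thesis by simp
  qed
  show ?thesis
  \<comment> \<open>\<open>B\<close> is the trace form here, theta is the difference of the first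
    and last diagonal entry, and rho has the coordinates (N - 1) / 2 - i.\<close>
  proof (rule top_spaces_diag[of "(0, N - 1)" 1 "\<lambda>i. if i = 0 then 1 else if i = N - 1 then - 1 else 0"
        "\<lambda>i. (of_nat N - 1 - 2 * of_nat i) / 2"])
    fix h k assume h: "h \<in> Hd" and k: "k \<in> Hd"
    have "2 * of_nat N * B h k = 2 * of_nat N * (\<Sum>i<N. \<phi> h $$ (i, i) * \<phi> k $$ (i, i))"
      using killing_diag[OF h k] unfolding R_sum[of "\<lambda>i j. (\<phi> h $$ (i, i) - \<phi> h $$ (j, j)) * (\<phi> k $$ (i, i) - \<phi> k $$ (j, j))", simplified]
        double_sum_diff[OF trace[OF h]] by simp
    thus "B h k = 1 * (\<Sum>i<N. \<phi> h $$ (i, i) * \<phi> k $$ (i, i))" using N by simp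
  next
    fix h assume h: "h \<in> Hd"
    have "(\<Sum>i<N. (if i = 0 then 1 else if i = N - 1 then - 1 else 0) * \<phi> h $$ (i, i)) =
      (\<Sum>i<N. (if i = 0 then \<phi> h $$ (0, 0) else 0) - (if i = N - 1 then \<phi> h $$ (N - 1, N - 1) else 0))"
      using N by (intro sum.cong) auto
    also have "\<dots> = \<phi> h $$ (0, 0) - \<phi> h $$ (N - 1, N - 1)" using N unfolding sum_subtractf by simp
    finally show "\<phi> h $$ (fst (0, N - 1), fst (0, N - 1)) - \<phi> h $$ (snd (0, N - 1), snd (0, N - 1)) =
       1 * (\<Sum>i<N. (if i = 0 then 1 else if i = N - 1 then - 1 else 0) * \<phi> h $$ (i, i))" by simp
    have "(\<Sum>(i, j)\<in>{p \<in> R. fst p < snd p}. \<phi> h $$ (i, i) - \<phi> h $$ (j, j)) =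
       (\<Sum>(i, j)\<in>R. if i < j then \<phi> h $$ (i, i) - \<phi> h $$ (j, j) else 0)"
      by (rule sum.mono_neutral_cong_left[OF finite_R]) (auto split: if_splits)
    also have "\<dots> = (\<Sum>i<N. \<Sum>j<N. if i < j then \<phi> h $$ (i, i) - \<phi> h $$ (j, j) else 0)" by (rule R_sum) simp
    also have "\<dots> = (\<Sum>i<N. (of_nat N - 1 - 2 * of_nat i) * \<phi> h $$ (i, i))" by (rule double_sum_less)
    also have "\<dots> = 2 * 1 * (\<Sum>i<N. (of_nat N - 1 - 2 * of_nat i) / 2 * \<phi> h $$ (i, i))" by (simp add: sum_distrib_left)
    finally show "(\<Sum>(i, j)\<in>{p \<in> R. fst p < snd p}. \<phi> h $$ (i, i) - \<phi> h $$ (j, j)) = \<dots>" .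
  next
    fix k
    let ?a = "\<lambda>i. if i = 0 then 1 else if i = N - 1 then - 1 else (0 :: complex)"
      and ?b = "\<lambda>i. (of_nat N - 1 - 2 * of_nat i) / (2 :: complex)"
    let ?f = "\<lambda>(i, j). fac k ((?b i - ?b j) / (?a i - ?a j))"
    \<comment> \<open>Besides theta itself, the positive roots not orthogonal to it are the rest of
      the first row and of the last column.\<close>
    let ?D = "{p \<in> R. fst p < snd p \<and> ?a (fst p) \<noteq> ?a (snd p)}"
      and ?S = "insert (0, N - 1) ((\<lambda>j. (0, j)) ` {1..N - 2} \<union> (\<lambda>j. (N - 1 - j, N - 1)) ` {1..N - 2})"
    have s: "?D = ?S"
    proof (intro equalityI subsetI)
      fix p assume pR: "p \<in> ?D"
      obtain i j where ij: "p = (i, j)" by (cases p)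
      have "j < N" "i < j" "?a i \<noteq> ?a j" using pR unfolding ij R_def mem_Collect_eq fst_conv snd_conv case_prod_conv by blast+
      note p = ij this
      then consider "i = 0" "j = N - 1" | "i = 0" "j < N - 1" | "i > 0" "j = N - 1" by (auto split: if_splits)
      thus "p \<in> ?S"
      proof cases
        case 3
        hence "p = (N - 1 - (N - 1 - i), N - 1)" "N - 1 - i \<in> {1..N - 2}" using p by auto
        thus ?thesis by blast
      qed (use p in auto)
    qed (use N in \<open>auto simp: R_def\<close>)
    have "(\<Prod>p\<in>?S. ?f p) =
      ?f (0, N - 1) * ((\<Prod>j\<in>{1..N - 2}. ?f (0, j)) * (\<Prod>j\<in>{1..N - 2}. ?f (N - 1 - j, N - 1)))"
      by (rule prod_insert_rows) (use N in \<open>auto simp: inj_on_def\<close>)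
    also have "(\<Prod>j\<in>{1..N - 2}. ?f (0, j)) = (\<Prod>j\<in>{1..N - 2}. fac k (of_nat j))"
    proof (intro prod.cong refl)
      fix j assume j: "j \<in> {1..N - 2}"
      hence "?a j = 0" using N by auto
      moreover have "?b 0 - ?b j = of_nat j" by (simp add: field_simps)
      ultimately show "?f (0, j) = fac k (of_nat j)" by (simp only: case_prod_conv) simp
    qed
    also have "(\<Prod>j\<in>{1..N - 2}. ?f (N - 1 - j, N - 1)) = (\<Prod>j\<in>{1..N - 2}. fac k (of_nat j))"
    proof (intro prod.cong refl)
      fix j assume j: "j \<in> {1..N - 2}"
      hence "?a (N - 1 - j) = 0" "?a (N - 1) = - 1" using N by auto
      moreover have "N - 1 = (N - 1 - j) + j" using j by auto
      hence "complex_of_nat (N - 1) = of_nat (N - 1 - j) + of_nat j" by (metis of_nat_add)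
      hence "?b (N - 1 - j) - ?b (N - 1) = of_nat j" by (simp add: field_simps)
      ultimately show "?f (N - 1 - j, N - 1) = fac k (of_nat j)" by (simp only: case_prod_conv) simp
    qed
    also have "?f (0, N - 1) = fac k ((of_nat N - 1) / 2)" 
    proof -
      have "(?b 0 - ?b (N - 1)) / (?a 0 - ?a (N - 1)) = (of_nat N - 1) / 2" using N by (simp add: of_nat_diff field_simps)
      thus ?thesis by (simp only: case_prod_conv)
    qed
    finally show "(\<Prod>(i, j)\<in>?D. fac k ((?b i - ?b j) / (?a i - ?a j))) = cartan_dim 2 (of_nat N) k"
      unfolding s cartan_dim_sl[OF N] by (simp only: power2_eq_square)
  qed (use N in \<open>auto simp: R_def of_nat_diff field_simps\<close>)
qed

end

text \<open>One representative of each pair of positions exchanged by reflection in the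
  antidiagonal. The sign \<open>e\<close> is 1 in the orthogonal and -1 in the symplectic case; only
  the latter has nonzero entries on the antidiagonal, namely the long roots.\<close>

definition split_pos :: "complex => nat => (nat \<times> nat) set" where
  "split_pos e N = {(i, j). i < N \<and> j < N \<and> i \<noteq> j \<and> (i + j < N - 1 \<or> i + j = N - 1 \<and> e = - 1)}"

definition anti_pos :: "nat => nat \<times> nat => nat \<times> nat" where "anti_pos N p = (N - 1 - snd p, N - 1 - fst p)"

lemma anti_pos_pair [simp]: "anti_pos N (i, j) = (N - 1 - j, N - 1 - i)" by (simp add: anti_pos_def)

text \<open>The diagonal coefficients of the sum of all antidiagonal positions above the diagonal,
  by which the sum of positive roots is corrected.\<close>

definition half_sign :: "nat => nat => complex" where "half_sign N i = (if 2 * i < N - 1 then 1 else if 2 * i > N - 1 then - 1 else 0)"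

text \<open>The full double sum counts each representative off the antidiagonal twice and each
  antidiagonal position once; the term with \<open>e\<close> drops the latter or completes them to
  two.\<close>

lemma split_pos_sum: fixes F :: "nat => nat => complex"
  assumes e: "e = 1 \<or> e = - 1" and F: "\<And>i j. i < N ==> j < N ==> F (N - 1 - j) (N - 1 - i) = F i j" and F0: "\<And>i. F i i = 0"
  shows "2 * (\<Sum>(i, j)\<in>split_pos e N. F i j) = (\<Sum>i<N. \<Sum>j<N. F i j) - e * (\<Sum>i<N. F i (N - 1 - i))"
proof -
  let ?A = "{(i, j). i < N \<and> j < N \<and> i + j < N - 1}" and ?D = "{(i, j). i < N \<and> j < N \<and> i + j = N - 1}"
  have fin: "finite ?A" "finite ?D" by (rule finite_subset[of _ "{..<N} \<times> {..<N}"]; auto)+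
  have D: "(\<Sum>(i, j)\<in>?D. F i j) = (\<Sum>i<N. F i (N - 1 - i))"
    by (rule sum.reindex_bij_witness[of _ "\<lambda>i. (i, N - 1 - i)" fst]) (auto intro!: arg_cong[of _ _ "F _"])
  have "(\<Sum>(i, j)\<in>split_pos e N. F i j) = (\<Sum>(i, j)\<in>?A \<union> (if e = 1 then {} else ?D). F i j)"
    using e fin by (intro sum.mono_neutral_left) (auto simp: split_pos_def F0 split: if_splits)
  also have "\<dots> = (\<Sum>(i, j)\<in>?A. F i j) + (if e = 1 then 0 else \<Sum>i<N. F i (N - 1 - i))"
    unfolding D[symmetric] using fin by (subst sum.union_disjoint) (auto split: if_splits)
  finally have S: "(\<Sum>(i, j)\<in>split_pos e N. F i j) = (\<Sum>(i, j)\<in>?A. F i j) + (if e = 1 then 0 else \<Sum>i<N. F i (N - 1 - i))" .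
  have all: "(\<Sum>i<N. \<Sum>j<N. F i j) = 2 * (\<Sum>(i, j)\<in>?A. F i j) + (\<Sum>i<N. F i (N - 1 - i))"
    by (rule sum_antidiagonal) (rule F)
  show ?thesis unfolding S all using e by (elim disjE) (simp_all add: algebra_simps)
qed

context lie_algebra
begin

lemma split_matrix_form:
  assumes s: "\<And>i. i < N ==> s i * s i = 1" "\<And>i. i < N ==> s (N - 1 - i) = e * s i" and e: "e = 1 \<or> e = - 1"
    and form: "simple" "casimir_normalized B (of_real \<tau>)" "\<tau> > 0" and \<phi>: "mat_iso \<phi> (split_mat s N)"
  shows "matrix_form scale G br \<phi> (split_mat s N) N (split_pos e N) (anti_pos N) (\<lambda>(i, j). - (s i * s j)) B \<tau>"
proof unfold_locales
  have r: "N - 1 - i < N" "N - 1 - (N - 1 - i) = i" if "i < N" for i using that by auto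
  have m: "N - 1 - a = b \<longleftrightarrow> a = N - 1 - b" if "a < N" "b < N" for a b using that by auto
  have ss: "(s i * s j) * (s i * s j) = 1" if "i < N" "j < N" for i j
  proof -
    have "(s i * s j) * (s i * s j) = (s i * s i) * (s j * s j)" by (simp only: mult_ac)
    thus ?thesis using s(1) that by simp
  qed
  have ss': "s (N - 1 - j) * s (N - 1 - i) = s i * s j" if "i < N" "j < N" for i j
    unfolding s(2)[OF that(1)] s(2)[OF that(2)] using e by auto
  have entry: "A $$ (N - 1 - j, N - 1 - i) = - (s i * s j) * A $$ (i, j)" if "A \<in> split_mat s N" "i < N" "j < N" for A i j
  proof -
    have "A $$ (N - 1 - j, N - 1 - i) = - (s (N - 1 - j) * s (N - 1 - i)) * A $$ (N - 1 - (N - 1 - i), N - 1 - (N - 1 - j))"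
      using that r unfolding split_mat_def by blast
    thus ?thesis unfolding ss'[OF that(2,3)] r(2)[OF that(2)] r(2)[OF that(3)] .
  qed
  fix p q assume p: "p \<in> split_pos e N"
  obtain i j where ij: "p = (i, j)" by (cases p)
  have lt: "i < N" "j < N" "i \<noteq> j" "i + j \<le> N - 1" "i + j = N - 1 ==> e = - 1" using p unfolding ij split_pos_def by auto
  show "fst p < N \<and> snd p < N \<and> fst p \<noteq> snd p" using lt ij by simp
  show "A $$ (anti_pos N p) = (case p of (i, j) => - (s i * s j)) * A $$ p" if "A \<in> split_mat s N" for A
    using entry[OF that lt(1,2)] ij by simp
  have diag: "A $$ (N - 1 - k, N - 1 - k) = - A $$ (k, k)" if "A \<in> split_mat s N" "k < N" for A k
    using entry[OF that(1) that(2) that(2)] s(1)[OF that(2)] by simp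
  show "diag_diff A (anti_pos N p) =
      diag_diff A p" if "A \<in> split_mat s N" for A
    unfolding ij anti_pos_pair fst_conv snd_conv diag[OF that lt(1)] diag[OF that lt(2)] by simp
  show "mat N N (\<lambda>q. if q = p then 1 else if q = anti_pos N p then case p of (i, j) => - (s i * s j) else 0) \<in> split_mat s N"
  proof -
    let ?f = "\<lambda>q. if q = (i, j) then 1 else if q = (N - 1 - j, N - 1 - i) then - (s i * s j) else (0 :: complex)"
    have f: "?f (k, l) = - (s k * s l) * ?f (N - 1 - l, N - 1 - k)" if kl: "k < N" "l < N" for k l
    proof -
      have e1: "(N - 1 - l, N - 1 - k) = (N - 1 - j, N - 1 - i) \<longleftrightarrow> (k, l) = (i, j)"
        unfolding prod.inject using m[OF kl(2) r(1)[OF lt(2)]] m[OF kl(1) r(1)[OF lt(1)]] r(2)[OF lt(1)] r(2)[OF lt(2)] by auto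
      have e2: "(N - 1 - l, N - 1 - k) = (i, j) \<longleftrightarrow> (k, l) = (N - 1 - j, N - 1 - i)"
        unfolding prod.inject m[OF kl(2) lt(1)] m[OF kl(1) lt(2)] by (rule conj_commute)
      show ?thesis
      \<comment> \<open>A position on the antidiagonal is its own opposite. It occurs only for
        \<open>e = - 1\<close>, where \<open>s i * s j = - 1\<close>, so the entry 1 is consistent
        with the sign rule.\<close>
      proof (cases "(i, j) = (N - 1 - j, N - 1 - i)")
        case True
        have j: "j = N - 1 - i" using True[unfolded prod.inject] by (rule conjunct2)
        hence "i + j = N - 1" using lt(1) by arith
        hence "s j = - s i" using s(2)[OF lt(1)] lt(5) unfolding j[symmetric] by simp
        hence "s i * s j = - 1" using s(1)[OF lt(1)] by simp
        thus ?thesis unfolding e1 e2 True[symmetric] by (cases "(k, l) = (i, j)") simp_all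
      next
        case False
        hence False': "(N - 1 - j, N - 1 - i) \<noteq> (i, j)" by metis
        consider (a) "k = i" "l = j" | (b) "k = N - 1 - j" "l = N - 1 - i" | (c) "(k, l) \<noteq> (i, j)" "(k, l) \<noteq> (N - 1 - j, N - 1 - i)"
          by blast
        thus ?thesis
        proof cases
          case a
          show ?thesis unfolding e1 e2 unfolding a by (simp only: False if_False refl if_True minus_mult_minus ss[OF lt(1,2)])
        next
          case b
          show ?thesis unfolding e1 e2 unfolding b by (simp only: False' if_False refl if_True mult_1_right ss'[OF lt(1,2)])
        next
          case c
          show ?thesis unfolding e1 e2 by (simp only: c if_False mult_zero_right)
        qed
      qed
    qed
    have "mat N N ?f $$ (k, l) = - (s k * s l) * mat N N ?f $$ (N - 1 - l, N - 1 - k)" if kl: "k < N" "l < N" for k l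
      unfolding index_mat(1)[OF kl] index_mat(1)[OF r(1)[OF kl(2)] r(1)[OF kl(1)]] by (rule f[OF kl])
    moreover have "mat N N ?f \<in> carrier_mat N N" by simp
    ultimately show ?thesis unfolding ij split_mat_def case_prod_conv anti_pos_pair by blast
  qed
  fix q' assume q: "q' \<in> split_pos e N"
  obtain k l where kl: "q' = (k, l)" by (cases q')
  have lt': "k < N" "l < N" "k + l \<le> N - 1" using q unfolding kl split_pos_def by auto
  show "q' = p" if "anti_pos N q' = p" using that lt lt' unfolding ij kl by auto
  show "q' = p" if "anti_pos N q' = anti_pos N p" using that lt lt' unfolding ij kl by auto
next
  fix q :: "nat \<times> nat" assume q: "fst q < N" "snd q < N" "fst q \<noteq> snd q"
  obtain k l where kl: "q = (k, l)" by (cases q)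
  have lt: "k < N" "l < N" "k \<noteq> l" using q kl by auto
  consider "(k, l) \<in> split_pos e N" | "k + l > N - 1" | "k + l = N - 1" "e = 1" using lt e unfolding split_pos_def by force
  thus "q \<in> split_pos e N \<or> (\<exists>p\<in>split_pos e N. q = anti_pos N p) \<or> (\<forall>A\<in>split_mat s N. A $$ q = 0)"
  proof cases
    case 2
    hence "(N - 1 - l, N - 1 - k) \<in> split_pos e N" "q = anti_pos N (N - 1 - l, N - 1 - k)" using lt unfolding kl split_pos_def by auto
    thus ?thesis by blast
  next
    case 3
    hence i': "l = N - 1 - k" "k = N - 1 - l" using lt by auto
    have "A $$ (k, l) = 0" if "A \<in> split_mat s N" for A
    proof -
      have "A $$ (k, l) = - (s k * s l) * A $$ (N - 1 - l, N - 1 - k)" using that lt unfolding split_mat_def by blast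
      moreover have "s k * s l = 1" using s(1)[OF lt(1)] s(2)[OF lt(1)] i'(1) 3(2) by simp
      ultimately show ?thesis unfolding i'(1)[symmetric] i'(2)[symmetric] by simp
    qed
    thus ?thesis unfolding kl by blast
  qed (use kl in blast)
next
  fix d :: "nat => complex" assume d: "\<And>i. i < N ==> d (N - 1 - i) = - d i"
  have "diag_mat_of N d $$ (i, j) = - (s i * s j) * diag_mat_of N d $$ (N - 1 - j, N - 1 - i)" if ij: "i < N" "j < N" for i j
  proof (cases "i = j")
    case True
    thus ?thesis using s(1)[OF ij(1)] d[OF ij(1)] ij unfolding diag_mat_of_def by simp
  next
    case False
    hence "N - 1 - j \<noteq> N - 1 - i" using ij by auto
    thus ?thesis using False ij unfolding diag_mat_of_def by simp
  qed
  moreover have "diag_mat_of N d \<in> carrier_mat N N" by (simp add: diag_mat_of_def)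
  ultimately show "diag_mat_of N d \<in> split_mat s N" unfolding split_mat_def by blast
next
  show "split_mat s N \<subseteq> carrier_mat N N" by (auto simp: split_mat_def)
qed (use \<phi> form in auto)

text \<open>The Killing form is N - 2e times the trace form on \<open>Hd\<close>, which fixes
  \<open>\<kappa>\<close>. In the denominator 4 of \<open>b\<close>, one factor 2 comes from the
  double count in \<open>split_pos_sum\<close> and the other from passing from 2 rho to rho.\<close>

lemma split_top_spaces: assumes iso: "isomorphic_to_mat (split_mat s N)"
    and s: "\<And>i. i < N ==> s i * s i = 1" "\<And>i. i < N ==> s (N - 1 - i) = e * s i" and e: "e = 1 \<or> e = - 1"
    and form: "simple" "casimir_normalized B (of_real \<tau>)" "\<tau> > 0" and \<kappa>: "2 * of_real \<tau> * \<kappa> = of_nat N - 2 * e" "\<kappa> \<noteq> 0"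
    and p0: "p0 \<in> split_pos e N" "fst p0 < snd p0"
    and max: "\<And>p. p \<in> split_pos e N ==> fst p < snd p ==> snd p - fst p \<le> snd p0 - fst p0"
    and a: "\<And>i. i < N ==> a (N - 1 - i) = - a i"
    and \<theta>: "\<And>f. (\<And>i. i < N ==> f (N - 1 - i) = - f i) ==> f (fst p0) - f (snd p0) = \<kappa> * (\<Sum>i<N. a i * f i)"
    and norm: "a (fst p0) - a (snd p0) = 2" and b: "\<And>i. b i = (of_nat N - 1 - 2 * of_nat i - e * half_sign N i) / (4 * \<kappa>)"
    and dims: "\<And>k. (\<Prod>(i, j)\<in>{p \<in> split_pos e N. fst p < snd p \<and> a (fst p) \<noteq> a (snd p)}. fac k ((b i - b j) / (a i - a j))) = cartan_dim \<beta> \<gamma> k"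
  shows "top_spaces B \<tau> \<beta> \<gamma>"
proof -
  obtain \<phi> where \<phi>: "mat_iso \<phi> (split_mat s N)" using iso unfolding isomorphic_mat_iso by blast
  interpret matrix_form scale G br \<phi> "split_mat s N" N "split_pos e N" "anti_pos N" "\<lambda>(i, j). - (s i * s j)" B \<tau>
    by (rule split_matrix_form[OF s e form \<phi>])
  have anti: "\<phi> h $$ (N - 1 - i, N - 1 - i) = - \<phi> h $$ (i, i)" if h: "h \<in> Hd" and i: "i < N" for h i
  proof -
    have "\<phi> h $$ (i, i) = - (s i * s i) * \<phi> h $$ (N - 1 - i, N - 1 - i)"
      using phi_L[OF Hd_G[OF h]] i unfolding split_mat_def by blast
    thus ?thesis unfolding s(1)[OF i] by simp
  qed
  show ?thesis
  proof (rule top_spaces_diag[OF p0 max _ a _ _ _ norm dims])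
    fix h k assume h: "h \<in> Hd" and k: "k \<in> Hd"
    let ?F = "\<lambda>i j. (\<phi> h $$ (i, i) - \<phi> h $$ (j, j)) * (\<phi> k $$ (i, i) - \<phi> k $$ (j, j))"
    let ?S = "\<Sum>i<N. \<phi> h $$ (i, i) * \<phi> k $$ (i, i)"
    have "(\<Sum>i<N. \<phi> h $$ (i, i)) = (\<Sum>i<N. \<phi> h $$ (N - 1 - i, N - 1 - i))"
      by (rule sum_reflect[symmetric, of "\<lambda>i. \<phi> h $$ (i, i)"])
    also have "\<dots> = (\<Sum>i<N. - \<phi> h $$ (i, i))" using anti[OF h] by (intro sum.cong) auto
    finally have trace: "(\<Sum>i<N. \<phi> h $$ (i, i)) = 0" by (simp add: sum_negf)
    have "(\<Sum>i<N. ?F i (N - 1 - i)) = (\<Sum>i<N. 4 * (\<phi> h $$ (i, i) * \<phi> k $$ (i, i)))"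
      by (intro sum.cong refl) (simp add: anti[OF h, simplified] anti[OF k, simplified])
    hence D: "(\<Sum>i<N. ?F i (N - 1 - i)) = 4 * ?S" by (simp add: sum_distrib_left)
    have "2 * (2 * of_real \<tau> * B h k) = 2 * (\<Sum>(i, j)\<in>split_pos e N. ?F i j)" unfolding killing_diag[OF h k] ..
    also have "\<dots> = (\<Sum>i<N. \<Sum>j<N. ?F i j) - e * (\<Sum>i<N. ?F i (N - 1 - i))"
      by (rule split_pos_sum[OF e]) (simp_all add: anti[OF h, simplified] anti[OF k, simplified] algebra_simps)
    also have "\<dots> = 2 * (of_nat N - 2 * e) * ?S" unfolding double_sum_diff[OF trace] D by (simp add: algebra_simps)
    also have "\<dots> = 2 * (2 * of_real \<tau> * (\<kappa> * ?S))" unfolding \<kappa>(1)[symmetric] by (simp only: mult_ac)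
    finally show "B h k = \<kappa> * ?S" using form(3) by simp
  next
    show "b (N - 1 - i) = - b i" if "i < N" for i
    proof -
      have "half_sign N (N - 1 - i) = - half_sign N i" using that by (auto simp: half_sign_def)
      moreover have "N - 1 = (N - 1 - i) + i" using that by simp
      hence "complex_of_nat N - 1 = of_nat (N - 1 - i) + of_nat i" using that by (simp add: of_nat_diff)
      ultimately show ?thesis unfolding b minus_divide_left
        by (intro arg_cong[where f = "\<lambda>x. x / (4 * \<kappa>)"]) (simp only: algebra_simps, simp)
    qed
    fix h assume h: "h \<in> Hd"
    show "diag_diff (\<phi> h) p0 = \<kappa> * (\<Sum>i<N. a i * \<phi> h $$ (i, i))"
      by (rule \<theta>[of "\<lambda>i. \<phi> h $$ (i, i)", OF anti[OF h]])
    let ?F = "\<lambda>i j. if i < j then \<phi> h $$ (i, i) - \<phi> h $$ (j, j) else 0"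
    have D: "(\<Sum>i<N. ?F i (N - 1 - i)) = (\<Sum>i<N. half_sign N i * \<phi> h $$ (i, i))"
    proof -
      have "(\<Sum>i<N. ?F i (N - 1 - i)) = (\<Sum>i<N. (if i < N - 1 - i then \<phi> h $$ (i, i) else 0)) -
          (\<Sum>i<N. if i < N - 1 - i then \<phi> h $$ (N - 1 - i, N - 1 - i) else 0)"
        unfolding sum_subtractf[symmetric] by (intro sum.cong) auto
      also have "(\<Sum>i<N. if i < N - 1 - i then \<phi> h $$ (N - 1 - i, N - 1 - i) else 0) =
          (\<Sum>i<N. if N - 1 - i < i then \<phi> h $$ (i, i) else 0)"
        by (rule sum.reindex_bij_witness[of _ "\<lambda>i. N - 1 - i" "\<lambda>i. N - 1 - i"]) auto
      finally show ?thesis unfolding sum_subtractf[symmetric] by (simp only:) (intro sum.cong refl, auto simp: half_sign_def)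
    qed
    have "2 * (\<Sum>(i, j)\<in>{p \<in> split_pos e N. fst p < snd p}. \<phi> h $$ (i, i) - \<phi> h $$ (j, j)) =
       2 * (\<Sum>(i, j)\<in>split_pos e N. ?F i j)"
      by (rule arg_cong[where f = "(*) 2"], rule sum.mono_neutral_cong_left[OF finite_R]) (auto split: if_splits)
    also have "\<dots> = (\<Sum>i<N. \<Sum>j<N. ?F i j) - e * (\<Sum>i<N. ?F i (N - 1 - i))"
      by (rule split_pos_sum[OF e]) (auto simp: anti[OF h, simplified])
    also have "\<dots> = (\<Sum>i<N. (of_nat N - 1 - 2 * of_nat i - e * half_sign N i) * \<phi> h $$ (i, i))"
      unfolding D double_sum_less by (simp add: sum_distrib_left sum_subtractf[symmetric] algebra_simps)
    also have "\<dots> = (\<Sum>i<N. 4 * \<kappa> * (b i * \<phi> h $$ (i, i)))" unfolding b using \<kappa>(2) by simp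
    also have "\<dots> = 2 * (2 * \<kappa> * (\<Sum>i<N. b i * \<phi> h $$ (i, i)))" unfolding sum_distrib_left[symmetric] by simp
    finally show "(\<Sum>(i, j)\<in>{p \<in> split_pos e N. fst p < snd p}. \<phi> h $$ (i, i) - \<phi> h $$ (j, j)) =
       2 * \<kappa> * (\<Sum>i<N. b i * \<phi> h $$ (i, i))" by simp
  qed
qed

end

context lie_algebra
begin

lemma so_top_spaces: assumes iso: "isomorphic_to_mat (so_mat N)" and N: "N \<ge> 5"
    and form: "simple" "casimir_normalized B (of_real (real N - 2))" shows "top_spaces B (real N - 2) 4 (of_nat N - 4)"
proof -
  \<comment> \<open>Theta is the sum of the first two coordinates, found at the position (0, N - 2);
    the entry of a matrix at N - 2 on the diagonal is minus the one at 1.\<close>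
  let ?a = "\<lambda>i. if i < 2 then 1 else if i \<ge> N - 2 then - 1 else (0 :: complex)"
    and ?b = "\<lambda>i. (of_nat N - 1 - 2 * of_nat i - 1 * half_sign N i) / (4 * (1 / 2))"
  have a: "?a 0 = 1" "?a 1 = 1" "?a (N - 2) = - 1" "?a (N - 1) = - 1" "\<And>j. j \<in> {2..N - 3} ==> ?a j = 0" using N by auto
  show ?thesis
  proof (rule split_top_spaces[OF so_split[OF iso], where e = 1 and \<kappa> = "1 / 2" and a = ?a and b = ?b and ?p0.0 = "(0, N - 2)"])
    show "2 * complex_of_real (real N - 2) * (1 / 2) = of_nat N - 2 * 1" by simp
    fix f :: "nat => complex" assume f: "\<And>i. i < N ==> f (N - 1 - i) = - f i"
    have "f (N - 1) = - f 0" using f[of 0] N by simp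
    moreover have "N - 1 - 1 = N - 2" by simp
    hence "f (N - 2) = - f 1" using f[of 1] N by (simp only:)
    moreover have "(\<Sum>i<N. ?a i * f i) = f 0 + f 1 - f (N - 2) - f (N - 1)"
    proof -
      have "(\<Sum>i<N. ?a i * f i) = (\<Sum>i\<in>{0, 1, N - 2, N - 1}. ?a i * f i)" using N by (intro sum.mono_neutral_right) auto
      also have "\<dots> = ?a 0 * f 0 + (?a 1 * f 1 + (?a (N - 2) * f (N - 2) + ?a (N - 1) * f (N - 1)))"
        using N by (subst sum.insert, simp, simp, subst sum.insert, simp, force, subst sum.insert, simp, force, simp)
      finally show ?thesis unfolding a by simp
    qed
    ultimately show "f (fst (0, N - 2)) - f (snd (0, N - 2)) = 1 / 2 * (\<Sum>i<N. ?a i * f i)" by simp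
  next
    fix k
    let ?f = "\<lambda>(i, j). fac k ((?b i - ?b j) / (?a i - ?a j))"
    let ?D = "{p \<in> split_pos 1 N. fst p < snd p \<and> ?a (fst p) \<noteq> ?a (snd p)}"
      and ?S = "insert (0, N - 2) ((\<lambda>j. (0, j)) ` {2..N - 3} \<union> (\<lambda>j. (1, j)) ` {2..N - 3})"
    have s: "?D = ?S"
    proof (intro equalityI subsetI)
      fix p assume pR: "p \<in> ?D"
      obtain i j where ij: "p = (i, j)" by (cases p)
      have p: "i < j" "i + j < N - 1" "?a i \<noteq> ?a j"
        using pR unfolding ij split_pos_def mem_Collect_eq fst_conv snd_conv case_prod_conv by auto
      hence "i < 2" "2 \<le> j" by (auto split: if_splits)
      hence "i = 0 \<and> j = N - 2 \<or> i = 0 \<and> 2 \<le> j \<and> j \<le> N - 3 \<or> i = 1 \<and> 2 \<le> j \<and> j \<le> N - 3" using p(2) N by arith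
      then consider "i = 0" "j = N - 2" | "i = 0" "j \<in> {2..N - 3}" | "i = 1" "j \<in> {2..N - 3}" by auto
      thus "p \<in> ?S" unfolding ij by cases auto
    qed (use N in \<open>auto simp: split_pos_def\<close>)
    have h: "half_sign N 0 = 1" "half_sign N 1 = 1" "half_sign N (N - 2) = - 1" using N by (auto simp: half_sign_def)
    have b: "?b 0 - ?b j = so_height N j" "?b 1 - ?b j = so_height N j - 1" for j
      unfolding h by (auto simp: so_height_def half_sign_def field_simps)
    have "(\<Prod>p\<in>?S. ?f p) =
      ?f (0, N - 2) * ((\<Prod>j\<in>{2..N - 3}. ?f (0, j)) * (\<Prod>j\<in>{2..N - 3}. ?f (1, j)))"
      by (rule prod_insert_rows) (use N in \<open>auto simp: inj_on_def\<close>)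
    also have "(\<Prod>j\<in>{2..N - 3}. ?f (0, j)) = (\<Prod>j\<in>{2..N - 3}. fac k (so_height N j))"
      by (intro prod.cong refl) (simp only: case_prod_conv a b diff_zero div_by_1)
    also have "(\<Prod>j\<in>{2..N - 3}. ?f (1, j)) = (\<Prod>j\<in>{2..N - 3}. fac k (so_height N j - 1))"
      by (intro prod.cong refl) (simp only: case_prod_conv a b diff_zero div_by_1)
    also have "?f (0, N - 2) = fac k ((of_nat N - 3) / 2)"
    proof -
      have "?b 0 - ?b (N - 2) = of_nat N - 3" unfolding h using N by (simp add: of_nat_diff field_simps)
      thus ?thesis unfolding case_prod_conv a by simp
    qed
    finally show "(\<Prod>(i, j)\<in>?D. fac k ((?b i - ?b j) / (?a i - ?a j))) =
        cartan_dim 4 (of_nat N - 4) k" unfolding s cartan_dim_so[OF N] prod.distrib .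
  qed (use N form in \<open>auto simp: split_pos_def\<close>)
qed

lemma sp_top_spaces: assumes iso: "isomorphic_to_mat (sp_mat n)" and n: "n \<ge> 1"
    and form: "simple" "casimir_normalized B (of_real (real n + 1))" shows "top_spaces B (real n + 1) 1 (of_nat n + 2)"
proof -
  let ?N = "2 * n"
  \<comment> \<open>Theta is twice the first coordinate, found at the corner position on the
    antidiagonal.\<close>
  let ?a = "\<lambda>i. if i = 0 then 1 else if i = ?N - 1 then - 1 else (0 :: complex)"
    and ?b = "\<lambda>i. (of_nat ?N - 1 - 2 * of_nat i - (- 1) * half_sign ?N i) / (4 * 1)"
  have a: "?a 0 = 1" "?a (?N - 1) = - 1" "\<And>j. j \<in> {1..?N - 2} ==> ?a j = 0" using n by auto
  show ?thesis
  proof (rule split_top_spaces[OF sp_split[OF iso], where e = "- 1" and \<kappa> = 1 and a = ?a and b = ?b and ?p0.0 = "(0, ?N - 1)"])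
    fix f :: "nat => complex" assume f: "\<And>i. i < ?N ==> f (?N - 1 - i) = - f i"
    have "(\<Sum>i<?N. ?a i * f i) = (\<Sum>i<?N. (if i = 0 then f 0 else 0) - (if i = ?N - 1 then f (?N - 1) else 0))"
      using n by (intro sum.cong) auto
    also have "\<dots> = f 0 - f (?N - 1)" using n unfolding sum_subtractf by simp
    finally show "f (fst (0, ?N - 1)) - f (snd (0, ?N - 1)) = 1 * (\<Sum>i<?N. ?a i * f i)" by simp
  next
    fix k
    let ?f = "\<lambda>(i, j). fac k ((?b i - ?b j) / (?a i - ?a j))"
    let ?D = "{p \<in> split_pos (- 1) ?N. fst p < snd p \<and> ?a (fst p) \<noteq> ?a (snd p)}"
      and ?S = "insert (0, ?N - 1) ((\<lambda>j. (0, j)) ` {1..?N - 2})"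
    have s: "?D = ?S"
    proof (intro equalityI subsetI)
      fix p assume pR: "p \<in> ?D"
      obtain i j where ij: "p = (i, j)" by (cases p)
      have p: "i < j" "i + j \<le> ?N - 1" "?a i \<noteq> ?a j"
        using pR unfolding ij split_pos_def mem_Collect_eq fst_conv snd_conv case_prod_conv by auto
      then consider "i = 0" "j = ?N - 1" | "i = 0" "j \<in> {1..?N - 2}" by (cases "i = 0") (auto split: if_splits)
      thus "p \<in> ?S" unfolding ij by cases auto
    qed (use n in \<open>auto simp: split_pos_def\<close>)
    have h: "half_sign ?N 0 = 1" "half_sign ?N (?N - 1) = - 1" using n by (auto simp: half_sign_def)
    have b: "?b 0 - ?b j = (if j < n then of_nat j else of_nat j + 1) / 2" for j
      unfolding h using n by (auto simp: half_sign_def field_simps)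
    have "(\<Prod>p\<in>?S. ?f p) =
      ?f (0, ?N - 1) * (\<Prod>p\<in>(\<lambda>j. (0, j)) ` {1..?N - 2}. ?f p)" using n by (subst prod.insert) auto
    also have "(\<Prod>p\<in>(\<lambda>j. (0, j)) ` {1..?N - 2}. ?f p) = (\<Prod>j\<in>{1..?N - 2}. fac k ((if j < n then of_nat j else of_nat j + 1) / 2))"
      by (subst prod.reindex, simp add: inj_on_def, intro prod.cong refl) (simp only: comp_def case_prod_conv a b diff_zero div_by_1)
    also have "?f (0, ?N - 1) = fac k (of_nat n / 2)"
    proof -
      have "?b 0 - ?b (?N - 1) = of_nat n" unfolding h using n by (simp add: of_nat_diff field_simps)
      thus ?thesis unfolding case_prod_conv a by simp
    qed
    finally show "(\<Prod>(i, j)\<in>?D. fac k ((?b i - ?b j) / (?a i - ?a j))) =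
        cartan_dim 1 (of_nat n + 2) k" unfolding s cartan_dim_sp[OF n] .
  qed (use n form in \<open>auto simp: split_pos_def sp_sign_def\<close>)
qed

end

section \<open>The exceptional Lie algebras\<close>

definition dotp :: "int list => int list => int" where "dotp xs ys = sum_list (map2 (*) xs ys)"

text \<open>\<open>dotp (A ! i) v\<close> is the value of the root on the i-th coroot. Where it is
  negative, the i-th reflection raises the root; one call collects all such raised roots.\<close>

definition grow :: "int list list => int list list => int list list" where
  "grow A L = remdups (concat (map (\<lambda>v. concat (map (\<lambda>i. let c = dotp (A ! i) v in if c < 0 then [v[i := v ! i - c]] else [])
     [0..<length A])) L))"

text \<open>The number bounds the rounds, and a result is returned only if no further root appears.
  In E8 each round raises the height by one and the highest root has height 29, so the bound 30 used
  below is enough.\<close>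

fun grow_all :: "int list list => nat => int list list => int list list option" where "grow_all A 0 L = (if L = [] then Some [] else None)"
| "grow_all A (Suc m) L = map_option ((@) L) (grow_all A m (grow A L))"

fun linked :: "int list list => int list => nat list => (nat \<times> nat) list => bool" where
  "linked A d vs [] \<longleftrightarrow> list_all (\<lambda>i. i \<in> set vs) [0..<length A]"
| "linked A d vs ((p, i) # es) \<longleftrightarrow> p \<in> set vs \<and> i < length A \<and> A ! i ! p \<noteq> 0 \<and> d ! i * A ! i ! p = d ! p * A ! p ! i \<and>
     linked A d (i # vs) es"

definition simples :: "nat => int list list" where "simples n = map (\<lambda>i. (replicate n 0)[i := 1]) [0..<n]"

text \<open>The roots are listed by their coefficients with respect to the base; \<open>th\<close> is the highest root,
  \<open>d\<close> lists the squared lengths of the simple roots, and the roots \<open>r \<noteq> \<theta>\<close> that are not orthogonal to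
  \<open>\<theta>\<close> satisfy \<open>(r, \<rho>) / (r, \<theta>) = g / f\<close> with \<open>g\<close> running through the three arithmetic progressions.
  The edges \<open>es\<close> of the Dynkin diagram determine the ratios of the squared lengths.\<close>

definition heights :: "int => int => int => int => int => int => int list" where
  "heights f a p b q m = map (\<lambda>j. a + f * j) [1..p] @ map (\<lambda>j. b + f * j) [1..q] @ map (\<lambda>j. f * j) [1..m]"

definition root_data :: "int list list => int list => (nat \<times> nat) list => int list => int => int list => bool" where
  "root_data A d es th f gs \<longleftrightarrow> (let F = dotp (map2 (*) d (map (\<lambda>a. dotp a th) A)); G = dotp d in
       F th = 2 * f \<and> f > 0 \<and> length d = length A \<and> length th = length A \<and> list_all (\<lambda>a. length a = length A) A \<and> A \<noteq> [] \<and>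
       list_all (\<lambda>a. a > 0) d \<and> linked A d [0] es \<and> (case grow_all A 30 (simples (length A)) of None => False
        | Some L => th \<in> set L \<and> list_all (\<lambda>v. list_all2 (\<le>) v th) L \<and>
           (let K = filter (\<lambda>v. F v \<noteq> 0 \<and> v \<noteq> th) L in distinct K \<and> list_all (\<lambda>v. F v = f) K \<and> sort (map G K) = sort gs)))"

text \<open>The equation for \<open>\<tau>\<close> is (theta, theta + 2 rho) = 2 tau in the units of
  \<open>d\<close>. By \<open>bin_steps\<close> the three progressions of heights become the three
  binomial quotients of the formula. The two denominators are matched with their numerators in one
  order for F4 and the E series and in the other for G2.\<close>

definition vogel_data :: "int list list => real => complex => complex => bool" where
  "vogel_data A \<tau> \<beta> \<gamma> \<longleftrightarrow> (\<exists>d es th f a b p q m. root_data A d es th f (heights f a (int p) b (int q) (int m)) \<and>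
     \<tau> * of_int f = of_int f + of_int (dotp d th) \<and> of_real \<tau> = \<beta> + \<gamma> - 2 \<and>
     \<beta> + \<gamma> / 2 - 3 = of_int a / of_int f + of_nat p \<and> \<gamma> + \<beta> / 2 - 3 = of_int b / of_int f + of_nat q \<and> \<beta> + \<gamma> - 4 = of_nat m \<and>
     (- 1 + \<gamma> / 2 = of_int a / of_int f \<and> - 1 + \<beta> / 2 = of_int b / of_int f \<or>
      - 1 + \<gamma> / 2 = of_int b / of_int f \<and> - 1 + \<beta> / 2 = of_int a / of_int f) \<and> a \<ge> 0 \<and> b \<ge> 0)"

lemmas vogel_dataI = vogel_data_def[THEN iffD2, OF exI, OF exI, OF exI, OF exI, OF exI, OF exI, OF exI, OF exI, OF exI]

lemma vogel_data_G2: "vogel_data cartan_G2 4 (10 / 3) (8 / 3)"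
proof (rule vogel_dataI[OF conjI])
  show "root_data cartan_G2 [3, 1] [(0, 1)] [2, 3] 3 (heights 3 2 (int 1) 1 (int 1) (int 2))" by code_simp
qed (simp add: dotp_def)

lemma vogel_data_F4: "vogel_data cartan_F4 9 5 6"
proof (rule vogel_dataI[OF conjI])
  show "root_data cartan_F4 [1, 1, 2, 2] [(0, 1), (1, 2), (2, 3)] [2, 4, 3, 2] 2 (heights 2 4 (int 3) 3 (int 4) (int 7))" by code_simp
qed (simp add: dotp_def)

lemma vogel_data_E6: "vogel_data cartan_E6 12 6 8"
proof (rule vogel_dataI[OF conjI])
  show "root_data cartan_E6 (replicate 6 1) [(0, 2), (2, 3), (3, 1), (3, 4), (4, 5)]
    [1, 2, 2, 3, 2, 1] 1 (heights 1 3 (int 4) 2 (int 6) (int 10))" by code_simp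
qed (simp add: dotp_def numeral_eq_Suc)

lemma vogel_data_E7: "vogel_data cartan_E7 18 8 12"
proof (rule vogel_dataI[OF conjI])
  show "root_data cartan_E7 (replicate 7 1) [(0, 2), (2, 3), (3, 1), (3, 4), (4, 5), (5, 6)]
    [2, 2, 3, 4, 3, 2, 1] 1 (heights 1 5 (int 6) 3 (int 10) (int 16))" by code_simp
qed (simp add: dotp_def numeral_eq_Suc)

lemma vogel_data_E8: "vogel_data cartan_E8 30 12 20"
proof (rule vogel_dataI[OF conjI])
  show "root_data cartan_E8 (replicate 8 1) [(0, 2), (2, 3), (3, 1), (3, 4), (4, 5), (5, 6), (6, 7)]
    [2, 3, 4, 6, 5, 4, 3, 2] 1 (heights 1 9 (int 10) 5 (int 18) (int 28))" by code_simp
qed (simp add: dotp_def numeral_eq_Suc)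

lemma dotp_nth: "length xs = n ==> length ys = n ==> dotp xs ys = (\<Sum>i<n. xs ! i * ys ! i)"
  unfolding dotp_def by (simp add: sum_list_sum_nth atLeast0LessThan)

lemma grow_iff: "w \<in> set (grow A L) \<longleftrightarrow> (\<exists>v\<in>set L. \<exists>i<length A. dotp (A ! i) v < 0 \<and> w = v[i := v ! i - dotp (A ! i) v])"
proof
  assume "w \<in> set (grow A L)"
  then obtain v i where "v \<in> set L" "i < length A" "dotp (A ! i) v < 0" "w = v[i := v ! i - dotp (A ! i) v]"
    unfolding grow_def by (auto simp: Let_def split: if_splits)
  thus "\<exists>v\<in>set L. \<exists>i<length A. dotp (A ! i) v < 0 \<and> w = v[i := v ! i - dotp (A ! i) v]" by metis
next
  assume "\<exists>v\<in>set L. \<exists>i<length A. dotp (A ! i) v < 0 \<and> w = v[i := v ! i - dotp (A ! i) v]"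
  then obtain v i where "v \<in> set L" "i < length A" "dotp (A ! i) v < 0" "w = v[i := v ! i - dotp (A ! i) v]" by metis
  thus "w \<in> set (grow A L)" unfolding grow_def by (auto simp: Let_def intro!: bexI[of _ v] bexI[of _ i])
qed

lemma grow_all_props: assumes "grow_all A m L = Some M" shows "set L \<subseteq> set M" "set (grow A M) \<subseteq> set M"
    and "(\<And>v. v \<in> set L ==> P v) ==>
      (\<And>v i. P v ==> i < length A ==> dotp (A ! i) v < 0 ==> P (v[i := v ! i - dotp (A ! i) v])) ==> v \<in> set M ==> P v" using assms
proof (induction m arbitrary: L M)
  case 0
  {
    case 1
    thus ?case by (simp split: if_splits)
  next
    case 2
    thus ?case by (auto simp: grow_def split: if_splits)
  next
    case 3
    thus ?case by (simp split: if_splits)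
  }
next
  case (Suc m)
  {
    case 1
    thus ?case by auto
  next
    case 2
    then obtain M' where M': "grow_all A m (grow A L) = Some M'" "M = L @ M'" by auto
    have "set (grow A M) = set (grow A L) \<union> set (grow A M')" unfolding M'(2)
      by (simp only: set_eq_iff grow_iff set_append Un_iff bex_Un simp_thms)
    thus ?case using Suc.IH(1)[OF M'(1)] Suc.IH(2)[OF M'(1)] M'(2) by auto
  next
    case 3
    then obtain M' where M': "grow_all A m (grow A L) = Some M'" "M = L @ M'" by auto
    show ?case
    proof (cases "v \<in> set L")
      case False
      have "P w" if "w \<in> set (grow A L)" for w using that 3(1,2) unfolding grow_iff by blast
      thus ?thesis using Suc.IH(3)[OF _ 3(2) _ M'(1)] False 3(3) M'(2) by auto
    qed (use 3(1) in blast)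
  }
qed

lemma simples_nth: "i < n ==> (replicate n 0)[i := 1] \<in> set (simples n)"
  and simplesE: "v \<in> set (simples n) ==> \<exists>i<n. v = (replicate n 0)[i := 1]" unfolding simples_def by auto

section \<open>Root systems grown from a Cartan matrix\<close>

context based_alg
begin

context fixes ds :: "('a => complex) list" and A :: "int list list" and n :: nat
  assumes ds: "\<Delta> = set ds" "distinct ds" "length ds = n" "length A = n" "\<forall>a\<in>set A. length a = n"
    and cartan_entry: "\<And>i j. i < n ==> j < n ==> (ds ! j) (hv (ds ! i)) = of_int (A ! i ! j)"
begin

definition comb :: "int list => 'a => complex" where "comb v = (\<Sum>i<n. fun_scale (of_int (v ! i)) (ds ! i))"

lemma ds_Delta: "i < n ==> ds ! i \<in> \<Delta>" and ds_root: "i < n ==> ds ! i \<in> roots H" using ds Delta_root by auto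

lemma comb_coeffs: "\<exists>ix. (\<forall>i<n. ix (ds ! i) = i) \<and> (\<forall>v. comb v = (\<Sum>d\<in>\<Delta>. fun_scale (of_int (v ! ix d)) d))"
proof -
  have bij: "bij_betw ((!) ds) {..<n} \<Delta>" unfolding ds(1) by (rule bij_betw_nth) (use ds in auto)
  define ix where "ix = the_inv_into {..<n} ((!) ds)"
  have ix: "ix (ds ! i) = i" if "i < n" for i
    unfolding ix_def by (rule the_inv_into_f_f) (use bij that in \<open>auto simp: bij_betw_def\<close>)
  hence "comb v = (\<Sum>d\<in>\<Delta>. fun_scale (of_int (v ! ix d)) d)" for v
    unfolding comb_def sum.reindex_bij_betw[OF bij, symmetric] by (intro sum.cong) auto
  thus ?thesis using ix by blast
qed

lemma comb_inj: "length v = n ==> length w = n ==> comb v = comb w ==> v = w"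
proof (rule nth_equalityI)
  assume v: "length v = n" "length w = n" and eq: "comb v = comb w"
  obtain ix where ix: "\<And>i. i < n ==> ix (ds ! i) = i" "\<And>v. comb v = (\<Sum>d\<in>\<Delta>. fun_scale (of_int (v ! ix d)) d)"
    using comb_coeffs by metis
  fix i assume "i < length v"
  hence i: "i < n" using v by simp
  show "v ! i = w ! i"
    using coeff_unique[of "\<lambda>d. of_int (v ! ix d)" "\<lambda>d. of_int (w ! ix d)", OF _ ds_Delta[OF i]] eq unfolding ix by (simp add: ix(1)[OF i])
qed simp

lemma comb_natc: assumes "\<And>i. i < n ==> v ! i \<ge> 0" shows "natc (comb v)"
proof -
  obtain ix where ix: "\<And>i. i < n ==> ix (ds ! i) = i" "\<And>v. comb v = (\<Sum>d\<in>\<Delta>. fun_scale (of_int (v ! ix d)) d)"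
    using comb_coeffs by metis
  have "comb v = (\<Sum>d\<in>\<Delta>. fun_scale (of_nat (nat (v ! ix d))) d)"
    unfolding ix(2) using ds ix(1) assms by (intro sum.cong) (auto simp: in_set_conv_nth)
  thus ?thesis unfolding nat_combination_def by (rule exI[of _ "\<lambda>d. nat (v ! ix d)"])
qed

lemma comb_hv: "length v = n ==> i < n ==> comb v (hv (ds ! i)) = of_int (dotp (A ! i) v)"
  unfolding comb_def fun_sum_apply fun_scale_def using ds by (simp add: cartan_entry dotp_nth[of _ n] mult.commute)

lemma comb_simple: "i < n ==> comb ((replicate n 0)[i := 1]) = ds ! i"
proof
  fix x assume i: "i < n"
  have "comb ((replicate n 0)[i := 1]) x = (\<Sum>j<n. if j = i then (ds ! i) x else 0)"
    unfolding comb_def fun_sum_apply fun_scale_def by (intro sum.cong) (auto simp: nth_list_update)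
  thus "comb ((replicate n 0)[i := 1]) x = (ds ! i) x" using i by simp
qed

lemma refl_comb: "length v = n ==> i < n ==> refl (ds ! i) (comb v) = comb (v[i := v ! i - dotp (A ! i) v])"
proof
  fix x assume v: "length v = n" and i: "i < n"
  let ?c = "dotp (A ! i) v"
  have "comb (v[i := v ! i - ?c]) x = (\<Sum>j<n. of_int (v ! j) * (ds ! j) x - (if j = i then of_int ?c * (ds ! i) x else 0))"
    unfolding comb_def fun_sum_apply fun_scale_def using v by (intro sum.cong) (auto simp: nth_list_update algebra_simps)
  also have "\<dots> = comb v x - of_int ?c * (ds ! i) x" unfolding sum_subtractf comb_def fun_sum_apply fun_scale_def using i by simp
  finally show "refl (ds ! i) (comb v) x = comb (v[i := v ! i - ?c]) x" unfolding refl_def comb_hv[OF v i] by (simp add: fun_scale_def)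
qed

text \<open>Completeness: a positive root that is not simple has a positive product with some simple
  root, since otherwise its length would not be positive. Reflecting there gives a lower positive
  root, already listed by induction, and a growth step leads back.\<close>

lemma Pos_list: assumes M: "grow_all A m (simples n) = Some M" shows "v \<in> set M ==> length v = n" "Pos = comb ` set M"
proof -
  have P: "length v = n \<and> comb v \<in> Pos" if "v \<in> set M" for v
  proof (rule grow_all_props(3)[OF M _ _ that])
    fix v assume "v \<in> set (simples n)"
    then obtain i where i: "i < n" "v = (replicate n 0)[i := 1]" using simplesE by blast
    thus "length v = n \<and> comb v \<in> Pos" using comb_simple Delta_Pos ds_Delta by simp
  next
    fix v i assume v: "length v = n \<and> comb v \<in> Pos" and "i < length A" and neg: "dotp (A ! i) v < 0"
    hence i: "i < n" using ds by simp
    have "comb v \<noteq> ds ! i"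
    proof
      assume "comb v = ds ! i"
      hence "of_int (dotp (A ! i) v) = (2 :: complex)" using comb_hv[of v i] root_hv[OF ds_root[OF i]] v i by simp
      hence "dotp (A ! i) v = 2" by (metis of_int_eq_iff of_int_numeral)
      thus False using neg by simp
    qed
    hence "refl (ds ! i) (comb v) \<in> Pos" using refl_Pos(1)[OF ds_Delta[OF i]] v by blast
    thus "length (v[i := v ! i - dotp (A ! i) v]) = n \<and> comb (v[i := v ! i - dotp (A ! i) v]) \<in> Pos"
      using refl_comb[of v i] v i by simp
  qed
  thus "v \<in> set M ==> length v = n" by blast
  have "r \<in> comb ` set M" if "r \<in> Pos" for r using that
  proof (induction "card {s \<in> Pos. Re (ip s wrho) < Re (ip r wrho)}" arbitrary: r rule: less_induct)
    case less
    note rR = Pos_root[OF less.prems]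
    show ?case
    proof (cases "r \<in> \<Delta>")
      case True
      then obtain i where i: "i < n" "r = ds ! i" using ds by (metis in_set_conv_nth)
      thus ?thesis using comb_simple[OF i(1)] simples_nth[OF i(1)] grow_all_props(1)[OF M] by (metis image_eqI subsetD)
    next
      case False
      obtain c where c: "r = (\<Sum>d\<in>\<Delta>. fun_scale (of_nat (c d)) d)"
        using less.prems unfolding positive_roots_def nat_combination_def by blast
      have "ip r r = (\<Sum>d\<in>\<Delta>. of_nat (c d) * ip r d)" by (subst (2) c) (simp only: ip_sum_right ip_scale_right)
      hence "Re (ip r r) = (\<Sum>d\<in>\<Delta>. of_nat (c d) * Re (ip r d))" by simp
      moreover have "(\<Sum>d\<in>\<Delta>. of_nat (c d) * Re (ip r d)) \<le> 0" if "\<forall>d\<in>\<Delta>. Re (ip r d) \<le> 0"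
        using that by (intro sum_nonpos) (simp add: mult_nonneg_nonpos)
      ultimately have "\<not> (\<forall>d\<in>\<Delta>. Re (ip r d) \<le> 0)" using ip_root_pos[OF rR] by auto
      then obtain d where d: "d \<in> \<Delta>" "Re (ip r d) > 0" by (auto simp: not_le)
      then obtain i where i: "i < n" "d = ds ! i" using ds by (metis in_set_conv_nth)
      note dR = Delta_root[OF d(1)]
      have pos: "Re (r (hv d)) > 0" using hv_sign(1)[OF dR rootsD(1)[OF rR]] d(2) by blast
      let ?s = "refl d r"
      have s: "?s \<in> Pos" by (rule refl_Pos(1)[OF d(1) less.prems]) (use d(1) False in blast)
      obtain z where z: "r (hv d) = of_int z" using root_hv_int[OF dR rR] by (auto elim: Ints_cases)
      have "ip ?s wrho = ip r wrho - of_int z * ip d wrho" unfolding refl_def z by (simp only: ip_diff_left ip_scale_left)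
      hence lt: "Re (ip ?s wrho) < Re (ip r wrho)" using wrho_Delta_pos[OF d(1)] pos z by simp
      have "card {t \<in> Pos. Re (ip t wrho) < Re (ip ?s wrho)} < card {t \<in> Pos. Re (ip t wrho) < Re (ip r wrho)}"
        by (rule psubset_card_mono) (use lt s finite_Pos in auto)
      hence "?s \<in> comb ` set M" using less.hyps s by blast
      then obtain w where w: "w \<in> set M" "?s = comb w" by blast
      have lw: "length w = n" using P w by blast
      have "of_int (dotp (A ! i) w) = ?s (hv d)" using comb_hv[OF lw i(1)] w i by simp
      also have "\<dots> = - r (hv d)" using root_hv[OF dR] by (simp add: refl_def fun_scale_def)
      finally have "dotp (A ! i) w < 0" using pos z by (simp flip: of_int_minus)
      hence "w[i := w ! i - dotp (A ! i) w] \<in> set M" using grow_all_props(2)[OF M] w(1) i(1) ds(4) grow_iff by (metis subsetD)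
      moreover have "comb (w[i := w ! i - dotp (A ! i) w]) = r"
        unfolding refl_comb[OF lw i(1), symmetric] i(2)[symmetric] w(2)[symmetric] by (rule refl_involution[OF dR])
      ultimately show ?thesis by (metis image_eqI)
    qed
  qed
  thus "Pos = comb ` set M" using P by blast
qed

text \<open>Twice the product of two simple roots equals either Cartan entry times the corresponding
  squared length, so along an edge one length determines the other.\<close>

lemma linked_lengths:
  assumes "linked A d vs es" "\<And>i. i \<in> set vs ==> i < n \<and> ip (ds ! i) (ds ! i) = of_int (d ! i) * u" "i < n"
  shows "ip (ds ! i) (ds ! i) = of_int (d ! i) * u" using assms
proof (induction es arbitrary: vs)
  case Nil
  thus ?case using ds by (auto simp: list_all_iff)
next
  case (Cons e es)
  obtain p j where e: "e = (p, j)" by (cases e)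
  have h: "p \<in> set vs" "j < n" "A ! j ! p \<noteq> 0" "d ! j * A ! j ! p = d ! p * A ! p ! j" "linked A d (j # vs) es"
    using Cons.prems(1) ds unfolding e by auto
  have p: "p < n" "ip (ds ! p) (ds ! p) = of_int (d ! p) * u" using Cons.prems(2)[OF h(1)] by auto
  have x: "of_int (A ! j ! p) * ip (ds ! j) (ds ! j) = 2 * ip (ds ! p) (ds ! j)"
    "of_int (A ! p ! j) * ip (ds ! p) (ds ! p) = 2 * ip (ds ! j) (ds ! p)"
    using apply_hv_ip[OF ds_root rootsD(1)[OF ds_root]] ip_root_nonzero[OF ds_root] h(2) p(1)
    unfolding cartan_entry[OF h(2) p(1), symmetric] cartan_entry[OF p(1) h(2), symmetric] by auto
  have "of_int (A ! j ! p) * ip (ds ! j) (ds ! j) = of_int (A ! p ! j) * (of_int (d ! p) * u)"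
    using x p(2) ip_sym[of "ds ! p" "ds ! j"] by simp
  also have "\<dots> = of_int (d ! j * A ! j ! p) * u" unfolding h(4) by simp
  finally have "ip (ds ! j) (ds ! j) = of_int (d ! j) * u" using h(3) by simp
  thus ?case using Cons.IH[OF h(5)] Cons.prems(2,3) h(2) by auto
qed

lemma top_spaces_root_data: assumes "vogel_data A \<tau> \<beta> \<gamma>" shows "top_spaces B \<tau> \<beta> \<gamma>"
proof -
  obtain d es th f a b p q m where data: "root_data A d es th f (heights f a (int p) b (int q) (int m))"
    and \<tau>: "\<tau> * of_int f = of_int f + of_int (dotp d th)" "of_real \<tau> = \<beta> + \<gamma> - 2"
    and x: "\<beta> + \<gamma> / 2 - 3 = of_int a / of_int f + of_nat p" "\<gamma> + \<beta> / 2 - 3 = of_int b / of_int f + of_nat q" "\<beta> + \<gamma> - 4 = of_nat m"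
    and y: "- 1 + \<gamma> / 2 = of_int a / of_int f \<and> - 1 + \<beta> / 2 = of_int b / of_int f \<or>
      - 1 + \<gamma> / 2 = of_int b / of_int f \<and> - 1 + \<beta> / 2 = of_int a / of_int f" and ab: "a \<ge> 0" "b \<ge> 0"
    using assms unfolding vogel_data_def by metis
  define Fv where "Fv = dotp (map2 (*) d (map (\<lambda>a. dotp a th) A))"
  define Gv where "Gv = dotp d"
  have D: "Fv th = 2 * f" "f > 0" "length d = n" "length th = n" "n > 0" "\<And>i. i < n ==> d ! i > 0" "linked A d [0] es"
    using data ds(4) unfolding root_data_def Fv_def Gv_def Let_def by (auto simp: list_all_length)
  obtain L where L: "grow_all A 30 (simples n) = Some L" "th \<in> set L" "\<And>v. v \<in> set L ==> list_all2 (\<le>) v th"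
    using data ds(4) unfolding root_data_def Fv_def Gv_def Let_def by (auto simp: list_all_iff split: option.splits)
  define K where "K = filter (\<lambda>v. Fv v \<noteq> 0 \<and> v \<noteq> th) L"
  have K: "distinct K" "\<And>v. v \<in> set K ==> Fv v = f" "sort (map Gv K) = sort (heights f a (int p) b (int q) (int m))"
    using data ds(4) L(1) unfolding root_data_def Fv_def Gv_def K_def Let_def by (auto simp: list_all_iff)
  have PosL: "Pos = comb ` set L" and len: "\<And>v. v \<in> set L ==> length v = n" using Pos_list[OF L(1)] by blast+
  \<comment> \<open>The common scale between the list \<open>d\<close> and the actual squared
    lengths of the simple roots.\<close>
  define u where "u = ip (ds ! 0) (ds ! 0) / of_int (d ! 0)"
  have d0: "(of_int (d ! 0) :: complex) \<noteq> 0" using D(5,6) by fastforce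
  have dl: "ip (ds ! i) (ds ! i) = of_int (d ! i) * u" if "i < n" for i
    by (rule linked_lengths[OF D(7) _ that]) (use D(5) d0 in \<open>auto simp: u_def\<close>)
  obtain w where w: "u = of_real w" "w > 0"
  proof -
    obtain x where x: "ip (ds ! 0) (ds ! 0) = of_real x" "x > 0" using ip_root_pos[OF ds_root[OF D(5)]] by (auto elim!: Reals_cases)
    have "u = of_real (x / of_int (d ! 0))" unfolding u_def x by simp
    moreover have "x / of_int (d ! 0) > 0" using x D(5,6) by simp
    ultimately show thesis by (rule that)
  qed
  have rho: "ip (comb v) wrho = u / 2 * of_int (Gv v)" if "length v = n" for v
  proof -
    have "ip (comb v) wrho = (\<Sum>i<n. of_int (v ! i) * (of_int (d ! i) * u / 2))"
      unfolding comb_def ip_sum_left ip_scale_left using ip_wrho_Delta[OF ds_Delta] dl ip_sym by (intro sum.cong) auto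
    also have "\<dots> = u / 2 * of_int (Gv v)" unfolding Gv_def dotp_nth[OF D(3) that] of_int_sum sum_distrib_left by (intro sum.cong) auto
    finally show ?thesis .
  qed
  have th: "ip (comb v) (comb th) = u / 2 * of_int (Fv v)" if v: "length v = n" for v
  proof -
    have e: "ip (ds ! i) (comb th) = of_int (d ! i * dotp (A ! i) th) * (u / 2)" if i: "i < n" for i
    proof -
      have "comb th \<in> dual H" unfolding comb_def using rootsD(1)[OF ds_root] by (intro dual_sum dual_scale) auto
      from apply_hv_ip[OF ds_root[OF i] this] comb_hv[OF D(4) i]
      have "2 * ip (comb th) (ds ! i) = of_int (dotp (A ! i) th) * ip (ds ! i) (ds ! i)"
        using ip_root_nonzero[OF ds_root[OF i]] by (simp add: field_simps)
      thus ?thesis unfolding dl[OF i] ip_sym[of "ds ! i" "comb th"] by (simp add: field_simps)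
    qed
    have "ip (comb v) (comb th) = (\<Sum>i<n. of_int (v ! i) * (of_int (d ! i * dotp (A ! i) th) * (u / 2)))"
      unfolding comb_def[of v] ip_sum_left ip_scale_left using e by (intro sum.cong) auto
    also have "\<dots> = u / 2 * of_int (Fv v)"
    proof -
      have l: "length (map2 (*) d (map (\<lambda>a. dotp a th) A)) = n" using D(3) ds(4) by simp
      show ?thesis unfolding Fv_def dotp_nth[OF l v] of_int_sum sum_distrib_left using D(3) ds(4) by (intro sum.cong) auto
    qed
    finally show ?thesis .
  qed
  have lth: "length th = n" by (rule D(4))
  have tP: "comb th \<in> Pos" using PosL L(2) by blast
  interpret h: highest_alg scale G br H B \<tau> \<Delta> "comb th"
  proof (unfold_locales, unfold highest_root_def, intro conjI ballI)
    show "comb th \<in> roots H" by (rule Pos_root[OF tP])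
    fix r assume r: "r \<in> roots H"
    show "natc (comb th - r)"
    proof (cases "r \<in> Pos")
      case True
      then obtain v where v: "v \<in> set L" "r = comb v" using PosL by blast
      have "comb th - r = comb (map2 (-) th v)"
        unfolding v(2) using lth len[OF v(1)] by (simp add: fun_eq_iff comb_def fun_sum_apply fun_scale_def sum_subtractf algebra_simps)
      thus ?thesis using comb_natc[of "map2 (-) th v"] L(3)[OF v(1)] lth len[OF v(1)] by (simp add: list_all2_conv_all_nth)
    next
      case False
      hence "natc (- r)" "natc (comb th)" using r root_natc tP by (auto simp: positive_roots_def)
      thus ?thesis using natc_add[of "comb th" "- r"] by simp
    qed
  qed
  \<comment> \<open>The scale is forced by \<open>h.cas_theta\<close>, because (theta, theta + 2
    rho) is proportional to \<open>u\<close>.\<close>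
  have norm: "u * of_int f = 2"
  proof -
    have "cas (comb th) = u * of_int f + u * of_int (Gv th)" unfolding cas_def th[OF lth] rho[OF lth] D(1) by (simp add: algebra_simps)
    hence "of_real (w * (of_int f + of_int (Gv th))) = (of_real (2 * \<tau>) :: complex)" using h.cas_theta w(1) by (simp add: algebra_simps)
    hence "w * (of_int f + of_int (Gv th)) = 2 * \<tau>" by (simp only: of_real_eq_iff)
    hence "\<tau> * (w * of_int f) = \<tau> * 2" unfolding \<tau>(1)[folded Gv_def, symmetric] by simp
    hence "w * of_int f = 2" using tau_pos by simp
    hence "of_real (w * of_int f) = (2 :: complex)" by simp
    thus ?thesis unfolding w(1) by simp
  qed
  have u0: "u \<noteq> 0" using norm by auto
  show ?thesis
  proof (rule h.top_spacesI)
    show "ip (comb th) (comb th) = 2" unfolding th[OF lth] D(1) using norm by simp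
    fix k
    let ?h = "\<lambda>v. fac k (of_int (Gv v) / of_int (Fv v))"
    have inj: "inj_on comb (set L)" using comb_inj len by (auto intro!: inj_onI)
    have KL: "set K \<subseteq> set L" "th \<notin> set K" by (auto simp: K_def)
    have F0: "Fv th \<noteq> 0" using D by simp
    have s: "{r \<in> Pos. ip r (comb th) \<noteq> 0} = comb ` insert th (set K)"
    proof -
      have "ip (comb v) (comb th) = 0 \<longleftrightarrow> Fv v = 0" if "v \<in> set L" for v
        unfolding th[OF len[OF that]] using u0 by simp
      hence "{r \<in> Pos. ip r (comb th) \<noteq> 0} = comb ` {v \<in> set L. Fv v \<noteq> 0}" unfolding PosL by blast
      also have "{v \<in> set L. Fv v \<noteq> 0} = insert th (set K)" using L(2) F0 by (auto simp: K_def)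
      finally show ?thesis .
    qed
    have "(\<Prod>r\<in>{r \<in> Pos. ip r (comb th) \<noteq> 0}. fac k (ip r wrho / ip r (comb th))) =
       (\<Prod>v\<in>insert th (set K). fac k (ip (comb v) wrho / ip (comb v) (comb th)))"
    proof -
      have "inj_on comb (insert th (set K))" by (rule inj_on_subset[OF inj]) (use KL L(2) in blast)
      thus ?thesis unfolding s by (simp only: prod.reindex comp_def)
    qed
    also have "\<dots> = (\<Prod>v\<in>insert th (set K). ?h v)"
    proof (intro prod.cong refl arg_cong[of _ _ "fac k"])
      fix v assume "v \<in> insert th (set K)"
      hence "v \<in> set L" using KL L(2) by blast
      thus "ip (comb v) wrho / ip (comb v) (comb th) = of_int (Gv v) / of_int (Fv v)"
        unfolding th[OF len[OF \<open>v \<in> set L\<close>]] rho[OF len[OF \<open>v \<in> set L\<close>]] using u0 by simp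
    qed
    also have "\<dots> = ?h th * (\<Prod>v\<in>set K. ?h v)" using KL(2) by simp
    also have "(\<Prod>v\<in>set K. ?h v) = prod_list (map ?h K)" by (rule prod.distinct_set_conv_list[OF K(1)])
    also have "map ?h K = map (\<lambda>g. fac k (of_int g / of_int f)) (map Gv K)" using K(2) by simp
    also have "prod_list \<dots> = prod_list (map (\<lambda>g. fac k (of_int g / of_int f)) (heights f a (int p) b (int q) (int m)))"
    proof -
      have "mset (map Gv K) = mset (heights f a (int p) b (int q) (int m))" by (metis K(3) mset_sort)
      hence "mset (map (\<lambda>g. fac k (of_int g / of_int f)) (map Gv K)) =
          mset (map (\<lambda>g. fac k (of_int g / of_int f)) (heights f a (int p) b (int q) (int m)))" by (metis mset_map)
      thus ?thesis by (metis prod_mset_prod_list)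
    qed
    also have "\<dots> = (\<Prod>j\<in>{1..p}. fac k (of_int a / of_int f + of_nat j)) *
       ((\<Prod>j\<in>{1..q}. fac k (of_int b / of_int f + of_nat j)) * (\<Prod>j\<in>{1..m}. fac k (of_nat j)))"
    proof -
      have e: "prod_list (map (\<lambda>j. g j) [1..int l]) = (\<Prod>j\<in>{1..l}. g (int j))" for g :: "int => complex" and l
      proof (induction l)
        case (Suc l)
        have "[1..int (Suc l)] = [1..int l] @ [int (Suc l)]" using upto_rec2[of 1 "int (Suc l)"] by simp
        thus ?case using Suc by simp
      qed simp
      have f0: "(of_int f :: complex) \<noteq> 0" using D(2) by simp
      show ?thesis unfolding heights_def map_append prod_list.append map_map comp_def e using f0 by (simp add: add_divide_distrib)
    qed
    also have "?h th = fac k ((\<beta> + \<gamma> - 3) / 2)"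
    proof -
      have "of_real (\<tau> * of_int f) = (of_real (of_int f + of_int (Gv th)) :: complex)" using \<tau>(1) unfolding Gv_def by simp
      hence "of_int (Gv th) = of_int f * (\<beta> + \<gamma> - 3)" unfolding of_real_mult \<tau>(2) by (simp add: algebra_simps)
      hence "of_int (Gv th) / of_int (Fv th) = (\<beta> + \<gamma> - 3) / 2" unfolding D(1) using D(2) by simp
      thus ?thesis by (rule arg_cong)
    qed
    also have "fac k ((\<beta> + \<gamma> - 3) / 2) * ((\<Prod>j\<in>{1..p}. fac k (of_int a / of_int f + of_nat j)) *
       ((\<Prod>j\<in>{1..q}. fac k (of_int b / of_int f + of_nat j)) * (\<Prod>j\<in>{1..m}. fac k (of_nat j)))) = cartan_dim \<beta> \<gamma> k"
    proof -
      have r: "Re (of_int a / of_int f) \<ge> 0" "Re (of_int b / of_int f) \<ge> 0"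
      proof -
        have "(of_int z / of_int f :: complex) = of_real (of_int z / of_int f)" for z by simp
        thus "Re (of_int a / of_int f) \<ge> 0" "Re (of_int b / of_int f) \<ge> 0"
          using ab D(2) by (simp_all only: Re_complex_of_real) simp_all
      qed
      have nz: "bin k (of_int a / of_int f) \<noteq> 0" "bin k (of_int b / of_int f) \<noteq> 0" using r by (auto intro!: bin_nonzero)
      have b: "bin k (of_int a / of_int f + of_nat p) = bin k (of_int a / of_int f) * (\<Prod>j\<in>{1..p}. fac k (of_int a / of_int f + of_nat j))"
        "bin k (of_int b / of_int f + of_nat q) = bin k (of_int b / of_int f) * (\<Prod>j\<in>{1..q}. fac k (of_int b / of_int f + of_nat j))"
        by (rule bin_steps; use r in simp)+
      have "bin k (- 1 + \<beta> / 2) * bin k (- 1 + \<gamma> / 2) = bin k (of_int a / of_int f) * bin k (of_int b / of_int f)"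
        using y by auto
      thus ?thesis unfolding cartan_dim_def x b bin_nat[symmetric] fac_two using nz by simp
    qed
    finally show "(\<Prod>r\<in>{r \<in> Pos. ip r (comb th) \<noteq> 0}. fac k (ip r wrho / ip r (comb th))) = cartan_dim \<beta> \<gamma> k" .
  qed
qed

end

end

lemma (in form_alg) coroot_hv: assumes r: "r \<in> roots H" and h: "coroot H r h" shows "h = hv r"
proof -
  obtain x y where xy: "x \<in> root_space H r" "y \<in> root_space H (- r)" "h = br x y" "r h = 2" using h unfolding coroot_def by blast
  have e: "h = scale (B x y) (tv r)" using root_br_tv[OF r xy(1,2)] xy(3) by simp
  hence "B x y * r (tv r) = 2" using xy(4) rootsD(1)[OF r] tv(1)[OF r] by (auto simp: dual_def)
  thus ?thesis unfolding e hv_def by (metis mult_eq_0_iff nonzero_eq_divide_eq zero_neq_numeral)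
qed

lemma (in lie_algebra) exceptional_top_spaces: assumes A: "has_cartan_matrix A" and data: "vogel_data A \<tau> \<beta> \<gamma>"
    and form: "simple" "casimir_normalized B (of_real \<tau>)" "\<tau> > 0" shows "top_spaces B \<tau> \<beta> \<gamma>"
proof -
  obtain H ds hs where h: "cartan_subalgebra H" "distinct ds" "root_base H (set ds)" "length ds = length A"
    "\<And>i. i < length A ==> coroot H (ds ! i) (hs ! i)"
    "\<And>i j. i < length A ==> j < length A ==> (ds ! j) (hs ! i) = of_int (A ! i ! j)" using A unfolding has_cartan_matrix_def by blast
  interpret based_alg scale G br H B \<tau> "set ds" by unfold_locales (rule h form)+
  have rows: "\<forall>a\<in>set A. length a = length A" using data unfolding vogel_data_def root_data_def Let_def list_all_iff by blast
  have "(ds ! j) (hv (ds ! i)) = of_int (A ! i ! j)" if "i < length A" "j < length A" for i j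
    using h(6)[OF that] coroot_hv[OF Delta_root h(5)[OF that(1)]] that h(4) by simp
  thus ?thesis by (rule top_spaces_root_data[OF refl h(2,4) refl rows _ data])
qed

section \<open>The dimension of Vogel's modules\<close>

lemma cartan_dim_commute: "cartan_dim \<beta> \<gamma> k = cartan_dim \<gamma> \<beta> k"
  unfolding cartan_dim_def by (simp add: add.commute mult.commute)

context lie_algebra
begin

lemma top_spaces_commute: "top_spaces B \<tau> \<beta> \<gamma> ==> top_spaces B \<tau> \<gamma> \<beta>"
  unfolding top_spaces_def cartan_dim_commute[of \<beta> \<gamma>] .

lemma vogel_dim_eq: "vogel_dim (- 2) \<beta> \<gamma> k = cartan_dim \<beta> \<gamma> k"
proof -
  let ?t = "- 2 + \<beta> + \<gamma>"
  have "(?t - (of_nat k - 1 / 2) * - 2) / (?t + - 2 / 2) = (\<beta> + \<gamma> - 3 + 2 * of_nat k) / (\<beta> + \<gamma> - 3)"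
    by (rule arg_cong2[where f = "(/)"]) (simp_all add: algebra_simps)
  moreover have "- 2 * ?t / - 2 - 2 + of_nat k = \<beta> + \<gamma> - 4 + of_nat k"
    "(\<beta> - 2 * ?t) / - 2 - 1 + of_nat k = \<gamma> + \<beta> / 2 - 3 + of_nat k"
    "(\<gamma> - 2 * ?t) / - 2 - 1 + of_nat k = \<beta> + \<gamma> / 2 - 3 + of_nat k"
    "- \<beta> / - 2 - 1 + of_nat k = - 1 + \<beta> / 2 + of_nat k" "- \<gamma> / - 2 - 1 + of_nat k = - 1 + \<gamma> / 2 + of_nat k"
    by (simp_all add: field_simps)
  ultimately show ?thesis unfolding vogel_dim_def Let_def cartan_dim_def bin_def by (simp only: mult_ac)
qed

lemma vogel_top_spaces:
  assumes simple: "simple" and triple: "vogel_triple \<alpha> \<beta> \<gamma>" and norm: "casimir_normalized B (\<alpha> + \<beta> + \<gamma>)"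
  shows "\<exists>\<tau>>0. of_real \<tau> = \<alpha> + \<beta> + \<gamma> \<and> \<alpha> = - 2 \<and> top_spaces B \<tau> \<beta> \<gamma>"
proof -
  have spc: ?thesis if "n \<ge> 1" "isomorphic_to_mat (sp_mat n)" "\<alpha> = - 2" "\<beta> = 1" "\<gamma> = of_nat n + 2" for n
  proof (intro exI[of _ "real n + 1"] conjI)
    show eq: "of_real (real n + 1) = \<alpha> + \<beta> + \<gamma>" using that by simp
    show "top_spaces B (real n + 1) \<beta> \<gamma>" unfolding that(4,5) by (rule sp_top_spaces[OF that(2,1) simple norm[folded eq]])
  qed (use that in auto)
  have slc: ?thesis if "n \<ge> 2" "isomorphic_to_mat (sl_mat n)" "\<alpha> = - 2" "\<beta> = 2 \<and> \<gamma> = of_nat n \<or> \<gamma> = 2 \<and> \<beta> = of_nat n" for n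
  proof (intro exI[of _ "real n"] conjI)
    show eq: "of_real (real n) = \<alpha> + \<beta> + \<gamma>" using that by auto
    have "casimir_normalized B (of_nat n)" using norm[folded eq] by simp
    from sl_top_spaces[OF that(2,1) simple this] show "top_spaces B (real n) \<beta> \<gamma>" using that(4) top_spaces_commute by auto
  qed (use that in auto)
  have soc: ?thesis if "n \<ge> 5" "isomorphic_to_mat (so_mat n)" "\<alpha> = - 2" "\<beta> = 4" "\<gamma> = of_nat n - 4" for n
  proof (intro exI[of _ "real n - 2"] conjI)
    show eq: "of_real (real n - 2) = \<alpha> + \<beta> + \<gamma>" using that by simp
    show "top_spaces B (real n - 2) \<beta> \<gamma>" unfolding that(4,5) by (rule so_top_spaces[OF that(2,1) simple norm[folded eq]])
  qed (use that in auto)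
  have exc: ?thesis if "\<alpha> = - 2" "has_cartan_matrix A" "vogel_data A \<tau> \<beta> \<gamma>" "\<tau> > 0" for A \<tau>
  proof (intro exI[of _ \<tau>] conjI)
    show eq: "of_real \<tau> = \<alpha> + \<beta> + \<gamma>" using that(3) unfolding vogel_data_def that(1) by (auto simp: algebra_simps)
    show "top_spaces B \<tau> \<beta> \<gamma>" by (rule exceptional_top_spaces[OF that(2,3) simple norm[folded eq] that(4)])
  qed (use that in auto)
  show ?thesis using triple
  proof cases
    case (sp n)
    thus ?thesis using spc by simp
  next
    case (sl n)
    thus ?thesis using slc by simp
  next
    case (so n)
    thus ?thesis using soc by simp
  next
    case (exceptional a)
    consider "a = - 1" "isomorphic_to_mat (sl_mat 3)" | "a = - 2 / 3" "has_cartan_matrix cartan_G2"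
      | "a = 0" "isomorphic_to_mat (so_mat 8)" | "a = 1" "has_cartan_matrix cartan_F4" | "a = 2" "has_cartan_matrix cartan_E6"
      | "a = 4" "has_cartan_matrix cartan_E7" | "a = 8" "has_cartan_matrix cartan_E8"
      using exceptional(4) unfolding exceptional_series_def by blast
    thus ?thesis
    proof cases
      case 1
      thus ?thesis using slc[of 3] exceptional by simp
    next
      case 2
      hence "\<beta> = 10 / 3" "\<gamma> = 8 / 3" using exceptional by simp_all
      thus ?thesis using exc[of cartan_G2 4] 2 exceptional(1) vogel_data_G2 by (simp only:) simp
    next
      case 3
      thus ?thesis using soc[of 8] exceptional by simp
    next
      case 4
      show ?thesis by (rule exc[of cartan_F4 9]) (use 4 exceptional vogel_data_F4 in simp_all)
    next
      case 5
      show ?thesis by (rule exc[of cartan_E6 12]) (use 5 exceptional vogel_data_E6 in simp_all)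
    next
      case 6
      show ?thesis by (rule exc[of cartan_E7 18]) (use 6 exceptional vogel_data_E7 in simp_all)
    next
      case 7
      show ?thesis by (rule exc[of cartan_E8 30]) (use 7 exceptional vogel_data_E8 in simp_all)
    qed
  next
    case (F3 r)
    consider "r \<ge> 3" "\<beta> = 1" "isomorphic_to_mat (sp_mat r)" | "r \<ge> 3" "\<beta> = 2" "isomorphic_to_mat (sl_mat (2 * r))"
      | "r \<ge> 3" "\<beta> = 4" "isomorphic_to_mat (so_mat (4 * r))" | "r = 3" "\<beta> = 8" "has_cartan_matrix cartan_E7"
      using F3(3) unfolding F3_series_def by blast
    thus ?thesis
    proof cases
      case 1
      thus ?thesis using spc[of r] F3 by simp
    next
      case 2
      show ?thesis by (rule slc[of "2 * r"]) (use 2 F3 in \<open>simp_all add: algebra_simps\<close>)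
    next
      case 3
      show ?thesis by (rule soc[of "4 * r"]) (use 3 F3 in \<open>simp_all add: algebra_simps\<close>)
    next
      case 4
      show ?thesis by (rule exc[of cartan_E7 18]) (use 4 F3 vogel_data_E7 in simp_all)
    qed
  qed
qed

end

section \<open>Return to the given Cartan subalgebra\<close>

context highest_alg
begin

text \<open>In the given Cartan subalgebra the tensor square of the root vector of theta has
  eigenvalue \<open>cas (ktheta 2)\<close>, hence at most 4 tau + 4. Conversely 4 tau + 4 occurs as
  an eigenvalue, hence is at most \<open>cas (ktheta 2)\<close>.\<close>

lemma top_spaces_norm: assumes "top_spaces B \<tau> \<beta> \<gamma>" shows "ip \<theta> \<theta> = 2"
proof -
  have c: "cas (ktheta 2) = 4 * of_real \<tau> + 2 * ip \<theta> \<theta>" using cas_ktheta[of 2] by (simp add: power2_eq_square)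
  have "Re (cas (ktheta 2)) \<le> 4 * \<tau> + 4" using assms ek_cas_space[of 2] ek_nonzero[of 2] unfolding top_spaces_def by blast
  moreover obtain T where "T \<in> cas_space B 2 (4 * of_real \<tau> + 4)" "T \<noteq> 0" using assms unfolding top_spaces_def by blast
  hence "Re (4 * of_real \<tau> + 4) \<le> Re (cas (ktheta 2))" by (rule cas_space_bound)
  ultimately have "Re (ip \<theta> \<theta>) = 2" unfolding c by simp
  thus ?thesis using ip_root_pos[OF theta_root] by (auto simp: complex_eq_iff complex_is_Real_iff)
qed

text \<open>A module with the required eigenvalue is a submodule of the eigenspace, which is
  irreducible; the prescribed dimension excludes the zero submodule.\<close>

lemma Y_module_cas_space: assumes top: "top_spaces B \<tau> \<beta> \<gamma>" and t: "of_real \<tau> = - 2 + \<beta> + \<gamma>"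
  shows "Y_module B (- 2) \<beta> \<gamma> k Y \<longleftrightarrow> Y = cas_space B k (cas (ktheta k))"
proof -
  let ?E = "cas_space B k (cas (ktheta k))"
  have c: "cas (ktheta k) = top_eig \<tau> k" using cas_ktheta[of k] top_spaces_norm[OF top] by simp
  have c': "2 * of_nat k * (- 2 + \<beta> + \<gamma>) - ((of_nat k)\<^sup>2 - of_nat k) * - 2 = cas (ktheta k)" unfolding c t by simp
  have dimE: "of_nat (fun_space.dim ?E) = cartan_dim \<beta> \<gamma> k" using top unfolding top_spaces_def c by blast
  have Esub: "?E \<subseteq> sym_power k" by (auto simp: cas_space_def)
  have irr: "irreducible_module fun_scale ?E (tensor_action k)"
    using cartan_power_cas_space[of k] unfolding cartan_power_def irreducible_with_highest_weight_def by blast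
  show ?thesis
  proof
    assume "Y = ?E"
    thus "Y_module B (- 2) \<beta> \<gamma> k Y"
      unfolding Y_module_def c' vogel_dim_eq using dimE Esub cas_space_submod[of k "cas (ktheta k)"]
      by (auto simp: submodule_def cas_space_def)
  next
    assume Y: "Y_module B (- 2) \<beta> \<gamma> k Y"
    have "submodule fun_scale ?E (tensor_action k) Y" using Y unfolding Y_module_def submodule_def c' cas_space_def by blast
    hence "Y = {0} \<or> Y = ?E" using irr unfolding irreducible_module_def by blast
    moreover have "Y \<noteq> {0}"
    proof
      assume "Y = {0}"
      hence "fun_space.dim Y = 0" using fun_space.dim_eq_card[of "{}" Y] by (simp add: fun_space.independent_empty)
      hence 0: "fun_space.dim ?E = 0" using Y dimE unfolding Y_module_def vogel_dim_eq by (metis of_nat_0 of_nat_eq_0_iff)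
      have "\<exists>S. finite S \<and> fun_space.span S = ?E" using irr unfolding irreducible_module_def lie_module_def by (elim conjE)
      then obtain S where S: "finite S" "fun_space.span S = ?E" by (elim exE conjE)
      obtain b where b: "b \<subseteq> ?E" "fun_space.independent b" "?E \<subseteq> fun_space.span b" "card b = 0"
        by (rule fun_space.basis_exists[of ?E]) (simp only: 0)
      \<comment> \<open>By itself \<open>card b = 0\<close> would also hold for an infinite
        basis.\<close>
      have "finite b" using fun_space.independent_span_bound[OF S(1) b(2)] b(1) S(2) by simp
      hence "b = {}" using b(4) by simp
      hence "?E \<subseteq> {0}" using b(3) by simp
      thus False using irr ek_cas_space[of k] ek_nonzero[of k] by blast
    qed
    ultimately show "Y = ?E" by blast
  qed
qed

lemma cartan_power_dim_eq: assumes top: "top_spaces B \<tau> \<beta> \<gamma>" and V: "cartan_power H \<Delta> \<theta> k sV V \<rho>"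
  shows "of_nat (vector_space.dim sV V) = cartan_dim \<beta> \<gamma> k"
proof -
  have "cas (ktheta k) = top_eig \<tau> k" using cas_ktheta[of k] top_spaces_norm[OF top] by simp
  hence "of_nat (fun_space.dim (cas_space B k (cas (ktheta k)))) = cartan_dim \<beta> \<gamma> k" using top unfolding top_spaces_def by simp
  moreover have "(\<Prod>r\<in>Pos. ip r wrho) \<noteq> 0" using ip_wrho_nonzero finite_Pos by (simp add: prod_zero_iff)
  ultimately show ?thesis using cartan_power_dim[OF V] cartan_power_dim[OF cartan_power_cas_space[of k]] by (metis mult_left_cancel)
qed

end

theorem theorem1p2: fixes scale :: "complex \<Rightarrow> 'a::ab_group_add \<Rightarrow> 'a"
    and G :: "'a set" and br :: "'a \<Rightarrow> 'a \<Rightarrow> 'a"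
    and \<alpha> \<beta> \<gamma> :: complex and B :: "'a \<Rightarrow> 'a \<Rightarrow> complex"
    and H :: "'a set" and \<Delta> :: "('a \<Rightarrow> complex) set" and \<alpha>\<^sub>0 :: "'a \<Rightarrow> complex" and k :: nat
  assumes "lie_algebra scale G br" and "lie_algebra.simple scale G br" and "lie_algebra.vogel_triple scale G br \<alpha> \<beta> \<gamma>"
    and "lie_algebra.casimir_normalized scale G br B (\<alpha> + \<beta> + \<gamma>)" and "lie_algebra.cartan_subalgebra scale G br H"
    and "lie_algebra.root_base scale G br H \<Delta>" and "lie_algebra.highest_root scale G br H \<Delta> \<alpha>\<^sub>0" and "k \<ge> 1"
  shows "(\<exists>!Y. lie_algebra.Y_module scale G br B \<alpha> \<beta> \<gamma> k Y) \<and>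
    (\<forall>Y. lie_algebra.Y_module scale G br B \<alpha> \<beta> \<gamma> k Y \<longrightarrow>
      lie_algebra.cartan_power scale G br H \<Delta> \<alpha>\<^sub>0 k
        fun_scale Y (lie_algebra.tensor_action scale G br k)) \<and>
    (\<forall>(sV :: complex \<Rightarrow> 'v::ab_group_add \<Rightarrow> 'v) V \<rho>.
      lie_algebra.cartan_power scale G br H \<Delta> \<alpha>\<^sub>0 k sV V \<rho> \<longrightarrow>
      of_nat (vector_space.dim sV V) = (\<beta> + \<gamma> - 3 + 2 * of_nat k) / (\<beta> + \<gamma> - 3) *
        (((\<beta> + \<gamma> / 2 - 3 + of_nat k) gchoose k) * ((\<gamma> + \<beta> / 2 - 3 + of_nat k) gchoose k) *
         ((\<beta> + \<gamma> - 4 + of_nat k) gchoose k)) /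
        (((- 1 + \<beta> / 2 + of_nat k) gchoose k) * ((- 1 + \<gamma> / 2 + of_nat k) gchoose k)))"
proof -
  obtain \<tau> where \<tau>: "\<tau> > 0" "of_real \<tau> = \<alpha> + \<beta> + \<gamma>" "\<alpha> = - 2" "lie_algebra.top_spaces scale G br B \<tau> \<beta> \<gamma>"
    using lie_algebra.vogel_top_spaces[OF assms(1-4)] by blast
  interpret lie_algebra scale G br by (rule assms(1))
  interpret highest_alg scale G br H B \<tau> \<Delta> \<alpha>\<^sub>0 by unfold_locales (use assms \<tau> in simp_all)
  note Y = Y_module_cas_space[OF \<tau>(4) \<tau>(2)[unfolded \<tau>(3)], of k]
  show ?thesis using cartan_power_dim_eq[OF \<tau>(4), of k] cartan_power_cas_space[of k]
    unfolding \<tau>(3) Y cartan_dim_def bin_def by blast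
qed

end
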